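(* Let $A$ be an Artin algebra, $n\ge 2$ an integer, and $T$ a finitely generated left $A$-module. (i) If there is an exact sequence $0\to T_s\to\cdots\to T_0\to D(A_A)\to 0$ of $A$-modules with $T_i\in\operatorname{add}(T)$ for $0\le i\le s$, then $\mathcal S_n({}^\perp T)={}^\perp\mathbf m(T)$ (as full subcategories of $T_n(A)\text{-mod}=\operatorname{Mor}_n(A)$). (ii) If $T$ is a cotilting $A$-module, then $\mathbf m(T)$ is a cotilting $T_n(A)$-module with $\mathcal S_n({}^\perp T)={}^\perp\mathbf m(T)$, and it is the unique such cotilting module up to multiplicities of indecomposable direct summands; that is, if $C$ is a cotilting $T_n(A)$-module with $\mathcal S_n({}^\perp T)={}^\perp C$, then $\operatorname{add}(C)=\operatorname{add}(\mathbf m(T))$.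
   Context: For an Artin algebra $B$, $B\text{-mod}$ is the category of finitely generated left $B$-modules, $D: B^{op}\text{-mod}\to B\text{-mod}$ is the standard duality, so $D(B_B)$ is an injective cogenerator of $B\text{-mod}$. For $M\in B\text{-mod}$, $\operatorname{add}(M)$ is the full subcategory of direct summands of finite direct sums of copies of $M$, and ${}^\perp M=\{X\in B\text{-mod}\mid \operatorname{Ext}^i_B(X,M)=0\ \forall i\ge 1\}$. A $B$-module $T$ is cotilting if (1) $\operatorname{inj.dim} T<\infty$; (2) $\operatorname{Ext}^i_B(T,T)=0$ for $i\ge 1$; (3) there is an exact sequence $0\to T_s\to\cdots\to T_0\to D(B_B)\to 0$ with all $T_i\in\operatorname{add}(T)$. $T_n(A)$ is the algebra of upper triangular $n\times n$ matrices over $A$. $\operatorname{Mor}_n(A)$ is the category whose objects $X_{(\phi_i)}$ are sequences $X_n\xrightarrow{\phi_{n-1}}X_{n-1}\to\cdots\xrightarrow{\phi_1}X_1$ of $A$-maps in $A\text{-mod}$ (written as columns with entries $X_1,\dots,X_n$ from top to bottom), and whose morphisms are $n$-tuples $(f_1,\dots,f_n)$ of $A$-maps commuting with the structure maps. It is identified with $T_n(A)\text{-mod}$: $X_{(\phi_i)}$ corresponds to $\bigoplus_i X_i$, where $(a_{ij})$ sends $(x_i)_i$ to the column with $i$-th entry $a_{ii}x_i+\sum_{j>i}a_{ij}\phi_i\cdots\phi_{j-1}(x_j)$. For a full subcategory $\mathcal X$ of $A\text{-mod}$, $\mathcal S_n(\mathcal X)$ is the full subcategory of $\operatorname{Mor}_n(A)$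 of objects $X_{(\phi_i)}$ with all $X_i\in\mathcal X$, all $\phi_i$ monomorphisms, and all $\operatorname{Coker}\phi_i\in\mathcal X$ ($1\le i\le n-1$). For $M\in A\text{-mod}$ and $1\le i\le n$, $\mathbf m_i(M)\in\operatorname{Mor}_n(A)$ has $j$-th branch $M$ for $j\le i$ and $0$ for $j>i$, with $j$-th structure map $\operatorname{id}_M$ for $j<i$ and $0$ for $j\ge i$. Put $\mathbf m(M)=\bigoplus_{1\le i\le n}\mathbf m_i(M)$. *)

theory Defs
  imports "HOL-Algebra.Module" "HOL-Algebra.Ideal" "HOL-Algebra.Elementary_Groups"
begin

section \<open>Left modules over arbitrary rings\<close>

text \<open>
  The library locale \<open>module\<close> requires commutative scalars.  We keep its record type
  (whose fields \<open>mult\<close> and \<open>one\<close> are irrelevant for a module) and drop commutativity.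
\<close>

locale lmodule = R?: ring R + M?: abelian_group M
  for R :: "('b, 'z) ring_scheme" and M :: "('b, 'm) module" (structure) +
  assumes smult_closed [simp, intro]:
      "\<lbrakk> a \<in> carrier R; x \<in> carrier M \<rbrakk> \<Longrightarrow> a \<odot> x \<in> carrier M"
    and smult_l_distr:
      "\<lbrakk> a \<in> carrier R; b \<in> carrier R; x \<in> carrier M \<rbrakk> \<Longrightarrow>
       (a \<oplus>\<^bsub>R\<^esub> b) \<odot> x = a \<odot> x \<oplus> b \<odot> x"
    and smult_r_distr:
      "\<lbrakk> a \<in> carrier R; x \<in> carrier M; y \<in> carrier M \<rbrakk> \<Longrightarrow>
       a \<odot> (x \<oplus> y) = a \<odot> x \<oplus> a \<odot> y"
    and smult_assoc1:
      "\<lbrakk> a \<in> carrier R; b \<in> carrier R; x \<in> carrier M \<rbrakk> \<Longrightarrow>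
       (a \<otimes>\<^bsub>R\<^esub> b) \<odot> x = a \<odot> (b \<odot> x)"
    and smult_one [simp]:
      "x \<in> carrier M \<Longrightarrow> \<one>\<^bsub>R\<^esub> \<odot> x = x"

definition fg_module :: "('b, 'z) ring_scheme \<Rightarrow> ('b, 'm) module \<Rightarrow> bool" where
  "fg_module B M \<longleftrightarrow> lmodule B M \<and>
     (\<exists>S. finite S \<and> S \<subseteq> carrier M \<and>
        (\<forall>N. submodule N B M \<and> S \<subseteq> N \<longrightarrow> N = carrier M))"

definition mod_hom ::
  "('b, 'z) ring_scheme \<Rightarrow> ('b, 'm) module \<Rightarrow> ('b, 'n) module \<Rightarrow> ('m \<Rightarrow> 'n) set" where
  "mod_hom B M N =
     {f \<in> hom (add_monoid M) (add_monoid N).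
        \<forall>b\<in>carrier B. \<forall>x\<in>carrier M. f (b \<odot>\<^bsub>M\<^esub> x) = b \<odot>\<^bsub>N\<^esub> f x}"

definition mod_iso ::
  "('b, 'z) ring_scheme \<Rightarrow> ('b, 'm) module \<Rightarrow> ('b, 'n) module \<Rightarrow> bool" where
  "mod_iso B M N \<longleftrightarrow> (\<exists>f\<in>mod_hom B M N. bij_betw f (carrier M) (carrier N))"

text \<open>Homomorphisms are made extensional, so that equal maps are equal functions.\<close>

definition hom_group ::
  "('b, 'z) ring_scheme \<Rightarrow> ('b, 'm) module \<Rightarrow> ('b, 'n) module \<Rightarrow> ('m \<Rightarrow> 'n) monoid" where
  "hom_group B M N =
     \<lparr> carrier = mod_hom B M N \<inter> extensional (carrier M),
       mult = (\<lambda>f g. \<lambda>x\<in>carrier M. f x \<oplus>\<^bsub>N\<^esub> g x),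
       one = (\<lambda>x\<in>carrier M. \<zero>\<^bsub>N\<^esub>) \<rparr>"

definition quot_module :: "('b, 'm) module \<Rightarrow> 'm set \<Rightarrow> ('b, 'm set) module" where
  "quot_module M N =
     \<lparr> carrier = a_rcosets\<^bsub>M\<^esub> N, mult = undefined, one = undefined,
       zero = N, add = set_add M,
       smult = (\<lambda>b S. \<Union>x\<in>S. N +>\<^bsub>M\<^esub> (b \<odot>\<^bsub>M\<^esub> x)) \<rparr>"

definition coker :: "('b, 'm) module \<Rightarrow> ('b, 'n) module \<Rightarrow> ('m \<Rightarrow> 'n) \<Rightarrow> ('b, 'n set) module" where
  "coker M N f = quot_module N (f ` carrier M)"

text \<open>Direct sums are only formed over finite index sets, where they are direct products.\<close>

definition dsum :: "'i set \<Rightarrow> ('i \<Rightarrow> ('b, 'm) module) \<Rightarrow> ('b, 'i \<Rightarrow> 'm) module" where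
  "dsum I M =
     \<lparr> carrier = (\<Pi>\<^sub>E i\<in>I. carrier (M i)), mult = undefined, one = undefined,
       zero = (\<lambda>i\<in>I. \<zero>\<^bsub>M i\<^esub>),
       add = (\<lambda>x y. \<lambda>i\<in>I. x i \<oplus>\<^bsub>M i\<^esub> y i),
       smult = (\<lambda>b x. \<lambda>i\<in>I. b \<odot>\<^bsub>M i\<^esub> x i) \<rparr>"

definition reg_module :: "('b, 'z) ring_scheme \<Rightarrow> ('b, 'b) module" where
  "reg_module B =
     \<lparr> carrier = carrier B, mult = undefined, one = undefined,
       zero = \<zero>\<^bsub>B\<^esub>, add = (\<lambda>x y. x \<oplus>\<^bsub>B\<^esub> y), smult = (\<lambda>b x. b \<otimes>\<^bsub>B\<^esub> x) \<rparr>"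

definition free_module :: "('b, 'z) ring_scheme \<Rightarrow> nat \<Rightarrow> ('b, nat \<Rightarrow> 'b) module" where
  "free_module B m = dsum {..<m} (\<lambda>_. reg_module B)"


section \<open>The carrier type for finitely generated modules\<close>

text \<open>
  HOL cannot quantify over all types inside a formula.  Every finitely generated left
  \<open>B\<close>-module is a quotient of some \<open>B\<^sup>m\<close>, hence isomorphic to one whose elements are sets of
  vectors over \<open>B\<close> (lemma \<open>fg_module_copy\<close> below).  Quantifying over the finitely generated
  modules with this element type therefore covers all of \<open>B\<close>-mod up to isomorphism.
\<close>

type_synonym 'b fg_carrier = "(nat \<Rightarrow> 'b) set"

text \<open>
  Classes of modules (\<open>perp\<close>, \<open>add_class\<close>, \<open>mor_perp\<close>, \<open>mono_cat\<close> below) are polymorphic in the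
  element type of their members.  All of them are closed under isomorphism, so each is determined
  by its members over this element type (by those whose branches have it, for \<open>mor_perp\<close> and
  \<open>mono_cat\<close>).
\<close>

definition transport :: "('m \<Rightarrow> 'n) \<Rightarrow> ('b, 'm) module \<Rightarrow> ('b, 'n) module" where
  "transport h M = (let g = inv_into (carrier M) h in
     \<lparr> carrier = h ` carrier M, mult = undefined, one = undefined, zero = h \<zero>\<^bsub>M\<^esub>,
       add = (\<lambda>x y. h (g x \<oplus>\<^bsub>M\<^esub> g y)), smult = (\<lambda>b x. h (b \<odot>\<^bsub>M\<^esub> g x)) \<rparr>)"

lemma transport_simps:
  assumes "inj_on h (carrier M)"
  shows "carrier (transport h M) = h ` carrier M" "\<zero>\<^bsub>transport h M\<^esub> = h \<zero>\<^bsub>M\<^esub>"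
    "x \<in> carrier M \<Longrightarrow> y \<in> carrier M \<Longrightarrow> h x \<oplus>\<^bsub>transport h M\<^esub> h y = h (x \<oplus>\<^bsub>M\<^esub> y)"
    "x \<in> carrier M \<Longrightarrow> b \<odot>\<^bsub>transport h M\<^esub> h x = h (b \<odot>\<^bsub>M\<^esub> x)"
  using assms by (auto simp: transport_def Let_def)

lemma lmodule_transport:
  assumes M: "lmodule B M" and h: "inj_on h (carrier M)"
  shows "lmodule B (transport h M)"
proof -
  interpret M: lmodule B M by fact
  note s = transport_simps[OF h]
  show ?thesis
  proof (intro lmodule.intro lmodule_axioms.intro M.R.ring_axioms)
    show "abelian_group (transport h M)"
    proof (rule abelian_groupI)
      fix x assume "x \<in> carrier (transport h M)"
      then obtain u where u: "u \<in> carrier M" "x = h u" by (auto simp: s)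
      then show "\<exists>y\<in>carrier (transport h M). y \<oplus>\<^bsub>transport h M\<^esub> x = \<zero>\<^bsub>transport h M\<^esub>"
        by (intro bexI[of _ "h (\<ominus>\<^bsub>M\<^esub> u)"]) (auto simp: s M.M.l_neg)
    qed (auto simp: s M.M.a_ac)
  qed (auto simp: s M.smult_l_distr M.smult_r_distr M.smult_assoc1)
qed

lemma transport_iso:
  assumes M: "lmodule B M" and h: "inj_on h (carrier M)"
  shows "h \<in> mod_hom B M (transport h M)" "bij_betw h (carrier M) (carrier (transport h M))"
  using h by (auto simp: mod_hom_def hom_def transport_simps bij_betw_def)

lemma fg_transport:
  assumes M: "fg_module B M" and h: "inj_on h (carrier M)"
  shows "fg_module B (transport h M)"
proof -
  from M have lm: "lmodule B M" by (simp add: fg_module_def)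
  interpret M: lmodule B M by fact
  interpret N: lmodule B "transport h M" using lm h by (rule lmodule_transport)
  note s = transport_simps[OF h]
  from M obtain S where S: "finite S" "S \<subseteq> carrier M"
    "\<And>N. submodule N B M \<Longrightarrow> S \<subseteq> N \<Longrightarrow> N = carrier M" by (auto simp: fg_module_def)
  have "N = carrier (transport h M)" if N: "submodule N B (transport h M)" "h ` S \<subseteq> N" for N
  proof -
    interpret N': submodule N B "transport h M" by fact
    have Ns: "N \<subseteq> h ` carrier M" using N'.subset by (simp add: s)
    let ?K = "{x\<in>carrier M. h x \<in> N}"
    have "submodule ?K B M"
    proof (intro submodule.intro subgroup.intro submodule_axioms.intro)
      fix x assume "x \<in> ?K"
      then have x: "x \<in> carrier M" "h x \<in> N" by auto
      have "\<ominus>\<^bsub>transport h M\<^esub> h x = h (\<ominus>\<^bsub>M\<^esub> x)"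
        by (rule N.M.minus_equality) (use x in \<open>auto simp: s M.M.l_neg\<close>)
      moreover have "\<ominus>\<^bsub>transport h M\<^esub> h x \<in> N"
        unfolding a_inv_def by (rule N'.m_inv_closed) (rule x(2))
      ultimately have "\<ominus>\<^bsub>M\<^esub> x \<in> ?K" using x by simp
      then show "inv\<^bsub>add_monoid M\<^esub> x \<in> ?K" unfolding a_inv_def .
    next
      fix x y assume "x \<in> ?K" "y \<in> ?K"
      then show "x \<otimes>\<^bsub>add_monoid M\<^esub> y \<in> ?K"
        using N'.m_closed[of "h x" "h y"] by (auto simp: s)
    next
      fix a x assume "a \<in> carrier B" "x \<in> ?K"
      then show "a \<odot>\<^bsub>M\<^esub> x \<in> ?K" using N'.smult_closed[of a "h x"] by (auto simp: s)
    next
      show "\<one>\<^bsub>add_monoid M\<^esub> \<in> ?K" using N'.one_closed by (auto simp: s)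
    qed auto
    moreover have "S \<subseteq> ?K" using N S by auto
    ultimately have "?K = carrier M" by (rule S(3))
    then show ?thesis using Ns by (auto simp: s)
  qed
  moreover have "finite (h ` S)" "h ` S \<subseteq> carrier (transport h M)" using S by (auto simp: s)
  ultimately show ?thesis using N.lmodule_axioms by (auto simp: fg_module_def)
qed

lemma (in lmodule) smult_zero: "a \<in> carrier R \<Longrightarrow> a \<odot> \<zero> = \<zero>"
  using smult_r_distr[of a \<zero> \<zero>] smult_closed[of a \<zero>] 
  by (metis M.add.l_cancel_one' M.add.r_cancel_one M.zero_closed M.l_zero)

lemma (in lmodule) smult_zero_left: "x \<in> carrier M \<Longrightarrow> \<zero>\<^bsub>R\<^esub> \<odot> x = \<zero>"
  using smult_l_distr[of "\<zero>\<^bsub>R\<^esub>" "\<zero>\<^bsub>R\<^esub>" x] smult_closed[of "\<zero>\<^bsub>R\<^esub>" x] 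
  by (metis M.add.r_cancel_one R.zero_closed R.l_zero)

lemma (in lmodule) smult_finsum:
  "finite I \<Longrightarrow> a \<in> carrier R \<Longrightarrow> f \<in> I \<rightarrow> carrier M \<Longrightarrow>
   a \<odot> (\<Oplus>i\<in>I. f i) = (\<Oplus>i\<in>I. a \<odot> f i)"
  by (induct I rule: finite_induct) (auto simp: smult_zero smult_r_distr Pi_def)

lemma fg_module_copy:
  assumes M: "fg_module B M"
  shows "\<exists>N :: ('b, 'b fg_carrier) module. fg_module B N \<and> mod_iso B M N"
proof -
  from M have lm: "lmodule B M" by (simp add: fg_module_def)
  interpret M: lmodule B M by fact
  from M obtain S where S: "finite S" "S \<subseteq> carrier M"
    "\<And>N. submodule N B M \<Longrightarrow> S \<subseteq> N \<Longrightarrow> N = carrier M" by (auto simp: fg_module_def)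
  from finite_imp_nat_seg_image_inj_on[OF S(1)] obtain m :: nat and u
    where u: "S = u ` {i. i < m}" "inj_on u {i. i < m}" by auto
  then have uc: "\<And>i. i < m \<Longrightarrow> u i \<in> carrier M" using S by auto
  define p where "p c = (\<Oplus>\<^bsub>M\<^esub>i\<in>{..<m}. c i \<odot>\<^bsub>M\<^esub> u i)" for c
  define P where "P = {c :: nat \<Rightarrow> _. \<forall>i. c i \<in> carrier B}"
  have pc: "p c \<in> carrier M" if "c \<in> P" for c
    unfolding p_def using that by (auto intro!: M.M.finsum_closed simp: P_def uc)
  have padd: "p (\<lambda>i. c i \<oplus>\<^bsub>B\<^esub> d i) = p c \<oplus>\<^bsub>M\<^esub> p d" if "c \<in> P" "d \<in> P" for c d
  proof -
    have "p (\<lambda>i. c i \<oplus>\<^bsub>B\<^esub> d i) = (\<Oplus>\<^bsub>M\<^esub>i\<in>{..<m}. c i \<odot>\<^bsub>M\<^esub> u i \<oplus>\<^bsub>M\<^esub> d i \<odot>\<^bsub>M\<^esub> u i)"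
      unfolding p_def using that
      by (intro M.M.finsum_cong') (auto simp: P_def uc M.smult_l_distr)
    also have "\<dots> = p c \<oplus>\<^bsub>M\<^esub> p d"
      unfolding p_def using that by (intro M.M.finsum_addf) (auto simp: P_def uc)
    finally show ?thesis .
  qed
  have psm: "p (\<lambda>i. a \<otimes>\<^bsub>B\<^esub> c i) = a \<odot>\<^bsub>M\<^esub> p c" if "c \<in> P" "a \<in> carrier B" for a c
    unfolding p_def using that
    by (subst M.smult_finsum) (auto simp: P_def uc M.smult_assoc1 intro!: M.M.finsum_cong')
  have p0: "p (\<lambda>_. \<zero>\<^bsub>B\<^esub>) = \<zero>\<^bsub>M\<^esub>"
    unfolding p_def by (rule M.M.add.finprod_one_eqI) (auto simp: uc M.smult_zero_left)
  have pu: "p (\<lambda>i. if i = j then \<one>\<^bsub>B\<^esub> else \<zero>\<^bsub>B\<^esub>) = u j" if "j < m" for j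
  proof -
    have "p (\<lambda>i. if i = j then \<one>\<^bsub>B\<^esub> else \<zero>\<^bsub>B\<^esub>) = (\<Oplus>\<^bsub>M\<^esub>i\<in>{..<m}. if j = i then u i else \<zero>\<^bsub>M\<^esub>)"
      unfolding p_def by (rule M.M.finsum_cong') (auto simp: uc M.smult_zero_left)
    also have "\<dots> = u j" using that by (intro M.M.add.finprod_singleton) (auto simp: uc)
    finally show ?thesis .
  qed
  have "submodule (p ` P) B M"
  proof (intro submodule.intro subgroup.intro submodule_axioms.intro)
    show "p ` P \<subseteq> carrier (add_monoid M)" using pc by auto
    fix a x assume a: "a \<in> carrier B" and "x \<in> p ` P"
    then obtain c where c: "c \<in> P" "x = p c" by auto
    show "a \<odot>\<^bsub>M\<^esub> x \<in> p ` P"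
      by (rule image_eqI[of _ _ "\<lambda>i. a \<otimes>\<^bsub>B\<^esub> c i"])
         (use a c psm[OF c(1) a] in \<open>auto simp: P_def\<close>)
  next
    fix x y assume "x \<in> p ` P" "y \<in> p ` P"
    then obtain c d where c: "c \<in> P" "x = p c" and d: "d \<in> P" "y = p d" by auto
    show "x \<otimes>\<^bsub>add_monoid M\<^esub> y \<in> p ` P"
      by (rule image_eqI[of _ _ "\<lambda>i. c i \<oplus>\<^bsub>B\<^esub> d i"])
         (use c d padd[OF c(1) d(1)] in \<open>auto simp: P_def\<close>)
  next
    show "\<one>\<^bsub>add_monoid M\<^esub> \<in> p ` P"
      by (rule image_eqI[of _ _ "\<lambda>_. \<zero>\<^bsub>B\<^esub>"]) (auto simp: p0 P_def)
  next
    fix x assume "x \<in> p ` P"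
    then obtain c where c: "c \<in> P" "x = p c" by auto
    let ?d = "\<lambda>i. \<ominus>\<^bsub>B\<^esub> c i"
    have d: "?d \<in> P" using c by (auto simp: P_def)
    have "p ?d \<oplus>\<^bsub>M\<^esub> p c = p (\<lambda>i. ?d i \<oplus>\<^bsub>B\<^esub> c i)" using c d by (simp add: padd)
    also have "(\<lambda>i. ?d i \<oplus>\<^bsub>B\<^esub> c i) = (\<lambda>i. \<zero>\<^bsub>B\<^esub>)" using c by (auto simp: P_def M.R.l_neg)
    finally have "\<ominus>\<^bsub>M\<^esub> p c = p ?d"
      using pc c d by (intro M.M.minus_equality) (auto simp: p0)
    then show "inv\<^bsub>add_monoid M\<^esub> x \<in> p ` P" using c d by (auto simp: a_inv_def)
  qed
  moreover have "S \<subseteq> p ` P"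
  proof
    fix x assume "x \<in> S"
    then obtain j where j: "j < m" "x = u j" using u by auto
    show "x \<in> p ` P"
      by (rule image_eqI[of _ _ "\<lambda>i. if i = j then \<one>\<^bsub>B\<^esub> else \<zero>\<^bsub>B\<^esub>"])
         (use j in \<open>simp_all add: pu P_def\<close>)
  qed
  ultimately have P: "p ` P = carrier M" by (rule S(3))
  have "inj_on (\<lambda>x. {c\<in>P. p c = x}) (carrier M)"
  proof (rule inj_onI)
    fix x y assume x: "x \<in> carrier M" and eq: "{c\<in>P. p c = x} = {c\<in>P. p c = y}"
    from x obtain c where "c \<in> P" "p c = x" unfolding P [symmetric] by auto
    then have "c \<in> {c\<in>P. p c = x}" by simp
    then have "c \<in> {c\<in>P. p c = y}" unfolding eq .
    then show "x = y" using \<open>p c = x\<close> by simp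
  qed
  from fg_transport[OF M this] transport_iso[OF lm this]
  have "fg_module B (transport (\<lambda>x. {c\<in>P. p c = x}) M) \<and>
        mod_iso B M (transport (\<lambda>x. {c\<in>P. p c = x}) M)"
    unfolding mod_iso_def by (intro conjI bexI)
  then show ?thesis by (rule exI)
qed


section \<open>Ext\<close>

text \<open>
  \<open>\<cdots> \<rightarrow> B\<^sup>(r 2) \<rightarrow> B\<^sup>(r 1) \<rightarrow> B\<^sup>(r 0) \<rightarrow> X \<rightarrow> 0\<close> with differentials \<open>d i : B\<^sup>(r (i+1)) \<rightarrow> B\<^sup>(r i)\<close> and
  augmentation \<open>e\<close>.  Such resolutions exist for finitely generated \<open>X\<close> when \<open>B\<close> is left
  noetherian, in particular when \<open>B\<close> is an Artin algebra.
\<close>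

definition free_resolution ::
  "('b, 'z) ring_scheme \<Rightarrow> ('b, 'x) module \<Rightarrow>
   (nat \<Rightarrow> nat) \<Rightarrow> (nat \<Rightarrow> (nat \<Rightarrow> 'b) \<Rightarrow> (nat \<Rightarrow> 'b)) \<Rightarrow> ((nat \<Rightarrow> 'b) \<Rightarrow> 'x) \<Rightarrow> bool" where
  "free_resolution B X r d e \<longleftrightarrow>
     e \<in> mod_hom B (free_module B (r 0)) X \<and>
     e ` carrier (free_module B (r 0)) = carrier X \<and>
     (\<forall>i. d i \<in> mod_hom B (free_module B (r (Suc i))) (free_module B (r i))) \<and>
     d 0 ` carrier (free_module B (r (Suc 0))) = a_kernel (free_module B (r 0)) X e \<and>
     (\<forall>i. d (Suc i) ` carrier (free_module B (r (Suc (Suc i)))) =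
          a_kernel (free_module B (r (Suc i))) (free_module B (r i)) (d i))"

definition cocycles ::
  "('b, 'z) ring_scheme \<Rightarrow> (nat \<Rightarrow> nat) \<Rightarrow> (nat \<Rightarrow> (nat \<Rightarrow> 'b) \<Rightarrow> (nat \<Rightarrow> 'b)) \<Rightarrow>
   ('b, 'm) module \<Rightarrow> nat \<Rightarrow> ((nat \<Rightarrow> 'b) \<Rightarrow> 'm) set" where
  "cocycles B r d M i =
     {f \<in> carrier (hom_group B (free_module B (r i)) M).
        \<forall>x\<in>carrier (free_module B (r (Suc i))). f (d i x) = \<zero>\<^bsub>M\<^esub>}"

definition coboundaries ::
  "('b, 'z) ring_scheme \<Rightarrow> (nat \<Rightarrow> nat) \<Rightarrow> (nat \<Rightarrow> (nat \<Rightarrow> 'b) \<Rightarrow> (nat \<Rightarrow> 'b)) \<Rightarrow>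
   ('b, 'm) module \<Rightarrow> nat \<Rightarrow> ((nat \<Rightarrow> 'b) \<Rightarrow> 'm) set" where
  "coboundaries B r d M i =
     (case i of
        0 \<Rightarrow> {\<one>\<^bsub>hom_group B (free_module B (r 0)) M\<^esub>}
      | Suc j \<Rightarrow> (\<lambda>g. \<lambda>x\<in>carrier (free_module B (r (Suc j))). g (d j x)) `
                   carrier (hom_group B (free_module B (r j)) M))"

text \<open>
  The cohomology of \<open>Hom\<^sub>B(F, M)\<close> for a chosen resolution \<open>F\<close> of \<open>X\<close>; a different choice gives
  an isomorphic group.
\<close>

definition Ext ::
  "('b, 'z) ring_scheme \<Rightarrow> nat \<Rightarrow> ('b, 'x) module \<Rightarrow> ('b, 'm) module \<Rightarrow>
   ((nat \<Rightarrow> 'b) \<Rightarrow> 'm) set monoid" where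
  "Ext B i X M =
     (let (r, d, e) = (SOME (r, d, e). free_resolution B X r d e)
      in (hom_group B (free_module B (r i)) M) \<lparr> carrier := cocycles B r d M i \<rparr>
           Mod coboundaries B r d M i)"

definition perp :: "('b, 'z) ring_scheme \<Rightarrow> ('b, 'm) module \<Rightarrow> ('b, 'x) module set" where
  "perp B M = {X. fg_module B X \<and> (\<forall>i\<ge>1. trivial_group (Ext B i X M))}"


section \<open>Injective modules\<close>

text \<open>
  Extension along monomorphisms of finitely generated modules.  Over a left noetherian ring this
  is injectivity among all modules, by Baer's criterion.
\<close>

definition injective_module :: "('b, 'z) ring_scheme \<Rightarrow> ('b, 'i) module \<Rightarrow> bool" where
  "injective_module B I \<longleftrightarrow> lmodule B I \<and>
     (\<forall>(X :: ('b, 'b fg_carrier) module) (Y :: ('b, 'b fg_carrier) module) f g.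
        fg_module B X \<and> fg_module B Y \<and>
        f \<in> mod_hom B X Y \<and> inj_on f (carrier X) \<and> g \<in> mod_hom B X I \<longrightarrow>
        (\<exists>h\<in>mod_hom B Y I. \<forall>x\<in>carrier X. h (f x) = g x))"

text \<open>An exact sequence \<open>0 \<rightarrow> M \<rightarrow> I\<^sub>0 \<rightarrow> \<cdots> \<rightarrow> I\<^sub>r \<rightarrow> 0\<close> in \<open>B\<close>-mod with injective \<open>I\<^sub>j\<close>.\<close>

definition inj_dim_le :: "('b, 'z) ring_scheme \<Rightarrow> ('b, 'm) module \<Rightarrow> nat \<Rightarrow> bool" where
  "inj_dim_le B M r \<longleftrightarrow>
     (\<exists>(I :: nat \<Rightarrow> ('b, 'b fg_carrier) module) e d.
        (\<forall>j\<le>r. fg_module B (I j) \<and> injective_module B (I j)) \<and>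
        e \<in> mod_hom B M (I 0) \<and> inj_on e (carrier M) \<and>
        (\<forall>j<r. d j \<in> mod_hom B (I j) (I (Suc j))) \<and>
        (let Z = (\<lambda>j. if j < r then a_kernel (I j) (I (Suc j)) (d j) else carrier (I j))
         in e ` carrier M = Z 0 \<and> (\<forall>j<r. d j ` carrier (I j) = Z (Suc j))))"

definition injective_envelope ::
  "('b, 'z) ring_scheme \<Rightarrow> ('b, 'm) module \<Rightarrow> ('b, 'e) module \<Rightarrow> bool" where
  "injective_envelope B M E \<longleftrightarrow> injective_module B E \<and>
     (\<exists>f\<in>mod_hom B M E. inj_on f (carrier M) \<and>
        (\<forall>N. submodule N B E \<and> N \<inter> f ` carrier M = {\<zero>\<^bsub>E\<^esub>} \<longrightarrow> N = {\<zero>\<^bsub>E\<^esub>}))"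


section \<open>Artin algebras and the standard duality\<close>

locale artinian_cring = cring +
  assumes descending_ideal_chain_stationary:
    "\<And>I :: nat \<Rightarrow> 'a set. \<lbrakk> \<And>i. ideal (I i) R; \<And>i. I (Suc i) \<subseteq> I i \<rbrakk> \<Longrightarrow>
       \<exists>N. \<forall>i\<ge>N. I i = I N"

text \<open>The record \<open>A\<close> carries the ring structure and the action of \<open>k\<close>.\<close>

locale artin_algebra = artinian_cring k + A?: ring A + module k A
  for k :: "'k ring" and A :: "('k, 'a) module" (structure) +
  assumes smult_mult_left:
      "\<lbrakk> c \<in> carrier k; x \<in> carrier A; y \<in> carrier A \<rbrakk> \<Longrightarrow> (c \<odot> x) \<otimes> y = c \<odot> (x \<otimes> y)"
    and smult_mult_right:
      "\<lbrakk> c \<in> carrier k; x \<in> carrier A; y \<in> carrier A \<rbrakk> \<Longrightarrow> x \<otimes> (c \<odot> y) = c \<odot> (x \<otimes> y)"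
    and finitely_generated: "fg_module k A"

definition jacobson_radical :: "('k, 'z) ring_scheme \<Rightarrow> 'k set" where
  "jacobson_radical k = carrier k \<inter> \<Inter> {I. maximalideal I k}"

definition op_ring :: "('b, 'z) ring_scheme \<Rightarrow> ('b, 'z) ring_scheme" where
  "op_ring B = B \<lparr> mult := (\<lambda>x y. y \<otimes>\<^bsub>B\<^esub> x) \<rparr>"

text \<open>Restriction of scalars along \<open>k \<rightarrow> B, c \<mapsto> c \<odot> \<one>\<close>.\<close>

definition base_module :: "('k, 'b) module \<Rightarrow> ('b, 'm) module \<Rightarrow> ('k, 'm) module" where
  "base_module B M =
     \<lparr> carrier = carrier M, mult = undefined, one = undefined,
       zero = \<zero>\<^bsub>M\<^esub>, add = (\<lambda>x y. x \<oplus>\<^bsub>M\<^esub> y),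
       smult = (\<lambda>c x. (c \<odot>\<^bsub>B\<^esub> \<one>\<^bsub>B\<^esub>) \<odot>\<^bsub>M\<^esub> x) \<rparr>"

text \<open>
  \<open>D M = Hom\<^sub>k(M, E)\<close> for a right \<open>B\<close>-module \<open>M\<close>, given as a left module over \<open>op_ring B\<close>, with
  \<open>(b f)(x) = f (x b)\<close>.  It is the standard duality when \<open>E\<close> is the injective envelope of
  \<open>k / rad k\<close>.
\<close>

definition dual ::
  "'k ring \<Rightarrow> ('k, 'e) module \<Rightarrow> ('k, 'b) module \<Rightarrow> ('b, 'm) module \<Rightarrow> ('b, 'm \<Rightarrow> 'e) module" where
  "dual k E B M =
     \<lparr> carrier = carrier (hom_group k (base_module B M) E), mult = undefined, one = undefined,
       zero = \<one>\<^bsub>hom_group k (base_module B M) E\<^esub>,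
       add = (\<lambda>f g. f \<otimes>\<^bsub>hom_group k (base_module B M) E\<^esub> g),
       smult = (\<lambda>b f. \<lambda>x\<in>carrier M. f (b \<odot>\<^bsub>M\<^esub> x)) \<rparr>"

text \<open>\<open>D(B\<^sub>B)\<close>\<close>

definition dual_reg ::
  "'k ring \<Rightarrow> ('k, 'e) module \<Rightarrow> ('k, 'b) module \<Rightarrow> ('b, 'b \<Rightarrow> 'e) module" where
  "dual_reg k E B = dual k E B (reg_module (op_ring B))"


section \<open>Cotilting modules\<close>

definition add_class :: "('b, 'z) ring_scheme \<Rightarrow> ('b, 'm) module \<Rightarrow> ('b, 'x) module set" where
  "add_class B M =
     {X. lmodule B X \<and>
        (\<exists>m U V. let P = dsum {..<m::nat} (\<lambda>_. M) in
           submodule U B P \<and> submodule V B P \<and>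
           U \<inter> V = {\<zero>\<^bsub>P\<^esub>} \<and> set_add P U V = carrier P \<and>
           mod_iso B X (P \<lparr> carrier := U \<rparr>))}"

text \<open>
  There is an exact sequence \<open>0 \<rightarrow> T\<^sub>s \<rightarrow> \<cdots> \<rightarrow> T\<^sub>0 \<rightarrow> Y \<rightarrow> 0\<close> with all \<open>T\<^sub>i\<close> in \<open>add(T)\<close>.  A module in
  \<open>add(T)\<close> is isomorphic to a submodule of some \<open>T\<^sup>m\<close>, so the element type of the \<open>T\<^sub>i\<close> is no
  restriction.
\<close>

definition has_add_resolution ::
  "('b, 'z) ring_scheme \<Rightarrow> ('b, 'm) module \<Rightarrow> ('b, 'y) module \<Rightarrow> bool" where
  "has_add_resolution B T Y \<longleftrightarrow>
     (\<exists>s (Ts :: nat \<Rightarrow> ('b, nat \<Rightarrow> 'm) module) p d.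
        (\<forall>i\<le>s. Ts i \<in> add_class B T) \<and>
        p \<in> mod_hom B (Ts 0) Y \<and> p ` carrier (Ts 0) = carrier Y \<and>
        (\<forall>i<s. d i \<in> mod_hom B (Ts (Suc i)) (Ts i)) \<and>
        (let Im = (\<lambda>i. if i < s then d i ` carrier (Ts (Suc i)) else {\<zero>\<^bsub>Ts i\<^esub>})
         in a_kernel (Ts 0) Y p = Im 0 \<and>
            (\<forall>i<s. a_kernel (Ts (Suc i)) (Ts i) (d i) = Im (Suc i))))"

definition cotilting ::
  "'k ring \<Rightarrow> ('k, 'e) module \<Rightarrow> ('k, 'b) module \<Rightarrow> ('b, 'm) module \<Rightarrow> bool" where
  "cotilting k E B T \<longleftrightarrow> fg_module B T \<and>
     (\<exists>r. inj_dim_le B T r) \<and>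
     (\<forall>i\<ge>1. trivial_group (Ext B i T T)) \<and>
     has_add_resolution B T (dual_reg k E B)"


section \<open>Triangular matrix algebras and morphism categories\<close>

definition tri_algebra :: "nat \<Rightarrow> ('k, 'a) module \<Rightarrow> ('k, nat \<Rightarrow> nat \<Rightarrow> 'a) module" where
  "tri_algebra n A =
     \<lparr> carrier = (\<Pi>\<^sub>E i\<in>{1..n}. \<Pi>\<^sub>E j\<in>{1..n}. if i \<le> j then carrier A else {\<zero>\<^bsub>A\<^esub>}),
       mult = (\<lambda>a b. \<lambda>i\<in>{1..n}. \<lambda>j\<in>{1..n}. \<Oplus>\<^bsub>A\<^esub>l\<in>{1..n}. a i l \<otimes>\<^bsub>A\<^esub> b l j),
       one = (\<lambda>i\<in>{1..n}. \<lambda>j\<in>{1..n}. if i = j then \<one>\<^bsub>A\<^esub> else \<zero>\<^bsub>A\<^esub>),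
       zero = (\<lambda>i\<in>{1..n}. \<lambda>j\<in>{1..n}. \<zero>\<^bsub>A\<^esub>),
       add = (\<lambda>a b. \<lambda>i\<in>{1..n}. \<lambda>j\<in>{1..n}. a i j \<oplus>\<^bsub>A\<^esub> b i j),
       smult = (\<lambda>c a. \<lambda>i\<in>{1..n}. \<lambda>j\<in>{1..n}. c \<odot>\<^bsub>A\<^esub> a i j) \<rparr>"

text \<open>
  A sequence \<open>X\<^sub>n \<rightarrow> \<cdots> \<rightarrow> X\<^sub>1\<close> with \<open>strmap X i : X\<^sub>(i+1) \<rightarrow> X\<^sub>i\<close>.  The fields are only relevant for
  indices \<open>1..n\<close> and \<open>1..n-1\<close>, respectively.
\<close>

record ('a, 'x) mor =
  branch :: "nat \<Rightarrow> ('a, 'x) module"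
  strmap :: "nat \<Rightarrow> 'x \<Rightarrow> 'x"

definition Mor :: "nat \<Rightarrow> ('a, 'z) ring_scheme \<Rightarrow> ('a, 'x) mor set" where
  "Mor n A =
     {X. (\<forall>i\<in>{1..n}. fg_module A (branch X i)) \<and>
         (\<forall>i\<in>{1..n-1}. strmap X i \<in> mod_hom A (branch X (Suc i)) (branch X i))}"

text \<open>\<open>mor_path X i d = \<phi>\<^sub>i \<cdots> \<phi>\<^sub>(i+d-1) : X\<^sub>(i+d) \<rightarrow> X\<^sub>i\<close>\<close>

primrec mor_path :: "('a, 'x) mor \<Rightarrow> nat \<Rightarrow> nat \<Rightarrow> 'x \<Rightarrow> 'x" where
  "mor_path X i 0 = id"
| "mor_path X i (Suc d) = mor_path X i d \<circ> strmap X (i + d)"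

text \<open>The left module over \<open>tri_algebra n A\<close> corresponding to an object of \<open>Mor n A\<close>.\<close>

definition mor_module :: "nat \<Rightarrow> ('a, 'x) mor \<Rightarrow> (nat \<Rightarrow> nat \<Rightarrow> 'a, nat \<Rightarrow> 'x) module" where
  "mor_module n X =
     \<lparr> carrier = (\<Pi>\<^sub>E i\<in>{1..n}. carrier (branch X i)), mult = undefined, one = undefined,
       zero = (\<lambda>i\<in>{1..n}. \<zero>\<^bsub>branch X i\<^esub>),
       add = (\<lambda>x y. \<lambda>i\<in>{1..n}. x i \<oplus>\<^bsub>branch X i\<^esub> y i),
       smult = (\<lambda>a x. \<lambda>i\<in>{1..n}.
          (a i i \<odot>\<^bsub>branch X i\<^esub> x i) \<oplus>\<^bsub>branch X i\<^esub>
          (\<Oplus>\<^bsub>branch X i\<^esub>j\<in>{i<..n}. a i j \<odot>\<^bsub>branch X i\<^esub> mor_path X i (j - i) (x j))) \<rparr>"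

text \<open>
  The left perpendicular category of a \<open>tri_algebra n A\<close>-module, as a class of objects of \<open>Mor n A\<close>.
\<close>

definition mor_perp ::
  "nat \<Rightarrow> ('k, 'a) module \<Rightarrow> (nat \<Rightarrow> nat \<Rightarrow> 'a, 'm) module \<Rightarrow> ('a, 'x) mor set" where
  "mor_perp n A M = {X \<in> Mor n A. mor_module n X \<in> perp (tri_algebra n A) M}"

text \<open>
  The cokernel has elements of type \<open>'x set\<close>; membership in \<open>\<X>\<close> is up to isomorphism.  (Cosets
  have representatives in \<open>'x\<close>, so an isomorphic module with element type \<open>'x\<close> always exists.)
\<close>

definition mono_cat ::
  "nat \<Rightarrow> ('a, 'z) ring_scheme \<Rightarrow> ('a, 'x) module set \<Rightarrow> ('a, 'x) mor set" where
  "mono_cat n A \<X> =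
     {X \<in> Mor n A.
        (\<forall>i\<in>{1..n}. branch X i \<in> \<X>) \<and>
        (\<forall>i\<in>{1..n-1}. inj_on (strmap X i) (carrier (branch X (Suc i))) \<and>
           (\<exists>Z\<in>\<X>. mod_iso A (coker (branch X (Suc i)) (branch X i) (strmap X i)) Z))}"

definition m_obj :: "('a, 't) module \<Rightarrow> nat \<Rightarrow> ('a, 't) mor" where
  "m_obj M i =
     \<lparr> branch = (\<lambda>j. if j \<le> i then M else M \<lparr> carrier := {\<zero>\<^bsub>M\<^esub>} \<rparr>),
       strmap = (\<lambda>j. if j < i then id else (\<lambda>_. \<zero>\<^bsub>M\<^esub>)) \<rparr>"

definition m_module ::
  "nat \<Rightarrow> ('a, 't) module \<Rightarrow> (nat \<Rightarrow> nat \<Rightarrow> 'a, nat \<Rightarrow> nat \<Rightarrow> 't) module" where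
  "m_module n M = dsum {1..n} (\<lambda>i. mor_module n (m_obj M i))"

end

theory Submission
 imports Defs
begin

text \<open>
 Write \<open>Ivl M j n\<close> for the object with \<open>M\<close> at the positions \<open>j, ..., n\<close> and \<open>Z\<^sub>j\<close> for the \<open>j\<close>-th branch
 of \<open>Z\<close>.  The functor \<open>Ivl _ j n\<close> is right adjoint to the exact functor \<open>Z \<mapsto> Z\<^sub>j\<close>, which preserves
 projectives, so \<open>Z\<close> is orthogonal to \<open>Ivl M j n\<close> iff \<open>Z\<^sub>j\<close> is orthogonal to \<open>M\<close>.  The exact sequences
 \<open>0 \<rightarrow> m\<^sub>i(M) \<rightarrow> m\<^sub>n(M) \<rightarrow> Ivl M (i+1) n \<rightarrow> 0\<close> turn this into: \<open>Z\<close> is orthogonal to \<open>m(M)\<close> iff all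
 \<open>Z\<^sub>i\<close> are orthogonal to \<open>M\<close> and all maps \<open>Hom(Z\<^sub>i, M) \<rightarrow> Hom(Z\<^sub>i\<^sub>+\<^sub>1, M)\<close> are surjective.  If \<open>D(A)\<close>
 has a finite resolution by \<open>add(M)\<close>, a map \<open>Z\<^sub>i\<^sub>+\<^sub>1 \<rightarrow> D(A)\<close> then lifts to \<open>add(M)\<close> and extends to
 \<open>Z\<^sub>i\<close>, so that \<open>Z\<^sub>i\<^sub>+\<^sub>1 \<rightarrow> Z\<^sub>i\<close> is mono, and its cokernel is orthogonal to \<open>M\<close>.

 If \<open>M\<close> is cotilting, the same sequences bound the injective dimension of \<open>m(M)\<close> and resolve
 \<open>D(T\<^sub>n(A))\<close>, the direct sum of the \<open>Ivl D(A) j n\<close>, by \<open>add(m(M))\<close>.  For uniqueness, every module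
 orthogonal to a cotilting module \<open>C\<close> embeds into \<open>add(C)\<close> with orthogonal cokernel; this applies
 to every cotilting module with the same orthogonal class, and the embedding splits.

 Orthogonality is handled without Ext groups: \<open>X\<close> is orthogonal to \<open>M\<close> iff some projective \<open>P \<rightarrow> X\<close>
 has a kernel \<open>K\<close> orthogonal to \<open>M\<close> such that all maps \<open>K \<rightarrow> M\<close> extend to \<open>P\<close> (coinductively).
\<close>

text \<open>Two obstacles shape the development. Formulas cannot range over element types, while
  syzygies, kernels and cokernels change the element type at every step; so recursive notions are
  set up over \<open>fgm\<close>, and each induction replaces the next module by a copy. And
  \<open>Ext\<close> is computed from one chosen resolution; each use of its long exact sequences
  becomes a closure property of \<open>orth\<close>, proved by coinduction along projective covers.
  The surjectivity condition arises as follows. If \<open>Z\<close> is orthogonal to the middle and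
  the right term of the sequence for \<open>m_i(M)\<close>, then \<open>Ext^1(Z, m_i(M))\<close> is
  the cokernel of the map between their Hom groups. By adjunction this map is
  \<open>Hom(Z_1, M) -> Hom(Z_(i+1), M)\<close>, so composite arrows appear before single ones.
  \<open>D(A)\<close> matters because it is a cogenerator, which is derived from minimal ideals of
  \<open>k\<close>. Resolutions by finitely generated projectives need noetherian rings, but
  \<open>k\<close> is only given as artinian; hence Akizuki's theorem.\<close>

type_synonym 'b fgm = "('b, 'b fg_carrier) module"

abbreviation add_in ("(_ +[_] _)" [65, 0, 66] 65) where "x +[M] y \<equiv> add M x y"
abbreviation mult_in ("(_ *[_] _)" [70, 0, 71] 70) where "x *[B] y \<equiv> mult B x y"
abbreviation smult_in ("(_ .[_] _)" [70, 0, 71] 70) where "b .[M] x \<equiv> smult M b x"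

section \<open>Modules and homomorphisms\<close>

text \<open>Since the zero scalar acts as zero, \<open>(-1) x\<close> is an additive inverse of
  \<open>x\<close>, so no inverses have to be exhibited.\<close>

lemma lmoduleI:
 assumes "ring B"
  and zero: "zero M \<in> carrier M"
  and add: "!!x y. x \<in> carrier M ==> y \<in> carrier M ==> x +[M] y \<in> carrier M"
  and smult: "!!a x. a \<in> carrier B ==> x \<in> carrier M ==> a .[M] x \<in> carrier M"
  and assoc: "!!x y z. x \<in> carrier M ==> y \<in> carrier M ==> z \<in> carrier M ==>
   (x +[M] y) +[M] z = x +[M] (y +[M] z)"
  and comm: "!!x y. x \<in> carrier M ==> y \<in> carrier M ==> x +[M] y = y +[M] x"
  and l_zero: "!!x. x \<in> carrier M ==> zero M +[M] x = x"
  and l_distr: "!!a b x. a \<in> carrier B ==> b \<in> carrier B ==> x \<in> carrier M ==>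
   (a +[B] b) .[M] x = a .[M] x +[M] b .[M] x"
  and r_distr: "!!a x y. a \<in> carrier B ==> x \<in> carrier M ==> y \<in> carrier M ==>
   a .[M] (x +[M] y) = a .[M] x +[M] a .[M] y"
  and smult_assoc: "!!a b x. a \<in> carrier B ==> b \<in> carrier B ==> x \<in> carrier M ==>
   (a *[B] b) .[M] x = a .[M] (b .[M] x)"
  and one: "!!x. x \<in> carrier M ==> one B .[M] x = x"
  and zero_smult: "!!x. x \<in> carrier M ==> zero B .[M] x = zero M"
 shows "lmodule B M"
proof (intro lmodule.intro lmodule_axioms.intro abelian_groupI)
 interpret B: ring B by fact
 fix x assume x: "x \<in> carrier M"
 have "(\<ominus>\<^bsub>B\<^esub> (one B)) .[M] x +[M] x = (\<ominus>\<^bsub>B\<^esub> (one B) +[B] one B) .[M] x"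
  using x l_distr[of "\<ominus>\<^bsub>B\<^esub> (one B)" "one B" x] one[of x] by simp
 also have "... = zero M" using x by (simp add: B.l_neg zero_smult)
 finally show "\<exists>y\<in>carrier M. y +[M] x = zero M" using x smult by blast
qed (use assms in auto)

text \<open>
 Subtraction is expressed through the action of \<open>-1\<close>, because \<open>a_inv\<close> of a submodule or of a
 product is not definitionally the one of the ambient modules.
\<close>

definition msub :: "('b, 'z) ring_scheme => ('b, 'm) module => 'm => 'm => 'm" where
 "msub B M x y = x +[M] (\<ominus>\<^bsub>B\<^esub> (one B)) .[M] y"

context lmodule
begin

lemma neg_one_smult: "x \<in> carrier M ==> (\<ominus>\<^bsub>R\<^esub> (one R)) \<odot> x = \<ominus> x"
proof -
 assume x: "x \<in> carrier M"
 have "(\<ominus>\<^bsub>R\<^esub> (one R)) \<odot> x \<oplus> x = (\<ominus>\<^bsub>R\<^esub> (one R) +[R] one R) \<odot> x"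
  using x by (simp add: smult_l_distr)
 also have "... = \<zero>" using x by (simp add: R.l_neg smult_zero_left)
 finally show ?thesis using x by (metis M.minus_equality R.add.inv_closed R.one_closed smult_closed)
qed

lemma msub_minus: "x \<in> carrier M ==> y \<in> carrier M ==> msub R M x y = x \<ominus> y"
 by (simp add: msub_def neg_one_smult M.minus_eq)

lemma msub_closed [simp, intro]: "x \<in> carrier M ==> y \<in> carrier M ==> msub R M x y \<in> carrier M"
 by (simp add: msub_def)

lemma msub_eq_zero: "x \<in> carrier M ==> y \<in> carrier M ==> msub R M x y = \<zero> \<longleftrightarrow> x = y"
 by (metis M.add.inv_closed M.minus_eq M.minus_equality M.minus_minus M.r_neg msub_minus)

lemma add_msub: "x \<in> carrier M ==> y \<in> carrier M ==> x \<oplus> msub R M y x = y"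
 by (simp add: msub_minus M.minus_eq M.a_ac M.r_neg1 M.r_neg2)
   (metis M.a_comm M.a_inv_closed M.r_neg2)

lemma msub_zero: "x \<in> carrier M ==> msub R M x \<zero> = x"
 by (simp add: msub_minus M.minus_eq)

lemma msub_add_left: "x \<in> carrier M ==> y \<in> carrier M ==> msub R M (x \<oplus> y) x = y"
 by (simp add: msub_minus M.minus_eq M.a_ac)
   (metis M.a_assoc M.a_comm M.a_inv_closed M.r_neg1)

lemma msub_smult: "a \<in> carrier R ==> x \<in> carrier M ==> y \<in> carrier M ==>
  msub R M (a \<odot> x) (a \<odot> y) = a \<odot> msub R M x y"
 by (simp add: msub_def smult_r_distr flip: smult_assoc1) (simp add: R.l_minus R.r_minus)

lemma msub_add: "x \<in> carrier M ==> y \<in> carrier M ==> x' \<in> carrier M ==> y' \<in> carrier M ==>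
  msub R M (x \<oplus> x') (y \<oplus> y') = msub R M x y \<oplus> msub R M x' y'"
 by (simp add: msub_def smult_r_distr M.a_ac)

lemma submoduleI:
 assumes "N \<subseteq> carrier M" "\<zero> \<in> N"
  and "!!x y. x \<in> N ==> y \<in> N ==> x \<oplus> y \<in> N"
  and "!!a x. a \<in> carrier R ==> x \<in> N ==> a \<odot> x \<in> N"
 shows "submodule N R M"
proof (intro submodule.intro subgroup.intro submodule_axioms.intro)
 fix x assume x: "x \<in> N"
 then have "\<ominus> x = (\<ominus>\<^bsub>R\<^esub> (one R)) \<odot> x" using assms(1) by (auto simp: neg_one_smult)
 then have "\<ominus> x \<in> N" using x assms(4) by simp
 then show "inv\<^bsub>add_monoid M\<^esub> x \<in> N" unfolding a_inv_def .
qed (use assms in auto)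

end

section \<open>Submodules and restriction of the carrier\<close>

lemma submoduleD:
 assumes "submodule N B M"
 shows "N \<subseteq> carrier M" "zero M \<in> N"
  "x \<in> N ==> y \<in> N ==> x +[M] y \<in> N" "a \<in> carrier B ==> x \<in> N ==> a .[M] x \<in> N"
proof -
 interpret submodule N B M by fact
 show "N \<subseteq> carrier M" "zero M \<in> N" 
  "x \<in> N ==> y \<in> N ==> x +[M] y \<in> N" "a \<in> carrier B ==> x \<in> N ==> a .[M] x \<in> N"
  using subset one_closed m_closed[of x y] smult_closed[of a x] by auto
qed

lemma submodule_in: "submodule N B M ==> x \<in> N ==> x \<in> carrier M"
 using submoduleD(1) by blast

lemma submodule_msub:
 "submodule N B M ==> ring B ==> x \<in> N ==> y \<in> N ==> msub B M x y \<in> N"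
 unfolding msub_def by (intro submoduleD(3,4)) (auto simp: ring.ring_simprules)

lemma lmodule_ring: "lmodule B M ==> ring B"
 by (rule lmodule.axioms)

lemma lmodule_restrict:
 assumes M: "lmodule B M" and N: "submodule N B M"
 shows "lmodule B (M\<lparr>carrier := N\<rparr>)"
proof -
 interpret lmodule B M by fact
 show ?thesis
  by (rule lmoduleI)
    (use submoduleD[OF N] submodule_in[OF N] in
     \<open>auto simp: R.ring_axioms M.a_ac smult_l_distr smult_r_distr smult_assoc1 smult_zero_left\<close>)
qed

lemma submodule_restrict:
 assumes M: "lmodule B M" and N: "submodule N B M"
 shows "submodule K B (M\<lparr>carrier := N\<rparr>) \<longleftrightarrow> submodule K B M & K \<subseteq> N"
proof -
 interpret M: lmodule B M by fact
 interpret N: lmodule B "M\<lparr>carrier := N\<rparr>" using M N by (rule lmodule_restrict)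
 show ?thesis
 proof
  assume K: "submodule K B (M\<lparr>carrier := N\<rparr>)"
  show "submodule K B M & K \<subseteq> N"
   using submoduleD[OF K] submoduleD(1)[OF N] by (intro conjI M.submoduleI) auto
 next
  assume K: "submodule K B M & K \<subseteq> N"
  then show "submodule K B (M\<lparr>carrier := N\<rparr>)"
   using submoduleD[of K B M] by (intro N.submoduleI) auto
 qed
qed

lemma submodule_carrier: "lmodule B M ==> submodule (carrier M) B M"
proof -
 assume "lmodule B M"
 then interpret lmodule B M .
 show ?thesis by (rule submoduleI) auto
qed

lemma submodule_zero: "lmodule B M ==> submodule {zero M} B M"
proof -
 assume "lmodule B M"
 then interpret lmodule B M .
 show ?thesis by (rule submoduleI) (auto simp: smult_zero)
qed

lemma submodule_Int:
 assumes "lmodule B M" "submodule K B M" "submodule N B M"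
 shows "submodule (K \<inter> N) B M"
proof -
 interpret lmodule B M by fact
 show ?thesis using submoduleD[OF assms(2)] submoduleD[OF assms(3)] by (intro submoduleI) auto
qed

lemma submodule_Inter:
 assumes "lmodule B M" "F ~= {}" "!!K. K \<in> F ==> submodule K B M"
 shows "submodule (\<Inter>F) B M"
proof -
 interpret lmodule B M by fact
 note F = submoduleD[OF assms(3)]
 show ?thesis
 proof (rule submoduleI)
  show "\<Inter>F \<subseteq> carrier M" using assms(2) F(1) by blast
 qed (use F in auto)
qed

section \<open>Homomorphisms, kernels and images\<close>

lemma mod_homI:
 assumes "!!x. x \<in> carrier M ==> f x \<in> carrier N"
  "!!x y. x \<in> carrier M ==> y \<in> carrier M ==> f (x +[M] y) = f x +[N] f y"
  "!!b x. b \<in> carrier B ==> x \<in> carrier M ==> f (b .[M] x) = b .[N] f x"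
 shows "f \<in> mod_hom B M N"
 using assms by (auto simp: mod_hom_def hom_def)

lemma mod_homD:
 assumes "f \<in> mod_hom B M N"
 shows "x \<in> carrier M ==> f x \<in> carrier N"
  "x \<in> carrier M ==> y \<in> carrier M ==> f (x +[M] y) = f x +[N] f y"
  "b \<in> carrier B ==> x \<in> carrier M ==> f (b .[M] x) = b .[N] f x"
 using assms by (auto simp: mod_hom_def hom_def)

lemma mod_hom_zero:
 assumes "f \<in> mod_hom B M N" "lmodule B M" "lmodule B N"
 shows "f (zero M) = zero N"
proof -
 interpret M: lmodule B M by fact
 interpret N: lmodule B N by fact
 have "f (zero M) = f (zero B .[M] zero M)" by (simp add: M.smult_zero)
 also have "... = zero N" using mod_homD[OF assms(1)] by (simp add: N.smult_zero_left)
 finally show ?thesis .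
qed

lemma mod_hom_msub:
 assumes "f \<in> mod_hom B M N" "lmodule B M" "x \<in> carrier M" "y \<in> carrier M"
 shows "f (msub B M x y) = msub B N (f x) (f y)"
proof -
 interpret M: lmodule B M by fact
 show ?thesis using assms mod_homD[OF assms(1)] by (simp add: msub_def)
qed

lemma mod_hom_comp:
 "f \<in> mod_hom B X Y ==> g \<in> mod_hom B Y Z ==> (%x. g (f x)) \<in> mod_hom B X Z"
 by (rule mod_homI) (simp_all add: mod_homD)

lemma mod_hom_id: "(%x. x) \<in> mod_hom B X X"
 by (rule mod_homI) simp_all

lemma mod_hom_const_zero: "lmodule B Y ==> (%x. zero Y) \<in> mod_hom B X Y"
proof -
 assume "lmodule B Y"
 then interpret lmodule B Y .
 show ?thesis by (rule mod_homI) (simp_all add: smult_zero)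
qed

lemma mod_hom_add:
 assumes "lmodule B Y" "f \<in> mod_hom B X Y" "g \<in> mod_hom B X Y"
 shows "(%x. f x +[Y] g x) \<in> mod_hom B X Y"
proof -
 interpret Y: lmodule B Y by fact
 show ?thesis
  by (rule mod_homI)
    (use mod_homD[OF assms(2)] mod_homD[OF assms(3)] in \<open>auto simp: Y.smult_r_distr Y.M.a_ac\<close>)
qed

lemma mod_hom_diff:
 assumes "lmodule B Y" "f \<in> mod_hom B X Y" "g \<in> mod_hom B X Y"
 shows "(%x. msub B Y (f x) (g x)) \<in> mod_hom B X Y"
proof -
 interpret Y: lmodule B Y by fact
 show ?thesis
  by (rule mod_homI)
    (use mod_homD[OF assms(2)] mod_homD[OF assms(3)] in \<open>auto simp: Y.msub_smult Y.msub_add\<close>)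
qed

lemma mod_hom_cong:
 assumes "f \<in> mod_hom B X Y" "lmodule B X" "!!x. x \<in> carrier X ==> g x = f x"
 shows "g \<in> mod_hom B X Y"
proof -
 interpret X: lmodule B X by fact
 show ?thesis by (rule mod_homI) (use mod_homD[OF assms(1)] assms(3) in auto)
qed

lemma mod_hom_restrict:
 "f \<in> mod_hom B X Y ==> N \<subseteq> carrier X ==> f \<in> mod_hom B (X\<lparr>carrier := N\<rparr>) Y"
 by (rule mod_homI) (auto simp: mod_homD subset_iff)

lemma mod_hom_restrict_cod:
 "f \<in> mod_hom B X Y ==> f ` carrier X \<subseteq> N ==> f \<in> mod_hom B X (Y\<lparr>carrier := N\<rparr>)"
 by (rule mod_homI) (auto simp: mod_homD image_subset_iff)

lemma mod_hom_extend_cod: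
 "f \<in> mod_hom B X (Y\<lparr>carrier := N\<rparr>) ==> N \<subseteq> carrier Y ==> f \<in> mod_hom B X Y"
 by (rule mod_homI) (use mod_homD[of f B X "Y\<lparr>carrier := N\<rparr>"] in auto)

lemma a_kernel_eq: "a_kernel X Y f = {x \<in> carrier X. f x = zero Y}"
 by (simp add: a_kernel_def kernel_def)

lemma submodule_kernel:
 assumes "lmodule B X" "lmodule B Y" "f \<in> mod_hom B X Y"
 shows "submodule (a_kernel X Y f) B X"
proof -
 interpret X: lmodule B X by fact
 interpret Y: lmodule B Y by fact
 show ?thesis
  by (rule X.submoduleI)
    (use assms in \<open>auto simp: a_kernel_eq mod_homD mod_hom_zero Y.smult_zero\<close>)
qed

lemma submodule_vimage:
 assumes "lmodule B X" "lmodule B Y" "f \<in> mod_hom B X Y" "submodule N B Y"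
 shows "submodule {x \<in> carrier X. f x \<in> N} B X"
proof -
 interpret X: lmodule B X by fact
 show ?thesis
  by (rule X.submoduleI)
    (use assms mod_hom_zero[OF assms(3,1,2)] in \<open>auto simp: mod_homD submoduleD\<close>)
qed

lemma submodule_image:
 assumes "lmodule B X" "lmodule B Y" "f \<in> mod_hom B X Y" "submodule N B X"
 shows "submodule (f ` N) B Y"
proof -
 interpret Y: lmodule B Y by fact
 note N = submoduleD[OF assms(4)] and f = mod_homD[OF assms(3)]
 show ?thesis
 proof (rule Y.submoduleI)
  show "f ` N \<subseteq> carrier Y" using N f by auto
  show "zero Y \<in> f ` N" using N(2) mod_hom_zero[OF assms(3,1,2)] by force
 next
  fix x y assume "x \<in> f ` N" "y \<in> f ` N"
  then obtain u v where "u \<in> N" "v \<in> N" "x = f u" "y = f v" by auto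
  then show "x +[Y] y \<in> f ` N" using N f(2)[of u v] by (intro image_eqI[of _ _ "u +[X] v"]) (auto simp: subset_iff)
 next
  fix a x assume a: "a \<in> carrier B" and "x \<in> f ` N"
  then obtain u where "u \<in> N" "x = f u" by auto
  then show "a .[Y] x \<in> f ` N" using a N f(3)[of a u] by (intro image_eqI[of _ _ "a .[X] u"]) auto
 qed
qed

lemma inj_on_mod_hom:
 assumes "lmodule B X" "lmodule B Y" "f \<in> mod_hom B X Y"
 shows "inj_on f (carrier X) \<longleftrightarrow> (\<forall>x\<in>carrier X. f x = zero Y --> x = zero X)"
proof -
 interpret X: lmodule B X by fact
 interpret Y: lmodule B Y by fact
 note f = mod_homD[OF assms(3)]
 show ?thesis
 proof
  assume "inj_on f (carrier X)"
  then show "\<forall>x\<in>carrier X. f x = zero Y --> x = zero X"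
   by (metis X.M.zero_closed assms inj_onD mod_hom_zero)
 next
  assume *: "\<forall>x\<in>carrier X. f x = zero Y --> x = zero X"
  show "inj_on f (carrier X)"
  proof (rule inj_onI)
   fix x y assume xy: "x \<in> carrier X" "y \<in> carrier X" "f x = f y"
   then have "f (msub B X x y) = zero Y"
    using f by (simp add: mod_hom_msub[OF assms(3,1)] Y.msub_eq_zero)
   then show "x = y" using * xy X.msub_closed X.msub_eq_zero by blast
  qed
 qed
qed

text \<open>The universal property of a surjection. Maps out of quotients, sums of submodules and
  pushouts are all obtained from it, without choosing cosets.\<close>

lemma mod_hom_factor:
 assumes S: "lmodule B S" and Q: "lmodule B Q" and M: "lmodule B M"
  and s: "s \<in> mod_hom B S Q" "s ` carrier S = carrier Q" and t: "t \<in> mod_hom B S M"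
  and ker: "!!x. x \<in> carrier S ==> s x = zero Q ==> t x = zero M"
 shows "\<exists>h\<in>mod_hom B Q M. \<forall>x\<in>carrier S. h (s x) = t x"
proof -
 interpret S: lmodule B S by fact
 interpret Q: lmodule B Q by fact
 interpret M: lmodule B M by fact
 define h where "h q = t (inv_into (carrier S) s q)" for q
 have eq: "t x = t y" if "x \<in> carrier S" "y \<in> carrier S" "s x = s y" for x y
 proof -
  have "s (msub B S x y) = zero Q"
   using that mod_homD[OF s(1)] by (simp add: mod_hom_msub[OF s(1) S] Q.msub_eq_zero)
  then have "t (msub B S x y) = zero M" using that by (intro ker) auto
  then show ?thesis
   using that mod_homD[OF t] by (simp add: mod_hom_msub[OF t S] M.msub_eq_zero)
 qed
 have hs: "h (s x) = t x" if "x \<in> carrier S" for x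
  unfolding h_def using that by (intro eq) (auto intro: inv_into_into f_inv_into_f)
 have "h \<in> mod_hom B Q M"
 proof (rule mod_homI)
  fix x assume "x \<in> carrier Q"
  then obtain u where "u \<in> carrier S" "x = s u" using s(2) by blast
  then show "h x \<in> carrier M" using mod_homD[OF t] by (simp add: hs)
 next
  fix x y assume "x \<in> carrier Q" "y \<in> carrier Q"
  then obtain u v where uv: "u \<in> carrier S" "x = s u" "v \<in> carrier S" "y = s v"
   using s(2) by blast
  then have "h (x +[Q] y) = h (s (u +[S] v))" by (simp add: mod_homD[OF s(1)])
  then show "h (x +[Q] y) = h x +[M] h y" using uv by (simp add: hs mod_homD[OF t])
 next
  fix b x assume b: "b \<in> carrier B" and "x \<in> carrier Q"
  then obtain u where u: "u \<in> carrier S" "x = s u" using s(2) by blast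
  then have "h (b .[Q] x) = h (s (b .[S] u))" using b by (simp add: mod_homD[OF s(1)])
  then show "h (b .[Q] x) = b .[M] h x" using u b by (simp add: hs mod_homD[OF t])
 qed
 then show ?thesis using hs by blast
qed

lemma mod_hom_inv_into:
 assumes "lmodule B X" "f \<in> mod_hom B X Y" "bij_betw f (carrier X) (carrier Y)"
 shows "inv_into (carrier X) f \<in> mod_hom B Y X"
proof -
 interpret X: lmodule B X by fact
 let ?g = "inv_into (carrier X) f"
 note f = mod_homD[OF assms(2)]
 have im: "f ` carrier X = carrier Y" and inj: "inj_on f (carrier X)"
  using assms(3) by (auto simp: bij_betw_def)
 have gf: "!!x. x \<in> carrier X ==> ?g (f x) = x" using inj by (rule inv_into_f_f)
 show ?thesis
 proof (rule mod_homI)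
  fix x assume "x \<in> carrier Y"
  then show "?g x \<in> carrier X" unfolding im[symmetric] by (rule inv_into_into)
 next
  fix x y assume "x \<in> carrier Y" "y \<in> carrier Y"
  then obtain u v where "u \<in> carrier X" "x = f u" "v \<in> carrier X" "y = f v"
   unfolding im[symmetric] by blast
  then show "?g (x +[Y] y) = ?g x +[X] ?g y" using gf[of "u +[X] v"] by (simp add: f gf)
 next
  fix b x assume b: "b \<in> carrier B" and "x \<in> carrier Y"
  then obtain u where "u \<in> carrier X" "x = f u" unfolding im[symmetric] by blast
  then show "?g (b .[Y] x) = b .[X] ?g x" using b gf[of "b .[X] u"] by (simp add: f gf)
 qed
qed

section \<open>Isomorphisms\<close>

lemma mod_isoI:
 assumes "f \<in> mod_hom B X Y" "g \<in> mod_hom B Y X"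
  and "!!x. x \<in> carrier X ==> g (f x) = x" "!!y. y \<in> carrier Y ==> f (g y) = y"
 shows "mod_iso B X Y"
 unfolding mod_iso_def using assms
 by (intro bexI[of _ f] bij_betwI[where g = g]) (auto simp: mod_homD)

lemma mod_isoE:
 assumes "mod_iso B X Y" "lmodule B X"
 obtains f g where "f \<in> mod_hom B X Y" "g \<in> mod_hom B Y X"
  "!!x. x \<in> carrier X ==> g (f x) = x" "!!y. y \<in> carrier Y ==> f (g y) = y"
proof -
 from assms(1) obtain f where f: "f \<in> mod_hom B X Y" "bij_betw f (carrier X) (carrier Y)"
  by (auto simp: mod_iso_def)
 show thesis
  by (rule that[OF f(1) mod_hom_inv_into[OF assms(2) f]])
    (use f(2) in \<open>auto simp: bij_betw_def f_inv_into_f\<close>)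
qed

lemma mod_iso_refl: "mod_iso B X X"
 by (rule mod_isoI[of "%x. x" _ _ _ "%x. x"]) (auto intro: mod_hom_id)

lemma mod_iso_sym: "mod_iso B X Y ==> lmodule B X ==> mod_iso B Y X"
 by (erule mod_isoE, assumption, rule mod_isoI)

lemma mod_iso_trans: "mod_iso B X Y ==> mod_iso B Y Z ==> mod_iso B X Z"
proof -
 assume "mod_iso B X Y" "mod_iso B Y Z"
 then obtain f g where "f \<in> mod_hom B X Y" "bij_betw f (carrier X) (carrier Y)"
  "g \<in> mod_hom B Y Z" "bij_betw g (carrier Y) (carrier Z)" by (auto simp: mod_iso_def)
 then have "(%x. g (f x)) \<in> mod_hom B X Z" "bij_betw (g \<circ> f) (carrier X) (carrier Z)"
  by (auto intro: mod_hom_comp bij_betw_trans)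
 then show ?thesis unfolding mod_iso_def comp_def by blast
qed

lemma mod_iso_bij:
 assumes "f \<in> mod_hom B X Y" "inj_on f (carrier X)" "f ` carrier X = carrier Y"
 shows "mod_iso B X Y"
 using assms by (auto simp: mod_iso_def bij_betw_def)

text \<open>Reduces the coset construction to a surjection with prescribed kernel; after this the
  cosets themselves are rarely touched.\<close>

lemma quot_module_projection:
 assumes M: "lmodule B M" and N: "submodule N B M"
 defines "p \<equiv> (%x. N +>\<^bsub>M\<^esub> x)"
 shows "lmodule B (quot_module M N)" "p \<in> mod_hom B M (quot_module M N)"
  "p ` carrier M = carrier (quot_module M N)"
  "!!x. x \<in> carrier M ==> p x = zero (quot_module M N) \<longleftrightarrow> x \<in> N"
proof -
 interpret M: lmodule B M by fact
 interpret S: submodule N B M by fact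
 have ag: "additive_subgroup N M" by (simp add: additive_subgroup.intro S.subgroup_axioms)
 interpret N: abelian_subgroup N M
  by (rule abelian_subgroupI3[OF ag M.abelian_group_axioms])
 have eqv: "p x = p y \<longleftrightarrow> msub B M x y \<in> N" if "x \<in> carrier M" "y \<in> carrier M" for x y
 proof
  assume "p x = p y"
  then have "x \<in> N +>\<^bsub>M\<^esub> y" using that N.a_rcos_self[of x] by (simp add: p_def)
  then have "x \<ominus>\<^bsub>M\<^esub> y \<in> N" using that N.a_rcos_module_imp[of y x] by (simp add: M.M.minus_eq)
  then show "msub B M x y \<in> N" using that by (simp add: M.msub_minus)
 next
  assume "msub B M x y \<in> N"
  then have "x +[M] \<ominus>\<^bsub>M\<^esub> y \<in> N" using that by (simp add: M.msub_minus M.M.minus_eq)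
  then have "x \<in> N +>\<^bsub>M\<^esub> y" using that by (intro N.a_rcos_module_rev) auto
  then show "p x = p y" unfolding p_def using that N.a_repr_independence'[of x y] by simp
 qed
 have car: "carrier (quot_module M N) = p ` carrier M"
  by (auto simp: quot_module_def A_RCOSETS_def' p_def)
 have zero: "zero (quot_module M N) = p (zero M)"
  by (simp add: quot_module_def p_def) (metis M.M.a_coset_add_zero N.a_subset)
 have add: "p x +[quot_module M N] p y = p (x +[M] y)" if "x \<in> carrier M" "y \<in> carrier M" for x y
  using that by (simp add: quot_module_def p_def N.a_rcos_sum)
 have sm: "b .[quot_module M N] p x = p (b .[M] x)" if b: "b \<in> carrier B" and x: "x \<in> carrier M" for b x
 proof -
  \<comment> \<open>\<open>smult\<close> of \<open>quot_module\<close> is a union over all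
    representatives of a coset; it collapses because each of them yields the same coset.\<close>
  have "p (b .[M] y) = p (b .[M] x)" if "y \<in> p x" for y
  proof -
   from that x have y: "y \<in> carrier M" unfolding p_def by (rule N.a_elemrcos_carrier[rotated])
   from that x have "p x = p y" unfolding p_def by (intro N.a_repr_independence') auto
   then have "msub B M x y \<in> N" using x y eqv by blast
   then have "b .[M] msub B M x y \<in> N" using b submoduleD[OF N] by blast
   then have "p (b .[M] x) = p (b .[M] y)" using b x y eqv by (simp add: M.msub_smult)
   then show ?thesis by simp
  qed
  moreover have "x \<in> p x" using x N.a_rcos_self[of x] by (simp add: p_def)
  ultimately have "(\<Union>y\<in>p x. p (b .[M] y)) = p (b .[M] x)" by blast
  then show ?thesis by (simp add: quot_module_def p_def)
 qed
 show "lmodule B (quot_module M N)"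
  by (rule lmoduleI)
    (auto simp: car zero add sm M.R.ring_axioms M.M.a_ac M.smult_l_distr M.smult_r_distr
     M.smult_assoc1 M.smult_zero_left)
 show "p \<in> mod_hom B M (quot_module M N)" by (rule mod_homI) (auto simp: car add sm)
 show "p ` carrier M = carrier (quot_module M N)" by (simp add: car)
 show "p x = zero (quot_module M N) \<longleftrightarrow> x \<in> N" if "x \<in> carrier M" for x
  using that eqv[of x "zero M"] by (simp add: zero M.msub_zero)
qed

text \<open>Used besides \<open>dsum\<close> because the two factors may have different element
  types.\<close>

definition prod_mod :: "('b, 'x) module => ('b, 'y) module => ('b, 'x \<times> 'y) module" where
 "prod_mod X Y =
   \<lparr> carrier = carrier X \<times> carrier Y, mult = undefined, one = undefined,
    zero = (zero X, zero Y), add = (%u v. (fst u +[X] fst v, snd u +[Y] snd v)),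
    smult = (%b u. (b .[X] fst u, b .[Y] snd u)) \<rparr>"

lemma prod_mod_simps [simp]:
 "carrier (prod_mod X Y) = carrier X \<times> carrier Y" "zero (prod_mod X Y) = (zero X, zero Y)"
 "(x, y) +[prod_mod X Y] (x', y') = (x +[X] x', y +[Y] y')"
 "b .[prod_mod X Y] (x, y) = (b .[X] x, b .[Y] y)"
 by (simp_all add: prod_mod_def)

lemma lmodule_prod_mod:
 assumes "lmodule B X" "lmodule B Y"
 shows "lmodule B (prod_mod X Y)"
proof -
 interpret X: lmodule B X by fact
 interpret Y: lmodule B Y by fact
 show ?thesis
  by (rule lmoduleI)
    (auto simp: X.R.ring_axioms X.M.a_ac Y.M.a_ac X.smult_l_distr X.smult_r_distr X.smult_assoc1
     X.smult_zero_left Y.smult_l_distr Y.smult_r_distr Y.smult_assoc1 Y.smult_zero_left)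
qed

lemma fst_mod_hom: "fst \<in> mod_hom B (prod_mod X Y) X"
 by (rule mod_homI) auto

lemma snd_mod_hom: "snd \<in> mod_hom B (prod_mod X Y) Y"
 by (rule mod_homI) auto

lemma pair_mod_hom:
 "f \<in> mod_hom B W X ==> g \<in> mod_hom B W Y ==> (%w. (f w, g w)) \<in> mod_hom B W (prod_mod X Y)"
 by (rule mod_homI) (auto simp: mod_homD)

lemma copair_mod_hom:
 assumes "lmodule B W" "f \<in> mod_hom B X W" "g \<in> mod_hom B Y W"
 shows "(%u. f (fst u) +[W] g (snd u)) \<in> mod_hom B (prod_mod X Y) W"
 using mod_hom_add[OF assms(1) mod_hom_comp[OF fst_mod_hom assms(2)] mod_hom_comp[OF snd_mod_hom assms(3)]] .

lemma dsum_simps: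
 "carrier (dsum I M) = (\<Pi>\<^sub>E i\<in>I. carrier (M i))" "zero (dsum I M) = (\<lambda>i\<in>I. zero (M i))"
 "x +[dsum I M] y = (\<lambda>i\<in>I. x i +[M i] y i)" "b .[dsum I M] x = (\<lambda>i\<in>I. b .[M i] x i)"
 by (simp_all add: dsum_def)

lemma lmodule_dsum:
 assumes "ring B" "!!i. i \<in> I ==> lmodule B (M i)"
 shows "lmodule B (dsum I M)"
proof -
 note l = assms(2)
 have ag: "abelian_group (M i)" if "i \<in> I" for i using l[OF that] by (rule lmodule.axioms)
 show ?thesis
 proof (rule lmoduleI)
  show "ring B" by fact
  show "zero (dsum I M) \<in> carrier (dsum I M)"
   by (auto simp: dsum_simps ag abelian_groupE)
  fix x assume x: "x \<in> carrier (dsum I M)"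
  show "zero (dsum I M) +[dsum I M] x = x" "one B .[dsum I M] x = x" "zero B .[dsum I M] x = zero (dsum I M)"
   using x by (auto simp: dsum_simps fun_eq_iff PiE_iff extensional_def abelian_groupE(5)[OF ag]
     lmodule.smult_one[OF l] lmodule.smult_zero_left[OF l])
  fix y assume y: "y \<in> carrier (dsum I M)"
  show "x +[dsum I M] y \<in> carrier (dsum I M)"
   using x y by (auto simp: dsum_simps intro!: abelian_groupE(1)[OF ag])
  show "x +[dsum I M] y = y +[dsum I M] x"
   using x y by (auto simp: dsum_simps fun_eq_iff PiE_iff intro!: abelian_groupE(4)[OF ag])
  show "x +[dsum I M] y +[dsum I M] z = x +[dsum I M] (y +[dsum I M] z)"
   if "z \<in> carrier (dsum I M)" for z
   using x y that by (auto simp: dsum_simps fun_eq_iff PiE_iff intro!: abelian_groupE(3)[OF ag])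
  show "a .[dsum I M] (x +[dsum I M] y) = a .[dsum I M] x +[dsum I M] a .[dsum I M] y"
   if "a \<in> carrier B" for a
   using x y that
   by (auto simp: dsum_simps fun_eq_iff PiE_iff intro!: lmodule.smult_r_distr[OF l])
 next
  fix a x assume a: "a \<in> carrier B" and x: "x \<in> carrier (dsum I M)"
  show "a .[dsum I M] x \<in> carrier (dsum I M)"
   using a x by (auto simp: dsum_simps intro!: lmodule.smult_closed[OF l])
  fix b assume b: "b \<in> carrier B"
  show "(a +[B] b) .[dsum I M] x = a .[dsum I M] x +[dsum I M] b .[dsum I M] x"
   "(a *[B] b) .[dsum I M] x = a .[dsum I M] (b .[dsum I M] x)"
   using a b x by (auto simp: dsum_simps fun_eq_iff PiE_iff
     intro!: lmodule.smult_l_distr[OF l] lmodule.smult_assoc1[OF l])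
 qed
qed

lemma proj_mod_hom: "i \<in> I ==> (%x. x i) \<in> mod_hom B (dsum I M) (M i)"
 by (rule mod_homI) (auto simp: dsum_simps)

lemma tuple_mod_hom:
 "(!!i. i \<in> I ==> f i \<in> mod_hom B X (M i)) ==> (%x. \<lambda>i\<in>I. f i x) \<in> mod_hom B X (dsum I M)"
 by (rule mod_homI) (auto simp: dsum_simps fun_eq_iff intro: mod_homD)

definition single :: "'i set => ('i => ('b, 'm) module) => 'i => 'm => 'i => 'm" where
 "single I M i x = (\<lambda>j\<in>I. if j = i then x else zero (M j))"

lemma single_mod_hom:
 assumes "!!i. i \<in> I ==> lmodule B (M i)"
 shows "single I M i \<in> mod_hom B (M i) (dsum I M)"
proof -
 have ag: "abelian_group (M i)" if "i \<in> I" for i using assms[OF that] by (rule lmodule.axioms)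
 show ?thesis
  by (rule mod_homI)
    (auto simp: single_def dsum_simps fun_eq_iff abelian_groupE(2,5)[OF ag]
     lmodule.smult_zero[OF assms])
qed

lemma dsum_induct [consumes 3, case_names zero single add]:
 assumes "finite I" "!!i. i \<in> I ==> lmodule B (M i)" "x \<in> carrier (dsum I M)"
  and zero: "P (zero (dsum I M))"
  and single: "!!i y. i \<in> I ==> y \<in> carrier (M i) ==> P (single I M i y)"
  and add: "!!x y. x \<in> carrier (dsum I M) ==> y \<in> carrier (dsum I M) ==> P x ==> P y ==> P (x +[dsum I M] y)"
 shows "P x"
proof -
 have ag: "abelian_group (M i)" if "i \<in> I" for i using assms(2)[OF that] by (rule lmodule.axioms)
 note ag' = abelian_groupE(2)[OF ag] abelian_groupE(5)[OF ag]
  abelian_monoid.r_zero[OF abelian_group.axioms(1)[OF ag]]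
 have x: "x i \<in> carrier (M i)" if "i \<in> I" for i using assms(3) that by (auto simp: dsum_simps)
 \<comment> \<open>\<open>?t J\<close> keeps the coordinates in \<open>J\<close> and replaces the
   others by zero. The induction runs over \<open>J\<close>, since the index set \<open>I\<close> of
   the sum has to stay fixed.\<close>
 let ?t = "%J. \<lambda>i\<in>I. if i \<in> J then x i else zero (M i)"
 have "P (?t J)" if "finite J" "J \<subseteq> I" for J
  using that
 proof induction
  case empty
  then show ?case using zero by (simp add: dsum_simps restrict_def)
 next
  case (insert j J)
  have eq: "?t (insert j J) = single I M j (x j) +[dsum I M] ?t J"
   using insert by (auto simp: single_def dsum_simps fun_eq_iff x ag')
  have "single I M j (x j) \<in> carrier (dsum I M)" "?t J \<in> carrier (dsum I M)"
   using insert by (auto simp: single_def dsum_simps x ag')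
  moreover have "P (single I M j (x j))" using insert.prems single[of j "x j"] x by auto
  moreover have "P (?t J)" by (rule insert.IH) (use insert.prems in auto)
  ultimately show ?case unfolding eq by (rule add)
 qed
 from this[OF assms(1)] have "P (?t I)" by simp
 moreover have "?t I = x" using assms(3) by (auto simp: dsum_simps fun_eq_iff PiE_iff extensional_def)
 ultimately show ?thesis by simp
qed

section \<open>Finite generation and chain conditions\<close>

lemma fg_lmodule: "fg_module B X ==> lmodule B X"
 by (simp add: fg_module_def)

lemma fg_moduleE:
 assumes "fg_module B X"
 obtains S where "finite S" "S \<subseteq> carrier X"
  "!!N. submodule N B X ==> S \<subseteq> N ==> carrier X \<subseteq> N"
 using assms by (auto simp: fg_module_def)

lemma fg_moduleI:
 assumes "lmodule B X" "finite S" "S \<subseteq> carrier X"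
  "!!N. submodule N B X ==> S \<subseteq> N ==> carrier X \<subseteq> N"
 shows "fg_module B X"
proof -
 have "\<forall>N. submodule N B X & S \<subseteq> N --> N = carrier X"
  using assms(4) submoduleD(1) by (metis subset_antisym)
 with assms(1-3) show ?thesis unfolding fg_module_def by metis
qed

text \<open>Generation is tested against submodules of the ambient module, so that no nested
  restrictions appear.\<close>

lemma fg_restrictI:
 assumes "lmodule B X" "submodule N B X" "finite S" "S \<subseteq> N"
  "!!K. submodule K B X ==> S \<subseteq> K ==> N \<subseteq> K"
 shows "fg_module B (X\<lparr>carrier := N\<rparr>)"
 by (rule fg_moduleI[where S = S])
   (use assms in \<open>auto simp: lmodule_restrict submodule_restrict\<close>)

lemma fg_restrictE:
 assumes "fg_module B (X\<lparr>carrier := N\<rparr>)" "lmodule B X" "submodule N B X"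
 obtains S where "finite S" "S \<subseteq> N" "!!K. submodule K B X ==> S \<subseteq> K ==> N \<subseteq> K"
proof -
 from assms(1) obtain S where S: "finite S" "S \<subseteq> N"
  "!!K. submodule K B (X\<lparr>carrier := N\<rparr>) ==> S \<subseteq> K ==> N \<subseteq> K"
  by (auto elim!: fg_moduleE)
 have "N \<subseteq> K" if "submodule K B X" "S \<subseteq> K" for K
  using S(3)[of "K \<inter> N"] S(2) that assms submodule_Int[of B X K N]
  by (auto simp: submodule_restrict)
 with S that show thesis by blast
qed

lemma fg_image:
 assumes X: "fg_module B X" and Y: "lmodule B Y"
  and f: "f \<in> mod_hom B X Y" "f ` carrier X = carrier Y"
 shows "fg_module B Y"
proof -
 from X obtain S where S: "finite S" "S \<subseteq> carrier X"
  "!!N. submodule N B X ==> S \<subseteq> N ==> carrier X \<subseteq> N" by (rule fg_moduleE) blast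
 show ?thesis
 proof (rule fg_moduleI[OF Y, of "f ` S"])
  show "finite (f ` S)" "f ` S \<subseteq> carrier Y" using S f by auto
  fix N assume N: "submodule N B Y" "f ` S \<subseteq> N"
  have "carrier X \<subseteq> {x \<in> carrier X. f x \<in> N}"
   using N S(2) by (intro S(3) submodule_vimage[OF fg_lmodule[OF X] Y f(1)]) auto
  then show "carrier Y \<subseteq> N" unfolding f(2)[symmetric] by blast
 qed
qed

lemma fg_iso: "mod_iso B X Y ==> fg_module B X ==> lmodule B Y ==> fg_module B Y"
 unfolding mod_iso_def bij_betw_def using fg_image by blast

lemma fg_ext:
 assumes X: "fg_module B X" and Y: "lmodule B Y" and Z: "fg_module B Z"
  and f: "f \<in> mod_hom B X Y" and g: "g \<in> mod_hom B Y Z" "g ` carrier Y = carrier Z"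
  and ker: "a_kernel Y Z g \<subseteq> f ` carrier X"
 shows "fg_module B Y"
proof -
 interpret Y: lmodule B Y by fact
 interpret Z: lmodule B Z using Z by (rule fg_lmodule)
 from X obtain S where S: "finite S" "S \<subseteq> carrier X"
  "!!N. submodule N B X ==> S \<subseteq> N ==> carrier X \<subseteq> N" by (rule fg_moduleE) blast
 from Z obtain S' where S': "finite S'" "S' \<subseteq> carrier Z"
  "!!N. submodule N B Z ==> S' \<subseteq> N ==> carrier Z \<subseteq> N" by (rule fg_moduleE) blast
 define t where "t = inv_into (carrier Y) g"
 have t: "t z \<in> carrier Y" "g (t z) = z" if "z \<in> carrier Z" for z
  using that g(2) by (auto simp: t_def inv_into_into f_inv_into_f)
 show ?thesis
 proof (rule fg_moduleI[OF Y, of "f ` S \<union> t ` S'"])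
  show "finite (f ` S \<union> t ` S')" "f ` S \<union> t ` S' \<subseteq> carrier Y"
   using S S' t mod_homD(1)[OF f] by auto
  fix N assume N: "submodule N B Y" "f ` S \<union> t ` S' \<subseteq> N"
  have "carrier X \<subseteq> {x \<in> carrier X. f x \<in> N}"
   by (intro S(3) submodule_vimage[OF fg_lmodule[OF X] Y f N(1)]) (use N S(2) in blast)
  then have 1: "f ` carrier X \<subseteq> N" by auto
  have "g ` t ` S' = S'" using t(2) S'(2) by force
  then have "S' \<subseteq> g ` N" using N(2) by blast
  then have 2: "carrier Z \<subseteq> g ` N"
   using S'(3) submodule_image[OF Y Z.lmodule_axioms g(1) N(1)] by blast
  show "carrier Y \<subseteq> N"
  proof
   fix y assume y: "y \<in> carrier Y"
   then have "g y \<in> carrier Z" using mod_homD(1)[OF g(1)] by blast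
   with 2 obtain n where n: "n \<in> N" "g y = g n" by blast
   have nc: "n \<in> carrier Y" by (rule submodule_in[OF N(1) n(1)])
   have "g (msub B Y y n) = zero Z"
    using y nc n(2) mod_homD(1)[OF g(1)]
    by (simp add: mod_hom_msub[OF g(1) Y] Z.msub_eq_zero)
   then have "msub B Y y n \<in> a_kernel Y Z g" using y nc by (simp add: a_kernel_eq)
   with 1 ker have "msub B Y y n \<in> N" by blast
   then have "n +[Y] msub B Y y n \<in> N" by (rule submoduleD(3)[OF N(1) n(1)])
   then show "y \<in> N" using y nc by (simp add: Y.add_msub)
  qed
 qed
qed

lemma fg_prod_mod: "fg_module B X ==> fg_module B Y ==> fg_module B (prod_mod X Y)"
proof -
 assume X: "fg_module B X" and Y: "fg_module B Y"
 interpret X: lmodule B X using X by (rule fg_lmodule)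
 interpret Y: lmodule B Y using Y by (rule fg_lmodule)
 have P: "lmodule B (prod_mod X Y)"
  by (intro lmodule_prod_mod X.lmodule_axioms Y.lmodule_axioms)
 show ?thesis
 proof (rule fg_ext[OF X P Y])
  show "(%x. (x, zero Y)) \<in> mod_hom B X (prod_mod X Y)"
   by (intro pair_mod_hom mod_hom_id mod_hom_const_zero Y.lmodule_axioms)
  show "snd ` carrier (prod_mod X Y) = carrier Y" by force
 qed (auto simp: snd_mod_hom a_kernel_eq)
qed

lemma fg_dsum:
 assumes "ring B" "finite I" "!!i. i \<in> I ==> fg_module B (M i)"
 shows "fg_module B (dsum I M)"
proof -
 have l: "!!i. i \<in> I ==> lmodule B (M i)" using assms(3) fg_lmodule by blast
 have D: "lmodule B (dsum I M)" using assms(1) l by (rule lmodule_dsum)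
 have "\<forall>i\<in>I. \<exists>S. finite S & S \<subseteq> carrier (M i) &
   (\<forall>N. submodule N B (M i) & S \<subseteq> N --> carrier (M i) \<subseteq> N)"
 proof
  fix i assume "i \<in> I"
  with assms(3) have "fg_module B (M i)" by blast
  then show "\<exists>S. finite S & S \<subseteq> carrier (M i) &
    (\<forall>N. submodule N B (M i) & S \<subseteq> N --> carrier (M i) \<subseteq> N)"
   by (rule fg_moduleE) blast
 qed
 then obtain S where S': "\<forall>i\<in>I. finite (S i) & S i \<subseteq> carrier (M i) &
   (\<forall>N. submodule N B (M i) & S i \<subseteq> N --> carrier (M i) \<subseteq> N)"
  unfolding bchoice_iff by (rule exE)
 have S: "finite (S i)" "S i \<subseteq> carrier (M i)"
  "submodule N B (M i) ==> S i \<subseteq> N ==> carrier (M i) \<subseteq> N" if "i \<in> I" for i N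
  using S' that by simp_all
 show ?thesis
 proof (rule fg_moduleI[OF D, of "\<Union>i\<in>I. single I M i ` S i"])
  show "finite (\<Union>i\<in>I. single I M i ` S i)" using S(1) assms(2) by auto
  show "(\<Union>i\<in>I. single I M i ` S i) \<subseteq> carrier (dsum I M)"
  proof (intro UN_least image_subsetI)
   fix i x assume "i \<in> I" "x \<in> S i"
   then show "single I M i x \<in> carrier (dsum I M)"
    using S(2) by (intro mod_homD(1)[OF single_mod_hom[OF l]]) auto
  qed
  fix N assume N: "submodule N B (dsum I M)" "(\<Union>i\<in>I. single I M i ` S i) \<subseteq> N"
  have s: "single I M i x \<in> N" if i: "i \<in> I" "x \<in> carrier (M i)" for i x
  proof -
   have "carrier (M i) \<subseteq> {x \<in> carrier (M i). single I M i x \<in> N}"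
    using N S(2)[OF i(1)] i
    by (intro S(3)[OF i(1)] submodule_vimage[OF l[OF i(1)] D single_mod_hom[OF l]]) auto
   then show ?thesis using i(2) by blast
  qed
  show "carrier (dsum I M) \<subseteq> N"
  proof
   fix x assume "x \<in> carrier (dsum I M)"
   then show "x \<in> N"
    by (intro dsum_induct[where P = "%x. x \<in> N" and I = I and M = M and B = B and x = x])
      (use assms(2) l s submoduleD[OF N(1)] in auto)
  qed
 qed
qed

lemma reg_module_simps [simp]:
 "carrier (reg_module B) = carrier B" "zero (reg_module B) = zero B"
 "x +[reg_module B] y = x +[B] y" "b .[reg_module B] x = b *[B] x"
 by (simp_all add: reg_module_def)

lemma lmodule_reg: "ring B ==> lmodule B (reg_module B)"
proof -
 assume "ring B"
 then interpret ring B .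
 show ?thesis by (rule lmoduleI) (auto simp: ring_axioms a_ac l_distr r_distr m_assoc)
qed

lemma smult_right_mod_hom:
 "lmodule B X ==> x \<in> carrier X ==> (%b. b .[X] x) \<in> mod_hom B (reg_module B) X"
proof -
 assume "lmodule B X" "x \<in> carrier X"
 then interpret lmodule B X by simp
 show ?thesis
  by (rule mod_homI) (use \<open>x \<in> carrier X\<close> in \<open>auto simp: smult_l_distr smult_assoc1\<close>)
qed

lemma fg_reg: "ring B ==> fg_module B (reg_module B)"
proof (rule fg_moduleI[OF lmodule_reg, of B "{one B}"])
 assume "ring B"
 then interpret ring B .
 show "{one B} \<subseteq> carrier (reg_module B)" by simp
 fix N assume N: "submodule N B (reg_module B)" "{one B} \<subseteq> N"
 show "carrier (reg_module B) \<subseteq> N"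
 proof
  fix b assume b: "b \<in> carrier (reg_module B)"
  then have "b .[reg_module B] one B \<in> N" using N by (intro submoduleD(4)[OF N(1)]) auto
  then show "b \<in> N" using b by simp
 qed
qed auto

text \<open>Only left ideals are tested; \<open>noetherian_fg_submodule\<close> carries the property
  to submodules of all finitely generated modules.\<close>

definition left_noetherian :: "('b, 'z) ring_scheme => bool" where
 "left_noetherian B \<longleftrightarrow> ring B &
   (\<forall>N. submodule N B (reg_module B) --> fg_module B ((reg_module B)\<lparr>carrier := N\<rparr>))"

text \<open>The set is \<open>R s + T\<close>. It adds one generator in the noetherian induction,
  and it enlarges a maximal submodule in Akizuki's theorem.\<close>

lemma (in lmodule) submodule_cyclic_add:
 assumes s: "s \<in> carrier M" and T: "submodule T R M"
 shows "submodule {a \<odot> s \<oplus> y | a y. a \<in> carrier R & y \<in> T} R M" (is "submodule ?W R M")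
  "T \<subseteq> {a \<odot> s \<oplus> y | a y. a \<in> carrier R & y \<in> T}"
  "s \<in> {a \<odot> s \<oplus> y | a y. a \<in> carrier R & y \<in> T}"
proof -
 note T' = submoduleD[OF T] submodule_in[OF T]
 show "T \<subseteq> ?W"
 proof
  fix y assume "y \<in> T"
  then have "y = zero R \<odot> s \<oplus> y" using s T' by (simp add: smult_zero_left)
  with \<open>y \<in> T\<close> show "y \<in> ?W" by blast
 qed
 show "s \<in> ?W"
 proof -
  have "s = one R \<odot> s \<oplus> \<zero>" using s by simp
  then show ?thesis using T' by blast
 qed
 show "submodule ?W R M"
 proof (rule submoduleI)
  show "?W \<subseteq> carrier M" using s T' by auto
  show "\<zero> \<in> ?W" using \<open>T \<subseteq> ?W\<close> T' by blast
 next
  fix x y assume "x \<in> ?W" "y \<in> ?W"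
  then obtain a u b v where *: "a \<in> carrier R" "u \<in> T" "x = a \<odot> s \<oplus> u"
   "b \<in> carrier R" "v \<in> T" "y = b \<odot> s \<oplus> v" by blast
  then have "x \<oplus> y = (a +[R] b) \<odot> s \<oplus> (u \<oplus> v)"
   using s T' by (simp add: smult_l_distr M.a_ac)
  then show "x \<oplus> y \<in> ?W" using * T' by blast
 next
  fix c x assume c: "c \<in> carrier R" and "x \<in> ?W"
  then obtain a u where *: "a \<in> carrier R" "u \<in> T" "x = a \<odot> s \<oplus> u" by blast
  then have "c \<odot> x = (c *[R] a) \<odot> s \<oplus> c \<odot> u"
   using c s T' by (simp add: smult_r_distr smult_assoc1)
  then show "c \<odot> x \<in> ?W" using * c T' by blast
 qed
qed

text \<open>The analogue of the ideal of leading coefficients: all coefficients that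
  \<open>s\<close> has in elements of \<open>N\<close>, taken modulo \<open>T\<close>.\<close>

lemma (in lmodule) submodule_coefficients:
 assumes s: "s \<in> carrier M" and T: "submodule T R M" and N: "submodule N R M"
 shows "submodule {a \<in> carrier R. \<exists>y\<in>T. a \<odot> s \<oplus> y \<in> N} R (reg_module R)" (is "submodule ?I R _")
proof -
 interpret R: lmodule R "reg_module R" by (rule lmodule_reg) (rule R.ring_axioms)
 note T' = submoduleD[OF T] submodule_in[OF T]
 note N' = submoduleD[OF N] submodule_in[OF N]
 show ?thesis
 proof (rule R.submoduleI)
  have "zero R \<odot> s \<oplus> \<zero> \<in> N" using s N' by (simp add: smult_zero_left)
  then show "zero (reg_module R) \<in> ?I" using T' by auto
 next
  fix a b assume "a \<in> ?I" "b \<in> ?I"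
  then obtain u v where *: "a \<in> carrier R" "b \<in> carrier R" "u \<in> T" "v \<in> T"
   "a \<odot> s \<oplus> u \<in> N" "b \<odot> s \<oplus> v \<in> N" by auto
  have "(a +[R] b) \<odot> s \<oplus> (u \<oplus> v) = (a \<odot> s \<oplus> u) \<oplus> (b \<odot> s \<oplus> v)"
   using * s T' by (simp add: smult_l_distr M.a_ac)
  then have "(a +[R] b) \<odot> s \<oplus> (u \<oplus> v) \<in> N" using * N' by simp
  then show "a +[reg_module R] b \<in> ?I" using * T' by auto
 next
  fix c a assume c: "c \<in> carrier R" and "a \<in> ?I"
  then obtain u where *: "a \<in> carrier R" "u \<in> T" "a \<odot> s \<oplus> u \<in> N" by auto
  have "(c *[R] a) \<odot> s \<oplus> c \<odot> u = c \<odot> (a \<odot> s \<oplus> u)"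
   using * c s T' by (simp add: smult_r_distr smult_assoc1)
  then have "(c *[R] a) \<odot> s \<oplus> c \<odot> u \<in> N" using * c N' by simp
  then show "c .[reg_module R] a \<in> ?I" using * c T' by auto
 qed auto
qed

text \<open>Induction on the generators of \<open>X\<close>. A submodule \<open>N\<close> of
  \<open>B s + sp S\<close> is generated by elements realizing generators of its coefficient ideal,
  together with generators of \<open>N \<inter> sp S\<close>, which exist by induction.\<close>

lemma noetherian_fg_submodule:
 assumes B: "left_noetherian B" and X: "fg_module B X" and N: "submodule N B X"
 shows "fg_module B (X\<lparr>carrier := N\<rparr>)"
proof -
 interpret X: lmodule B X using X by (rule fg_lmodule)
 define sp where "sp S = \<Inter>{K. submodule K B X & S \<subseteq> K}" for S
 have spX: "submodule (carrier X) B X" by (rule submodule_carrier) (rule X.lmodule_axioms)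
 have sp: "submodule (sp S) B X" if "S \<subseteq> carrier X" for S
  unfolding sp_def using that spX by (intro submodule_Inter X.lmodule_axioms) auto
 have "\<forall>N. submodule N B X & N \<subseteq> sp S --> fg_module B (X\<lparr>carrier := N\<rparr>)"
  if "finite S" "S \<subseteq> carrier X" for S
  using that
 proof induction
  case empty
  have "sp {} \<subseteq> {zero X}" unfolding sp_def using submodule_zero[OF X.lmodule_axioms] by blast
  then show ?case
   using submoduleD(2) by (auto intro!: fg_restrictI[of _ _ _ "{}"] X.lmodule_axioms) blast
 next
  case (insert s S)
  then have s: "s \<in> carrier X" and S: "S \<subseteq> carrier X" by auto
  note T = sp[OF S]
  note W = X.submodule_cyclic_add[OF s T]
  have "S \<subseteq> sp S" unfolding sp_def by blast
  then have spW: "sp (insert s S) \<subseteq> {a .[X] s +[X] y | a y. a \<in> carrier B & y \<in> sp S}"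
   unfolding sp_def[of "insert s S"] using W by (intro Inter_lower) auto
  show ?case
  proof (intro allI impI, elim conjE)
   fix N assume N: "submodule N B X" "N \<subseteq> sp (insert s S)"
   let ?I = "%N. {a \<in> carrier B. \<exists>y\<in>sp S. a .[X] s +[X] y \<in> N}"
   have I: "submodule (?I K) B (reg_module B)" if "submodule K B X" for K
    using X.submodule_coefficients[OF s T that] .
   have "fg_module B ((reg_module B)\<lparr>carrier := ?I N\<rparr>)"
    using B I[OF N(1)] by (simp add: left_noetherian_def)
   then obtain G where G: "finite G" "G \<subseteq> ?I N"
    "!!K. submodule K B (reg_module B) ==> G \<subseteq> K ==> ?I N \<subseteq> K"
    by (rule fg_restrictE[OF _ lmodule_reg[OF X.R.ring_axioms] I[OF N(1)]]) blast
   have "\<forall>g\<in>G. \<exists>y\<in>sp S. g .[X] s +[X] y \<in> N" using G(2) by auto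
   then obtain y where y: "!!g. g \<in> G ==> y g \<in> sp S" "!!g. g \<in> G ==> g .[X] s +[X] y g \<in> N"
    by metis
   have NT: "submodule (N \<inter> sp S) B X" by (rule submodule_Int[OF X.lmodule_axioms N(1) T])
   then have "fg_module B (X\<lparr>carrier := N \<inter> sp S\<rparr>)" using insert.IH[OF S] by blast
   then obtain H where H: "finite H" "H \<subseteq> N \<inter> sp S"
    "!!K. submodule K B X ==> H \<subseteq> K ==> N \<inter> sp S \<subseteq> K"
    by (rule fg_restrictE[OF _ X.lmodule_axioms NT]) blast
   show "fg_module B (X\<lparr>carrier := N\<rparr>)"
   proof (rule fg_restrictI[OF X.lmodule_axioms N(1), of "(%g. g .[X] s +[X] y g) ` G \<union> H"])
    fix K assume K: "submodule K B X" "(%g. g .[X] s +[X] y g) ` G \<union> H \<subseteq> K"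
    have "G \<subseteq> ?I (N \<inter> K)" using G(2) y K(2) by blast
    then have sub: "?I N \<subseteq> ?I (N \<inter> K)"
     by (intro G(3) I submodule_Int[OF X.lmodule_axioms N(1) K(1)])
    show "N \<subseteq> K"
    proof
     fix x assume x: "x \<in> N"
     then have "x \<in> {a .[X] s +[X] y | a y. a \<in> carrier B & y \<in> sp S}" using N spW by blast
     then obtain a u where a: "a \<in> carrier B" "u \<in> sp S" "x = a .[X] s +[X] u" by blast
     then have "a \<in> ?I N" using x by blast
     with sub obtain v where v: "v \<in> sp S" "a .[X] s +[X] v \<in> N" "a .[X] s +[X] v \<in> K" by blast
     \<comment> \<open>\<open>x\<close> and \<open>?z\<close> have the same coefficient at
       \<open>s\<close>, so their difference lies in \<open>N \<inter> sp S\<close> and hence in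
       \<open>K\<close>.\<close>
     let ?z = "a .[X] s +[X] v"
     have uv: "u \<in> carrier X" "v \<in> carrier X" using a v submodule_in[OF T] by auto
     have eq: "msub B X x ?z = msub B X u v"
      using a s uv X.msub_eq_zero[of "a .[X] s" "a .[X] s"] by (simp add: X.msub_add)
     have "msub B X x ?z \<in> N" using N(1) x v by (intro submodule_msub X.R.ring_axioms)
     moreover have "msub B X u v \<in> sp S" using T a v by (intro submodule_msub X.R.ring_axioms)
     ultimately have "msub B X x ?z \<in> K" using H(3)[OF K(1)] K(2) eq by auto
     then have "?z +[X] msub B X x ?z \<in> K" by (rule submoduleD(3)[OF K(1) v(3)])
     then show "x \<in> K" using a s uv by (simp add: X.add_msub)
    qed
   qed (use G(1) H y in auto)
  qed
 qed
 moreover from X obtain S where S: "finite S" "S \<subseteq> carrier X"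
  "!!N. submodule N B X ==> S \<subseteq> N ==> carrier X \<subseteq> N" by (rule fg_moduleE) blast
 moreover have "carrier X \<subseteq> sp S" unfolding sp_def using S(3) by blast
 ultimately have "N \<subseteq> sp S" "\<forall>N. submodule N B X & N \<subseteq> sp S --> fg_module B (X\<lparr>carrier := N\<rparr>)"
  using submoduleD(1)[OF N] by auto
 then show ?thesis using N by simp
qed

lemma submodule_reg_iff_ideal:
 assumes "cring k"
 shows "submodule I k (reg_module k) \<longleftrightarrow> ideal I k"
proof -
 interpret cring k by fact
 interpret R: lmodule k "reg_module k" by (rule lmodule_reg) (rule ring_axioms)
 show ?thesis
 proof
  assume I: "submodule I k (reg_module k)"
  then interpret I: submodule I k "reg_module k" .
  have "subgroup I (add_monoid k)"
   using I.subgroup_axioms by (simp add: subgroup_def m_inv_def)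
  then show "ideal I k"
  proof (intro idealI ring_axioms)
   fix a x assume *: "a \<in> I" "x \<in> carrier k"
   then show "x *[k] a \<in> I" using submoduleD(4)[OF I, of x a] by simp
   then show "a *[k] x \<in> I" using * submodule_in[OF I, of a] m_comm[of a x] by simp
  qed
 next
  assume "ideal I k"
  then interpret I: ideal I k .
  show "submodule I k (reg_module k)"
   using I.a_subset I.zero_closed I.a_closed I.I_l_closed by (intro R.submoduleI) simp_all
 qed
qed

text \<open>Without a minimal member, dependent choice would build a strictly descending chain
  inside the family.\<close>

lemma (in artinian_cring) minimal_ideal:
 assumes "I0 \<in> F" "!!I. I \<in> F ==> ideal I R"
 shows "\<exists>I\<in>F. \<forall>J\<in>F. J \<subseteq> I --> J = I"
proof (rule ccontr)
 assume "~ ?thesis"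
 then have *: "\<exists>J. J \<in> F & J \<subset> I" if "I \<in> F" for I using that by blast
 have "\<exists>f. \<forall>n. f n \<in> F & f (Suc n) \<subset> f n"
  by (rule dependent_nat_choice) (use assms(1) * in auto)
 then obtain f where f: "!!n. f n \<in> F" "!!n. f (Suc n) \<subset> f n" by blast
 have "\<exists>N. \<forall>i\<ge>N. f i = f N"
  by (rule descending_ideal_chain_stationary) (use f assms(2) in auto)
 then obtain N where N: "\<forall>i\<ge>N. f i = f N" by blast
 have "f (Suc N) = f N" by (rule N[rule_format]) simp
 with f(2)[of N] show False by blast
qed

lemma submodule_chain_Union:
 assumes X: "lmodule B X" and C: "C ~= {}" "subset.chain A C"
  and A: "!!N. N \<in> A ==> submodule N B X"
 shows "submodule (\<Union>C) B X"
proof -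
 interpret X: lmodule B X by fact
 have sub: "!!N. N \<in> C ==> submodule N B X" using C(2) A by (auto simp: subset.chain_def)
 note s = submoduleD[OF sub]
 show ?thesis
 proof (rule X.submoduleI)
  fix x y assume "x \<in> \<Union>C" "y \<in> \<Union>C"
  then obtain N K where NK: "N \<in> C" "x \<in> N" "K \<in> C" "y \<in> K" by blast
  then have "N \<subseteq> K | K \<subseteq> N" using C(2) by (auto simp: subset.chain_def)
  then show "x +[X] y \<in> \<Union>C"
  proof
   assume "N \<subseteq> K"
   then show ?thesis using NK s(3)[of K x y] by auto
  next
   assume "K \<subseteq> N"
   then show ?thesis using NK s(3)[of N x y] by auto
  qed
 next
  show "\<Union>C \<subseteq> carrier X" using s(1) by blast
  show "zero X \<in> \<Union>C" using C(1) s(2) by auto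
  fix a x assume "a \<in> carrier B" "x \<in> \<Union>C"
  then show "a .[X] x \<in> \<Union>C" using s(4) by auto
 qed
qed

text \<open>
 Akizuki's theorem.  A minimal ideal \<open>I\<close> that is not finitely generated satisfies \<open>a I = I\<close> or
 \<open>a I = 0\<close> for every \<open>a\<close>, so it is a vector space over a field all of whose proper subspaces are
 finite-dimensional; a complement of a line then shows that \<open>I\<close> is finite-dimensional.
\<close>

theorem artinian_cring_noetherian:
 assumes "artinian_cring k"
 shows "left_noetherian k"
proof -
 interpret artinian_cring k by fact
 let ?R = "reg_module k"
 interpret R: lmodule k ?R by (rule lmodule_reg) (rule ring_axioms)
 have cr: "cring k" ..
 show ?thesis
 proof (rule ccontr)
  assume "~ left_noetherian k"
  then obtain I0 where I0: "submodule I0 k ?R" "~ fg_module k (?R\<lparr>carrier := I0\<rparr>)"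
   by (auto simp: left_noetherian_def ring_axioms)
  let ?F = "{I. submodule I k ?R & ~ fg_module k (?R\<lparr>carrier := I\<rparr>)}"
  have "\<exists>I\<in>?F. \<forall>J\<in>?F. J \<subseteq> I --> J = I"
   by (rule minimal_ideal[of I0]) (use I0 in \<open>auto simp: submodule_reg_iff_ideal[OF cr]\<close>)
  then obtain I where I: "submodule I k ?R" "~ fg_module k (?R\<lparr>carrier := I\<rparr>)"
   and min: "!!J. submodule J k ?R ==> J \<subseteq> I ==> J ~= I ==> fg_module k (?R\<lparr>carrier := J\<rparr>)"
   by auto
  note I' = submoduleD[OF I(1), simplified] submodule_in[OF I(1), simplified]
  let ?I = "?R\<lparr>carrier := I\<rparr>"
  have lI: "lmodule k ?I" using R.lmodule_axioms I(1) by (rule lmodule_restrict)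
  have mult_hom: "(%x. a *[k] x) \<in> mod_hom k ?I ?R" if "a \<in> carrier k" for a
   by (rule mod_homI) (use that I' in \<open>auto simp: r_distr m_lcomm\<close>)
  \<comment> \<open>If \<open>a I\<close> were a proper part of \<open>I\<close>, then
    \<open>a I\<close> and the kernel of multiplication by \<open>a\<close>, which misses
    \<open>x\<close>, would both be finitely generated by minimality, and so would their extension
    \<open>I\<close>.\<close>
  have surj: "(%x. a *[k] x) ` I = I"
   if a: "a \<in> carrier k" and x: "x \<in> I" "a *[k] x ~= zero k" for a x
  proof (rule ccontr)
   assume ne: "(%x. a *[k] x) ` I ~= I"
   let ?J = "(%x. a *[k] x) ` I" and ?L = "{x \<in> I. a *[k] x = zero k}"
   have J: "submodule ?J k ?R"
    using submodule_image[OF lI R.lmodule_axioms mult_hom[OF a] submodule_carrier[OF lI]] by simp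
   have "?J \<subseteq> I" using a I' by auto
   then have fJ: "fg_module k (?R\<lparr>carrier := ?J\<rparr>)" using ne by (intro min J)
   have "submodule ?L k ?I"
    using submodule_kernel[OF lI R.lmodule_axioms mult_hom[OF a]] by (simp add: a_kernel_eq)
   then have L: "submodule ?L k ?R" using submodule_restrict[OF R.lmodule_axioms I(1)] by blast
   have "?L ~= I" using x by blast
   then have fL: "fg_module k (?R\<lparr>carrier := ?L\<rparr>)" by (intro min L) auto
   have "fg_module k ?I"
   proof (rule fg_ext[OF fL lI fJ, where f = "%x. x" and g = "%x. a *[k] x"])
    show "(%x. x) \<in> mod_hom k (?R\<lparr>carrier := ?L\<rparr>) ?I" by (rule mod_homI) auto
    show "(%x. a *[k] x) \<in> mod_hom k ?I (?R\<lparr>carrier := ?J\<rparr>)"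
     by (rule mod_hom_restrict_cod[OF mult_hom[OF a]]) auto
   qed (auto simp: a_kernel_eq)
   with I(2) show False by blast
  qed
  \<comment> \<open>The ideals generated by the powers of \<open>a\<close> become stationary, so
    \<open>a^N = e a^(N+1)\<close> for some \<open>e\<close>. As \<open>a^N I = I\<close>, this
    \<open>e\<close> undoes multiplication by \<open>a\<close> on all of \<open>I\<close>.\<close>
  have inverse: "\<exists>e\<in>carrier k. \<forall>x\<in>I. e *[k] (a *[k] x) = x"
   if a: "a \<in> carrier k" and y: "y \<in> I" "a *[k] y ~= zero k" for a y
  proof -
   have "\<exists>N::nat. \<forall>i\<ge>N. PIdl\<^bsub>k\<^esub> (a [^]\<^bsub>k\<^esub> i) = PIdl\<^bsub>k\<^esub> (a [^]\<^bsub>k\<^esub> N)"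
   proof (rule descending_ideal_chain_stationary[of "%i. PIdl\<^bsub>k\<^esub> (a [^]\<^bsub>k\<^esub> i)"])
    fix i :: nat
    show "ideal (PIdl\<^bsub>k\<^esub> (a [^]\<^bsub>k\<^esub> i)) k" using a by (intro cgenideal_ideal) auto
    show "PIdl\<^bsub>k\<^esub> (a [^]\<^bsub>k\<^esub> Suc i) \<subseteq> PIdl\<^bsub>k\<^esub> (a [^]\<^bsub>k\<^esub> i)"
    proof
     fix x assume "x \<in> PIdl\<^bsub>k\<^esub> (a [^]\<^bsub>k\<^esub> Suc i)"
     then obtain c where "c \<in> carrier k" "x = c *[k] (a [^]\<^bsub>k\<^esub> i *[k] a)"
      by (auto simp: cgenideal_def)
     then have "c *[k] a \<in> carrier k" "x = (c *[k] a) *[k] a [^]\<^bsub>k\<^esub> i"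
      using a by (auto simp: m_ac)
     then show "x \<in> PIdl\<^bsub>k\<^esub> (a [^]\<^bsub>k\<^esub> i)" by (auto simp: cgenideal_def)
    qed
   qed
   then obtain N :: nat where N: "PIdl\<^bsub>k\<^esub> (a [^]\<^bsub>k\<^esub> Suc N) = PIdl\<^bsub>k\<^esub> (a [^]\<^bsub>k\<^esub> N)"
    by (metis le_Suc_eq order_refl)
   have "a [^]\<^bsub>k\<^esub> N \<in> PIdl\<^bsub>k\<^esub> (a [^]\<^bsub>k\<^esub> N)" using a by (intro cgenideal_self) auto
   then obtain e where e: "e \<in> carrier k" "a [^]\<^bsub>k\<^esub> N = e *[k] a [^]\<^bsub>k\<^esub> Suc N"
    unfolding N[symmetric] by (auto simp: cgenideal_def)
   have pow: "(%x. a [^]\<^bsub>k\<^esub> i *[k] x) ` I = I" for i :: nat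
   proof (induction i)
    case 0
    show ?case using I' by (force simp: image_iff)
   next
    case (Suc i)
    have "(%x. a [^]\<^bsub>k\<^esub> Suc i *[k] x) ` I = (%x. a [^]\<^bsub>k\<^esub> i *[k] x) ` (%x. a *[k] x) ` I"
     unfolding image_image using a I' by (intro image_cong) (auto simp: m_assoc)
    then show ?case using Suc surj[OF a y] by simp
   qed
   have "e *[k] (a *[k] x) = x" if "x \<in> I" for x
   proof -
    from that pow[of N] obtain u where u: "u \<in> I" "x = a [^]\<^bsub>k\<^esub> N *[k] u" by blast
    have "e *[k] (a *[k] x) = (e *[k] a [^]\<^bsub>k\<^esub> Suc N) *[k] u"
     using u(2) e(1) a I'(5)[OF u(1)] by (simp add: m_ac)
    then show ?thesis using u(2) e(2) by metis
   qed
   with e(1) show ?thesis by blast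
  qed
  have "I ~= {zero k}"
  proof
   assume I0: "I = {zero k}"
   have "fg_module k ?I"
    by (rule fg_restrictI[OF R.lmodule_axioms I(1), of "{}"])
      (use I0 submoduleD(2)[of _ k ?R] in auto)
   with I(2) show False by blast
  qed
  then obtain x where x: "x \<in> I" "x ~= zero k" using I'(2) by blast
  \<comment> \<open>Zorn's lemma provides a submodule of \<open>I\<close> maximal among those
    missing \<open>x\<close>. Being proper in \<open>I\<close> it is finitely generated, and
    together with \<open>x\<close> it will turn out to generate \<open>I\<close>.\<close>
  let ?A = "{N. submodule N k ?R & N \<subseteq> I & x \<notin> N}"
  have "\<exists>M\<in>?A. \<forall>N\<in>?A. M \<subseteq> N --> N = M"
  proof (rule subset_Zorn_nonempty)
   show "?A ~= {}" using submodule_zero[OF R.lmodule_axioms] x I'(2) by auto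
   fix C assume C: "C ~= {}" "subset.chain ?A C"
   have "submodule (\<Union>C) k ?R" by (rule submodule_chain_Union[OF R.lmodule_axioms C]) auto
   then show "\<Union>C \<in> ?A" using C by (auto simp: subset.chain_def)
  qed
  then obtain N where N: "submodule N k ?R" "N \<subseteq> I" "x \<notin> N"
   and maxN: "!!K. submodule K k ?R ==> K \<subseteq> I ==> x \<notin> K ==> N \<subseteq> K ==> K = N" by auto
  note N' = submoduleD[OF N(1), simplified] submodule_in[OF N(1), simplified]
  have "fg_module k (?R\<lparr>carrier := N\<rparr>)" using N x by (intro min) auto
  then obtain G where G: "finite G" "G \<subseteq> N" "!!K. submodule K k ?R ==> G \<subseteq> K ==> N \<subseteq> K"
   by (rule fg_restrictE[OF _ R.lmodule_axioms N(1)]) blast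
  have "fg_module k ?I"
  proof (rule fg_restrictI[OF R.lmodule_axioms I(1), of "insert x G"])
   fix K assume K: "submodule K k ?R" "insert x G \<subseteq> K"
   then have NK: "N \<subseteq> K" using G by blast
   show "I \<subseteq> K"
   proof
    fix y assume y: "y \<in> I"
    then have yc: "y \<in> carrier k" by (rule I'(5))
    show "y \<in> K"
    proof (cases "y \<in> N")
     case False
     \<comment> \<open>By maximality \<open>k y + N\<close> contains \<open>x\<close>, say
       \<open>x = a y + n\<close>. Then \<open>a y\<close> is nonzero because \<open>x\<close> is
       not in \<open>N\<close>, and inverting \<open>a\<close> on \<open>I\<close> recovers
       \<open>y\<close> from \<open>x - n\<close>.\<close>
     let ?W = "{a *[k] y +[k] n | a n. a \<in> carrier k & n \<in> N}"
     have W: "submodule ?W k ?R" "N \<subseteq> ?W" "y \<in> ?W"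
      using R.submodule_cyclic_add[of y N] N(1) yc by auto
     have "?W \<subseteq> I" using y N(2) I' by auto
     then have "x \<in> ?W" using maxN[OF W(1)] W False by blast
     then obtain a n where an: "a \<in> carrier k" "n \<in> N" "x = a *[k] y +[k] n" by blast
     have "a *[k] y ~= zero k" using an N(3) N' by auto
     then obtain e where e: "e \<in> carrier k" "e *[k] (a *[k] y) = y"
      using inverse[OF an(1) y] y by blast
     have nc: "n \<in> carrier k" using an N' by blast
     have "msub k ?R x n \<in> K" using K an NK by (intro submodule_msub ring_axioms) auto
     moreover have "msub k ?R x n = a *[k] y"
      using R.msub_add_left[of n "a *[k] y"] an nc yc by (simp add: a_comm)
     ultimately have "e .[?R] (a *[k] y) \<in> K" using e(1) K(1) submoduleD(4) by metis
     then show ?thesis using e(2) by simp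
    qed (use NK in blast)
   qed
  qed (use G x N in auto)
  with I(2) show False by blast
 qed
qed

section \<open>Artin algebras and restriction to the base ring\<close>

lemma artin_algebraD:
 assumes "artin_algebra k A"
 shows "artinian_cring k" "ring A" "module k A" "lmodule k A" "fg_module k A"
  "c \<in> carrier k ==> x \<in> carrier A ==> y \<in> carrier A ==> (c .[A] x) *[A] y = c .[A] (x *[A] y)"
  "c \<in> carrier k ==> x \<in> carrier A ==> y \<in> carrier A ==> x *[A] (c .[A] y) = c .[A] (x *[A] y)"
proof -
 interpret artin_algebra k A by fact
 show "artinian_cring k" "ring A" "module k A" "fg_module k A"
  by unfold_locales (rule finitely_generated)
 then show "lmodule k A" by (simp add: fg_module_def)
 show "c \<in> carrier k ==> x \<in> carrier A ==> y \<in> carrier A ==> (c .[A] x) *[A] y = c .[A] (x *[A] y)"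
  "c \<in> carrier k ==> x \<in> carrier A ==> y \<in> carrier A ==> x *[A] (c .[A] y) = c .[A] (x *[A] y)"
  by (rule smult_mult_left smult_mult_right; assumption)+
qed

lemma base_module_simps [simp]:
 "carrier (base_module B M) = carrier M" "zero (base_module B M) = zero M"
 "x +[base_module B M] y = x +[M] y" "c .[base_module B M] x = (c .[B] one B) .[M] x"
 by (simp_all add: base_module_def)

lemma lmodule_base:
 assumes B: "artin_algebra k B" and X: "lmodule B X"
 shows "lmodule k (base_module B X)"
proof -
 interpret artin_algebra k B by fact
 interpret X: lmodule B X by fact
 interpret B: lmodule k B by (rule artin_algebraD(4)[OF B])
 show ?thesis
 proof (rule lmoduleI)
  fix a b x assume *: "a \<in> carrier k" "b \<in> carrier k" "x \<in> carrier (base_module B X)"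
  have "(a *[k] b) .[B] one B = (a .[B] one B) *[B] (b .[B] one B)"
   using * by (simp add: B.smult_assoc1 smult_mult_left)
  then show "(a *[k] b) .[base_module B X] x =
    a .[base_module B X] (b .[base_module B X] x)"
   using * by (simp add: X.smult_assoc1)
 qed (auto simp: lmodule_ring[OF B.lmodule_axioms] X.M.a_ac B.smult_l_distr X.smult_l_distr X.smult_r_distr
   B.smult_zero_left X.smult_zero_left)
qed

text \<open>Products of the \<open>k\<close>-generators of \<open>B\<close> with the
  \<open>B\<close>-generators of \<open>X\<close> generate \<open>X\<close> over
  \<open>k\<close>.\<close>

lemma fg_base:
 assumes B: "artin_algebra k B" and X: "fg_module B X"
 shows "fg_module k (base_module B X)"
proof -
 interpret X: lmodule B X using X by (rule fg_lmodule)
 interpret B: lmodule k B by (rule artin_algebraD(4)[OF B])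
 let ?X = "base_module B X"
 have X': "lmodule k ?X" by (rule lmodule_base[OF B X.lmodule_axioms])
 from X obtain S where S: "finite S" "S \<subseteq> carrier X"
  "!!N. submodule N B X ==> S \<subseteq> N ==> carrier X \<subseteq> N" by (rule fg_moduleE) blast
 from artin_algebraD(5)[OF B] obtain G where G: "finite G" "G \<subseteq> carrier B"
  "!!N. submodule N k B ==> G \<subseteq> N ==> carrier B \<subseteq> N" by (rule fg_moduleE) blast
 have hom: "(%b. b .[X] x) \<in> mod_hom k B ?X" if "x \<in> carrier X" for x
 proof (rule mod_homI)
  fix c b assume *: "c \<in> carrier k" "b \<in> carrier B"
  have "c .[B] b = (c .[B] one B) *[B] b" using * by (simp add: artin_algebraD(6)[OF B])
  then show "(c .[B] b) .[X] x = c .[?X] (b .[X] x)"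
   using that * by (simp add: X.smult_assoc1)
 qed (use that in \<open>auto simp: X.smult_l_distr\<close>)
 show ?thesis
 proof (rule fg_moduleI[OF X', of "\<Union>s\<in>S. (%b. b .[X] s) ` G"])
  fix N assume N: "submodule N k ?X" "(\<Union>s\<in>S. (%b. b .[X] s) ` G) \<subseteq> N"
  note N' = submoduleD(1-3)[OF N(1), simplified]
  \<comment> \<open>The elements whose \<open>B\<close>-multiples all lie in \<open>N\<close> form a
    \<open>B\<close>-submodule. It contains the generators \<open>S\<close>, hence
    everything.\<close>
  have "submodule {x \<in> carrier X. \<forall>b\<in>carrier B. b .[X] x \<in> N} B X" (is "submodule ?K B X")
  proof (rule X.submoduleI)
   fix a x assume *: "a \<in> carrier B" "x \<in> ?K"
   then have "b .[X] (a .[X] x) \<in> N" if "b \<in> carrier B" for b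
    using that X.smult_assoc1[of b a x, symmetric] by simp
   then show "a .[X] x \<in> ?K" using * by simp
  qed (use N' in \<open>auto simp: X.smult_zero X.smult_r_distr\<close>)
  moreover have "S \<subseteq> ?K"
  proof
   fix s assume s: "s \<in> S"
   then have sc: "s \<in> carrier X" using S by blast
   have "carrier B \<subseteq> {b \<in> carrier B. b .[X] s \<in> N}"
    using N s G(2) by (intro G(3) submodule_vimage[OF B.lmodule_axioms X' hom[OF sc]]) auto
   then show "s \<in> ?K" using sc by blast
  qed
  ultimately have K: "carrier X \<subseteq> ?K" by (rule S(3))
  show "carrier ?X \<subseteq> N"
  proof
   fix x assume x: "x \<in> carrier ?X"
   then have "x \<in> ?K" using K by auto
   then have "one B .[X] x \<in> N" by blast
   then show "x \<in> N" using x by simp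
  qed
 qed (use S G in auto)
qed

text \<open>A left ideal of \<open>B\<close> is a \<open>k\<close>-submodule of the finitely
  generated \<open>k\<close>-module \<open>B\<close>, and \<open>k\<close> is noetherian by
  Akizuki's theorem; generators over \<open>k\<close> also generate over \<open>B\<close>.\<close>

lemma artin_algebra_noetherian:
 assumes B: "artin_algebra k B"
 shows "left_noetherian B"
proof -
 interpret R: ring B by (rule artin_algebraD(2)[OF B])
 interpret B: lmodule k B by (rule artin_algebraD(4)[OF B])
 interpret reg: lmodule B "reg_module B" by (rule lmodule_reg) (rule R.ring_axioms)
 have k: "left_noetherian k"
  using artin_algebraD(1)[OF B] by (rule artinian_cring_noetherian)
 have sub: "submodule N k B" if N: "submodule N B (reg_module B)" for N
 proof (rule B.submoduleI)
  fix c x assume *: "c \<in> carrier k" "x \<in> N"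
  have "(c .[B] one B) *[B] x = c .[B] x"
   using * submodule_in[OF N] by (simp add: artin_algebraD(6)[OF B])
  moreover have "(c .[B] one B) .[reg_module B] x \<in> N"
   using * by (intro submoduleD(4)[OF N]) auto
  ultimately show "c .[B] x \<in> N" by simp
 qed (use submoduleD[OF N] in auto)
 show ?thesis
  unfolding left_noetherian_def
 proof (intro conjI allI impI R.ring_axioms)
  fix N assume N: "submodule N B (reg_module B)"
  have "fg_module k (B\<lparr>carrier := N\<rparr>)"
   by (rule noetherian_fg_submodule[OF k artin_algebraD(5)[OF B] sub[OF N]])
  then obtain G where G: "finite G" "G \<subseteq> N" "!!K. submodule K k B ==> G \<subseteq> K ==> N \<subseteq> K"
   by (rule fg_restrictE[OF _ B.lmodule_axioms sub[OF N]]) blast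
  show "fg_module B ((reg_module B)\<lparr>carrier := N\<rparr>)"
   by (rule fg_restrictI[OF reg.lmodule_axioms N G(1,2)]) (rule G(3)[OF sub])
 qed
qed

section \<open>Maps factoring through powers of a module\<close>

text \<open>\<open>fac B X M Y h\<close>: the map \<open>h : X \<rightarrow> Y\<close> is a finite sum of maps factoring through \<open>M\<close>.\<close>

inductive fac ::
 "('b, 'z) ring_scheme => ('b, 'x) module => ('b, 'm) module => ('b, 'y) module => ('x => 'y) => bool"
 for B X M Y where
 fac_zero: "(!!x. x \<in> carrier X ==> h x = zero Y) ==> fac B X M Y h"
| fac_step: "fac B X M Y h ==> f \<in> mod_hom B X M ==> g \<in> mod_hom B M Y ==>
  (!!x. x \<in> carrier X ==> h' x = g (f x) +[Y] h x) ==> fac B X M Y h'"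

lemma fac_hom:
 assumes "fac B X M Y h" "lmodule B X" "lmodule B Y"
 shows "h \<in> mod_hom B X Y"
 using assms(1)
proof induction
 case (fac_zero h)
 show ?case
  by (rule mod_hom_cong[OF mod_hom_const_zero[OF assms(3)] assms(2)]) (rule fac_zero)
next
 case (fac_step h f g h')
 show ?case
  by (rule mod_hom_cong[OF mod_hom_add[OF assms(3) mod_hom_comp[OF fac_step(2,3)] fac_step(5)] assms(2)])
    (rule fac_step(4))
qed

lemma fac_single:
 assumes "lmodule B Y" "f \<in> mod_hom B X M" "g \<in> mod_hom B M Y"
 shows "fac B X M Y (%x. g (f x))"
proof -
 interpret Y: lmodule B Y by fact
 show ?thesis
  by (rule fac_step[OF fac_zero[of X "%x. zero Y"] assms(2,3)])
    (use mod_homD(1)[OF mod_hom_comp[OF assms(2,3)]] in auto)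
qed

lemma fac_cong:
 assumes "fac B X M Y h" "!!x. x \<in> carrier X ==> h' x = h x"
 shows "fac B X M Y h'"
 using assms
proof (cases rule: fac.cases)
 case fac_zero
 then show ?thesis using assms(2) by (intro fac.fac_zero) simp
next
 case (fac_step h0 f g)
 show ?thesis by (rule fac.fac_step[OF fac_step(1-3)]) (simp add: assms(2) fac_step(4))
qed

lemma fac_add:
 assumes "lmodule B X" "lmodule B Y" "fac B X M Y h" "fac B X M Y h'"
 shows "fac B X M Y (%x. h x +[Y] h' x)"
 using assms(3)
proof induction
 case (fac_zero h)
 interpret Y: lmodule B Y by fact
 show ?case
  by (rule fac_cong[OF assms(4)]) (use mod_homD(1)[OF fac_hom[OF assms(4,1,2)]] fac_zero in auto)
next
 case (fac_step h f g h'')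
 interpret Y: lmodule B Y by fact
 show ?case
  by (rule fac.fac_step[OF fac_step(5,2,3)])
    (use mod_homD(1)[OF fac_hom[OF assms(4,1,2)]] mod_homD(1)[OF fac_hom[OF fac_step(1) assms(1,2)]]
     mod_homD(1)[OF mod_hom_comp[OF fac_step(2,3)]] fac_step(4) in \<open>auto simp: Y.M.a_assoc\<close>)
qed

lemma fac_post:
 assumes "lmodule B X" "lmodule B Y" "lmodule B Z" "u \<in> mod_hom B Y Z" "fac B X M Y h"
 shows "fac B X M Z (%x. u (h x))"
 using assms(5)
proof induction
 case (fac_zero h)
 show ?case by (rule fac.fac_zero) (simp add: fac_zero mod_hom_zero[OF assms(4,2,3)])
next
 case (fac_step h f g h')
 show ?case
  by (rule fac.fac_step[OF fac_step(5,2) mod_hom_comp[OF fac_step(3) assms(4)]])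
    (use mod_homD(1)[OF fac_hom[OF fac_step(1) assms(1,2)]]
     mod_homD(1)[OF mod_hom_comp[OF fac_step(2,3)]] fac_step(4) mod_homD(2)[OF assms(4)] in auto)
qed

lemma fac_pre:
 assumes "u \<in> mod_hom B W X" "fac B X M Y h"
 shows "fac B W M Y (%x. h (u x))"
 using assms(2)
proof induction
 case (fac_zero h)
 show ?case by (rule fac.fac_zero) (simp add: fac_zero mod_homD(1)[OF assms(1)])
next
 case (fac_step h f g h')
 show ?case
  by (rule fac.fac_step[OF fac_step(5) mod_hom_comp[OF assms(1) fac_step(2)] fac_step(3)])
    (use mod_homD(1)[OF assms(1)] fac_step(4) in auto)
qed

text \<open>The identity of \<open>X\<close> is a finite sum of maps through \<open>M\<close>
  exactly when \<open>X\<close> is a direct summand of a power of \<open>M\<close>. This form names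
  neither the power nor a complement; \<open>add_class_iff_addc\<close> compares it with
  \<open>add_class\<close>.\<close>

definition addc :: "('b, 'z) ring_scheme => ('b, 'm) module => ('b, 'x) module => bool" where
 "addc B M X \<longleftrightarrow> lmodule B X & fac B X M X (%x. x)"

lemma addc_lmodule: "addc B M X ==> lmodule B X"
 by (simp add: addc_def)

lemma fac_trans:
 assumes "lmodule B X" "lmodule B Y" "addc B M N" "fac B X N Y h"
 shows "fac B X M Y h"
 using assms(4)
proof induction
 case (fac_zero h)
 then show ?case by (rule fac.fac_zero)
next
 case (fac_step h f g h')
 have N: "lmodule B N" "fac B N M N (%x. x)" using assms(3) by (auto simp: addc_def)
 have "fac B X M Y (%x. g (f x))"
  by (rule fac_post[OF assms(1) N(1) assms(2) fac_step(3) fac_pre[OF fac_step(2) N(2)]])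
 from fac_add[OF assms(1,2) this fac_step(5)] show ?case
  by (rule fac_cong) (rule fac_step(4))
qed

lemma addc_trans: "addc B N X ==> addc B M N ==> addc B M X"
 using fac_trans addc_def by metis

lemma addc_refl: "lmodule B M ==> addc B M M"
 unfolding addc_def using fac_single[OF _ mod_hom_id mod_hom_id] by simp

lemma addc_retract:
 assumes "addc B M X" "lmodule B Y" "s \<in> mod_hom B Y X" "r \<in> mod_hom B X Y"
  "!!y. y \<in> carrier Y ==> r (s y) = y"
 shows "addc B M Y"
proof -
 have X: "lmodule B X" "fac B X M X (%x. x)" using assms(1) by (auto simp: addc_def)
 have "fac B Y M Y (%y. r (s y))"
  by (rule fac_post[OF assms(2) X(1) assms(2,4) fac_pre[OF assms(3) X(2)]])
 from fac_cong[OF this, of "%y. y"] assms(5) show ?thesis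
  unfolding addc_def using assms(2) by simp
qed

lemma addc_iso: "addc B M X ==> mod_iso B X Y ==> lmodule B Y ==> addc B M Y"
 by (erule mod_isoE, erule addc_lmodule) (rule addc_retract)

lemma addc_zero: "lmodule B X ==> carrier X = {zero X} ==> addc B M X"
 unfolding addc_def by (intro conjI fac_zero) auto

lemma addc_prod_mod:
 assumes "addc B M X" "addc B M Y"
 shows "addc B M (prod_mod X Y)"
proof -
 interpret X: lmodule B X using assms(1) by (rule addc_lmodule)
 interpret Y: lmodule B Y using assms(2) by (rule addc_lmodule)
 have P: "lmodule B (prod_mod X Y)"
  by (intro lmodule_prod_mod X.lmodule_axioms Y.lmodule_axioms)
 have X: "fac B X M X (%x. x)" and Y: "fac B Y M Y (%x. x)" using assms by (auto simp: addc_def)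
 have i: "(%x. (x, zero Y)) \<in> mod_hom B X (prod_mod X Y)" "(%y. (zero X, y)) \<in> mod_hom B Y (prod_mod X Y)"
  by (intro pair_mod_hom mod_hom_id mod_hom_const_zero X.lmodule_axioms Y.lmodule_axioms)+
 have "fac B (prod_mod X Y) M (prod_mod X Y) (%u. (fst u, zero Y))"
  by (rule fac_post[OF P X.lmodule_axioms P i(1) fac_pre[OF fst_mod_hom X]])
 moreover have "fac B (prod_mod X Y) M (prod_mod X Y) (%u. (zero X, snd u))"
  by (rule fac_post[OF P Y.lmodule_axioms P i(2) fac_pre[OF snd_mod_hom Y]])
 ultimately have "fac B (prod_mod X Y) M (prod_mod X Y)
   (%u. (fst u, zero Y) +[prod_mod X Y] (zero X, snd u))"
  by (rule fac_add[OF P P])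
 then have "fac B (prod_mod X Y) M (prod_mod X Y) (%u. u)" by (rule fac_cong) auto
 then show ?thesis using P by (simp add: addc_def)
qed

lemma addc_dsum:
 assumes "ring B" "finite I" "!!i. i \<in> I ==> addc B M (N i)"
 shows "addc B M (dsum I N)"
proof -
 have l: "!!i. i \<in> I ==> lmodule B (N i)" using assms(3) addc_lmodule by metis
 have D: "lmodule B (dsum I N)" using assms(1) l by (rule lmodule_dsum)
 have ag: "abelian_group (N i)" if "i \<in> I" for i using l[OF that] by (rule lmodule.axioms)
 note ag' = abelian_groupE(2)[OF ag] abelian_groupE(5)[OF ag]
  abelian_monoid.r_zero[OF abelian_group.axioms(1)[OF ag]]
 let ?t = "%J x. \<lambda>i\<in>I. if i \<in> J then x i else zero (N i)"
 have "fac B (dsum I N) M (dsum I N) (?t J)" if "finite J" "J \<subseteq> I" for J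
  using that
 proof induction
  case empty
  show ?case by (rule fac_zero) (simp add: dsum_simps restrict_def)
 next
  case (insert j J)
  then have j: "j \<in> I" by simp
  have N: "fac B (N j) M (N j) (%x. x)" using assms(3)[OF j] by (simp add: addc_def)
  have "fac B (dsum I N) M (dsum I N) (%x. single I N j (x j))"
   by (rule fac_post[OF D l[OF j] D single_mod_hom[OF l] fac_pre[OF proj_mod_hom[OF j, of B N] N]])
  moreover have "fac B (dsum I N) M (dsum I N) (?t J)" by (rule insert.IH) (use insert.prems in auto)
  ultimately have "fac B (dsum I N) M (dsum I N) (%x. single I N j (x j) +[dsum I N] ?t J x)"
   by (rule fac_add[OF D D])
  then show ?case
   by (rule fac_cong) (use insert in \<open>auto simp: single_def dsum_simps fun_eq_iff ag' PiE_iff\<close>)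
 qed
 from this[OF assms(2)] have "fac B (dsum I N) M (dsum I N) (?t I)" by simp
 then have "fac B (dsum I N) M (dsum I N) (%x. x)"
  by (rule fac_cong) (auto simp: dsum_simps fun_eq_iff PiE_iff extensional_def)
 then show ?thesis using D by (simp add: addc_def)
qed

lemma addc_component:
 assumes "i \<in> I" "!!i. i \<in> I ==> lmodule B (M i)" "ring B"
 shows "addc B (dsum I M) (M i)"
 by (rule addc_retract[OF addc_refl[OF lmodule_dsum[OF assms(3,2)]] assms(2)[OF assms(1)]
    single_mod_hom[of I B M i] proj_mod_hom[of i I B M]])
   (use assms in \<open>auto simp: single_def\<close>)

text \<open>Lifts of the single summands add up. A lifting property of maps out of \<open>M\<close>
  thus passes to all maps out of modules in \<open>add(M)\<close>; \<open>fac_extend\<close> does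
  the same for extensions of maps into \<open>M\<close>.\<close>

lemma fac_lift:
 assumes "lmodule B Y" "lmodule B Z" "g \<in> mod_hom B Y Z" "fac B X M Z h"
  and "!!u. u \<in> mod_hom B M Z ==> \<exists>v\<in>mod_hom B M Y. \<forall>x\<in>carrier M. g (v x) = u x"
 shows "\<exists>h'\<in>mod_hom B X Y. \<forall>x\<in>carrier X. g (h' x) = h x"
 using assms(4)
proof induction
 case (fac_zero h)
 show ?case
  by (rule bexI[of _ "%x. zero Y"])
    (use fac_zero mod_hom_zero[OF assms(3,1,2)] mod_hom_const_zero[OF assms(1)] in auto)
next
 case (fac_step h f u h')
 from fac_step(5) obtain w where w: "w \<in> mod_hom B X Y" "\<forall>x\<in>carrier X. g (w x) = h x" by blast
 from assms(5)[OF fac_step(3)] obtain v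
  where v: "v \<in> mod_hom B M Y" "\<forall>x\<in>carrier M. g (v x) = u x" by blast
 show ?case
  by (rule bexI[OF _ mod_hom_add[OF assms(1) mod_hom_comp[OF fac_step(2) v(1)] w(1)]])
    (use v w fac_step(4) mod_homD(2)[OF assms(3)] mod_homD(1)[OF w(1)] mod_homD(1)[OF v(1)]
     mod_homD(1)[OF fac_step(2)] in auto)
qed

lemma fac_extend:
 assumes "lmodule B Y" "fac B X M Y h" "i \<in> mod_hom B X P"
  and "!!u. u \<in> mod_hom B X M ==> \<exists>v\<in>mod_hom B P M. \<forall>x\<in>carrier X. v (i x) = u x"
 shows "\<exists>h'\<in>mod_hom B P Y. \<forall>x\<in>carrier X. h' (i x) = h x"
 using assms(2)
proof induction
 case (fac_zero h)
 show ?case by (rule bexI[OF _ mod_hom_const_zero[OF assms(1)]]) (use fac_zero in auto)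
next
 case (fac_step h f g h')
 from fac_step(5) obtain w where w: "w \<in> mod_hom B P Y" "\<forall>x\<in>carrier X. w (i x) = h x" by blast
 from assms(4)[OF fac_step(2)] obtain v
  where v: "v \<in> mod_hom B P M" "\<forall>x\<in>carrier X. v (i x) = f x" by blast
 show ?case
  by (rule bexI[OF _ mod_hom_add[OF assms(1) mod_hom_comp[OF v(1) fac_step(3)] w(1)]])
    (use v w fac_step(4) in auto)
qed

section \<open>Finitely generated projectives, as direct summands of finite free modules\<close>

abbreviation fgproj :: "('b, 'z) ring_scheme => ('b, 'x) module => bool" where
 "fgproj B P \<equiv> addc B (reg_module B) P"

text \<open>A map out of the regular module is governed by the image of \<open>one B\<close>, so
  each summand of \<open>h\<close> contributes one generator.\<close>

lemma fac_fg_image: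
 assumes "ring B" "lmodule B X" "lmodule B Y" "fac B X (reg_module B) Y h"
 shows "\<exists>S. finite S & S \<subseteq> carrier Y & (\<forall>N. submodule N B Y & S \<subseteq> N --> h ` carrier X \<subseteq> N)"
 using assms(4)
proof induction
 case (fac_zero h)
 show ?case by (rule exI[of _ "{}"]) (use fac_zero submoduleD(2) in auto)
next
 case (fac_step h f g h')
 interpret B: ring B by fact
 from fac_step(5) obtain S where S: "finite S" "S \<subseteq> carrier Y"
  "\<forall>N. submodule N B Y & S \<subseteq> N --> h ` carrier X \<subseteq> N" by blast
 note f = mod_homD(1)[OF fac_step(2), simplified]
 have g: "g b = b .[Y] g (one B)" if "b \<in> carrier B" for b
  using mod_homD(3)[OF fac_step(3), of b "one B"] that by simp
 have g1: "g (one B) \<in> carrier Y" using mod_homD(1)[OF fac_step(3)] by simp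
 show ?case
 proof (rule exI[of _ "insert (g (one B)) S"], intro conjI allI impI, goal_cases)
  case (3 N)
  then have N: "submodule N B Y" "insert (g (one B)) S \<subseteq> N" by auto
  then have hN: "h ` carrier X \<subseteq> N" using S(3) by blast
  show "h' ` carrier X \<subseteq> N"
  proof (rule image_subsetI)
   fix x assume x: "x \<in> carrier X"
   have "f x .[Y] g (one B) \<in> N" using N f[OF x] by (intro submoduleD(4)[of N]) auto
   then show "h' x \<in> N"
    using hN x by (simp add: fac_step(4) g[OF f[OF x]] submoduleD(3)[OF N(1)] image_subset_iff)
  qed
 qed (use S g1 in auto)
qed

lemma fgproj_fg:
 assumes "ring B" "fgproj B P"
 shows "fg_module B P"
proof -
 from assms(2) have P: "lmodule B P" "fac B P (reg_module B) P (%x. x)" by (auto simp: addc_def)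
 from fac_fg_image[OF assms(1) P(1) P(1) P(2)] obtain S where "finite S" "S \<subseteq> carrier P"
  "\<forall>N. submodule N B P & S \<subseteq> N --> (%x. x) ` carrier P \<subseteq> N" by blast
 then show ?thesis by (intro fg_moduleI[OF P(1), of S]) auto
qed

lemma projective_lift:
 assumes "fgproj B P" "h \<in> mod_hom B P Z" "lmodule B Y" "lmodule B Z"
  and g: "g \<in> mod_hom B Y Z" "g ` carrier Y = carrier Z"
 shows "\<exists>h'\<in>mod_hom B P Y. \<forall>x\<in>carrier P. g (h' x) = h x"
proof (rule fac_lift[OF assms(3,4) g(1)])
 interpret Y: lmodule B Y by fact
 interpret Z: lmodule B Z by fact
 from assms(1) have P: "lmodule B P" "fac B P (reg_module B) P (%x. x)" by (auto simp: addc_def)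
 show "fac B P (reg_module B) Z h"
  by (rule fac_post[OF P(1) P(1) assms(4,2) P(2)])
 fix u assume u: "u \<in> mod_hom B (reg_module B) Z"
 have "u (one B) \<in> carrier Z" using mod_homD(1)[OF u] by simp
 then obtain y where y: "y \<in> carrier Y" "g y = u (one B)" unfolding g(2)[symmetric] by auto
 show "\<exists>v\<in>mod_hom B (reg_module B) Y. \<forall>x\<in>carrier (reg_module B). g (v x) = u x"
 proof (rule bexI[OF _ smult_right_mod_hom[OF Y.lmodule_axioms y(1)]], rule ballI)
  fix b assume b: "b \<in> carrier (reg_module B)"
  then show "g (b .[Y] y) = u b"
   using mod_homD(3)[OF u, of b "one B"] mod_homD(3)[OF g(1), of b y] y by simp
 qed
qed

lemma fgproj_free: "ring B ==> fgproj B (free_module B m)"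
 unfolding free_module_def by (intro addc_dsum addc_refl lmodule_reg) auto

lemma free_cover:
 assumes X: "fg_module B X"
 shows "\<exists>m. \<exists>p\<in>mod_hom B (free_module B m) X. p ` carrier (free_module B m) = carrier X"
proof -
 interpret X: lmodule B X using X by (rule fg_lmodule)
 have free: "lmodule B (free_module B m)" for m
  by (rule addc_lmodule[OF fgproj_free[OF X.R.ring_axioms]])
 from X obtain S where S: "finite S" "S \<subseteq> carrier X"
  "!!N. submodule N B X ==> S \<subseteq> N ==> carrier X \<subseteq> N" by (rule fg_moduleE) blast
 from S(1,2) have "\<exists>m. \<exists>p\<in>mod_hom B (free_module B m) X. S \<subseteq> p ` carrier (free_module B m)"
 proof induction
  case empty
  show ?case using mod_hom_const_zero[OF X.lmodule_axioms] by blast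
 next
  case (insert s S)
  then obtain m p where p: "p \<in> mod_hom B (free_module B m) X" "S \<subseteq> p ` carrier (free_module B m)"
   by blast
  let ?F = "free_module B (Suc m)"
  let ?r = "%x. \<lambda>i\<in>{..<m}. x i"
  let ?q = "%x. x m .[X] s +[X] p (?r x)"
  have s: "s \<in> carrier X" using insert by simp
  have "(%x. x m) \<in> mod_hom B ?F (reg_module B)"
   using proj_mod_hom[of m "{..<Suc m}" B "%_. reg_module B"] by (simp add: free_module_def)
  from mod_hom_comp[OF this smult_right_mod_hom[OF X.lmodule_axioms s]]
  have "(%x. x m .[X] s) \<in> mod_hom B ?F X" .
  moreover have r: "?r \<in> mod_hom B ?F (free_module B m)"
   unfolding free_module_def by (rule tuple_mod_hom) (rule proj_mod_hom, simp)
  ultimately have q: "?q \<in> mod_hom B ?F X"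
   by (intro mod_hom_add X.lmodule_axioms mod_hom_comp[OF r p(1)])
  have "s \<in> ?q ` carrier ?F"
  proof (rule image_eqI)
   let ?x = "\<lambda>i\<in>{..<Suc m}. if i = m then one B else zero B"
   show "?x \<in> carrier ?F" by (auto simp: free_module_def dsum_simps)
   have "?r ?x = zero (free_module B m)" by (auto simp: free_module_def dsum_simps fun_eq_iff)
   then show "s = ?q ?x" using s mod_hom_zero[OF p(1) free X.lmodule_axioms] by simp
  qed
  moreover have "S \<subseteq> ?q ` carrier ?F"
  proof
   fix t assume t: "t \<in> S"
   then obtain x where x: "x \<in> carrier (free_module B m)" "t = p x" using p(2) by blast
   let ?x = "\<lambda>i\<in>{..<Suc m}. if i = m then zero B else x i"
   show "t \<in> ?q ` carrier ?F"
   proof (rule image_eqI)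
    show "?x \<in> carrier ?F" using x(1) by (auto simp: free_module_def dsum_simps PiE_iff)
    have "?r ?x = x" using x(1) by (auto simp: free_module_def dsum_simps fun_eq_iff PiE_iff extensional_def)
    then show "t = ?q ?x" using x t insert(4) s mod_homD(1)[OF p(1)] by (auto simp: X.smult_zero_left)
   qed
  qed
  ultimately show ?case using q by (intro exI[of _ "Suc m"] bexI[of _ ?q]) auto
 qed
 then obtain m p where p: "p \<in> mod_hom B (free_module B m) X" "S \<subseteq> p ` carrier (free_module B m)"
  by blast
 have "submodule (p ` carrier (free_module B m)) B X"
  by (rule submodule_image[OF free X.lmodule_axioms p(1) submodule_carrier[OF free]])
 then have "carrier X \<subseteq> p ` carrier (free_module B m)" using p(2) by (rule S(3))
 then have "p ` carrier (free_module B m) = carrier X" using mod_homD(1)[OF p(1)] by auto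
 then show ?thesis using p(1) by blast
qed

lemma zero_fgproj: "lmodule B X ==> carrier X = {zero X} ==> fgproj B X"
 by (rule addc_zero)

section \<open>Short exact sequences\<close>

definition ses ::
 "('b, 'z) ring_scheme => ('b, 'x) module => ('x => 'y) => ('b, 'y) module => ('y => 'w) =>
  ('b, 'w) module => bool" where
 "ses B X f Y g Z \<longleftrightarrow> lmodule B X & lmodule B Y & lmodule B Z &
   f \<in> mod_hom B X Y & inj_on f (carrier X) & g \<in> mod_hom B Y Z & g ` carrier Y = carrier Z &
   f ` carrier X = a_kernel Y Z g"

lemma sesD:
 assumes "ses B X f Y g Z"
 shows "lmodule B X" "lmodule B Y" "lmodule B Z" "f \<in> mod_hom B X Y" "inj_on f (carrier X)"
  "g \<in> mod_hom B Y Z" "g ` carrier Y = carrier Z" "f ` carrier X = a_kernel Y Z g"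
 using assms by (auto simp: ses_def)

lemma ses_comp_zero: "ses B X f Y g Z ==> x \<in> carrier X ==> g (f x) = zero Z"
 using sesD(8)[of B X f Y g Z] by (auto simp: a_kernel_eq)

lemma ses_kernelE:
 assumes "ses B X f Y g Z" "y \<in> carrier Y" "g y = zero Z"
 obtains x where "x \<in> carrier X" "y = f x"
 using sesD(8)[OF assms(1)] assms(2,3) by (auto simp: a_kernel_eq)

text \<open>Allows the terms of a sequence to be replaced by copies over one element type, as the
  inductions over \<open>fgm\<close> require.\<close>

lemma ses_iso:
 assumes s: "ses B X f Y g Z" and iso: "mod_iso B X X'" "mod_iso B Y Y'" "mod_iso B Z Z'"
  and l: "lmodule B X'" "lmodule B Y'" "lmodule B Z'"
 shows "\<exists>f' g'. ses B X' f' Y' g' Z'"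
proof -
 note s' = sesD[OF s]
 from iso(1) s'(1) obtain a a' where a: "a \<in> mod_hom B X X'" "a' \<in> mod_hom B X' X"
  "!!x. x \<in> carrier X ==> a' (a x) = x" "!!x. x \<in> carrier X' ==> a (a' x) = x" by (rule mod_isoE) (rule that)
 from iso(2) s'(2) obtain b b' where b: "b \<in> mod_hom B Y Y'" "b' \<in> mod_hom B Y' Y"
  "!!x. x \<in> carrier Y ==> b' (b x) = x" "!!x. x \<in> carrier Y' ==> b (b' x) = x" by (rule mod_isoE) (rule that)
 from iso(3) s'(3) obtain c c' where c: "c \<in> mod_hom B Z Z'" "c' \<in> mod_hom B Z' Z"
  "!!x. x \<in> carrier Z ==> c' (c x) = x" "!!x. x \<in> carrier Z' ==> c (c' x) = x" by (rule mod_isoE) (rule that)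
 note h = mod_homD(1)[OF a(1)] mod_homD(1)[OF a(2)] mod_homD(1)[OF b(1)] mod_homD(1)[OF b(2)]
  mod_homD(1)[OF c(1)] mod_homD(1)[OF c(2)] mod_homD(1)[OF s'(4)] mod_homD(1)[OF s'(6)]
 let ?f = "%x. b (f (a' x))" and ?g = "%y. c (g (b' y))"
 have "ses B X' ?f Y' ?g Z'"
  unfolding ses_def
 proof (intro conjI l)
  show "?f \<in> mod_hom B X' Y'" by (rule mod_hom_comp[OF mod_hom_comp[OF a(2) s'(4)] b(1)])
  show "?g \<in> mod_hom B Y' Z'" by (rule mod_hom_comp[OF mod_hom_comp[OF b(2) s'(6)] c(1)])
  show "inj_on ?f (carrier X')"
   by (rule inj_onI) (metis a(4) b(3) h s'(5) inj_onD)
  show "?g ` carrier Y' = carrier Z'"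
  proof (intro equalityI subsetI)
   fix z assume z: "z \<in> carrier Z'"
   then have "c' z \<in> g ` carrier Y" using h s'(7) by simp
   then obtain y where "y \<in> carrier Y" "c' z = g y" by auto
   then have "c (g y) = z" using c(4)[OF z] by simp
   then show "z \<in> ?g ` carrier Y'" using \<open>y \<in> carrier Y\<close> b h by (intro image_eqI[of _ _ "b y"]) auto
  qed (use h in auto)
  show "?f ` carrier X' = a_kernel Y' Z' ?g"
  proof (intro equalityI subsetI)
   fix y assume "y \<in> ?f ` carrier X'"
   then obtain x where x: "x \<in> carrier X'" "y = ?f x" by auto
   then show "y \<in> a_kernel Y' Z' ?g"
    using h b ses_comp_zero[OF s, of "a' x"] mod_hom_zero[OF c(1) s'(3) l(3)]
    by (simp add: a_kernel_eq)
  next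
   fix y assume "y \<in> a_kernel Y' Z' ?g"
   then have y: "y \<in> carrier Y'" "c (g (b' y)) = zero Z'" by (auto simp: a_kernel_eq)
   have "g (b' y) = c' (c (g (b' y)))" using c(3)[of "g (b' y)"] y(1) h by simp
   also have "... = zero Z" unfolding y(2) by (rule mod_hom_zero[OF c(2) l(3) s'(3)])
   finally obtain x where x: "x \<in> carrier X" "b' y = f x"
    using ses_kernelE[OF s] h(4)[OF y(1)] by metis
   then show "y \<in> ?f ` carrier X'" using y a h b by (intro image_eqI[of _ _ "a x"]) (auto, metis)
  qed
 qed
 then show ?thesis by blast
qed

lemma ses_kernel:
 assumes "lmodule B Y" "lmodule B Z" "g \<in> mod_hom B Y Z" "g ` carrier Y = carrier Z"
 shows "ses B (Y\<lparr>carrier := a_kernel Y Z g\<rparr>) (%x. x) Y g Z"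
proof -
 note K = submodule_kernel[OF assms(1-3)]
 show ?thesis
  unfolding ses_def
  using assms lmodule_restrict[OF assms(1) K] mod_hom_restrict[OF mod_hom_id submoduleD(1)[OF K]]
  by auto
qed

lemma ses_fg_middle: "ses B X f Y g Z ==> fg_module B X ==> fg_module B Z ==> fg_module B Y"
 by (rule fg_ext[of B X Y Z f g]) (auto simp: ses_def)

lemma ses_fg_quotient: "ses B X f Y g Z ==> fg_module B Y ==> fg_module B Z"
 by (rule fg_image[of B Y Z g]) (auto simp: ses_def)

lemma ses_fg_sub:
 assumes "left_noetherian B" "ses B X f Y g Z" "fg_module B Y"
 shows "fg_module B X"
proof -
 note s = sesD[OF assms(2)]
 let ?K = "Y\<lparr>carrier := f ` carrier X\<rparr>"
 have K: "submodule (f ` carrier X) B Y"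
  by (rule submodule_image[OF s(1,2,4) submodule_carrier[OF s(1)]])
 have "mod_iso B X ?K"
  by (rule mod_iso_bij[OF mod_hom_restrict_cod[OF s(4)] s(5)]) auto
 then show ?thesis
  using fg_iso[OF mod_iso_sym[OF _ s(1)] noetherian_fg_submodule[OF assms(1,3) K] s(1)] by blast
qed

lemma ses_quot_module:
 assumes "lmodule B M" "submodule N B M"
 shows "ses B (M\<lparr>carrier := N\<rparr>) (%x. x) M (%x. N +>\<^bsub>M\<^esub> x) (quot_module M N)"
proof -
 note q = quot_module_projection[OF assms]
 have "a_kernel M (quot_module M N) (%x. N +>\<^bsub>M\<^esub> x) = N"
  using q(4) submoduleD(1)[OF assms(2)] by (auto simp: a_kernel_eq)
 with ses_kernel[OF assms(1) q(1-3)] show ?thesis by simp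
qed

text \<open>Prepares dimension shifting along a quotient: a cover \<open>P\<close> of
  \<open>Y\<close> also covers \<open>Z\<close>, and its kernel over \<open>Z\<close> is an
  extension of \<open>X\<close> by its kernel over \<open>Y\<close>.\<close>

lemma ses_kernel_comp:
 assumes s: "ses B X f Y g Z" and P: "lmodule B P" and p: "p \<in> mod_hom B P Y" "p ` carrier P = carrier Y"
 shows "\<exists>q. ses B (P\<lparr>carrier := a_kernel P Y p\<rparr>) (%x. x) (P\<lparr>carrier := a_kernel P Z (%x. g (p x))\<rparr>) q X &
  (\<forall>a\<in>a_kernel P Z (%x. g (p x)). f (q a) = p a)"
proof -
 note s' = sesD[OF s]
 let ?V = "a_kernel P Z (%x. g (p x))" and ?K = "a_kernel P Y p"
 have gp: "(%x. g (p x)) \<in> mod_hom B P Z" by (rule mod_hom_comp[OF p(1) s'(6)])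
 note V = submodule_kernel[OF P s'(3) gp] and K = submodule_kernel[OF P s'(2) p(1)]
 let ?Y = "Y\<lparr>carrier := f ` carrier X\<rparr>"
 have Y: "submodule (f ` carrier X) B Y"
  by (rule submodule_image[OF s'(1,2,4) submodule_carrier[OF s'(1)]])
 have fY: "f \<in> mod_hom B X ?Y" by (rule mod_hom_restrict_cod[OF s'(4)]) auto
 have "inv_into (carrier X) f \<in> mod_hom B ?Y X"
  by (rule mod_hom_inv_into[OF s'(1) fY]) (use s'(5) in \<open>auto simp: bij_betw_def\<close>)
 moreover have "p \<in> mod_hom B (P\<lparr>carrier := ?V\<rparr>) ?Y"
  by (rule mod_hom_restrict_cod[OF mod_hom_restrict[OF p(1) submoduleD(1)[OF V]]])
    (use s'(8) mod_homD(1)[OF p(1)] in \<open>auto simp: a_kernel_eq\<close>)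
 ultimately have q: "(%a. inv_into (carrier X) f (p a)) \<in> mod_hom B (P\<lparr>carrier := ?V\<rparr>) X"
  by (rule mod_hom_comp[rotated])
 have KV: "?K \<subseteq> ?V" using mod_hom_zero[OF s'(6,2,3)] by (auto simp: a_kernel_eq)
 have fq: "f (inv_into (carrier X) f (p a)) = p a" if "a \<in> ?V" for a
 proof (rule f_inv_into_f)
  show "p a \<in> f ` carrier X" using that s'(8) mod_homD(1)[OF p(1)] by (auto simp: a_kernel_eq)
 qed
 have sub: "submodule ?K B (P\<lparr>carrier := ?V\<rparr>)"
  using K KV by (simp add: submodule_restrict[OF P V])
 have "ses B (P\<lparr>carrier := ?K\<rparr>) (%x. x) (P\<lparr>carrier := ?V\<rparr>) (%a. inv_into (carrier X) f (p a)) X"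
  unfolding ses_def
 proof (intro conjI lmodule_restrict[OF P] K V s'(1) q)
  show "(%x. x) \<in> mod_hom B (P\<lparr>carrier := ?K\<rparr>) (P\<lparr>carrier := ?V\<rparr>)"
   using KV by (intro mod_homI) auto
  show "(%a. inv_into (carrier X) f (p a)) ` carrier (P\<lparr>carrier := ?V\<rparr>) = carrier X"
  proof (intro equalityI subsetI)
   fix x assume x: "x \<in> carrier X"
   then have "f x \<in> p ` carrier P" using p(2) mod_homD(1)[OF s'(4)] by simp
   then obtain a where a: "a \<in> carrier P" "f x = p a" by auto
   then have "a \<in> ?V" using ses_comp_zero[OF s x] by (simp add: a_kernel_eq)
   moreover have "inv_into (carrier X) f (p a) = x"
    unfolding a(2)[symmetric] by (rule inv_into_f_f[OF s'(5) x])
   ultimately show "x \<in> (%a. inv_into (carrier X) f (p a)) ` carrier (P\<lparr>carrier := ?V\<rparr>)" by force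
  qed (use mod_homD(1)[OF q] in auto)
  have "inv_into (carrier X) f (p a) = zero X \<longleftrightarrow> p a = zero Y" if "a \<in> ?V" for a
   using fq[OF that] mod_hom_zero[OF s'(4,1,2)] inv_into_f_f[OF s'(5), of "zero X"]
    submoduleD(2)[OF submodule_carrier[OF s'(1)]] by metis
  then show "(%x. x) ` carrier (P\<lparr>carrier := ?K\<rparr>) =
    a_kernel (P\<lparr>carrier := ?V\<rparr>) X (%a. inv_into (carrier X) f (p a))"
   using KV by (auto simp: a_kernel_eq)
 qed auto
 with fq show ?thesis by blast
qed

section \<open>Left perpendicular classes\<close>

text \<open>When \<open>P\<close> is projective and \<open>K\<close> a submodule, this is
  \<open>Ext^1(P/K, M) = 0\<close>.\<close>

definition extends ::
 "('b, 'z) ring_scheme => ('b, 'x) module => 'x set => ('b, 'm) module => bool" where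
 "extends B P K M \<longleftrightarrow>
   (\<forall>h\<in>mod_hom B (P\<lparr>carrier := K\<rparr>) M. \<exists>h'\<in>mod_hom B P M. \<forall>x\<in>K. h' x = h x)"

lemma extendsD:
 assumes "extends B P K M" "h \<in> mod_hom B (P\<lparr>carrier := K\<rparr>) M"
 obtains h' where "h' \<in> mod_hom B P M" "!!x. x \<in> K ==> h' x = h x"
 using assms unfolding extends_def by blast

lemma extends_restrict:
 assumes "extends B P K M" "K \<subseteq> V" "V \<subseteq> carrier P"
 shows "extends B (P\<lparr>carrier := V\<rparr>) K M"
 unfolding extends_def
proof
 fix h assume "h \<in> mod_hom B (P\<lparr>carrier := V, carrier := K\<rparr>) M"
 then have "h \<in> mod_hom B (P\<lparr>carrier := K\<rparr>) M" by simp
 then obtain h' where h': "h' \<in> mod_hom B P M" "!!x. x \<in> K ==> h' x = h x"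
  by (rule extendsD[OF assms(1)]) blast
 show "\<exists>h'\<in>mod_hom B (P\<lparr>carrier := V\<rparr>) M. \<forall>x\<in>K. h' x = h x"
  by (rule bexI[OF _ mod_hom_restrict[OF h'(1) assms(3)]]) (use h'(2) in auto)
qed

definition cover ::
 "('b, 'z) ring_scheme => ('b, 'p) module => ('p => 'x) => ('b, 'x) module => bool" where
 "cover B P p X \<longleftrightarrow> fgproj B P & lmodule B X & p \<in> mod_hom B P X & p ` carrier P = carrier X"

abbreviation ker_mod :: "('b, 'x) module => ('b, 'y) module => ('x => 'y) => ('b, 'x) module" where
 "ker_mod X Y f \<equiv> X\<lparr>carrier := a_kernel X Y f\<rparr>"

lemma coverD:
 assumes "cover B P p X"
 shows "fgproj B P" "lmodule B P" "lmodule B X" "p \<in> mod_hom B P X" "p ` carrier P = carrier X"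
  "submodule (a_kernel P X p) B P" "lmodule B (ker_mod P X p)"
proof -
 show *: "fgproj B P" "lmodule B P" "lmodule B X" "p \<in> mod_hom B P X" "p ` carrier P = carrier X"
  using assms addc_lmodule unfolding cover_def by auto
 show K: "submodule (a_kernel P X p) B P" by (rule submodule_kernel[OF *(2-4)])
 show "lmodule B (ker_mod P X p)" by (rule lmodule_restrict[OF *(2) K])
qed

lemma cover_fg: "cover B P p X ==> fg_module B X"
 using fgproj_fg[of B P] fg_image[of B P X p] lmodule_ring[of B X] by (auto simp: cover_def)

lemma cover_comp:
 assumes "cover B P p X" "g \<in> mod_hom B X Y" "g ` carrier X = carrier Y" "lmodule B Y"
 shows "cover B P (%x. g (p x)) Y"
proof -
 have "(%x. g (p x)) ` carrier P = g ` (p ` carrier P)" by (simp add: image_image)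
 then show ?thesis
  using assms(1,3,4) mod_hom_comp[OF coverD(4)[OF assms(1)] assms(2)] by (simp add: cover_def)
qed

text \<open>
 \<open>perpc B M X\<close> says that \<open>X\<close> has a resolution by finitely generated projectives along which every
 map into \<open>M\<close> from a syzygy extends to the projective module containing it.  \<open>orth\<close>, and below
 \<open>gresx\<close> and \<open>idimx\<close>, carry such a notion over to modules with arbitrary element type.
\<close>

coinductive perpc ::
 "('b, 'z) ring_scheme => ('b, 'm) module => 'b fgm => bool" for B M where
 perpcI: "cover B P p X ==> extends B P (a_kernel P X p) M ==> perpc B M (ker_mod P X p) ==>
  perpc B M (X :: 'b fgm)"

definition orth :: "('b, 'z) ring_scheme => ('b, 'm) module => ('b, 'x) module => bool" where
 "orth B M X \<longleftrightarrow> lmodule B X &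
   (\<exists>X' :: 'b fgm. mod_iso B X X' & lmodule B X' & perpc B M X')"

lemma orth_lmodule: "orth B M X ==> lmodule B X"
 by (simp add: orth_def)

lemma orth_iso: "orth B M X ==> mod_iso B X Y ==> lmodule B Y ==> orth B M Y"
 unfolding orth_def using mod_iso_sym mod_iso_trans by metis

lemma surj_iso_target:
 assumes "lmodule B P" and p: "p \<in> mod_hom B P X" "p ` carrier P = carrier X"
  and iso: "mod_iso B X Y" and X: "lmodule B X" and Y: "lmodule B Y"
 obtains p' where "p' \<in> mod_hom B P Y" "p' ` carrier P = carrier Y" "a_kernel P Y p' = a_kernel P X p"
proof -
 from iso X obtain a a' where a: "a \<in> mod_hom B X Y" "a' \<in> mod_hom B Y X"
  "!!x. x \<in> carrier X ==> a' (a x) = x" "!!x. x \<in> carrier Y ==> a (a' x) = x" by (rule mod_isoE) (rule that)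
 have "(%x. a (p x)) ` carrier P = a ` carrier X" unfolding p(2)[symmetric] by (simp add: image_image)
 also have "... = carrier Y"
  using mod_homD(1)[OF a(1)] mod_homD(1)[OF a(2)] a(4) by (auto intro!: image_eqI[of _ a])
 finally have im: "(%x. a (p x)) ` carrier P = carrier Y" .
 have "a y = zero Y \<longleftrightarrow> y = zero X" if "y \<in> carrier X" for y
  using that a(3) mod_hom_zero[OF a(1) X Y] mod_hom_zero[OF a(2) Y X] by metis
 then have "a_kernel P Y (%x. a (p x)) = a_kernel P X p"
  using mod_homD(1)[OF p(1)] by (auto simp: a_kernel_eq)
 with mod_hom_comp[OF p(1) a(1)] im show thesis by (rule that)
qed

lemma cover_iso_kernel:
 assumes "cover B P p X" "mod_iso B X Y" "lmodule B Y"
 obtains p' where "cover B P p' Y" "a_kernel P Y p' = a_kernel P X p"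
proof -
 note c = coverD[OF assms(1)]
 from c(2,4,5) assms(2) c(3) assms(3) obtain p' where p': "p' \<in> mod_hom B P Y"
  "p' ` carrier P = carrier Y" "a_kernel P Y p' = a_kernel P X p" by (rule surj_iso_target)
 show thesis by (rule that[OF _ p'(3)]) (use p' c(1) assms(3) in \<open>simp add: cover_def\<close>)
qed

lemma orthE:
 assumes "orth B M X"
 obtains P :: "'b fgm" and p where
  "cover (B :: ('b, 'z) ring_scheme) P p X" "extends B P (a_kernel P X p) M"
  "orth B M (ker_mod P X p)"
proof -
 from assms obtain X' :: "'b fgm"
  where X': "mod_iso B X X'" "lmodule B X'" "perpc B M X'" and X: "lmodule B X"
  by (auto simp: orth_def)
 from X'(3) obtain P p where P: "cover B P p X'" "extends B P (a_kernel P X' p) M"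
  "perpc B M (ker_mod P X' p)" by (cases rule: perpc.cases)
 from P(1) mod_iso_sym[OF X'(1) X] X obtain q
  where q: "cover B P q X" "a_kernel P X q = a_kernel P X' p" by (rule cover_iso_kernel)
 have "orth B M (ker_mod P X q)"
  unfolding orth_def using coverD(7)[OF q(1)] mod_iso_refl P(3) q(2) by metis
 with q(1) P(2) show thesis unfolding q(2)[symmetric] by (rule that)
qed

lemma orth_fg: "orth B M X ==> fg_module B X"
 by (erule orthE) (rule cover_fg)

lemma cover_source_iso:
 assumes "cover B P p X" "mod_iso B P P'" "lmodule B P'" "extends B P (a_kernel P X p) M"
 obtains p' where "cover B P' p' X" "extends B P' (a_kernel P' X p') M"
  "mod_iso B (ker_mod P X p) (ker_mod P' X p')"
proof -
 note c = coverD[OF assms(1)]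
 from assms(2) c(2) obtain t t' where t: "t \<in> mod_hom B P P'" "t' \<in> mod_hom B P' P"
  "!!x. x \<in> carrier P ==> t' (t x) = x" "!!x. x \<in> carrier P' ==> t (t' x) = x" by (rule mod_isoE) (rule that)
 let ?p = "%x. p (t' x)"
 have im: "t' ` carrier P' = carrier P"
  using mod_homD(1)[OF t(1)] mod_homD(1)[OF t(2)] t(3) by (auto intro!: image_eqI[of _ t'])
 have "?p ` carrier P' = p ` (t' ` carrier P')" by (simp add: image_image)
 then have cov: "cover B P' ?p X"
  unfolding cover_def using addc_iso[OF c(1) assms(2,3)] mod_hom_comp[OF t(2) c(4)] c(3,5) im by simp
 have tK: "t \<in> mod_hom B (ker_mod P X p) (ker_mod P' X ?p)"
  by (rule mod_homI) (use mod_homD[OF t(1)] t(3) in \<open>auto simp: a_kernel_eq\<close>)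
 have tK': "t' \<in> mod_hom B (ker_mod P' X ?p) (ker_mod P X p)"
  by (rule mod_homI) (use mod_homD[OF t(2)] in \<open>auto simp: a_kernel_eq\<close>)
 have iso: "mod_iso B (ker_mod P X p) (ker_mod P' X ?p)"
  by (rule mod_isoI[OF tK tK']) (use t in \<open>auto simp: a_kernel_eq\<close>)
 have "extends B P' (a_kernel P' X ?p) M"
  unfolding extends_def
 proof
  fix h assume h: "h \<in> mod_hom B (ker_mod P' X ?p) M"
  obtain h' where h': "h' \<in> mod_hom B P M" "!!x. x \<in> a_kernel P X p ==> h' x = h (t x)"
   by (rule extendsD[OF assms(4) mod_hom_comp[OF tK h]]) blast
  show "\<exists>h'\<in>mod_hom B P' M. \<forall>x\<in>a_kernel P' X ?p. h' x = h x"
   by (rule bexI[OF _ mod_hom_comp[OF t(2) h'(1)]])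
     (use h'(2) t mod_homD(1)[OF t(2)] in \<open>auto simp: a_kernel_eq\<close>)
 qed
 with cov show thesis using iso by (rule that)
qed

text \<open>Coinduction up to isomorphism. The projective may have any element type and its kernel
  may be replaced by a copy, so that \<open>R\<close> has to be defined on \<open>fgm\<close>
  only.\<close>

lemma orth_coinduct:
 fixes X :: "'b fgm" and B :: "('b, 'z) ring_scheme"
 assumes R: "R X" and X: "lmodule B X"
  and step: "!!X :: 'b fgm. R X ==> lmodule B X ==>
   \<exists>(P :: ('b, 'c) module) p K'. cover B P p X & extends B P (a_kernel P X p) M &
    mod_iso B (ker_mod P X p) K' & lmodule B K' & (R K' | orth B M K')"
 shows "orth B M X"
proof -
 interpret X: lmodule B X by fact
 \<comment> \<open>\<open>S\<close> closes \<open>R\<close> under isomorphism and adds all modules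
   already known to be orthogonal.\<close>
 define S where "S Y \<longleftrightarrow> lmodule B Y & ((\<exists>X. R X & lmodule B X & mod_iso B X Y) | orth B M Y)"
  for Y :: "'b fgm"
 have "perpc B M X"
 proof (rule perpc.coinduct[of S])
  show "S X" unfolding S_def using R X mod_iso_refl by blast
  fix Y assume Y: "S Y"
  then have lY: "lmodule B Y" by (simp add: S_def)
  show "\<exists>P p Y'. Y = Y' & cover B P p Y' & extends B P (a_kernel P Y' p) M &
    (S (ker_mod P Y' p) | perpc B M (ker_mod P Y' p))"
  proof (cases "orth B M Y")
   case True
   then obtain P :: "'b fgm" and p where P: "cover B P p Y"
    "extends B P (a_kernel P Y p) M" "orth B M (ker_mod P Y p)" by (rule orthE)
   then have "S (ker_mod P Y p)" by (simp add: S_def orth_lmodule)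
   with P show ?thesis by blast
  next
   case False
   with Y obtain X where X: "R X" "lmodule B X" "mod_iso B X Y" by (auto simp: S_def)
   from step[OF X(1,2)] obtain P :: "('b, 'c) module" and p K' where P: "cover B P p X"
    "extends B P (a_kernel P X p) M" "mod_iso B (ker_mod P X p) K'" "lmodule B K'"
    "R K' | orth B M K'" by blast
   from P(1) X(3) lY obtain q
    where q: "cover B P q Y" "a_kernel P Y q = a_kernel P X p" by (rule cover_iso_kernel)
   have "fg_module B P" using fgproj_fg coverD(1)[OF P(1)] X.R.ring_axioms by blast
   then obtain P' :: "'b fgm" where P': "fg_module B P'" "mod_iso B P P'"
    using fg_module_copy by blast
   have "extends B P (a_kernel P Y q) M" using P(2) q(2) by simp
   from cover_source_iso[OF q(1) P'(2) fg_lmodule[OF P'(1)] this] obtain q' where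
    q': "cover B P' q' Y" "extends B P' (a_kernel P' Y q') M"
     "mod_iso B (ker_mod P Y q) (ker_mod P' Y q')" .
   have l: "lmodule B (ker_mod P Y q)" "lmodule B (ker_mod P' Y q')"
    using coverD(7)[OF q(1)] coverD(7)[OF q'(1)] .
   have "mod_iso B (ker_mod P Y q) K'" using P(3) q(2) by simp
   then have iso: "mod_iso B K' (ker_mod P' Y q')"
    using mod_iso_trans[OF mod_iso_sym q'(3)] l(1) by blast
   have "S (ker_mod P' Y q')"
   proof (cases "R K'")
    case True
    then show ?thesis unfolding S_def using iso P(4) l(2) by blast
   next
    case False
    then have "orth B M (ker_mod P' Y q')" using P(5) orth_iso[OF _ iso l(2)] by blast
    then show ?thesis unfolding S_def using l(2) by blast
   qed
   with q' show ?thesis by blast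
  qed
 qed
 then show ?thesis unfolding orth_def using X mod_iso_refl by blast
qed

lemma copy_exists:
 assumes "fg_module B X"
 obtains X' :: "'b fgm" where
  "fg_module (B :: ('b, 'z) ring_scheme) X'" "lmodule B X'" "mod_iso B X X'" "mod_iso B X' X"
 using fg_module_copy[OF assms] mod_iso_sym fg_lmodule assms by metis

lemma orth_intro:
 fixes B :: "('a, 'z) ring_scheme" and P :: "('a, 'p) module"
 assumes "cover B P p X" "extends B P (a_kernel P X p) M" "orth B M (ker_mod P X p)"
 shows "orth B M X"
proof -
 from cover_fg[OF assms(1)] obtain X' :: "'a fgm"
  where X': "fg_module B X'" "lmodule B X'" "mod_iso B X X'" "mod_iso B X' X" by (rule copy_exists)
 from assms(1) X'(3,2) obtain q
  where q: "cover B P q X'" "a_kernel P X' q = a_kernel P X p" by (rule cover_iso_kernel)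
 from orth_fg[OF assms(3)] obtain K' :: "'a fgm"
  where K': "fg_module B K'" "lmodule B K'" "mod_iso B (ker_mod P X p) K'"
   "mod_iso B K' (ker_mod P X p)" by (rule copy_exists)
 have "orth B M X'"
 proof (rule orth_coinduct[of "%Y. Y = X'"])
  fix Y :: "'a fgm" assume "Y = X'"
  moreover have "orth B M K'" by (rule orth_iso[OF assms(3) K'(3,2)])
  ultimately show "\<exists>(P :: ('a, 'p) module) p K'. cover B P p Y & extends B P (a_kernel P Y p) M &
    mod_iso B (ker_mod P Y p) K' & lmodule B K' & (K' = X' | orth B M K')"
   using q assms(2) K'(2,3) by (intro exI[of _ P] exI[of _ q] exI[of _ K']) simp
 qed (use X' in auto)
 then show ?thesis using X'(4) coverD(3)[OF assms(1)] by (rule orth_iso)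
qed

text \<open>A zero module is projective, covers itself, and is its own syzygy.\<close>

lemma orth_zero_module:
 assumes X: "lmodule B X" "carrier X = {zero X}" and M: "lmodule B M"
 shows "orth B M X"
proof -
 interpret X: lmodule B X by fact
 have fg: "fg_module B X"
  by (rule fg_moduleI[OF X(1), of "{}"]) (use X submoduleD(2) in auto)
 from fg obtain X' :: "'a fgm"
  where X': "fg_module B X'" "lmodule B X'" "mod_iso B X X'" "mod_iso B X' X" by (rule copy_exists)
 interpret X': lmodule B X' by fact
 have "card (carrier X') = 1"
  using X'(3) X(2) by (auto simp: mod_iso_def dest!: bij_betw_same_card)
 then have z: "carrier X' = {zero X'}" using X'.M.zero_closed by (auto simp: card_1_singleton_iff)
 have "orth B M X'"
 proof (rule orth_coinduct[of "%Y. carrier Y = {zero Y}", OF z X'(2)])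
  fix Y :: "'a fgm" assume Y: "carrier Y = {zero Y}" "lmodule B Y"
  interpret Y: lmodule B Y by fact
  have K: "ker_mod Y Y (%x. x) = Y" "a_kernel Y Y (%x. x) = carrier Y"
   using Y(1) by (auto simp: a_kernel_eq)
  have "cover B Y (%x. x) Y"
   unfolding cover_def using zero_fgproj[OF Y(2,1)] Y(2) mod_hom_id by auto
  moreover have "extends B Y (carrier Y) M" unfolding extends_def by auto
  ultimately show "\<exists>(P :: 'a fgm) p (K' :: 'a fgm). cover B P p Y &
    extends B P (a_kernel P Y p) M & mod_iso B (ker_mod P Y p) K' & lmodule B K' &
    (carrier K' = {zero K'} | orth B M K')"
   using Y mod_iso_refl[of B Y] K
   by (intro exI[of _ Y] exI[of _ "%x. x"] exI[of _ Y]) metis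
 qed
 then show ?thesis using X'(4) X(1) by (rule orth_iso)
qed

lemma orth_proj:
 assumes P: "fgproj B P" and M: "lmodule B M"
 shows "orth B M P"
proof -
 interpret P: lmodule B P using P by (rule addc_lmodule)
 interpret M: lmodule B M by fact
 have c: "cover B P (%x. x) P"
  unfolding cover_def using P P.lmodule_axioms mod_hom_id by auto
 have K: "a_kernel P P (%x. x) = {zero P}" by (auto simp: a_kernel_eq)
 have l: "lmodule B (P\<lparr>carrier := {zero P}\<rparr>)" using coverD(7)[OF c] K by simp
 show ?thesis
 proof (rule orth_intro[OF c])
  show "extends B P (a_kernel P P (%x. x)) M"
   unfolding extends_def K
  proof
   fix h assume h: "h \<in> mod_hom B (P\<lparr>carrier := {zero P}\<rparr>) M"
   show "\<exists>h'\<in>mod_hom B P M. \<forall>x\<in>{zero P}. h' x = h x"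
    by (rule bexI[OF _ mod_hom_const_zero[OF M]])
      (use mod_hom_zero[OF h l M] in simp)
  qed
  show "orth B M (ker_mod P P (%x. x))" unfolding K using l M by (intro orth_zero_module) auto
 qed
qed

text \<open>No projectivity enters here, only a lift \<open>t\<close> to \<open>Y\<close> of a
  surjection onto \<open>Z\<close>. The same sequence therefore serves projective resolutions and
  resolutions by \<open>add(T)\<close>.\<close>

lemma horseshoe_ses:
 assumes s: "ses B X f Y g Z" and P: "lmodule B P" and Q: "lmodule B Q"
  and p: "p \<in> mod_hom B P X" "p ` carrier P = carrier X"
  and t: "t \<in> mod_hom B Q Y" "(%b. g (t b)) ` carrier Q = carrier Z"
 defines "r \<equiv> (%u. f (p (fst u)) +[Y] t (snd u))"
 shows "r \<in> mod_hom B (prod_mod P Q) Y" "r ` carrier (prod_mod P Q) = carrier Y"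
  "ses B (ker_mod P X p) (%a. (a, zero Q)) (ker_mod (prod_mod P Q) Y r) snd
    (ker_mod Q Z (%b. g (t b)))"
proof -
 note s' = sesD[OF s]
 interpret Y: lmodule B Y by (rule s'(2))
 interpret Z: lmodule B Z by (rule s'(3))
 interpret P: lmodule B P by (rule P)
 interpret Q: lmodule B Q by (rule Q)
 let ?P = "prod_mod P Q"
 let ?r = "%u. f (p (fst u)) +[Y] t (snd u)"
 have fp: "(%a. f (p a)) \<in> mod_hom B P Y" by (rule mod_hom_comp[OF p(1) s'(4)])
 have r: "?r \<in> mod_hom B ?P Y" by (rule copair_mod_hom[OF s'(2) fp t(1)])
 have lP: "lmodule B ?P" by (rule lmodule_prod_mod[OF P Q])
 note cl = mod_homD(1)[OF fp] mod_homD(1)[OF t(1)] mod_homD(1)[OF p(1)] mod_homD(1)[OF mod_hom_comp[OF t(1) s'(6)]]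
  mod_homD(1)[OF s'(6)] mod_homD(1)[OF s'(4)]
 have gr: "g (?r u) = g (t (snd u))" if "u \<in> carrier ?P" for u
  using that cl mod_homD(2)[OF s'(6)] ses_comp_zero[OF s] by (auto simp: mem_Times_iff)
 have "y \<in> ?r ` carrier ?P" if y: "y \<in> carrier Y" for y
 proof -
  from cl(5)[OF y] obtain b where b: "b \<in> carrier Q" "g y = g (t b)" unfolding t(2)[symmetric] by blast
  have "g (msub B Y y (t b)) = zero Z"
   using y b cl by (simp add: mod_hom_msub[OF s'(6,2)] Z.msub_eq_zero)
  with s y cl(2)[OF b(1)] obtain x where x: "x \<in> carrier X" "msub B Y y (t b) = f x"
   by (elim ses_kernelE[of B X f Y g Z]) auto
  from x(1) obtain a where a: "a \<in> carrier P" "x = p a" unfolding p(2)[symmetric] by blast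
  have "y = ?r (a, b)"
   using Y.add_msub[OF cl(2)[OF b(1)] y] x(2) a cl b by (simp add: Y.M.a_comm)
  then show ?thesis by (rule image_eqI) (use a b in simp)
 qed
 then have r_surj: "?r ` carrier ?P = carrier Y" using mod_homD(1)[OF r] by blast
 note K = submodule_kernel[OF lP s'(2) r] and KP = submodule_kernel[OF P s'(1) p(1)]
  and KQ = submodule_kernel[OF Q s'(3) mod_hom_comp[OF t(1) s'(6)]]
 let ?K = "a_kernel ?P Y ?r" and ?KP = "a_kernel P X p" and ?KQ = "a_kernel Q Z (%b. g (t b))"
 let ?Km = "ker_mod ?P Y ?r" and ?KPm = "ker_mod P X p" and ?KQm = "ker_mod Q Z (%b. g (t b))"
 have tz: "t (zero Q) = zero Y" by (rule mod_hom_zero[OF t(1) Q s'(2)])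
 have fz: "f x = zero Y \<longleftrightarrow> x = zero X" if "x \<in> carrier X" for x
  using that inj_on_mod_hom[OF s'(1,2,4)] s'(5) mod_hom_zero[OF s'(4,1,2)] by blast
 have K0: "(a, zero Q) \<in> ?K \<longleftrightarrow> a \<in> ?KP" for a
  using cl(1,3)[of a] fz[of "p a"] by (auto simp: a_kernel_eq tz)
 have snd: "b \<in> ?KQ" if "(a, b) \<in> ?K" for a b
 proof -
  have u: "(a, b) \<in> carrier ?P" "?r (a, b) = zero Y" using that by (auto simp: a_kernel_eq)
  then show ?thesis using gr[OF u(1)] mod_hom_zero[OF s'(6,2,3)] by (simp add: a_kernel_eq)
 qed
 have i: "(%a. (a, zero Q)) \<in> mod_hom B ?KPm ?Km"
  by (rule mod_hom_restrict_cod[OF mod_hom_restrict[OF pair_mod_hom[OF mod_hom_id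
      mod_hom_const_zero[OF Q]] submoduleD(1)[OF KP]]])
    (use K0 in auto)
 have sn: "snd \<in> mod_hom B ?Km ?KQm"
  by (rule mod_homI) (use snd in \<open>auto simp: a_kernel_eq\<close>)
 have sn_surj: "snd ` carrier ?Km = carrier ?KQm"
 proof (intro equalityI subsetI)
  fix b assume "b \<in> carrier ?KQm"
  then have b: "b \<in> carrier Q" "g (t b) = zero Z" by (auto simp: a_kernel_eq)
  let ?y = "msub B Y (zero Y) (t b)"
  have "g ?y = zero Z"
   using b cl mod_hom_zero[OF s'(6,2,3)] by (simp add: mod_hom_msub[OF s'(6,2)] Z.msub_eq_zero)
  with s cl(2)[OF b(1)] obtain x where x: "x \<in> carrier X" "?y = f x"
   by (elim ses_kernelE[of B X f Y g Z]) auto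
  from x(1) obtain a where a: "a \<in> carrier P" "x = p a" unfolding p(2)[symmetric] by blast
  have "?r (a, b) = zero Y"
   using Y.add_msub[OF cl(2)[OF b(1)] Y.M.zero_closed] x(2) a cl b by (simp add: Y.M.a_comm)
  then have "(a, b) \<in> ?K" using a b by (simp add: a_kernel_eq)
  then show "b \<in> snd ` carrier ?Km" by force
 next
  fix b assume "b \<in> snd ` carrier ?Km"
  then show "b \<in> carrier ?KQm" using snd by auto
 qed
 have ker: "(%a. (a, zero Q)) ` carrier ?KPm = a_kernel ?Km ?KQm snd"
 proof (intro equalityI subsetI)
  fix u assume "u \<in> (%a. (a, zero Q)) ` carrier ?KPm"
  then obtain a where a: "a \<in> ?KP" "u = (a, zero Q)" by auto
  then have "u \<in> ?K" using K0 by blast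
  then show "u \<in> a_kernel ?Km ?KQm snd" using a(2) by (simp add: a_kernel_eq[of ?Km])
 next
  fix u assume "u \<in> a_kernel ?Km ?KQm snd"
  then have u: "u \<in> ?K" "snd u = zero Q" by (simp_all add: a_kernel_eq[of ?Km])
  then have "u = (fst u, zero Q)" by (simp add: prod_eq_iff)
  with u(1) K0[of "fst u"] show "u \<in> (%a. (a, zero Q)) ` carrier ?KPm" by force
 qed
 have sk: "ses B ?KPm (%a. (a, zero Q)) ?Km snd ?KQm"
  unfolding ses_def using lmodule_restrict[OF P KP] lmodule_restrict[OF lP K] lmodule_restrict[OF Q KQ] i sn sn_surj ker by (auto simp: inj_on_def)
 with r r_surj show "r \<in> mod_hom B ?P Y" "r ` carrier ?P = carrier Y"
  "ses B (ker_mod P X p) (%a. (a, zero Q)) (ker_mod ?P Y r) snd (ker_mod Q Z (%b. g (t b)))"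
  unfolding r_def by auto
qed

text \<open>A map on the new syzygy is extended in two stages: its restriction to the syzygy of
  \<open>X\<close> extends to \<open>P\<close>, and the difference vanishes there, so it factors
  over the syzygy of \<open>Z\<close> and extends to \<open>Q\<close>.\<close>

lemma horseshoe:
 assumes s: "ses B X f Y g Z" and M: "lmodule B M"
  and P: "cover B P p X" "extends B P (a_kernel P X p) M"
  and Q: "cover B Q q Z" "extends B Q (a_kernel Q Z q) M"
 shows "\<exists>r. cover B (prod_mod P Q) r Y & extends B (prod_mod P Q) (a_kernel (prod_mod P Q) Y r) M &
  ses B (ker_mod P X p) (%a. (a, zero Q)) (ker_mod (prod_mod P Q) Y r) snd (ker_mod Q Z q)"
proof -
 note s' = sesD[OF s] and P' = coverD[OF P(1)] and Q' = coverD[OF Q(1)]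
 interpret M: lmodule B M by (rule M)
 from projective_lift[OF Q'(1,4) s'(2,3,6,7)] obtain t
  where t: "t \<in> mod_hom B Q Y" "\<forall>x\<in>carrier Q. g (t x) = q x" by blast
 then have gt: "(%b. g (t b)) ` carrier Q = carrier Z" using Q'(5) by auto
 let ?P = "prod_mod P Q"
 let ?r = "%u. f (p (fst u)) +[Y] t (snd u)"
 note h = horseshoe_ses[OF s P'(2) Q'(2) P'(4,5) t(1) gt]
 let ?K = "a_kernel ?P Y ?r" and ?KP = "a_kernel P X p" and ?KQ = "a_kernel Q Z q"
 let ?Km = "ker_mod ?P Y ?r" and ?KPm = "ker_mod P X p" and ?KQm = "ker_mod Q Z q"
 have "a_kernel Q Z (%b. g (t b)) = ?KQ" using t(2) by (auto simp: a_kernel_eq)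
 then have sk: "ses B ?KPm (%a. (a, zero Q)) ?Km snd ?KQm" using h(3) by simp
 note i = sesD(4)[OF sk] and sn = sesD(6)[OF sk] and sn_surj = sesD(7)[OF sk]
 have cov: "cover B ?P ?r Y"
  unfolding cover_def using addc_prod_mod[OF P'(1) Q'(1)] s'(2) h(1,2) by blast
 have "extends B ?P ?K M"
  unfolding extends_def
 proof
  fix h assume h: "h \<in> mod_hom B ?Km M"
  obtain h1 where h1: "h1 \<in> mod_hom B P M" "!!x. x \<in> ?KP ==> h1 x = h (x, zero Q)"
   by (rule extendsD[OF P(2) mod_hom_comp[OF i h]]) blast
  have h1f: "(%u. h1 (fst u)) \<in> mod_hom B ?Km M"
   by (rule mod_hom_restrict[OF mod_hom_comp[OF fst_mod_hom h1(1)] submoduleD(1)[OF coverD(6)[OF cov]]])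
  have d: "(%u. msub B M (h u) (h1 (fst u))) \<in> mod_hom B ?Km M"
   by (rule mod_hom_diff[OF M h h1f])
  have "\<exists>k\<in>mod_hom B ?KQm M. \<forall>u\<in>carrier ?Km. k (snd u) = msub B M (h u) (h1 (fst u))"
  proof (rule mod_hom_factor[OF coverD(7)[OF cov] Q'(7) M sn sn_surj d])
   fix u assume u: "u \<in> carrier ?Km" "snd u = zero ?KQm"
   with u(1) sk obtain a where a: "a \<in> carrier ?KPm" "u = (a, zero Q)"
    by (elim ses_kernelE) auto
   then have "h1 (fst u) = h u" using h1(2)[of a] by simp
   then show "msub B M (h u) (h1 (fst u)) = zero M"
    using mod_homD(1)[OF h u(1)] by (simp add: M.msub_eq_zero)
  qed
  then obtain k where k: "k \<in> mod_hom B ?KQm M"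
   "\<forall>u\<in>carrier ?Km. k (snd u) = msub B M (h u) (h1 (fst u))" by blast
  obtain k' where k': "k' \<in> mod_hom B Q M" "!!x. x \<in> ?KQ ==> k' x = k x"
   by (rule extendsD[OF Q(2) k(1)]) blast
  show "\<exists>h'\<in>mod_hom B ?P M. \<forall>x\<in>?K. h' x = h x"
  proof (rule bexI[OF _ copair_mod_hom[OF M h1(1) k'(1)]], rule ballI)
   fix u assume u: "u \<in> ?K"
   then have "k' (snd u) = msub B M (h u) (h1 (fst u))"
    using mod_homD(1)[OF sn, of u] k k'(2) by simp
   moreover have "h u \<in> carrier M" "h1 (fst u) \<in> carrier M"
    using mod_homD(1)[OF h, of u] mod_homD(1)[OF h1f, of u] u by auto
   ultimately show "h1 (fst u) +[M] k' (snd u) = h u" by (simp add: M.add_msub)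
  qed
 qed
 with cov sk show ?thesis by blast
qed

text \<open>By the horseshoe lemma the syzygy of \<open>Y\<close> is again an extension of two
  orthogonal modules, so being such an extension is preserved in the coinductive step.\<close>

lemma orth_ext_copies:
 fixes B :: "('b, 'z) ring_scheme" and X Y Z :: "'b fgm"
 assumes s: "ses B X f Y g Z" and M: "lmodule B M" and X: "orth B M X" and Z: "orth B M Z"
 shows "orth B M Y"
proof -
 define R where "R Y \<longleftrightarrow> (\<exists>(X :: 'b fgm) (Z :: 'b fgm) f g.
  ses B X f Y g Z & orth B M X & orth B M Z)" for Y :: "'b fgm"
 show ?thesis
 proof (rule orth_coinduct[of R])
  show "R Y" unfolding R_def using s X Z by blast
  show "lmodule B Y" by (rule sesD(2)[OF s])
  fix Y :: "'b fgm" assume "R Y"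
  then obtain X Z :: "'b fgm" and f g where
   s: "ses B X f Y g Z" and X: "orth B M X" and Z: "orth B M Z" by (auto simp: R_def)
  from X obtain P :: "'b fgm" and p where P: "cover B P p X"
   "extends B P (a_kernel P X p) M" "orth B M (ker_mod P X p)" by (rule orthE)
  from Z obtain Q :: "'b fgm" and q where Q: "cover B Q q Z"
   "extends B Q (a_kernel Q Z q) M" "orth B M (ker_mod Q Z q)" by (rule orthE)
  from horseshoe[OF s M P(1,2) Q(1,2)] obtain r where r: "cover B (prod_mod P Q) r Y"
   "extends B (prod_mod P Q) (a_kernel (prod_mod P Q) Y r) M"
   "ses B (ker_mod P X p) (%a. (a, zero Q)) (ker_mod (prod_mod P Q) Y r) snd (ker_mod Q Z q)"
   by blast
  from ses_fg_middle[OF r(3) orth_fg[OF P(3)] orth_fg[OF Q(3)]]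
  obtain K' :: "'b fgm" where K': "fg_module B K'" "lmodule B K'"
   "mod_iso B (ker_mod (prod_mod P Q) Y r) K'" "mod_iso B K' (ker_mod (prod_mod P Q) Y r)"
   by (rule copy_exists)
  from ses_iso[OF r(3) mod_iso_refl K'(3) mod_iso_refl] sesD(1,3)[OF r(3)] K'(2)
  have "R K'" unfolding R_def using P(3) Q(3) by blast
  with r(1,2) K'(2,3) show "\<exists>P p K'. cover B (P :: ('b, (nat => 'b) set \<times> (nat => 'b) set) module) p Y &
    extends B P (a_kernel P Y p) M & mod_iso B (ker_mod P Y p) K' & lmodule B K' &
    (R K' | orth B M K')"
   by blast
 qed
qed

theorem orth_ext:
 assumes s: "ses B X f Y g Z" and M: "lmodule B M" and X: "orth B M X" and Z: "orth B M Z"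
 shows "orth B M Y"
proof -
 note fg = orth_fg[OF X] orth_fg[OF Z]
 from fg(1) obtain X' :: "'a fgm"
  where X': "fg_module B X'" "lmodule B X'" "mod_iso B X X'" "mod_iso B X' X" by (rule copy_exists)
 from fg(2) obtain Z' :: "'a fgm"
  where Z': "fg_module B Z'" "lmodule B Z'" "mod_iso B Z Z'" "mod_iso B Z' Z" by (rule copy_exists)
 from ses_fg_middle[OF s fg] obtain Y' :: "'a fgm"
  where Y': "fg_module B Y'" "lmodule B Y'" "mod_iso B Y Y'" "mod_iso B Y' Y" by (rule copy_exists)
 from ses_iso[OF s X'(3) Y'(3) Z'(3) X'(2) Y'(2) Z'(2)] obtain f' g'
  where "ses B X' f' Y' g' Z'" by blast
 from orth_ext_copies[OF this M orth_iso[OF X X'(3,2)] orth_iso[OF Z Z'(3,2)]]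
 show ?thesis using Y'(4) sesD(2)[OF s] by (rule orth_iso)
qed

text \<open>The part of the long exact sequence of \<open>Ext(-, M)\<close> around
  \<open>Hom(X, M)\<close>: hypothesis \<open>e\<close> kills \<open>Ext^1(Z, M)\<close>. For the
  higher groups the kernel over \<open>Z\<close> is an extension of \<open>X\<close> by a syzygy of
  \<open>Y\<close>, to which \<open>orth_ext\<close> applies.\<close>

lemma orth_quotient:
 assumes s: "ses B X f Y g Z" and M: "lmodule B M" and X: "orth B M X" and Y: "orth B M Y"
  and e: "!!h. h \<in> mod_hom B X M ==> \<exists>h'\<in>mod_hom B Y M. \<forall>x\<in>carrier X. h' (f x) = h x"
 shows "orth B M Z"
proof -
 note s' = sesD[OF s]
 interpret M: lmodule B M by (rule M)
 from Y obtain P :: "'a fgm" and p where P: "cover B P p Y"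
  "extends B P (a_kernel P Y p) M" "orth B M (ker_mod P Y p)" by (rule orthE)
 note P' = coverD[OF P(1)]
 let ?V = "a_kernel P Z (%x. g (p x))"
 from ses_kernel_comp[OF s P'(2,4,5)] obtain q where
  q: "ses B (ker_mod P Y p) (%x. x) (P\<lparr>carrier := ?V\<rparr>) q X" and fq: "\<forall>a\<in>?V. f (q a) = p a" by blast
 note q' = sesD[OF q]
 have cov: "cover B P (%x. g (p x)) Z" by (rule cover_comp[OF P(1) s'(6,7,3)])
 show ?thesis
 proof (rule orth_intro[OF cov])
  show "orth B M (ker_mod P Z (%x. g (p x)))" by (rule orth_ext[OF q M P(3) X])
  show "extends B P ?V M"
   unfolding extends_def
  proof
   fix h assume h: "h \<in> mod_hom B (P\<lparr>carrier := ?V\<rparr>) M"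
   have "h \<in> mod_hom B (ker_mod P Y p) M" using mod_hom_comp[OF q'(4) h] by simp
   then obtain h1 where h1: "h1 \<in> mod_hom B P M" "!!x. x \<in> a_kernel P Y p ==> h1 x = h x"
    by (rule extendsD[OF P(2)]) blast
   have h1V: "h1 \<in> mod_hom B (P\<lparr>carrier := ?V\<rparr>) M"
    by (rule mod_hom_restrict[OF h1(1) submoduleD(1)[OF coverD(6)[OF cov]]])
   \<comment> \<open>The difference of \<open>h\<close> and \<open>h1\<close> vanishes on the kernel
     over \<open>Y\<close>, so it factors through \<open>q\<close> over \<open>X\<close>; then
     \<open>e\<close> extends it to \<open>Y\<close>.\<close>
   have "\<exists>k\<in>mod_hom B X M. \<forall>a\<in>carrier (P\<lparr>carrier := ?V\<rparr>). k (q a) = msub B M (h a) (h1 a)"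
   proof (rule mod_hom_factor[OF q'(2,3) M q'(6,7) mod_hom_diff[OF M h h1V]])
    fix a assume a: "a \<in> carrier (P\<lparr>carrier := ?V\<rparr>)" "q a = zero X"
    then have "a \<in> a_kernel P Y p" using q'(8) by (auto simp: a_kernel_eq)
    then have "h1 a = h a" by (rule h1(2))
    then show "msub B M (h a) (h1 a) = zero M" using mod_homD(1)[OF h a(1)] by (simp add: M.msub_eq_zero)
   qed
   then obtain k where k: "k \<in> mod_hom B X M" "\<forall>a\<in>?V. k (q a) = msub B M (h a) (h1 a)" by auto
   from e[OF k(1)] obtain k' where k': "k' \<in> mod_hom B Y M" "\<forall>x\<in>carrier X. k' (f x) = k x" by blast
   show "\<exists>h'\<in>mod_hom B P M. \<forall>x\<in>?V. h' x = h x"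
   proof (rule bexI[OF _ mod_hom_add[OF M h1(1) mod_hom_comp[OF P'(4) k'(1)]]], rule ballI)
    fix a assume a: "a \<in> ?V"
    have "q a \<in> carrier X" using mod_homD(1)[OF q'(6), of a] a by simp
    then have "k' (p a) = msub B M (h a) (h1 a)" using fq a k(2) k'(2) by metis
    then show "h1 a +[M] k' (p a) = h a"
     using mod_homD(1)[OF h, of a] mod_homD(1)[OF h1V, of a] a by (simp add: M.add_msub)
   qed
  qed
 qed
qed

text \<open>\<open>Ext\<^sup>1(Z, M) = 0\<close> in terms of an arbitrary epimorphism onto \<open>Z\<close>.\<close>

lemma orth_extends:
 assumes Z: "orth B M Z" and M: "lmodule B M" and Q: "lmodule B Q"
  and q: "q \<in> mod_hom B Q Z" "q ` carrier Q = carrier Z"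
 shows "extends B Q (a_kernel Q Z q) M"
 unfolding extends_def
proof
 interpret Q: lmodule B Q by fact
 interpret Z: lmodule B Z using Z by (rule orth_lmodule)
 interpret M: lmodule B M by fact
 let ?K = "a_kernel Q Z q"
 note K = submodule_kernel[OF Q Z.lmodule_axioms q(1)]
 note lK = lmodule_restrict[OF Q K]
 fix h assume h: "h \<in> mod_hom B (Q\<lparr>carrier := ?K\<rparr>) M"
 from Z obtain P :: "'a fgm" and p where P: "cover B P p Z"
  "extends B P (a_kernel P Z p) M" "orth B M (ker_mod P Z p)" by (rule orthE)
 note P' = coverD[OF P(1)]
 from projective_lift[OF P'(1,4) Q Z.lmodule_axioms q] obtain l
  where l: "l \<in> mod_hom B P Q" "\<forall>x\<in>carrier P. q (l x) = p x" by blast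
 have lr: "l \<in> mod_hom B (ker_mod P Z p) (Q\<lparr>carrier := ?K\<rparr>)"
  by (rule mod_hom_restrict_cod[OF mod_hom_restrict[OF l(1) submoduleD(1)[OF P'(6)]]])
    (use l(2) mod_homD(1)[OF l(1)] in \<open>auto simp: a_kernel_eq\<close>)
 obtain h1 where h1: "h1 \<in> mod_hom B P M" "!!x. x \<in> a_kernel P Z p ==> h1 x = h (l x)"
  by (rule extendsD[OF P(2) mod_hom_comp[OF lr h]]) blast
 \<comment> \<open>\<open>P\<close> and the kernel \<open>?K\<close> together cover
   \<open>Q\<close>. The sum of \<open>h1\<close> and \<open>h\<close> vanishes on the relations
   because \<open>h1\<close> agrees with \<open>h\<close> after \<open>l\<close> on the syzygy, so
   the two maps glue to a map on \<open>Q\<close>.\<close>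
 let ?S = "prod_mod P (Q\<lparr>carrier := ?K\<rparr>)"
 have i: "(%x. x) \<in> mod_hom B (Q\<lparr>carrier := ?K\<rparr>) Q"
  by (rule mod_hom_restrict[OF mod_hom_id submoduleD(1)[OF K]])
 note s = copair_mod_hom[OF Q l(1) i] and t = copair_mod_hom[OF M h1(1) h]
 note cl = mod_homD(1)[OF l(1)] mod_homD(1)[OF q(1)] mod_homD(1)[OF h1(1)] mod_homD(1)[OF h, simplified]
 have "\<exists>k\<in>mod_hom B Q M. \<forall>u\<in>carrier ?S. k (l (fst u) +[Q] snd u) = h1 (fst u) +[M] h (snd u)"
 proof (rule mod_hom_factor[OF lmodule_prod_mod[OF P'(2) lK] Q M s _ t])
  show "(%u. l (fst u) +[Q] snd u) ` carrier ?S = carrier Q"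
  proof (intro equalityI subsetI)
   fix b assume b: "b \<in> carrier Q"
   then have "q b \<in> p ` carrier P" using P'(5) cl by simp
   then obtain a where a: "a \<in> carrier P" "q b = p a" by blast
   have "q (msub B Q b (l a)) = zero Z"
    using a b cl(1,2) l(2) mod_homD(1)[OF P'(4)]
    by (simp add: mod_hom_msub[OF q(1) Q] Z.msub_eq_zero)
   then have "msub B Q b (l a) \<in> ?K" using a b cl by (simp add: a_kernel_eq)
   moreover have "b = l a +[Q] msub B Q b (l a)" using a b cl by (simp add: Q.add_msub)
   ultimately show "b \<in> (%u. l (fst u) +[Q] snd u) ` carrier ?S"
    using a(1) by (intro image_eqI[of _ _ "(a, msub B Q b (l a))"]) auto
  qed (use cl in \<open>auto simp: a_kernel_eq\<close>)
  fix u assume u: "u \<in> carrier ?S" "l (fst u) +[Q] snd u = zero Q"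
  then obtain a y where ay: "u = (a, y)" "a \<in> carrier P" "y \<in> ?K" by auto
  then have y: "y \<in> carrier Q" "q y = zero Z" by (auto simp: a_kernel_eq)
  have "q (l a +[Q] y) = p a"
   using ay(2) y l(2) cl mod_homD(2)[OF q(1)] mod_homD(1)[OF P'(4)] by simp
  then have "p a = zero Z" using u(2) ay(1) mod_hom_zero[OF q(1) Q Z.lmodule_axioms] by simp
  then have a: "a \<in> a_kernel P Z p" using ay(2) by (simp add: a_kernel_eq)
  have "l a \<in> ?K" using mod_homD(1)[OF lr] a by simp
  then have "h (l a +[Q] y) = h1 a +[M] h y"
   using mod_homD(2)[OF h, of "l a" y] ay(3) h1(2)[OF a] by simp
  then show "h1 (fst u) +[M] h (snd u) = zero M"
   using u(2) ay(1) mod_hom_zero[OF h lK M] by simp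
 qed
 then obtain k where k: "k \<in> mod_hom B Q M"
  "\<forall>u\<in>carrier ?S. k (l (fst u) +[Q] snd u) = h1 (fst u) +[M] h (snd u)" by blast
 show "\<exists>h'\<in>mod_hom B Q M. \<forall>x\<in>?K. h' x = h x"
 proof (rule bexI[OF _ k(1)], rule ballI)
  fix y assume y: "y \<in> ?K"
  interpret P: lmodule B P by (rule P'(2))
  have "k (l (zero P) +[Q] y) = h1 (zero P) +[M] h y" using k(2) y by force
  then show "k y = h y"
   using y cl mod_hom_zero[OF l(1) P'(2) Q] mod_hom_zero[OF h1(1) P'(2) M]
   by (simp add: a_kernel_eq)
 qed
qed

text \<open>Any epimorphism from a projective may be used: the pullback of two of them is an extension of either kernel.\<close>

lemma orth_syzygy:
 assumes X: "orth B M X" and M: "lmodule B M" and Q: "cover B Q q X"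
 shows "orth B M (ker_mod Q X q)"
proof -
 note Q' = coverD[OF Q]
 from X obtain P :: "'a fgm" and p where P: "cover B P p X"
  "extends B P (a_kernel P X p) M" "orth B M (ker_mod P X p)" by (rule orthE)
 note P' = coverD[OF P(1)]
 interpret X: lmodule B X by (rule P'(3))
 interpret P: lmodule B P by (rule P'(2))
 interpret Q: lmodule B Q by (rule Q'(2))
 let ?PQ = "prod_mod P Q"
 \<comment> \<open>The pullback of the two covers.\<close>
 let ?W = "{u \<in> carrier ?PQ. p (fst u) = q (snd u)}"
 note pc = mod_homD(1)[OF P'(4)] and qc = mod_homD(1)[OF Q'(4)]
 have lPQ: "lmodule B ?PQ" by (rule lmodule_prod_mod[OF P'(2) Q'(2)])
 have W: "submodule ?W B ?PQ"
 proof -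
  have "submodule {u \<in> carrier ?PQ. msub B X (p (fst u)) (q (snd u)) \<in> {zero X}} B ?PQ"
   by (rule submodule_vimage[OF lPQ P'(3) mod_hom_diff[OF P'(3) mod_hom_comp[OF fst_mod_hom P'(4)]
      mod_hom_comp[OF snd_mod_hom Q'(4)]] submodule_zero[OF P'(3)]])
  moreover have "{u \<in> carrier ?PQ. msub B X (p (fst u)) (q (snd u)) \<in> {zero X}} = ?W"
   using pc qc by (auto simp: X.msub_eq_zero)
  ultimately show ?thesis by simp
 qed
 let ?Wm = "?PQ\<lparr>carrier := ?W\<rparr>"
 have lW: "lmodule B ?Wm" by (rule lmodule_restrict[OF lPQ W])
 have f1: "fst \<in> mod_hom B ?Wm P" and s1: "snd \<in> mod_hom B ?Wm Q"
  by (rule mod_hom_restrict[OF fst_mod_hom submoduleD(1)[OF W]],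
    rule mod_hom_restrict[OF snd_mod_hom submoduleD(1)[OF W]])
 have surj_snd: "snd ` carrier ?Wm = carrier Q"
 proof (intro equalityI subsetI)
  fix b assume b: "b \<in> carrier Q"
  then have "q b \<in> p ` carrier P" using qc P'(5) by simp
  then obtain a where "a \<in> carrier P" "p a = q b" by auto
  then have "(a, b) \<in> carrier ?Wm" using b by simp
  then show "b \<in> snd ` carrier ?Wm" by force
 qed auto
 have surj_fst: "fst ` carrier ?Wm = carrier P"
 proof (intro equalityI subsetI)
  fix a assume a: "a \<in> carrier P"
  then have "p a \<in> q ` carrier Q" using pc Q'(5) by simp
  then obtain b where "b \<in> carrier Q" "p a = q b" by auto
  then have "(a, b) \<in> carrier ?Wm" using a by simp
  then show "a \<in> fst ` carrier ?Wm" by force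
 qed auto
 have q0: "q (zero Q) = zero X" by (rule mod_hom_zero[OF Q'(4,2,3)])
 have p0: "p (zero P) = zero X" by (rule mod_hom_zero[OF P'(4,2,3)])
 have "ses B (ker_mod P X p) (%a. (a, zero Q)) ?Wm snd Q"
  unfolding ses_def
 proof (intro conjI P'(7) lW Q'(2) s1 surj_snd)
  show "(%a. (a, zero Q)) \<in> mod_hom B (ker_mod P X p) ?Wm"
   by (rule mod_homI) (auto simp: a_kernel_eq q0 Q.smult_zero)
  show "(%a. (a, zero Q)) ` carrier (ker_mod P X p) = a_kernel ?Wm Q snd"
   by (auto simp: a_kernel_eq q0)
 qed (auto simp: inj_on_def)
 from orth_ext[OF this M P(3) orth_proj[OF Q'(1) M]] have oW: "orth B M ?Wm" .
 then obtain P0 :: "'a fgm" and w where P0: "cover B P0 w ?Wm"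
  "extends B P0 (a_kernel P0 ?Wm w) M" "orth B M (ker_mod P0 ?Wm w)" by (rule orthE)
 note P0' = coverD[OF P0(1)]
 interpret P0: lmodule B P0 by (rule P0'(2))
 have cf: "cover B P0 (%x. fst (w x)) P" by (rule cover_comp[OF P0(1) f1 surj_fst P'(2)])
 note cf' = coverD[OF cf]
 \<comment> \<open>The surjection from \<open>P0\<close> through the pullback to \<open>P\<close>
   splits, so its kernel \<open>?P'\<close> is a direct summand of \<open>P0\<close> and hence
   projective. Its second component covers the kernel of \<open>q\<close>, and the kernel of this
   cover is exactly the kernel of \<open>w\<close>.\<close>
 from projective_lift[OF P'(1) mod_hom_id P0'(2) P'(2) cf'(4,5)] obtain s
  where s: "s \<in> mod_hom B P P0" "\<forall>x\<in>carrier P. fst (w (s x)) = x" by blast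
 let ?P' = "ker_mod P0 P (%x. fst (w x))"
 have "fgproj B ?P'"
 proof (rule addc_retract[OF P0'(1) cf'(7)])
  show "(%x. x) \<in> mod_hom B ?P' P0"
   by (rule mod_hom_restrict[OF mod_hom_id submoduleD(1)[OF cf'(6)]])
  have d: "(%x. msub B P0 x (s (fst (w x)))) \<in> mod_hom B P0 P0"
   by (rule mod_hom_diff[OF P0'(2) mod_hom_id mod_hom_comp[OF cf'(4) s(1)]])
  show "(%x. msub B P0 x (s (fst (w x)))) \<in> mod_hom B P0 ?P'"
  proof (rule mod_hom_restrict_cod[OF d], rule image_subsetI)
   fix x assume x: "x \<in> carrier P0"
   have "fst (w (msub B P0 x (s (fst (w x))))) = zero P"
    using x s mod_homD(1)[OF cf'(4)] mod_homD(1)[OF s(1)]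
    by (simp add: mod_hom_msub[OF cf'(4) P0'(2)] P.msub_eq_zero)
   then show "msub B P0 x (s (fst (w x))) \<in> a_kernel P0 P (%x. fst (w x))"
    using mod_homD(1)[OF d x] by (simp add: a_kernel_eq)
  qed
  fix x assume "x \<in> carrier ?P'"
  then show "msub B P0 x (s (fst (w x))) = x"
   by (simp add: a_kernel_eq mod_hom_zero[OF s(1) P'(2) P0'(2)] P0.msub_zero)
 qed
 have wm: "!!x. x \<in> carrier P0 ==> w x \<in> ?W" using mod_homD(1)[OF P0'(4)] by simp
 let ?v = "%x. snd (w x)"
 have v: "?v \<in> mod_hom B ?P' (ker_mod Q X q)"
 proof (rule mod_hom_restrict_cod)
  show "?v \<in> mod_hom B ?P' Q"
   by (rule mod_hom_restrict[OF mod_hom_comp[OF P0'(4) s1] submoduleD(1)[OF cf'(6)]])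
  show "?v ` carrier ?P' \<subseteq> a_kernel Q X q"
  proof (rule image_subsetI)
   fix x assume "x \<in> carrier ?P'"
   then have "x \<in> carrier P0" "fst (w x) = zero P" by (auto simp: a_kernel_eq)
   then show "?v x \<in> a_kernel Q X q" using wm[of x] p0 by (auto simp: a_kernel_eq mem_Times_iff)
  qed
 qed
 have v_surj: "?v ` carrier ?P' = carrier (ker_mod Q X q)"
 proof (intro equalityI subsetI)
  fix b assume "b \<in> carrier (ker_mod Q X q)"
  then have "(zero P, b) \<in> carrier ?Wm" by (simp add: a_kernel_eq p0)
  then obtain x where x: "x \<in> carrier P0" "w x = (zero P, b)" unfolding P0'(5)[symmetric] by (metis imageE)
  then show "b \<in> ?v ` carrier ?P'" by (intro image_eqI[of _ _ x]) (auto simp: a_kernel_eq)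
 qed (use mod_homD(1)[OF v] in blast)
 have cov: "cover B ?P' ?v (ker_mod Q X q)"
  unfolding cover_def using \<open>fgproj B ?P'\<close> Q'(7) v v_surj by blast
 have ker: "a_kernel ?P' (ker_mod Q X q) ?v = a_kernel P0 ?Wm w"
  by (auto simp: a_kernel_eq prod_eq_iff)
 show ?thesis
 proof (rule orth_intro[OF cov])
  show "extends B ?P' (a_kernel ?P' (ker_mod Q X q) ?v) M"
   unfolding ker by (rule extends_restrict[OF P0(2)]) (auto simp: a_kernel_eq)
  have "ker_mod ?P' (ker_mod Q X q) ?v = ker_mod P0 ?Wm w" unfolding ker by simp
  then show "orth B M (ker_mod ?P' (ker_mod Q X q) ?v)" using P0(3) by simp
 qed
qed

text \<open>Projectivity lifts \<open>h\<close> over the cover \<open>P\<close>. On the syzygy this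
  lift takes values in the image of \<open>M'\<close>; extending that part to \<open>P\<close> gives
  the correction after which the lift factors through \<open>K\<close>.\<close>

lemma orth_lift:
 assumes K: "orth B M' K" and s: "ses B M' i M r M''" and h: "h \<in> mod_hom B K M''"
 shows "\<exists>h'\<in>mod_hom B K M. \<forall>x\<in>carrier K. r (h' x) = h x"
proof -
 note s' = sesD[OF s]
 interpret M: lmodule B M by (rule s'(2))
 interpret M'': lmodule B M'' by (rule s'(3))
 from K obtain P :: "'a fgm" and p where P: "cover B P p K"
  "extends B P (a_kernel P K p) M'" "orth B M' (ker_mod P K p)" by (rule orthE)
 note P' = coverD[OF P(1)]
 from projective_lift[OF P'(1) mod_hom_comp[OF P'(4) h] s'(2,3,6,7)] obtain u
  where u: "u \<in> mod_hom B P M" "\<forall>x\<in>carrier P. r (u x) = h (p x)" by blast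
 let ?N = "M\<lparr>carrier := i ` carrier M'\<rparr>"
 have iN: "i \<in> mod_hom B M' ?N" by (rule mod_hom_restrict_cod[OF s'(4)]) auto
 have inv: "inv_into (carrier M') i \<in> mod_hom B ?N M'"
  by (rule mod_hom_inv_into[OF s'(1) iN]) (use s'(5) in \<open>auto simp: bij_betw_def\<close>)
 have uK: "u ` a_kernel P K p \<subseteq> i ` carrier M'"
  using u mod_homD(1)[OF u(1)] mod_hom_zero[OF h P'(3) s'(3)] unfolding s'(8) by (auto simp: a_kernel_eq)
 have "u \<in> mod_hom B (ker_mod P K p) ?N"
  by (rule mod_hom_restrict_cod[OF mod_hom_restrict[OF u(1) submoduleD(1)[OF P'(6)]]])
    (use uK in simp)
 from mod_hom_comp[OF this inv] obtain k where
  k: "k \<in> mod_hom B P M'" "!!x. x \<in> a_kernel P K p ==> k x = inv_into (carrier M') i (u x)"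
  by (rule extendsD[OF P(2)]) blast
 note ik = mod_hom_comp[OF k(1) s'(4)]
 have "\<exists>h'\<in>mod_hom B K M. \<forall>x\<in>carrier P. h' (p x) = msub B M (u x) (i (k x))"
 proof (rule mod_hom_factor[OF P'(2,3) s'(2) P'(4,5) mod_hom_diff[OF s'(2) u(1) ik]])
  fix x assume "x \<in> carrier P" "p x = zero K"
  then have x: "x \<in> a_kernel P K p" by (simp add: a_kernel_eq)
  then have "i (k x) = u x" unfolding k(2)[OF x] using uK by (intro f_inv_into_f) auto
  then show "msub B M (u x) (i (k x)) = zero M"
   using \<open>x \<in> carrier P\<close> mod_homD(1)[OF u(1)] by (simp add: M.msub_eq_zero)
 qed
 then obtain h' where h': "h' \<in> mod_hom B K M" "\<forall>x\<in>carrier P. h' (p x) = msub B M (u x) (i (k x))"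
  by blast
 have "r (h' x) = h x" if x: "x \<in> carrier K" for x
 proof -
  from x obtain a where a: "a \<in> carrier P" "x = p a" unfolding P'(5)[symmetric] by blast
  then have "r (h' x) = msub B M'' (h x) (r (i (k a)))"
   using h'(2) u mod_homD(1)[OF u(1)] mod_homD(1)[OF ik] by (simp add: mod_hom_msub[OF s'(6,2)])
  also have "r (i (k a)) = zero M''" using ses_comp_zero[OF s] mod_homD(1)[OF k(1) a(1)] by blast
  finally show ?thesis using mod_homD(1)[OF h x] by (simp add: M''.msub_zero)
 qed
 with h'(1) show ?thesis by blast
qed

lemma orth_coinduct_kernel:
 fixes X :: "('b, 'x) module" and B :: "('b, 'z) ring_scheme"
 assumes iso: "mod_iso B X X'" "lmodule B X" "lmodule B X'" and R: "R X'"
  and step: "!!Y :: 'b fgm. R Y ==>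
   \<exists>(P :: 'b fgm) p. cover B P p Y & extends B P (a_kernel P Y p) M &
    R (ker_mod P Y p)"
 shows "orth B M X"
proof -
 have "orth B M X'"
 proof (rule orth_coinduct[of R, OF R iso(3)])
  fix Y :: "'b fgm" assume "R Y"
  from step[OF this] obtain P :: "'b fgm" and p where
   "cover B P p Y" "extends B P (a_kernel P Y p) M" "R (ker_mod P Y p)" by blast
  with coverD(7)[OF this(1)] mod_iso_refl[of B "ker_mod P Y p"]
  show "\<exists>(P :: 'b fgm) p K'. cover B P p Y & extends B P (a_kernel P Y p) M &
    mod_iso B (ker_mod P Y p) K' & lmodule B K' & (R K' | orth B M K')" by blast
 qed
 then show ?thesis using mod_iso_sym[OF iso(1,2)] iso(2) by (rule orth_iso)
qed

lemma ker_mod_inclusion: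
 "lmodule B P ==> lmodule B Y ==> p \<in> mod_hom B P Y ==> (%x. x) \<in> mod_hom B (ker_mod P Y p) P"
 by (rule mod_hom_restrict[OF mod_hom_id submoduleD(1)[OF submodule_kernel]])

text \<open>Dimension shift in the second argument: a map from the syzygy to \<open>M''\<close>
  lifts to \<open>M\<close>, since the syzygy is orthogonal to \<open>M'\<close>, and maps to
  \<open>M\<close> extend to the cover.\<close>

theorem orth_target_quotient:
 fixes B :: "('a, 'z) ring_scheme"
 assumes s: "ses B M' i M r M''" and X: "orth B M' X" "orth B M X"
 shows "orth B M'' X"
proof -
 note s' = sesD[OF s]
 from orth_fg[OF X(1)] obtain X' :: "'a fgm"
  where X': "fg_module B X'" "lmodule B X'" "mod_iso B X X'" "mod_iso B X' X" by (rule copy_exists)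
 show ?thesis
 proof (rule orth_coinduct_kernel[where R = "%Y. orth B M' Y & orth B M Y", OF X'(3) orth_lmodule[OF X(1)] X'(2)])
  show "orth B M' X' & orth B M X'" using orth_iso[OF X(1) X'(3,2)] orth_iso[OF X(2) X'(3,2)] by blast
  fix Y :: "'a fgm" assume "orth B M' Y & orth B M Y"
  then have Y: "orth B M' Y" "orth B M Y" by auto
  from Y(1) obtain P :: "'a fgm" and p where P: "cover B P p Y"
   "extends B P (a_kernel P Y p) M'" "orth B M' (ker_mod P Y p)" by (rule orthE)
  note P' = coverD[OF P(1)]
  have "extends B P (a_kernel P Y p) M''"
   unfolding extends_def
  proof
   fix h assume h: "h \<in> mod_hom B (ker_mod P Y p) M''"
   from orth_lift[OF P(3) s h] obtain k where
    k: "k \<in> mod_hom B (ker_mod P Y p) M" "\<forall>x\<in>a_kernel P Y p. r (k x) = h x" by auto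
   obtain k' where k': "k' \<in> mod_hom B P M" "!!x. x \<in> a_kernel P Y p ==> k' x = k x"
    by (rule extendsD[OF orth_extends[OF Y(2) s'(2) P'(2,4,5)] k(1)]) blast
   show "\<exists>h'\<in>mod_hom B P M''. \<forall>x\<in>a_kernel P Y p. h' x = h x"
    by (rule bexI[OF _ mod_hom_comp[OF k'(1) s'(6)]]) (use k(2) k'(2) in auto)
  qed
  moreover have "orth B M (ker_mod P Y p)" by (rule orth_syzygy[OF Y(2) s'(2) P(1)])
  ultimately show "\<exists>(P :: 'a fgm) p. cover B P p Y &
    extends B P (a_kernel P Y p) M'' & (orth B M' (ker_mod P Y p) & orth B M (ker_mod P Y p))"
   using P by blast
 qed
qed

lemma orth_target_addc:
 fixes B :: "('a, 'z) ring_scheme"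
 assumes X: "orth B M X" and M': "addc B M M'"
 shows "orth B M' X"
proof -
 have lM': "lmodule B M'" "fac B M' M M' (%x. x)" using M' by (auto simp: addc_def)
 from orth_fg[OF X(1)] obtain X' :: "'a fgm"
  where X': "fg_module B X'" "lmodule B X'" "mod_iso B X X'" "mod_iso B X' X" by (rule copy_exists)
 show ?thesis
 proof (rule orth_coinduct_kernel[where R = "orth B M", OF X'(3) orth_lmodule[OF X(1)] X'(2)])
  show "orth B M X'" using X X'(3,2) by (rule orth_iso)
  fix Y :: "'a fgm" assume "orth B M Y"
  then obtain P :: "'a fgm" and p where P: "cover B P p Y"
   "extends B P (a_kernel P Y p) M" "orth B M (ker_mod P Y p)" by (rule orthE)
  note P' = coverD[OF P(1)]
  have "extends B P (a_kernel P Y p) M'"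
   unfolding extends_def
  proof
   fix h assume h: "h \<in> mod_hom B (ker_mod P Y p) M'"
   have "\<exists>h'\<in>mod_hom B P M'. \<forall>x\<in>carrier (ker_mod P Y p). h' x = h x"
   proof (rule fac_extend[OF lM'(1) fac_pre[OF h lM'(2)] ker_mod_inclusion[OF P'(2,3,4)]])
    fix u assume "u \<in> mod_hom B (ker_mod P Y p) M"
    with P(2) show "\<exists>v\<in>mod_hom B P M. \<forall>x\<in>carrier (ker_mod P Y p). v x = u x"
     by (simp add: extends_def)
   qed
   then show "\<exists>h'\<in>mod_hom B P M'. \<forall>x\<in>a_kernel P Y p. h' x = h x" by simp
  qed
  with P show "\<exists>(P :: 'a fgm) p. cover B P p Y &
    extends B P (a_kernel P Y p) M' & orth B M (ker_mod P Y p)" by blast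
 qed
qed

text \<open>The covers come from the index \<open>i0\<close>; by \<open>orth_syzygy\<close> and
  \<open>orth_extends\<close> they serve every other index as well, so the extensions can be taken
  coordinatewise.\<close>

lemma orth_target_dsum:
 fixes B :: "('a, 'z) ring_scheme"
 assumes I: "i0 \<in> I" and X: "!!i. i \<in> I ==> orth B (N i) X" and l: "!!i. i \<in> I ==> lmodule B (N i)"
 shows "orth B (dsum I N) X"
proof -
 from orth_fg[OF X[OF I]] obtain X' :: "'a fgm"
  where X': "fg_module B X'" "lmodule B X'" "mod_iso B X X'" "mod_iso B X' X" by (rule copy_exists)
 show ?thesis
 proof (rule orth_coinduct_kernel[where R = "%Y. \<forall>i\<in>I. orth B (N i) Y",
    OF X'(3) orth_lmodule[OF X[OF I]] X'(2)])
  show "\<forall>i\<in>I. orth B (N i) X'" using orth_iso[OF X X'(3,2)] by blast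
  fix Y :: "'a fgm" assume Y: "\<forall>i\<in>I. orth B (N i) Y"
  then have "orth B (N i0) Y" using I by blast
  then obtain P :: "'a fgm" and p where P: "cover B P p Y"
   "extends B P (a_kernel P Y p) (N i0)" "orth B (N i0) (ker_mod P Y p)" by (rule orthE)
  note P' = coverD[OF P(1)]
  have K: "\<forall>i\<in>I. orth B (N i) (ker_mod P Y p)" using orth_syzygy[OF _ l P(1)] Y by blast
  have "extends B P (a_kernel P Y p) (dsum I N)"
   unfolding extends_def
  proof
   fix h assume h: "h \<in> mod_hom B (ker_mod P Y p) (dsum I N)"
   have "\<exists>k\<in>mod_hom B P (N i). \<forall>x\<in>a_kernel P Y p. k x = h x i" if i: "i \<in> I" for i
    by (rule extendsD[OF orth_extends[OF Y[rule_format, OF i] l[OF i] P'(2,4,5)]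
       mod_hom_comp[OF h proj_mod_hom[OF i, of B N]]]) blast
   then obtain k where k: "!!i. i \<in> I ==> k i \<in> mod_hom B P (N i)"
    "!!i x. i \<in> I ==> x \<in> a_kernel P Y p ==> k i x = h x i" by metis
   show "\<exists>h'\<in>mod_hom B P (dsum I N). \<forall>x\<in>a_kernel P Y p. h' x = h x"
   proof (rule bexI[OF _ tuple_mod_hom], rule ballI)
    fix x assume x: "x \<in> a_kernel P Y p"
    then have "h x \<in> carrier (dsum I N)" using mod_homD(1)[OF h, of x] by simp
    then show "(\<lambda>i\<in>I. k i x) = h x"
     using k(2) x by (auto simp: dsum_simps fun_eq_iff PiE_iff extensional_def)
   qed (rule k(1))
  qed
  with P(1) K show "\<exists>(P :: 'a fgm) p. cover B P p Y &
    extends B P (a_kernel P Y p) (dsum I N) & (\<forall>i\<in>I. orth B (N i) (ker_mod P Y p))" by blast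
 qed
qed

text \<open>Reduces closure under finite direct sums to the zero module and closure under
  extensions. It is applied to \<open>orth\<close>, \<open>idimx\<close> and
  \<open>gresx\<close>.\<close>

lemma dsum_ses_induct:
 assumes "finite I" "ring B" "!!i. i \<in> I ==> lmodule B (N i)"
  and empty: "lmodule B (dsum {} N) ==> carrier (dsum {} N) = {zero (dsum {} N)} ==> Q (dsum {} N)"
  and step: "!!i J. i \<in> I ==> Q (dsum J N) ==> ses B (N i) (single (insert i J) N i)
   (dsum (insert i J) N) (%x. \<lambda>j\<in>J. x j) (dsum J N) ==> Q (dsum (insert i J) N)"
 shows "Q (dsum I N)"
 using assms(1,3) step
proof (induction I rule: finite_induct)
 case empty
 show ?case by (rule assms(4)) (auto simp: dsum_simps intro: lmodule_dsum assms(2))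
next
 case (insert i I)
 note l = insert.prems(1)
 have D: "lmodule B (dsum (insert i I) N)" "lmodule B (dsum I N)"
  by (rule lmodule_dsum[OF assms(2)], use l in blast)+
 let ?r = "%x. \<lambda>j\<in>I. x j"
 have r: "?r \<in> mod_hom B (dsum (insert i I) N) (dsum I N)"
  by (rule tuple_mod_hom) (rule proj_mod_hom, simp)
 have s: "single (insert i I) N i \<in> mod_hom B (N i) (dsum (insert i I) N)"
  using l by (rule single_mod_hom)
 have z: "zero (N j) \<in> carrier (N j)" if "j \<in> insert i I" for j
  using submoduleD(2)[OF submodule_carrier[OF l[OF that]]] .
 have ss: "ses B (N i) (single (insert i I) N i) (dsum (insert i I) N) ?r (dsum I N)"
  unfolding ses_def
 proof (intro conjI l D r s)
  show "inj_on (single (insert i I) N i) (carrier (N i))"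
   by (rule inj_onI) (auto simp: single_def fun_eq_iff split: if_splits)
  show "?r ` carrier (dsum (insert i I) N) = carrier (dsum I N)"
  proof (intro equalityI subsetI)
   fix y assume y: "y \<in> carrier (dsum I N)"
   show "y \<in> ?r ` carrier (dsum (insert i I) N)"
    by (rule image_eqI[of _ _ "\<lambda>j\<in>insert i I. if j = i then zero (N i) else y j"])
      (use y insert.hyps z in \<open>auto simp: dsum_simps fun_eq_iff PiE_iff extensional_def\<close>)
  qed (use mod_homD(1)[OF r] in blast)
  show "single (insert i I) N i ` carrier (N i) = a_kernel (dsum (insert i I) N) (dsum I N) ?r"
  proof (intro equalityI subsetI)
   fix y assume "y \<in> a_kernel (dsum (insert i I) N) (dsum I N) ?r"
   then have y: "y \<in> carrier (dsum (insert i I) N)" "!!j. j \<in> I ==> y j = zero (N j)"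
    by (auto simp: a_kernel_eq dsum_simps fun_eq_iff split: if_splits)
   show "y \<in> single (insert i I) N i ` carrier (N i)"
    by (rule image_eqI[of _ _ "y i"])
      (use y in \<open>auto simp: single_def dsum_simps fun_eq_iff PiE_iff extensional_def\<close>)
  next
   fix y assume "y \<in> single (insert i I) N i ` carrier (N i)"
   then obtain x where x: "x \<in> carrier (N i)" "y = single (insert i I) N i x" by blast
   then have "(\<lambda>j\<in>I. y j) = zero (dsum I N)"
    using insert.hyps by (auto simp: single_def dsum_simps fun_eq_iff)
   then show "y \<in> a_kernel (dsum (insert i I) N) (dsum I N) ?r"
    using mod_homD(1)[OF s x(1)] x(2) by (simp add: a_kernel_eq)
  qed
 qed auto
 have Q: "Q (dsum I N)" by (rule insert.IH[OF l insert.prems(2)]) simp_all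
 show ?case by (rule insert.prems(2)[OF _ Q ss]) simp
qed

lemma orth_dsum:
 assumes "finite I" "!!i. i \<in> I ==> orth B M (N i)" and M: "lmodule B M"
 shows "orth B M (dsum I N)"
 by (rule dsum_ses_induct[where Q = "orth B M", OF assms(1) lmodule_ring[OF M] orth_lmodule[OF assms(2)]])
   (blast intro: orth_zero_module orth_ext assms)+

section \<open>Comparison with Ext\<close>

lemma left_noetherian_ring: "left_noetherian B ==> ring B"
 by (simp add: left_noetherian_def)

lemma free_lmodule: "ring B ==> lmodule B (free_module B m)"
 by (rule addc_lmodule[OF fgproj_free])

lemma free_resolution_exists:
 assumes B: "left_noetherian B" and X: "fg_module B X"
 shows "\<exists>r d e. free_resolution B X r d e"
proof -
 note R = left_noetherian_ring[OF B]
 note F = free_lmodule[OF R]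
 from free_cover[OF X] obtain m e where e: "e \<in> mod_hom B (free_module B m) X"
  "e ` carrier (free_module B m) = carrier X" by blast
 have ex: "\<exists>m' u. u \<in> mod_hom B (free_module B m') (free_module B m) & u ` carrier (free_module B m') = K"
  if K: "submodule K B (free_module B m)" for K m
 proof -
  have "fg_module B ((free_module B m)\<lparr>carrier := K\<rparr>)"
   by (rule noetherian_fg_submodule[OF B fgproj_fg[OF R fgproj_free[OF R]] K])
  from free_cover[OF this] obtain m' u
   where "u \<in> mod_hom B (free_module B m') ((free_module B m)\<lparr>carrier := K\<rparr>)"
    "u ` carrier (free_module B m') = K" by auto
  then show ?thesis using mod_hom_extend_cod submoduleD(1)[OF K] by blast
 qed
 \<comment> \<open>The states of the dependent choice are triples \<open>(a, b, u)\<close> with a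
   differential \<open>u\<close> from rank \<open>b\<close> to rank \<open>a\<close>.
   \<open>Q\<close> expresses exactness between consecutive states, and \<open>P 0\<close> ties the
   first differential to the augmentation \<open>e\<close>.\<close>
 define ok where "ok = (%(a, b, u). u \<in> mod_hom B (free_module B b) (free_module B a))"
 define P where "P n x \<longleftrightarrow> ok x & (n = 0 --> fst x = m &
   snd (snd x) ` carrier (free_module B (fst (snd x))) = a_kernel (free_module B m) X e)"
  for n :: nat and x
 define Q where "Q = (%(n :: nat) (a, b, u) (a', b', u'). a' = b &
   u' ` carrier (free_module B b') = a_kernel (free_module B b) (free_module B a) u)"
 have "\<exists>f. \<forall>n. P n (f n) & Q n (f n) (f (Suc n))"
 proof (rule dependent_nat_choice)
  from ex[OF submodule_kernel[OF F fg_lmodule[OF X] e(1)]] obtain m' u where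
   "u \<in> mod_hom B (free_module B m') (free_module B m)"
   "u ` carrier (free_module B m') = a_kernel (free_module B m) X e" by blast
  then have "P 0 (m, m', u)" by (simp add: P_def ok_def)
  then show "\<exists>x. P 0 x" by blast
 next
  fix x n assume "P n x"
  then obtain a b u where x: "x = (a, b, u)" "u \<in> mod_hom B (free_module B b) (free_module B a)"
   by (cases x) (auto simp: P_def ok_def)
  from ex[OF submodule_kernel[OF F F x(2)]] obtain m' u' where
   "u' \<in> mod_hom B (free_module B m') (free_module B b)"
   "u' ` carrier (free_module B m') = a_kernel (free_module B b) (free_module B a) u" by blast
  then have "P (Suc n) (b, m', u') & Q n x (b, m', u')" by (simp add: P_def ok_def Q_def x(1))
  then show "\<exists>y. P (Suc n) y & Q n x y" by blast
 qed
 then obtain f where f: "!!n. P n (f n)" "!!n. Q n (f n) (f (Suc n))" by blast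
 define r where "r n = fst (f n)" for n
 define d where "d n = snd (snd (f n))" for n
 have r: "fst (snd (f n)) = r (Suc n)" for n
  using f(2)[of n] by (auto simp: Q_def r_def split: prod.splits)
 have d: "d n \<in> mod_hom B (free_module B (r (Suc n))) (free_module B (r n))" for n
  using f(1)[of n] r[of n] by (auto simp: P_def ok_def r_def d_def split: prod.splits)
 have k: "d (Suc n) ` carrier (free_module B (r (Suc (Suc n)))) =
   a_kernel (free_module B (r (Suc n))) (free_module B (r n)) (d n)" for n
 proof -
  obtain a b u where 1: "f n = (a, b, u)" by (rule prod_cases3)
  obtain a' b' u' where 2: "f (Suc n) = (a', b', u')" by (rule prod_cases3)
  show ?thesis using f(2)[of n] r[of n] r[of "Suc n"] unfolding r_def d_def Q_def 1 2 by simp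
 qed
 have "r 0 = m" "d 0 ` carrier (free_module B (r (Suc 0))) = a_kernel (free_module B m) X e"
  using f(1)[of 0] r[of 0] by (auto simp: P_def r_def d_def)
 then have "free_resolution B X r d e"
  unfolding free_resolution_def using e d k by simp
 then show ?thesis by blast
qed

text \<open>Exactness of the complex \<open>Hom(F, M)\<close> in positive degrees, with maps
  compared on carriers only. It mediates between cocycles modulo coboundaries and
  \<open>orth\<close>.\<close>

definition exact_hom ::
 "('b, 'z) ring_scheme => (nat => nat) => (nat => (nat => 'b) => (nat => 'b)) => ('b, 'm) module => bool"
 where "exact_hom B r d M \<longleftrightarrow> (\<forall>i. \<forall>f\<in>mod_hom B (free_module B (r (Suc i))) M.
   (\<forall>x\<in>carrier (free_module B (r (Suc (Suc i)))). f (d (Suc i) x) = zero M) -->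
   (\<exists>g\<in>mod_hom B (free_module B (r i)) M. \<forall>x\<in>carrier (free_module B (r (Suc i))). f x = g (d i x)))"

lemma free_resolution_iso:
 assumes res: "free_resolution B X r d e" and a: "a \<in> mod_hom B X Y" "bij_betw a (carrier X) (carrier Y)"
  and X: "lmodule B X" and Y: "lmodule B Y"
 shows "free_resolution B Y r d (%x. a (e x))"
proof -
 have e: "e \<in> mod_hom B (free_module B (r 0)) X" "e ` carrier (free_module B (r 0)) = carrier X"
  using res by (auto simp: free_resolution_def)
 have im: "a ` carrier X = carrier Y" and inj: "inj_on a (carrier X)"
  using a(2) by (auto simp: bij_betw_def)
 have "(%x. a (e x)) ` carrier (free_module B (r 0)) = carrier Y"
  unfolding im[symmetric] e(2)[symmetric] by (simp add: image_image)
 moreover have "a y = zero Y \<longleftrightarrow> y = zero X" if y: "y \<in> carrier X" for y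
  using y inj inj_on_mod_hom[OF X Y a(1)] mod_hom_zero[OF a(1) X Y] by blast
 then have "a_kernel (free_module B (r 0)) Y (%x. a (e x)) = a_kernel (free_module B (r 0)) X e"
  using mod_homD(1)[OF e(1)] by (auto simp: a_kernel_eq)
 ultimately show ?thesis
  using res mod_hom_comp[OF e(1) a(1)] by (simp add: free_resolution_def)
qed

text \<open>Dropping the first term of a free resolution leaves a free resolution of the first
  syzygy with the same exactness; this is the coinductive step.\<close>

lemma exact_hom_orth:
 fixes X :: "('b, 'x) module" and B :: "('b, 'z) ring_scheme"
 assumes X: "fg_module B X" and M: "lmodule B M"
  and res: "free_resolution B X r d e" "exact_hom B r d M"
 shows "orth B M X"
proof -
 interpret M: lmodule B M by (rule M)
 note B = M.R.ring_axioms
 note F = free_lmodule[OF B]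
 define R where "R Y \<longleftrightarrow> (\<exists>r d e. free_resolution B Y r d e & exact_hom B r d M)"
  for Y :: "'b fgm"
 from X obtain X' :: "'b fgm"
  where X': "fg_module B X'" "lmodule B X'" "mod_iso B X X'" "mod_iso B X' X" by (rule copy_exists)
 from X'(3) obtain a where a: "a \<in> mod_hom B X X'" "bij_betw a (carrier X) (carrier X')"
  by (auto simp: mod_iso_def)
 have "orth B M X'"
 proof (rule orth_coinduct[of R, OF _ X'(2)])
  show "R X'" unfolding R_def
   using free_resolution_iso[OF res(1) a fg_lmodule[OF X] X'(2)] res(2) by blast
  fix Y :: "'b fgm" assume "R Y" and lY: "lmodule B Y"
  then obtain r d e where res: "free_resolution B Y r d e" "exact_hom B r d M"
   by (auto simp: R_def)
  let ?F = "%i. free_module B (r i)"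
  have e: "e \<in> mod_hom B (?F 0) Y" "e ` carrier (?F 0) = carrier Y"
   and d: "!!i. d i \<in> mod_hom B (?F (Suc i)) (?F i)"
   and k0: "d 0 ` carrier (?F (Suc 0)) = a_kernel (?F 0) Y e"
   and k: "!!i. d (Suc i) ` carrier (?F (Suc (Suc i))) = a_kernel (?F (Suc i)) (?F i) (d i)"
   using res(1) by (auto simp: free_resolution_def)
  have cov: "cover B (?F 0) e Y" unfolding cover_def using e lY fgproj_free[OF B] by blast
  let ?K = "ker_mod (?F 0) Y e"
  have lK: "lmodule B ?K" by (rule coverD(7)[OF cov])
  have d0: "d 0 \<in> mod_hom B (?F (Suc 0)) ?K" "d 0 ` carrier (?F (Suc 0)) = carrier ?K"
   using mod_hom_restrict_cod[OF d[of 0]] k0 by auto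
  have resK: "free_resolution B ?K (%i. r (Suc i)) (%i. d (Suc i)) (d 0)"
   unfolding free_resolution_def using d0 d k by (auto simp: a_kernel_eq)
  have exK: "exact_hom B (%i. r (Suc i)) (%i. d (Suc i)) M"
   using res(2) by (simp add: exact_hom_def)
  have "fg_module B ?K"
   by (rule fg_image[OF fgproj_fg[OF B fgproj_free[OF B]] lK d0])
  then obtain K' :: "'b fgm" where K': "fg_module B K'" "lmodule B K'"
   "mod_iso B ?K K'" "mod_iso B K' ?K" by (rule copy_exists)
  from K'(3) obtain a where a: "a \<in> mod_hom B ?K K'" "bij_betw a (carrier ?K) (carrier K')"
   by (auto simp: mod_iso_def)
  have "R K'" unfolding R_def using free_resolution_iso[OF resK a lK K'(2)] exK by blast
  moreover have "extends B (?F 0) (a_kernel (?F 0) Y e) M"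
   unfolding extends_def
  proof
   fix h assume h: "h \<in> mod_hom B ?K M"
   have "h (d 0 (d (Suc 0) x)) = zero M" if "x \<in> carrier (?F (Suc (Suc 0)))" for x
   proof -
    have "d (Suc 0) x \<in> a_kernel (?F (Suc 0)) (?F 0) (d 0)" unfolding k[symmetric] using that by blast
    then have "d 0 (d (Suc 0) x) = zero ?K" by (simp add: a_kernel_eq)
    then show ?thesis using mod_hom_zero[OF h lK M] by simp
   qed
   with res(2)[unfolded exact_hom_def, rule_format, OF mod_hom_comp[OF d0(1) h]]
   obtain g where g: "g \<in> mod_hom B (?F 0) M"
    "\<forall>x\<in>carrier (?F (Suc 0)). h (d 0 x) = g (d 0 x)" by blast
   have "g y = h y" if "y \<in> a_kernel (?F 0) Y e" for y
    using that g(2) unfolding k0[symmetric] by auto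
   with g(1) show "\<exists>h'\<in>mod_hom B (?F 0) M. \<forall>x\<in>a_kernel (?F 0) Y e. h' x = h x" by blast
  qed
  ultimately show "\<exists>(P :: ('b, nat => 'b) module) p K'. cover B P p Y &
    extends B P (a_kernel P Y p) M & mod_iso B (ker_mod P Y p) K' & lmodule B K' &
    (R K' | orth B M K')"
   using cov K'(2,3) by blast
 qed
 then show ?thesis using X'(4) fg_lmodule[OF X] by (rule orth_iso)
qed

text \<open>By \<open>orth_syzygy\<close> the image of every differential is orthogonal. A cocycle
  factors over the image of the preceding differential, and from there it extends to the next free
  module.\<close>

lemma orth_exact_hom:
 assumes B: "ring B" and X: "lmodule B X" and M: "lmodule B M"
  and res: "free_resolution B X r d e" and o: "orth B M X"
 shows "exact_hom B r d M"
proof -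
 note F = free_lmodule[OF B]
 let ?F = "%i. free_module B (r i)"
 let ?W = "%i. d i ` carrier (?F (Suc i))"
 have e: "e \<in> mod_hom B (?F 0) X" "e ` carrier (?F 0) = carrier X"
  and d: "!!i. d i \<in> mod_hom B (?F (Suc i)) (?F i)"
  and k0: "?W 0 = a_kernel (?F 0) X e" and k: "!!i. ?W (Suc i) = a_kernel (?F (Suc i)) (?F i) (d i)"
  using res by (auto simp: free_resolution_def)
 have W: "submodule (?W i) B (?F i)" for i
  by (rule submodule_image[OF F F d submodule_carrier[OF F]])
 have cov: "cover B (?F (Suc i)) (d i) ((?F i)\<lparr>carrier := ?W i\<rparr>)" for i
  unfolding cover_def
  by (intro conjI fgproj_free B lmodule_restrict F W mod_hom_restrict_cod d) auto
 have ker: "a_kernel (?F (Suc i)) ((?F i)\<lparr>carrier := ?W i\<rparr>) (d i) = ?W (Suc i)" for i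
  unfolding k by (simp add: a_kernel_eq)
 have *: "orth B M ((?F i)\<lparr>carrier := ?W i\<rparr>) & extends B (?F i) (?W i) M" for i
 proof (induction i)
  case 0
  have "cover B (?F 0) e X" unfolding cover_def using e X fgproj_free[OF B] by blast
  then show ?case unfolding k0 using orth_syzygy[OF o M] orth_extends[OF o M F e] by blast
 next
  case (Suc i)
  then have o: "orth B M ((?F i)\<lparr>carrier := ?W i\<rparr>)" ..
  show ?case
   using orth_syzygy[OF o M cov] orth_extends[OF o M F coverD(4,5)[OF cov]] unfolding ker by blast
 qed
 show ?thesis
  unfolding exact_hom_def
 proof (intro allI ballI impI)
  fix i f assume f: "f \<in> mod_hom B (?F (Suc i)) M" "\<forall>x\<in>carrier (?F (Suc (Suc i))). f (d (Suc i) x) = zero M"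
  have "\<exists>h\<in>mod_hom B ((?F i)\<lparr>carrier := ?W i\<rparr>) M. \<forall>x\<in>carrier (?F (Suc i)). h (d i x) = f x"
  proof (rule mod_hom_factor[OF F lmodule_restrict[OF F W] M coverD(4,5)[OF cov] f(1)])
   fix x assume "x \<in> carrier (?F (Suc i))" "d i x = zero ((?F i)\<lparr>carrier := ?W i\<rparr>)"
   then have "x \<in> ?W (Suc i)" unfolding k by (simp add: a_kernel_eq)
   then show "f x = zero M" using f(2) by blast
  qed
  then obtain h where h: "h \<in> mod_hom B ((?F i)\<lparr>carrier := ?W i\<rparr>) M"
   "\<forall>x\<in>carrier (?F (Suc i)). h (d i x) = f x" by blast
  from * h(1) obtain h' where h': "h' \<in> mod_hom B (?F i) M" "!!x. x \<in> ?W i ==> h' x = h x"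
   using extendsD by metis
  show "\<exists>g\<in>mod_hom B (?F i) M. \<forall>x\<in>carrier (?F (Suc i)). f x = g (d i x)"
   by (rule bexI[OF _ h'(1)]) (use h h' in auto)
 qed
qed

section \<open>Vanishing of the Ext groups as an inclusion of cocycles in coboundaries\<close>

lemma trivial_factor_group:
 fixes G (structure)
 assumes "comm_group G" "subgroup H G"
 shows "trivial_group (G Mod H) \<longleftrightarrow> carrier G \<subseteq> H"
proof -
 interpret comm_group G by fact
 interpret N: normal H G using assms(2) subgroup_imp_normal by blast
 have grp: "group (G Mod H)" by (rule N.factorgroup_is_group)
 have "trivial_group (G Mod H) \<longleftrightarrow> rcosets H = {H}"
  using grp by (simp add: trivial_group_def FactGroup_def)
 also have "... \<longleftrightarrow> carrier G \<subseteq> H"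
 proof
  assume r: "rcosets H = {H}"
  show "carrier G \<subseteq> H"
  proof
   fix x assume x: "x \<in> carrier G"
   then have "H #> x \<in> rcosets H" using N.subset by (rule rcosetsI[rotated])
   then have "H #> x = H" using r by simp
   then show "x \<in> H" using x rcos_self[OF x assms(2)] by simp
  qed
 next
  assume "carrier G \<subseteq> H"
  then have "H #> x = H" if "x \<in> carrier G" for x
   using that assms(2) by (intro coset_join2) auto
  moreover have "H \<in> rcosets H" using N.subgroup_in_rcosets[OF is_group] .
  ultimately show "rcosets H = {H}" by (auto simp: RCOSETS_def)
 qed
 finally show ?thesis .
qed

lemma hom_group_comm_group:
 assumes X: "lmodule B X" and M: "lmodule B M"
 shows "comm_group (hom_group B X M)"
proof -
 interpret X: lmodule B X by fact
 interpret M: lmodule B M by fact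
 let ?G = "hom_group B X M"
 have restr: "(\<lambda>x\<in>carrier X. f x) \<in> carrier ?G" if "f \<in> mod_hom B X M" for f
  using mod_hom_cong[OF that X, of "\<lambda>x\<in>carrier X. f x"] by (simp add: hom_group_def)
 have hom: "f \<in> mod_hom B X M" "f \<in> extensional (carrier X)" if "f \<in> carrier ?G" for f
  using that by (auto simp: hom_group_def)
 show ?thesis
 proof (rule comm_groupI)
  show "one ?G \<in> carrier ?G"
   using restr[OF mod_hom_const_zero[OF M]] by (simp add: hom_group_def)
  fix f assume f: "f \<in> carrier ?G"
  note f' = mod_homD(1)[OF hom(1)[OF f]]
  have "(\<lambda>x\<in>carrier X. msub B M (zero M) (f x)) \<in> carrier ?G"
   by (rule restr[OF mod_hom_diff[OF M mod_hom_const_zero[OF M] hom(1)[OF f]]])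
  moreover have "(\<lambda>x\<in>carrier X. msub B M (zero M) (f x)) *[?G] f = one ?G"
   using f' M.add_msub by (auto simp: hom_group_def fun_eq_iff M.M.a_comm)
  ultimately show "\<exists>g\<in>carrier ?G. g *[?G] f = one ?G" by blast
  show "one ?G *[?G] f = f"
   using f' hom(2)[OF f] by (auto simp: hom_group_def fun_eq_iff extensional_def)
  fix g assume g: "g \<in> carrier ?G"
  note g' = mod_homD(1)[OF hom(1)[OF g]]
  show "f *[?G] g \<in> carrier ?G"
   using restr[OF mod_hom_add[OF M hom(1)[OF f] hom(1)[OF g]]] by (simp add: hom_group_def)
  show "f *[?G] g = g *[?G] f"
   using f' g' by (auto simp: hom_group_def fun_eq_iff M.M.a_comm)
  show "f *[?G] g *[?G] h = f *[?G] (g *[?G] h)" if "h \<in> carrier ?G" for h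
   using f' g' mod_homD(1)[OF hom(1)[OF that]] by (auto simp: hom_group_def fun_eq_iff M.M.a_assoc)
 qed
qed

text \<open>\<open>Ext\<close> is formed by overwriting the carrier of the Hom group. Once the
  coboundaries are known to be a subgroup of the cocycles, triviality of the quotient is an
  inclusion of sets.\<close>

lemma trivial_ext_group:
 assumes B: "ring B" and M: "lmodule B M" and res: "free_resolution B X r d e"
 shows "trivial_group ((hom_group B (free_module B (r (Suc i))) M)
   \<lparr>carrier := cocycles B r d M (Suc i)\<rparr> Mod coboundaries B r d M (Suc i)) \<longleftrightarrow>
  cocycles B r d M (Suc i) \<subseteq> coboundaries B r d M (Suc i)"
proof -
 note F = free_lmodule[OF B]
 let ?F = "%i. free_module B (r i)"
 let ?G = "hom_group B (?F (Suc i)) M" and ?Z = "cocycles B r d M (Suc i)"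
  and ?H = "coboundaries B r d M (Suc i)"
 interpret M: lmodule B M by fact
 interpret G: comm_group ?G by (rule hom_group_comm_group[OF F M])
 interpret G': comm_group "hom_group B (?F i) M" by (rule hom_group_comm_group[OF F M])
 have d: "!!i. d i \<in> mod_hom B (?F (Suc i)) (?F i)"
  and k: "!!i. d (Suc i) ` carrier (?F (Suc (Suc i))) = a_kernel (?F (Suc i)) (?F i) (d i)"
  using res by (auto simp: free_resolution_def)
 have car: "f \<in> carrier (hom_group B Y M) \<longleftrightarrow> f \<in> mod_hom B Y M & f \<in> extensional (carrier Y)" for f and Y :: "('a, nat => 'a) module"
  by (auto simp: hom_group_def)
 have one: "one (hom_group B Y M) = (\<lambda>x\<in>carrier Y. zero M)"
  and mult: "f *[hom_group B Y M] g = (\<lambda>x\<in>carrier Y. f x +[M] g x)" for f g and Y :: "('a, nat => 'a) module"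
  by (simp_all add: hom_group_def)
 have inv: "inv\<^bsub>hom_group B Y M\<^esub> f = (\<lambda>x\<in>carrier Y. msub B M (zero M) (f x))"
  if f: "f \<in> carrier (hom_group B Y M)" and Y: "lmodule B Y" for f and Y :: "('a, nat => 'a) module"
 proof -
  interpret Y: comm_group "hom_group B Y M" by (rule hom_group_comm_group[OF Y M])
  have fh: "f \<in> mod_hom B Y M" using f by (simp add: car)
  have "(\<lambda>x\<in>carrier Y. msub B M (zero M) (f x)) \<in> mod_hom B Y M"
   by (rule mod_hom_cong[OF mod_hom_diff[OF M mod_hom_const_zero[OF M] fh] Y]) simp
  then have "(\<lambda>x\<in>carrier Y. msub B M (zero M) (f x)) \<in> carrier (hom_group B Y M)" by (simp add: car)
  moreover have "(\<lambda>x\<in>carrier Y. msub B M (zero M) (f x)) *[hom_group B Y M] f = one (hom_group B Y M)"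
   using f mod_homD(1)[of f B Y M] by (auto simp: car mult one fun_eq_iff M.M.a_comm M.add_msub)
  ultimately show ?thesis using f Y.inv_equality by blast
 qed
 have F0: "d (Suc i) x \<in> carrier (?F (Suc i))" if "x \<in> carrier (?F (Suc (Suc i)))" for x
  using mod_homD(1)[OF d that] .
 have Z: "subgroup ?Z ?G"
 proof (rule G.subgroupI)
  show "?Z \<subseteq> carrier ?G" by (auto simp: cocycles_def)
  have "one ?G \<in> ?Z" unfolding cocycles_def using G.one_closed F0 by (auto simp: one)
  then show "?Z ~= {}" by blast
 next
  fix f assume f: "f \<in> ?Z"
  then have fc: "f \<in> carrier ?G" by (simp add: cocycles_def)
  show "inv\<^bsub>?G\<^esub> f \<in> ?Z"
   using f G.inv_closed[OF fc] F0 M.msub_zero by (auto simp: cocycles_def inv[OF fc F])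
  fix g assume g: "g \<in> ?Z"
  then have gc: "g \<in> carrier ?G" by (simp add: cocycles_def)
  show "f *[?G] g \<in> ?Z" using f g G.m_closed[OF fc gc] F0 by (auto simp: cocycles_def mult)
 qed
 have H: "?H = (%g. \<lambda>x\<in>carrier (?F (Suc i)). g (d i x)) ` carrier (hom_group B (?F i) M)"
  by (simp add: coboundaries_def)
 have dc: "d i x \<in> carrier (?F i)" if "x \<in> carrier (?F (Suc i))" for x using mod_homD(1)[OF d that] .
 have HZ: "?H \<subseteq> ?Z"
 proof
  fix f assume "f \<in> ?H"
  then obtain g where g: "g \<in> carrier (hom_group B (?F i) M)" "f = (\<lambda>x\<in>carrier (?F (Suc i)). g (d i x))"
   unfolding H by blast
  then have gh: "g \<in> mod_hom B (?F i) M" by (simp add: car)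
  have "f \<in> carrier ?G"
   unfolding car g(2) by (intro conjI mod_hom_cong[OF mod_hom_comp[OF d gh] F]) auto
  moreover have "f (d (Suc i) x) = zero M" if x: "x \<in> carrier (?F (Suc (Suc i)))" for x
  proof -
   have "d (Suc i) x \<in> a_kernel (?F (Suc i)) (?F i) (d i)" unfolding k[symmetric] using x by blast
   then show ?thesis using mod_hom_zero[OF gh F M] by (simp add: g(2) a_kernel_eq)
  qed
  ultimately show "f \<in> ?Z" by (simp add: cocycles_def)
 qed
 have HG: "subgroup ?H ?G"
 proof (rule G.subgroupI)
  show "?H \<subseteq> carrier ?G" using HZ by (auto simp: cocycles_def)
  show "?H ~= {}" unfolding H using G'.one_closed by blast
 next
  fix f assume f: "f \<in> ?H"
  then have fc: "f \<in> carrier ?G" using HZ by (auto simp: cocycles_def)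
  from f obtain u where u: "u \<in> carrier (hom_group B (?F i) M)" "f = (\<lambda>x\<in>carrier (?F (Suc i)). u (d i x))"
   unfolding H by blast
  show "inv\<^bsub>?G\<^esub> f \<in> ?H"
   unfolding H by (rule image_eqI[OF _ G'.inv_closed[OF u(1)]])
    (use u dc in \<open>auto simp: inv[OF fc F] inv[OF u(1) F] fun_eq_iff\<close>)
  fix g assume "g \<in> ?H"
  then obtain v where v: "v \<in> carrier (hom_group B (?F i) M)" "g = (\<lambda>x\<in>carrier (?F (Suc i)). v (d i x))"
   unfolding H by blast
  show "f *[?G] g \<in> ?H"
   unfolding H by (rule image_eqI[OF _ G'.m_closed[OF u(1) v(1)]])
    (use u v dc in \<open>auto simp: mult fun_eq_iff\<close>)
 qed
 have "comm_group (?G\<lparr>carrier := ?Z\<rparr>)"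
  using G.subgroup_imp_group[OF Z] G.m_comm
  by (intro group.group_comm_groupI) (auto simp: cocycles_def)
 moreover have "subgroup ?H (?G\<lparr>carrier := ?Z\<rparr>)"
  using G.subgroup_incl[OF HG Z HZ] .
 ultimately show ?thesis by (simp add: trivial_factor_group)
qed

lemma cocycles_coboundaries_iff_exact_hom:
 assumes B: "ring B" and M: "lmodule B M"
  and d: "!!i. d i \<in> mod_hom B (free_module B (r (Suc i))) (free_module B (r i))"
 shows "(\<forall>i. cocycles B r d M (Suc i) \<subseteq> coboundaries B r d M (Suc i)) \<longleftrightarrow> exact_hom B r d M"
proof -
 note F = free_lmodule[OF B]
 let ?F = "%i. free_module B (r i)"
 have restr: "(\<lambda>x\<in>carrier (?F i). f x) \<in> carrier (hom_group B (?F i) M)"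
  if "f \<in> mod_hom B (?F i) M" for f i
  using mod_hom_cong[OF that F, of "\<lambda>x\<in>carrier (?F i). f x"] by (simp add: hom_group_def)
 show ?thesis
 proof
  assume L: "\<forall>i. cocycles B r d M (Suc i) \<subseteq> coboundaries B r d M (Suc i)"
  show "exact_hom B r d M"
   unfolding exact_hom_def
  proof (intro allI ballI impI)
   fix i f assume f: "f \<in> mod_hom B (?F (Suc i)) M"
    "\<forall>x\<in>carrier (?F (Suc (Suc i))). f (d (Suc i) x) = zero M"
   have "(\<lambda>x\<in>carrier (?F (Suc i)). f x) \<in> cocycles B r d M (Suc i)"
    using restr[OF f(1)] f(2) mod_homD(1)[OF d] by (simp add: cocycles_def)
   then have "(\<lambda>x\<in>carrier (?F (Suc i)). f x) \<in> coboundaries B r d M (Suc i)" using L by blast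
   then obtain g where g: "g \<in> carrier (hom_group B (?F i) M)"
    "(\<lambda>x\<in>carrier (?F (Suc i)). f x) = (\<lambda>x\<in>carrier (?F (Suc i)). g (d i x))"
    by (auto simp: coboundaries_def)
   have "f x = g (d i x)" if "x \<in> carrier (?F (Suc i))" for x
    using fun_cong[OF g(2), of x] that by simp
   then show "\<exists>g\<in>mod_hom B (?F i) M. \<forall>x\<in>carrier (?F (Suc i)). f x = g (d i x)"
    using g(1) by (auto simp: hom_group_def)
  qed
 next
  assume E: "exact_hom B r d M"
  show "\<forall>i. cocycles B r d M (Suc i) \<subseteq> coboundaries B r d M (Suc i)"
  proof (intro allI subsetI)
   fix i f assume f: "f \<in> cocycles B r d M (Suc i)"
   then have f': "f \<in> mod_hom B (?F (Suc i)) M" "f \<in> extensional (carrier (?F (Suc i)))"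
    "\<forall>x\<in>carrier (?F (Suc (Suc i))). f (d (Suc i) x) = zero M"
    by (auto simp: cocycles_def hom_group_def)
   then obtain g where g: "g \<in> mod_hom B (?F i) M" "\<forall>x\<in>carrier (?F (Suc i)). f x = g (d i x)"
    using E unfolding exact_hom_def by blast
   have "f = (\<lambda>x\<in>carrier (?F (Suc i)). (\<lambda>x\<in>carrier (?F i). g x) (d i x))"
    using f'(2) g(2) mod_homD(1)[OF d] by (auto simp: fun_eq_iff extensional_def)
   then show "f \<in> coboundaries B r d M (Suc i)"
    unfolding coboundaries_def nat.case by (rule image_eqI[OF _ restr[OF g(1)]])
  qed
 qed
qed

theorem perp_iff_orth:
 assumes B: "left_noetherian B" and M: "lmodule B M"
 shows "X \<in> perp B M \<longleftrightarrow> orth B M X"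
proof -
 note R = left_noetherian_ring[OF B]
 have "(\<forall>i\<ge>1. trivial_group (Ext B i X M)) \<longleftrightarrow> orth B M X" if X: "fg_module B X"
 proof -
  \<comment> \<open>Of the chosen resolution only its being a resolution is used;
    \<open>orth\<close> does not depend on the choice.\<close>
  obtain r d e where s: "(SOME (r, d, e). free_resolution B X r d e) = (r, d, e)"
   by (rule prod_cases3)
  have "\<exists>t. case t of (r, d, e) => free_resolution B X r d e"
   using free_resolution_exists[OF B X] by auto
  from someI_ex[OF this] have res: "free_resolution B X r d e" unfolding s by simp
  have d: "!!i. d i \<in> mod_hom B (free_module B (r (Suc i))) (free_module B (r i))"
   using res by (auto simp: free_resolution_def)
  have "(\<forall>i\<ge>1. trivial_group (Ext B i X M)) \<longleftrightarrow> (\<forall>i. trivial_group (Ext B (Suc i) X M))"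
   by (auto simp: Suc_le_eq gr0_conv_Suc)
  also have "... \<longleftrightarrow> exact_hom B r d M"
   unfolding Ext_def s by (simp add: trivial_ext_group[OF R M res]
    cocycles_coboundaries_iff_exact_hom[where r = r and d = d, OF R M d])
  also have "... \<longleftrightarrow> orth B M X"
   using exact_hom_orth[OF X M res] orth_exact_hom[OF R fg_lmodule[OF X] M res] by blast
  finally show ?thesis .
 qed
 then show ?thesis using orth_fg[of B M X] unfolding perp_def by blast
qed

section \<open>Finite resolutions by direct summands of powers\<close>

lemma fac_power:
 assumes "lmodule B X" "lmodule B Y" "lmodule B M" "fac B X M Y h"
 shows "\<exists>m. \<exists>u\<in>mod_hom B X (dsum {..<m::nat} (%_. M)). \<exists>v\<in>mod_hom B (dsum {..<m} (%_. M)) Y.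
  \<forall>x\<in>carrier X. v (u x) = h x"
 using assms(4)
proof induction
 case (fac_zero h)
 have "lmodule B (dsum {..<0::nat} (%_. M))"
  by (rule lmodule_dsum[OF lmodule_ring[OF assms(1)]]) (rule assms(3))
 then show ?case
  using fac_zero
  by (intro exI[of _ 0] bexI[OF _ mod_hom_const_zero] bexI[OF _ mod_hom_const_zero[OF assms(2)]]) auto
next
 case (fac_step h f g h')
 then obtain m u v where u: "u \<in> mod_hom B X (dsum {..<m::nat} (%_. M))"
  and v: "v \<in> mod_hom B (dsum {..<m} (%_. M)) Y" and uv: "\<forall>x\<in>carrier X. v (u x) = h x" by blast
 let ?D = "dsum {..<Suc m} (%_. M)"
 let ?u = "%x. \<lambda>i\<in>{..<Suc m}. (if i = m then f x else u x i)"
 let ?r = "%y. \<lambda>i\<in>{..<m}. y i"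
 let ?v = "%y. g (y m) +[Y] v (?r y)"
 have "(%x. if i = m then f x else u x i) \<in> mod_hom B X M" if i: "i \<in> {..<Suc m}" for i
 proof (cases "i = m")
  case False
  with i have "i \<in> {..<m}" by auto
  from mod_hom_comp[OF u proj_mod_hom[OF this, of B "%_. M"]] False show ?thesis by simp
 qed (use fac_step(2) in simp)
 then have u': "?u \<in> mod_hom B X ?D" by (rule tuple_mod_hom)
 have "(%y. y i) \<in> mod_hom B ?D M" if "i < Suc m" for i
  using proj_mod_hom[of i "{..<Suc m}" B "%_. M"] that by simp
 note pr = this
 have r: "?r \<in> mod_hom B ?D (dsum {..<m} (%_. M))" by (rule tuple_mod_hom) (rule pr, simp)
 have v': "?v \<in> mod_hom B ?D Y"
  by (rule mod_hom_add[OF assms(2) mod_hom_comp[OF pr[of m] fac_step(3)] mod_hom_comp[OF r v]]) simp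
 have "?v (?u x) = h' x" if x: "x \<in> carrier X" for x
 proof -
  have "?r (?u x) = u x"
   using mod_homD(1)[OF u x] by (auto simp: dsum_simps fun_eq_iff PiE_iff extensional_def)
  then have "v (?r (?u x)) = h x" using uv x by simp
  then show ?thesis unfolding fac_step(4)[OF x] by simp
 qed
 then show ?case by (intro exI[of _ "Suc m"] bexI[of _ ?u] bexI[of _ ?v] ballI u' v')
qed

lemma set_add_iff: "x \<in> set_add P U V \<longleftrightarrow> (\<exists>u\<in>U. \<exists>v\<in>V. x = u +[P] v)"
 by (auto simp: set_add_def')

lemma add_class_iff_addc:
 assumes M: "lmodule B M"
 shows "X \<in> add_class B M \<longleftrightarrow> addc B M X"
proof
 interpret M: lmodule B M by (rule M)
 have D: "lmodule B (dsum {..<m::nat} (%_. M))" for m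
  by (rule lmodule_dsum[OF M.R.ring_axioms]) (rule M)
 {
  assume "X \<in> add_class B M"
  then obtain m :: nat and U V where X: "lmodule B X" and
   U: "submodule U B (dsum {..<m} (%_. M))" and V: "submodule V B (dsum {..<m} (%_. M))"
   and UV: "U \<inter> V = {zero (dsum {..<m} (%_. M))}"
    "set_add (dsum {..<m} (%_. M)) U V = carrier (dsum {..<m} (%_. M))"
   and iso: "mod_iso B X ((dsum {..<m} (%_. M))\<lparr>carrier := U\<rparr>)"
   unfolding add_class_def Let_def by blast
  let ?P = "dsum {..<m} (%_. M)"
  interpret P: lmodule B ?P by (rule D)
  let ?U = "?P\<lparr>carrier := U\<rparr>" and ?V = "?P\<lparr>carrier := V\<rparr>"
  note lU = lmodule_restrict[OF D U] and lV = lmodule_restrict[OF D V]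
  note iU = mod_hom_restrict[OF mod_hom_id submoduleD(1)[OF U]]
   and iV = mod_hom_restrict[OF mod_hom_id submoduleD(1)[OF V]]
  \<comment> \<open>The projection of \<open>?P\<close> to \<open>U\<close> along \<open>V\<close>,
    obtained by factoring the first projection over the sum map. It makes \<open>U\<close> a retract
    of the power \<open>?P\<close>.\<close>
  have "\<exists>h\<in>mod_hom B ?P ?U. \<forall>w\<in>carrier (prod_mod ?U ?V). h (fst w +[?P] snd w) = fst w"
  proof (rule mod_hom_factor[OF lmodule_prod_mod[OF lU lV] D lU copair_mod_hom[OF D iU iV] _ fst_mod_hom])
   have "(%w. fst w +[?P] snd w) ` carrier (prod_mod ?U ?V) = set_add ?P U V"
    unfolding set_eq_iff set_add_iff by force
   then show "(%w. fst w +[?P] snd w) ` carrier (prod_mod ?U ?V) = carrier ?P" using UV(2) by simp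
   fix w assume w: "w \<in> carrier (prod_mod ?U ?V)" "fst w +[?P] snd w = zero ?P"
   then have w': "fst w \<in> U" "snd w \<in> V" by auto
   then have c: "fst w \<in> carrier ?P" "snd w \<in> carrier ?P"
    using submodule_in[OF U] submodule_in[OF V] by auto
   have "msub B ?P (fst w +[?P] snd w) (snd w) = fst w"
    using P.msub_add_left[of "snd w" "fst w"] c by (simp add: P.M.a_comm)
   then have "fst w = msub B ?P (zero ?P) (snd w)" using w(2) by simp
   also have "... \<in> V" using w'(2) V submoduleD(2)[OF V] by (intro submodule_msub M.R.ring_axioms)
   finally show "fst w = zero ?U" using w'(1) UV(1) by auto
  qed
  then obtain h where h: "h \<in> mod_hom B ?P ?U"
   "\<forall>w\<in>carrier (prod_mod ?U ?V). h (fst w +[?P] snd w) = fst w" by blast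
  have "addc B M ?P" by (intro addc_dsum M.R.ring_axioms addc_refl M) auto
  moreover have "h u = u" if u: "u \<in> U" for u
  proof -
   have "h (u +[?P] zero ?P) = u" using h(2) u submoduleD(2)[OF V] by force
   then show ?thesis using submodule_in[OF U u] by simp
  qed
  ultimately have "addc B M ?U" by (intro addc_retract[OF _ lU iU h(1)]) auto
  then show "addc B M X" using mod_iso_sym[OF iso X] X by (rule addc_iso)
 }
 assume "addc B M X"
 then have X: "lmodule B X" "fac B X M X (%x. x)" by (auto simp: addc_def)
 from fac_power[OF X(1) X(1) M X(2)] obtain m u v where
  u: "u \<in> mod_hom B X (dsum {..<m::nat} (%_. M))" and v: "v \<in> mod_hom B (dsum {..<m} (%_. M)) X"
  and uv: "!!x. x \<in> carrier X ==> v (u x) = x" by blast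
 let ?P = "dsum {..<m} (%_. M)"
 interpret P: lmodule B ?P by (rule D)
 interpret X: lmodule B X by (rule X(1))
 let ?U = "u ` carrier X" and ?V = "a_kernel ?P X v"
 note U = submodule_image[OF X(1) D u submodule_carrier[OF X(1)]] and V = submodule_kernel[OF D X(1) v]
 have "mod_iso B X (?P\<lparr>carrier := ?U\<rparr>)"
 proof (rule mod_iso_bij[OF mod_hom_restrict_cod[OF u]])
  show "inj_on u (carrier X)" using uv by (metis inj_on_inverseI)
 qed auto
 moreover have "?U \<inter> ?V = {zero ?P}"
 proof -
  have "u x = zero ?P" if "x \<in> carrier X" "v (u x) = zero X" for x
   using that uv[OF that(1)] mod_hom_zero[OF u X(1) D] by simp
  then show ?thesis using submoduleD(2)[OF U] submoduleD(2)[OF V] by (auto simp: a_kernel_eq)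
 qed
 moreover have "set_add ?P ?U ?V = carrier ?P"
 proof (intro equalityI subsetI)
  fix y assume "y \<in> set_add ?P ?U ?V"
  then show "y \<in> carrier ?P"
   unfolding set_add_iff using submodule_in[OF U] submodule_in[OF V] by auto
 next
  fix y assume y: "y \<in> carrier ?P"
  have vy: "v y \<in> carrier X" "u (v y) \<in> carrier ?P" using mod_homD(1)[OF v y] mod_homD(1)[OF u] by auto
  have "v (msub B ?P y (u (v y))) = zero X"
   using y vy uv by (simp add: mod_hom_msub[OF v D] X.msub_eq_zero)
  then have "msub B ?P y (u (v y)) \<in> ?V" using y vy by (simp add: a_kernel_eq)
  moreover have "y = u (v y) +[?P] msub B ?P y (u (v y))" using y vy by (simp add: P.add_msub)
  ultimately show "y \<in> set_add ?P ?U ?V" unfolding set_add_iff using vy(1) by blast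
 qed
 ultimately show "X \<in> add_class B M"
  unfolding add_class_def Let_def using X(1) U V by blast
qed

lemma addc_fg:
 assumes "fg_module B M" "addc B M X"
 shows "fg_module B X"
proof -
 have M: "lmodule B M" using assms(1) by (rule fg_lmodule)
 from assms(2) have X: "lmodule B X" "fac B X M X (%x. x)" by (auto simp: addc_def)
 from fac_power[OF X(1) X(1) M X(2)] obtain m u v where
  u: "u \<in> mod_hom B X (dsum {..<m::nat} (%_. M))" and v: "v \<in> mod_hom B (dsum {..<m} (%_. M)) X"
  and uv: "\<forall>x\<in>carrier X. v (u x) = x" by blast
 have "fg_module B (dsum {..<m} (%_. M))"
  by (rule fg_dsum[OF lmodule_ring[OF M]]) (auto simp: assms(1))
 moreover have "v ` carrier (dsum {..<m} (%_. M)) = carrier X"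
 proof (intro equalityI subsetI)
  fix x assume x: "x \<in> carrier X"
  then show "x \<in> v ` carrier (dsum {..<m} (%_. M))"
   using uv mod_homD(1)[OF u x] by (intro image_eqI[of _ v "u x"]) simp_all
 qed (use mod_homD(1)[OF v] in auto)
 ultimately show ?thesis by (intro fg_image[OF _ X(1) v])
qed

text \<open>\<open>gres B T s Y\<close>: \<open>Y\<close> has a resolution of length less than \<open>s\<close> by modules in \<open>add(T)\<close>.\<close>

primrec gres :: "('b, 'z) ring_scheme => ('b, 't) module => nat => 'b fgm => bool" where
 "gres B T 0 Y \<longleftrightarrow> lmodule B Y & carrier Y = {zero Y}"
| "gres B T (Suc s) Y \<longleftrightarrow> lmodule B Y & (\<exists>(T0 :: 'b fgm) g. addc B T T0 &
   g \<in> mod_hom B T0 Y & g ` carrier T0 = carrier Y & gres B T s (ker_mod T0 Y g))"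

definition gresx :: "('b, 'z) ring_scheme => ('b, 't) module => nat => ('b, 'y) module => bool" where
 "gresx B T s Y \<longleftrightarrow> lmodule B Y &
   (\<exists>Y' :: 'b fgm. mod_iso B Y Y' & lmodule B Y' & gres B T s Y')"

lemma gresx_lmodule: "gresx B T s Y ==> lmodule B Y"
 by (simp add: gresx_def)

lemma gresx_iso: "gresx B T s X ==> mod_iso B X Y ==> lmodule B Y ==> gresx B T s Y"
 unfolding gresx_def using mod_iso_sym mod_iso_trans by metis

lemma mod_iso_zero:
 assumes "mod_iso B X Y" "lmodule B X" "lmodule B Y" "carrier X = {zero X}"
 shows "carrier Y = {zero Y}"
proof -
 from assms(1) obtain f where f: "f \<in> mod_hom B X Y" "f ` carrier X = carrier Y"
  by (auto simp: mod_iso_def bij_betw_def)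
 then show ?thesis using mod_hom_zero[OF f(1) assms(2,3)] assms(4) by simp
qed

lemma zero_fg: "lmodule B X ==> carrier X = {zero X} ==> fg_module B X"
 by (rule fg_moduleI[of _ _ "{}"]) (use submoduleD(2) in auto)

lemma gresx_0: "gresx B T 0 X \<longleftrightarrow> lmodule B X & carrier X = {zero X}"
proof
 assume "gresx B T 0 X"
 then show "lmodule B X & carrier X = {zero X}"
  unfolding gresx_def using mod_iso_sym mod_iso_zero by (metis gres.simps(1))
next
 assume X: "lmodule B X & carrier X = {zero X}"
 then have "fg_module B X" by (intro zero_fg) auto
 then obtain X' :: "'a fgm"
  where X': "fg_module B X'" "lmodule B X'" "mod_iso B X X'" "mod_iso B X' X" by (rule copy_exists)
 then show "gresx B T 0 X" unfolding gresx_def using X mod_iso_zero by (metis gres.simps(1))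
qed

lemma gresx_SucE:
 assumes "gresx B T (Suc s) Y"
 obtains T0 :: "'b fgm" and g where
  "addc (B :: ('b, 'z) ring_scheme) T T0" "g \<in> mod_hom B T0 Y" "g ` carrier T0 = carrier Y"
  "gresx B T s (ker_mod T0 Y g)"
proof -
 from assms obtain Y' :: "'b fgm" where Y: "lmodule B Y" "mod_iso B Y Y'"
  "lmodule B Y'" "gres B T (Suc s) Y'" by (auto simp: gresx_def)
 from Y(4) obtain T0 :: "'b fgm" and g where T0: "addc B T T0"
  "g \<in> mod_hom B T0 Y'" "g ` carrier T0 = carrier Y'" "gres B T s (ker_mod T0 Y' g)" by auto
 note l = addc_lmodule[OF T0(1)]
 from l T0(2,3) mod_iso_sym[OF Y(2,1)] Y(3,1) obtain h where h: "h \<in> mod_hom B T0 Y"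
  "h ` carrier T0 = carrier Y" "a_kernel T0 Y h = a_kernel T0 Y' g" by (rule surj_iso_target)
 have "gresx B T s (ker_mod T0 Y h)"
  unfolding gresx_def h(3)
  using T0(4) lmodule_restrict[OF l submodule_kernel[OF l Y(3) T0(2)]] mod_iso_refl by blast
 then show thesis by (rule that[OF T0(1) h(1,2)])
qed

lemma gres_iso:
 assumes "gres B T s X" "mod_iso B X Y" "lmodule B Y"
 shows "gres B T s Y"
proof (cases s)
 case 0
 with assms mod_iso_zero show ?thesis by auto
next
 case (Suc n)
 with assms(1) obtain T0 :: "'a fgm" and g where X: "lmodule B X" and
  T0: "addc B T T0" "g \<in> mod_hom B T0 X" "g ` carrier T0 = carrier X" "gres B T n (ker_mod T0 X g)"
  by auto
 from addc_lmodule[OF T0(1)] T0(2,3) assms(2) X assms(3) obtain h where "h \<in> mod_hom B T0 Y"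
  "h ` carrier T0 = carrier Y" "a_kernel T0 Y h = a_kernel T0 X g" by (rule surj_iso_target)
 with T0 assms(3) show ?thesis
  unfolding Suc gres.simps by (intro conjI exI[of _ T0] exI[of _ h]) simp_all
qed

lemma gresx_copy: "gresx B T s Y \<longleftrightarrow> lmodule B Y & gres B T s Y"
 for Y :: "'b fgm"
 unfolding gresx_def using gres_iso mod_iso_sym mod_iso_refl by metis

lemma gresx_Suc:
 fixes B :: "('b, 'z) ring_scheme"
 assumes T: "fg_module B T" and T0: "addc B T T0" and g: "g \<in> mod_hom B T0 Y" "g ` carrier T0 = carrier Y"
  and Y: "lmodule B Y" and k: "gresx B T s (ker_mod T0 Y g)"
 shows "gresx B T (Suc s) Y"
proof -
 note l = addc_lmodule[OF T0]
 have fT0: "fg_module B T0" by (rule addc_fg[OF T T0])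
 from fT0 obtain T1 :: "'b fgm"
  where T1: "fg_module B T1" "lmodule B T1" "mod_iso B T0 T1" "mod_iso B T1 T0" by (rule copy_exists)
 from fg_image[OF fT0 Y g] obtain Y1 :: "'b fgm"
  where Y1: "fg_module B Y1" "lmodule B Y1" "mod_iso B Y Y1" "mod_iso B Y1 Y" by (rule copy_exists)
 from l g Y1(3) Y Y1(2) obtain h where h: "h \<in> mod_hom B T0 Y1"
  "h ` carrier T0 = carrier Y1" "a_kernel T0 Y1 h = a_kernel T0 Y g" by (rule surj_iso_target)
 from T1(3) l obtain t t' where t: "t \<in> mod_hom B T0 T1" "t' \<in> mod_hom B T1 T0"
  "!!x. x \<in> carrier T0 ==> t' (t x) = x" "!!x. x \<in> carrier T1 ==> t (t' x) = x" by (rule mod_isoE) (rule that)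
 let ?h = "%x. h (t' x)"
 note cl = mod_homD(1)[OF t(1)] mod_homD(1)[OF t(2)]
 have h': "?h \<in> mod_hom B T1 Y1" by (rule mod_hom_comp[OF t(2) h(1)])
 have "t' ` carrier T1 = carrier T0" using cl t(3) by (auto intro!: image_eqI[of _ t'])
 then have im: "?h ` carrier T1 = carrier Y1" unfolding h(2)[symmetric] by (metis image_image)
 have l1: "lmodule B (ker_mod T1 Y1 ?h)"
  by (rule lmodule_restrict[OF T1(2) submodule_kernel[OF T1(2) Y1(2) h']])
 have "mod_iso B (ker_mod T0 Y1 h) (ker_mod T1 Y1 ?h)"
 proof (rule mod_isoI[of t _ _ _ t'])
  show "t \<in> mod_hom B (ker_mod T0 Y1 h) (ker_mod T1 Y1 ?h)"
   by (rule mod_hom_restrict_cod[OF mod_hom_restrict[OF t(1)]]) (use t(3) cl in \<open>auto simp: a_kernel_eq\<close>)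
  show "t' \<in> mod_hom B (ker_mod T1 Y1 ?h) (ker_mod T0 Y1 h)"
   by (rule mod_hom_restrict_cod[OF mod_hom_restrict[OF t(2)]]) (use cl in \<open>auto simp: a_kernel_eq\<close>)
 qed (use t in \<open>auto simp: a_kernel_eq\<close>)
 then have "gresx B T s (ker_mod T1 Y1 ?h)"
  using gresx_iso[OF k _ l1] unfolding h(3) by blast
 then have "gres B T s (ker_mod T1 Y1 ?h)" by (simp only: gresx_copy)
 then have "gres B T (Suc s) Y1"
  using addc_iso[OF T0 T1(3,2)] Y1(2) h' im by auto
 then have "gresx B T (Suc s) Y1" using Y1(2) by (simp only: gresx_copy)
 then show ?thesis using Y1(4) Y by (rule gresx_iso)
qed

lemma gresx_fg:
 assumes T: "fg_module B T" and Y: "gresx B T s Y"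
 shows "fg_module B Y"
proof (cases s)
 case 0
 with Y show ?thesis by (auto simp: gresx_0 intro: zero_fg)
next
 case (Suc n)
 from Y[unfolded Suc] obtain T0 :: "'a fgm" and g where
  T0: "addc B T T0" "g \<in> mod_hom B T0 Y" "g ` carrier T0 = carrier Y" by (rule gresx_SucE)
 then show ?thesis using fg_image[OF addc_fg[OF T T0(1)] gresx_lmodule[OF Y]] by blast
qed

lemma gresx_addc:
 assumes T: "fg_module B T" and Y: "addc B T Y"
 shows "gresx B T (Suc 0) Y"
proof (rule gresx_Suc[OF T Y mod_hom_id])
 note l = addc_lmodule[OF Y]
 have k: "a_kernel Y Y (%x. x) = {zero Y}"
  using submoduleD(2)[OF submodule_carrier[OF l]] by (auto simp: a_kernel_eq)
 show "gresx B T 0 (ker_mod Y Y (%x. x))"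
  unfolding gresx_0 k using lmodule_restrict[OF l submodule_zero[OF l]] by simp
qed (use addc_lmodule[OF Y] in auto)

lemma gres_mono:
 assumes T: "fg_module B T"
 shows "gres B T s Y ==> gres B T (Suc s) Y"
proof (induction s arbitrary: Y)
 case 0
 then have "gresx B T (Suc 0) Y" using addc_zero by (intro gresx_addc[OF T]) auto
 then show ?case by (simp only: gresx_copy)
next
 case (Suc s)
 from Suc.prems obtain T0 :: "'a fgm" and g where Y: "lmodule B Y" and
  T0: "addc B T T0" "g \<in> mod_hom B T0 Y" "g ` carrier T0 = carrier Y" "gres B T s (ker_mod T0 Y g)"
  by auto
 show ?case
  unfolding gres.simps(2)[of B T "Suc s"]
  using Y T0(1-3) Suc.IH[OF T0(4)] by (intro conjI exI[of _ T0] exI[of _ g])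
qed

lemma gresx_mono: "fg_module B T ==> gresx B T s Y ==> gresx B T (Suc s) Y"
 unfolding gresx_def using gres_mono by metis

lemma gresx_le:
 assumes "fg_module B T" "s \<le> t" "gresx B T s Y"
 shows "gresx B T t Y"
 using assms(2) by (induction rule: dec_induct) (use assms gresx_mono in blast)+

text \<open>\<open>Y\<close> is the quotient of a module in \<open>add(T)\<close> by one with a
  shorter resolution, and \<open>X\<close> is orthogonal to both.\<close>

lemma gres_orth:
 assumes X: "orth B T X"
 shows "gres B T s Y ==> orth B Y X"
proof (induction s arbitrary: Y)
 case 0
 then show ?case using addc_zero by (intro orth_target_addc[OF X]) auto
next
 case (Suc s)
 then obtain T0 :: "'a fgm" and g where Y: "lmodule B Y" and
  T0: "addc B T T0" "g \<in> mod_hom B T0 Y" "g ` carrier T0 = carrier Y" "gres B T s (ker_mod T0 Y g)"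
  by auto
 from ses_kernel[OF addc_lmodule[OF T0(1)] Y T0(2,3)] show ?case
  by (rule orth_target_quotient) (rule Suc.IH[OF T0(4)], rule orth_target_addc[OF X T0(1)])
qed

lemma orth_target_iso:
 assumes "orth B M X" "mod_iso B M M'" "lmodule B M" "lmodule B M'"
 shows "orth B M' X"
 by (rule orth_target_addc[OF assms(1) addc_iso[OF addc_refl[OF assms(3)] assms(2,4)]])

lemma gresx_orth:
 assumes "gresx B T s Y" "orth B T X"
 shows "orth B Y X"
proof -
 from assms(1) obtain Y' :: "'a fgm" where Y': "lmodule B Y" "mod_iso B Y Y'"
  "lmodule B Y'" "gres B T s Y'" by (auto simp: gresx_def)
 show ?thesis
  by (rule orth_target_iso[OF gres_orth[OF assms(2) Y'(4)] mod_iso_sym[OF Y'(2,1)] Y'(3,1)])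
qed

text \<open>Here \<open>orth B X T\<close> means that \<open>Ext(T, X)\<close> vanishes, so that
  modules in \<open>add(T)\<close> behave like projectives with respect to this sequence.\<close>

lemma addc_lift:
 assumes s: "ses B X f Y g Z" and T: "orth B X T" and P: "addc B T P" and h: "h \<in> mod_hom B P Z"
 shows "\<exists>h'\<in>mod_hom B P Y. \<forall>x\<in>carrier P. g (h' x) = h x"
proof -
 note s' = sesD[OF s]
 from P have P': "lmodule B P" "fac B P T P (%x. x)" by (auto simp: addc_def)
 show ?thesis
  by (rule fac_lift[OF s'(2,3,6) fac_post[OF P'(1) P'(1) s'(3) h P'(2)]])
    (rule orth_lift[OF T s])
qed

lemma ses_zero_middle:
 assumes s: "ses B X f Y g Z" and "carrier X = {zero X}" "carrier Z = {zero Z}"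
 shows "carrier Y = {zero Y}"
proof -
 note s' = sesD[OF s]
 have "y = zero Y" if y: "y \<in> carrier Y" for y
 proof -
  have "g y = zero Z" using mod_homD(1)[OF s'(6) y] assms(3) by simp
  with s y obtain x where "x \<in> carrier X" "y = f x" by (rule ses_kernelE)
  then show ?thesis using assms(2) mod_hom_zero[OF s'(4,1,2)] by simp
 qed
 with submoduleD(2)[OF submodule_carrier[OF s'(2)]] show ?thesis by blast
qed

lemma ses_zero_quotient:
 assumes s: "ses B X f Y g Z" and "carrier Y = {zero Y}"
 shows "carrier Z = {zero Z}"
proof -
 have "g (zero Y) = zero Z" by (rule mod_hom_zero[OF sesD(6)[OF s] sesD(2)[OF s] sesD(3)[OF s]])
 then show ?thesis using sesD(7)[OF s] assms(2) by simp
qed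

text \<open>The horseshoe lemma relative to \<open>add(T)\<close>. The map from \<open>Q\<close> to
  \<open>Z\<close> lifts to \<open>Y\<close> because \<open>T\<close>, being self-orthogonal, is
  also orthogonal to \<open>X\<close>, which is resolved by \<open>add(T)\<close>.\<close>

lemma gres_ext:
 fixes B :: "('b, 'z) ring_scheme" and X Y Z :: "'b fgm"
 assumes T: "fg_module B T" "orth B T T"
 shows "ses B X f Y g Z ==> gres B T s X ==> gres B T s Z ==> gres B T s Y"
proof (induction s arbitrary: X Y Z f g)
 case 0
 then show ?case using ses_zero_middle[OF 0(1)] sesD(2)[OF 0(1)] by simp
next
 case (Suc s)
 note s = Suc.prems(1)
 note s' = sesD[OF s]
 from Suc.prems(2) obtain P :: "'b fgm" and p where
  P: "addc B T P" "p \<in> mod_hom B P X" "p ` carrier P = carrier X" "gres B T s (ker_mod P X p)"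
  by auto
 from Suc.prems(3) obtain Q :: "'b fgm" and q where
  Q: "addc B T Q" "q \<in> mod_hom B Q Z" "q ` carrier Q = carrier Z" "gres B T s (ker_mod Q Z q)"
  by auto
 have "gresx B T (Suc s) X" unfolding gresx_copy using s'(1) Suc.prems(2) by blast
 then have "orth B X T" using T(2) by (rule gresx_orth)
 from addc_lift[OF s this Q(1,2)] obtain t where t: "t \<in> mod_hom B Q Y" "\<forall>x\<in>carrier Q. g (t x) = q x"
  by blast
 then have gt: "(%b. g (t b)) ` carrier Q = carrier Z" using Q(3) by auto
 note h = horseshoe_ses[OF s addc_lmodule[OF P(1)] addc_lmodule[OF Q(1)] P(2,3) t(1) gt]
 let ?r = "%u. f (p (fst u)) +[Y] t (snd u)"
 let ?K = "ker_mod (prod_mod P Q) Y ?r"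
 have "a_kernel Q Z (%b. g (t b)) = a_kernel Q Z q" using t(2) by (auto simp: a_kernel_eq)
 then have sk: "ses B (ker_mod P X p) (%a. (a, zero Q)) ?K snd (ker_mod Q Z q)" using h(3) by simp
 have gx: "gresx B T s (ker_mod P X p)" "gresx B T s (ker_mod Q Z q)"
  unfolding gresx_copy using P(4) Q(4) sesD(1,3)[OF sk] by auto
 from ses_fg_middle[OF sk gresx_fg[OF T(1) gx(1)] gresx_fg[OF T(1) gx(2)]]
 obtain K' :: "'b fgm" where K': "fg_module B K'" "lmodule B K'"
  "mod_iso B ?K K'" "mod_iso B K' ?K" by (rule copy_exists)
 from ses_iso[OF sk mod_iso_refl K'(3) mod_iso_refl sesD(1)[OF sk] K'(2) sesD(3)[OF sk]] obtain f' g'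
  where "ses B (ker_mod P X p) f' K' g' (ker_mod Q Z q)" by blast
 from Suc.IH[OF this P(4) Q(4)] have "gresx B T s K'" unfolding gresx_copy using K'(2) by blast
 then have "gresx B T s ?K" using K'(4) sesD(2)[OF sk] by (rule gresx_iso)
 from gresx_Suc[OF T(1) addc_prod_mod[OF P(1) Q(1)] h(1,2) s'(2) this]
 show ?case by (simp only: gresx_copy)
qed

lemma gresx_ext:
 assumes T: "fg_module B T" "orth B T T"
  and s: "ses B X f Y g Z" and X: "gresx B T n X" and Z: "gresx B T n Z"
 shows "gresx B T n Y"
proof -
 from X obtain X' :: "'a fgm" where X': "mod_iso B X X'" "lmodule B X'" "gres B T n X'"
  by (auto simp: gresx_def)
 from Z obtain Z' :: "'a fgm" where Z': "mod_iso B Z Z'" "lmodule B Z'" "gres B T n Z'"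
  by (auto simp: gresx_def)
 from ses_fg_middle[OF s gresx_fg[OF T(1) X] gresx_fg[OF T(1) Z]]
 obtain Y' :: "'a fgm" where Y': "fg_module B Y'" "lmodule B Y'" "mod_iso B Y Y'"
  "mod_iso B Y' Y" by (rule copy_exists)
 from ses_iso[OF s X'(1) Y'(3) Z'(1) X'(2) Y'(2) Z'(2)] obtain f' g'
  where "ses B X' f' Y' g' Z'" by blast
 from gres_ext[OF T this X'(3) Z'(3)] show ?thesis
  unfolding gresx_def using Y' sesD(2)[OF s] by blast
qed

text \<open>With \<open>P\<close> in \<open>add(T)\<close> mapping onto \<open>Y\<close>, the kernel
  of \<open>P -> Y -> Z\<close> is an extension of \<open>X\<close> by the kernel over
  \<open>Y\<close>. It is resolved in \<open>n\<close> steps, and \<open>P\<close> is one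
  more.\<close>

lemma gresx_quotient:
 assumes T: "fg_module B T" "orth B T T"
  and s: "ses B X f Y g Z" and X: "gresx B T n X" and Y: "gresx B T n Y"
 shows "gresx B T (Suc n) Z"
proof (cases n)
 case 0
 then have "gresx B T 0 Z"
  using Y ses_zero_quotient[OF s] sesD(3)[OF s] by (simp add: gresx_0)
 then show ?thesis unfolding 0 by (rule gresx_mono[OF T(1)])
next
 case (Suc m)
 note s' = sesD[OF s]
 from Y[unfolded Suc] obtain P :: "'a fgm" and p where
  P: "addc B T P" "p \<in> mod_hom B P Y" "p ` carrier P = carrier Y" "gresx B T m (ker_mod P Y p)"
  by (rule gresx_SucE)
 from ses_kernel_comp[OF s addc_lmodule[OF P(1)] P(2,3)] obtain q where
  q: "ses B (ker_mod P Y p) (%x. x) (ker_mod P Z (%x. g (p x))) q X" by blast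
 have "gresx B T n (ker_mod P Y p)" unfolding Suc by (rule gresx_mono[OF T(1) P(4)])
 from gresx_ext[OF T q this X] have k: "gresx B T n (ker_mod P Z (%x. g (p x)))" .
 have "(%x. g (p x)) ` carrier P = g ` (p ` carrier P)" by (simp add: image_image)
 then have "(%x. g (p x)) ` carrier P = carrier Z" using P(3) s'(7) by simp
 then show ?thesis
  by (rule gresx_Suc[OF T(1) P(1) mod_hom_comp[OF P(2) s'(6)] _ s'(3) k])
qed

text \<open>The content of \<open>has_add_resolution\<close> with the element type of the terms left
  free, so that the tail of a resolution can be read as a resolution of a kernel inside its first
  term.\<close>

definition hres ::
 "('b, 'z) ring_scheme => ('b, 'm) module => ('b, 'y) module => nat => (nat => ('b, 'w) module) =>
  ('w => 'y) => (nat => 'w => 'w) => bool" where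
 "hres B T Y s Ts p d \<longleftrightarrow> (\<forall>i\<le>s. addc B T (Ts i)) &
   p \<in> mod_hom B (Ts 0) Y & p ` carrier (Ts 0) = carrier Y &
   (\<forall>i<s. d i \<in> mod_hom B (Ts (Suc i)) (Ts i)) &
   a_kernel (Ts 0) Y p = (if 0 < s then d 0 ` carrier (Ts (Suc 0)) else {zero (Ts 0)}) &
   (\<forall>i<s. a_kernel (Ts (Suc i)) (Ts i) (d i) =
    (if Suc i < s then d (Suc i) ` carrier (Ts (Suc (Suc i))) else {zero (Ts (Suc i))}))"

lemma has_add_resolution_hres:
 fixes T :: "('b, 'm) module"
 assumes "lmodule B T"
 shows "has_add_resolution B T Y \<longleftrightarrow>
  (\<exists>s (Ts :: nat => ('b, nat => 'm) module) p d. hres B T Y s Ts p d)"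
 unfolding has_add_resolution_def hres_def Let_def add_class_iff_addc[OF assms] ..

lemma hres_Suc:
 assumes "hres B T Y (Suc s) Ts p d"
 shows "hres B T (ker_mod (Ts 0) Y p) s (%i. Ts (Suc i)) (d 0) (%i. d (Suc i))"
proof -
 have "d 0 \<in> mod_hom B (Ts (Suc 0)) (Ts 0)" and k: "a_kernel (Ts 0) Y p = d 0 ` carrier (Ts (Suc 0))"
  using assms by (auto simp: hres_def)
 then have "d 0 \<in> mod_hom B (Ts (Suc 0)) (ker_mod (Ts 0) Y p)" by (intro mod_hom_restrict_cod) auto
 with assms k show ?thesis by (auto simp: hres_def a_kernel_eq)
qed

lemma hres_step:
 assumes T: "fg_module B T" and Y: "lmodule B Y" and h: "hres B T Y s Ts p d"
  and k: "0 < s ==> gresx B T n (ker_mod (Ts 0) Y p)"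
 shows "\<exists>n. gresx B T n Y"
proof -
 have T0: "addc B T (Ts 0)" "p \<in> mod_hom B (Ts 0) Y" "p ` carrier (Ts 0) = carrier Y"
  using h by (auto simp: hres_def)
 have "gresx B T 0 (ker_mod (Ts 0) Y p)" if "s = 0"
  using h that lmodule_restrict[OF addc_lmodule[OF T0(1)]
    submodule_kernel[OF addc_lmodule[OF T0(1)] Y T0(2)]]
  by (simp add: gresx_0 hres_def)
 with k show ?thesis using gresx_Suc[OF T T0 Y] by blast
qed

text \<open>The induction passes to a kernel inside \<open>Ts 0\<close>, so \<open>Y\<close> must
  have the element type of the terms. \<open>hres_gresx\<close> treats an arbitrary \<open>Y\<close>
  by doing the first step separately.\<close>

lemma hres_gresx_copy:
 fixes Y :: "('b, 'w) module" and Ts :: "nat => ('b, 'w) module"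
 assumes T: "fg_module B T"
 shows "lmodule B Y ==> hres B T Y s Ts p d ==> \<exists>n. gresx B T n Y"
proof (induction s arbitrary: Y Ts p d)
 case 0
 show ?case by (rule hres_step[OF T 0]) simp
next
 case (Suc s)
 have T0: "addc B T (Ts 0)" "p \<in> mod_hom B (Ts 0) Y"
  using Suc.prems by (auto simp: hres_def)
 note l = lmodule_restrict[OF addc_lmodule[OF T0(1)]
   submodule_kernel[OF addc_lmodule[OF T0(1)] Suc.prems(1) T0(2)]]
 from Suc.IH[OF l hres_Suc[OF Suc.prems(2)]] obtain n where
  "gresx B T n (ker_mod (Ts 0) Y p)" by blast
 with hres_step[OF T Suc.prems] show ?case by blast
qed

lemma hres_gresx:
 assumes T: "fg_module B T" and Y: "lmodule B Y" and h: "hres B T Y s Ts p d"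
 shows "\<exists>n. gresx B T n Y"
proof (cases s)
 case 0
 with hres_step[OF T Y h] show ?thesis by blast
next
 case (Suc s')
 have T0: "addc B T (Ts 0)" "p \<in> mod_hom B (Ts 0) Y"
  using h by (auto simp: hres_def)
 note l = lmodule_restrict[OF addc_lmodule[OF T0(1)] submodule_kernel[OF addc_lmodule[OF T0(1)] Y T0(2)]]
 from hres_gresx_copy[OF T l hres_Suc[OF h[unfolded Suc]]] obtain n where
  "gresx B T n (ker_mod (Ts 0) Y p)" by blast
 with hres_step[OF T Y h] show ?thesis by blast
qed

text \<open>\<open>has_add_resolution\<close> prescribes the element type \<open>nat => 'm\<close>
  for its terms, that of submodules of a power of \<open>T\<close>.\<close>

lemma addc_copy:
 fixes T :: "('b, 'm) module"
 assumes T: "lmodule B T" and X: "addc B T X"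
 obtains X' :: "('b, nat => 'm) module" where "addc B T X'" "mod_iso B X X'"
proof -
 from X add_class_iff_addc[OF T] have "X \<in> add_class B T" by blast
 then obtain m :: nat and U where U: "submodule U B (dsum {..<m} (%_. T))"
  "mod_iso B X ((dsum {..<m} (%_. T))\<lparr>carrier := U\<rparr>)"
  unfolding add_class_def Let_def by blast
 have D: "lmodule B (dsum {..<m} (%_. T))" by (rule lmodule_dsum[OF lmodule_ring[OF T]]) (rule T)
 show thesis by (rule that[OF addc_iso[OF X U(2) lmodule_restrict[OF D U(1)]] U(2)])
qed

lemma gres_hres:
 fixes T :: "('b, 'm) module" and Y :: "'b fgm"
 assumes T: "lmodule B T"
 shows "gres B T n Y ==> \<exists>s (Ts :: nat => ('b, nat => 'm) module) p d. hres B T Y s Ts p d"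
proof (induction n arbitrary: Y)
 case 0
 then have "addc B T Y" by (intro addc_zero) auto
 then obtain Y' :: "('b, nat => 'm) module" where Y': "addc B T Y'" "mod_iso B Y Y'"
  by (rule addc_copy[OF T])
 from 0 have Y: "lmodule B Y" "carrier Y = {zero Y}" by auto
 note l = addc_lmodule[OF Y'(1)]
 have "carrier Y' = {zero Y'}" by (rule mod_iso_zero[OF Y'(2) Y(1) l Y(2)])
 then have "hres B T Y 0 (%_. Y') (%_. zero Y) (%_ x. x)"
  using Y Y'(1) mod_hom_const_zero[OF Y(1)] by (auto simp: hres_def a_kernel_eq)
 then show ?case by blast
next
 case (Suc n)
 then obtain T0 :: "'b fgm" and g where Y: "lmodule B Y" and
  T0: "addc B T T0" "g \<in> mod_hom B T0 Y" "g ` carrier T0 = carrier Y" "gres B T n (ker_mod T0 Y g)"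
  by auto
 note l = addc_lmodule[OF T0(1)]
 from T0(1) obtain T1 :: "('b, nat => 'm) module" where T1: "addc B T T1" "mod_iso B T0 T1"
  by (rule addc_copy[OF T])
 note l1 = addc_lmodule[OF T1(1)]
 from T1(2) l obtain t t' where t: "t \<in> mod_hom B T0 T1" "t' \<in> mod_hom B T1 T0"
  "!!x. x \<in> carrier T0 ==> t' (t x) = x" "!!x. x \<in> carrier T1 ==> t (t' x) = x" by (rule mod_isoE) (rule that)
 note cl = mod_homD(1)[OF t(1)] mod_homD(1)[OF t(2)] mod_homD(1)[OF T0(2)]
 from Suc.IH[OF T0(4)] obtain s and Ts :: "nat => ('b, nat => 'm) module" and p d
  where h: "hres B T (ker_mod T0 Y g) s Ts p d" by blast
 then have p: "p \<in> mod_hom B (Ts 0) (ker_mod T0 Y g)" "p ` carrier (Ts 0) = a_kernel T0 Y g"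
  by (auto simp: hres_def)
 note pc = mod_homD(1)[OF p(1), simplified]
 have pT: "p \<in> mod_hom B (Ts 0) T0"
  by (rule mod_hom_extend_cod[OF p(1) submoduleD(1)[OF submodule_kernel[OF l Y T0(2)]]])
 \<comment> \<open>The resolution of the kernel moves up by one place, and its augmentation
   \<open>p\<close>, transported by \<open>t\<close> into the new first term, becomes the first
   differential.\<close>
 let ?Ts = "%i. case i of 0 => T1 | Suc j => Ts j"
 let ?d = "%i. case i of 0 => (%x. t (p x)) | Suc j => d j"
 have "t' ` carrier T1 = carrier T0" using cl t(3) by (auto intro!: image_eqI[of _ t'])
 then have im: "(%x. g (t' x)) ` carrier T1 = carrier Y" unfolding T0(3)[symmetric] by (metis image_image)
 have k0: "a_kernel T1 Y (%x. g (t' x)) = (%x. t (p x)) ` carrier (Ts 0)"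
 proof -
  have "a_kernel T1 Y (%x. g (t' x)) = t ` a_kernel T0 Y g"
   using t cl by (auto simp: a_kernel_eq intro!: image_eqI[of _ t])
  then show ?thesis unfolding p(2)[symmetric] by (simp add: image_image)
 qed
 have tz: "t x = zero T1 \<longleftrightarrow> x = zero T0" if "x \<in> carrier T0" for x
  using that t(3) mod_hom_zero[OF t(1) l l1] mod_hom_zero[OF t(2) l1 l] by metis
 have k1: "a_kernel (Ts 0) T1 (%x. t (p x)) = a_kernel (Ts 0) (ker_mod T0 Y g) p"
  using tz mod_homD(1)[OF pT] by (auto simp: a_kernel_eq)
 have "hres B T Y (Suc s) ?Ts (%x. g (t' x)) ?d"
  unfolding hres_def
 proof (intro conjI allI impI)
  show "addc B T (?Ts i)" if "i \<le> Suc s" for i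
   using that h T1(1) by (auto simp: hres_def split: nat.split)
  show "(%x. g (t' x)) \<in> mod_hom B (?Ts 0) Y" using mod_hom_comp[OF t(2) T0(2)] by simp
  show "(%x. g (t' x)) ` carrier (?Ts 0) = carrier Y" using im by simp
  show "?d i \<in> mod_hom B (?Ts (Suc i)) (?Ts i)" if "i < Suc s" for i
   using that h mod_hom_comp[OF pT t(1)] by (auto simp: hres_def split: nat.split)
  show "a_kernel (?Ts 0) Y (%x. g (t' x)) =
    (if 0 < Suc s then ?d 0 ` carrier (?Ts (Suc 0)) else {zero (?Ts 0)})" using k0 by simp
  show "a_kernel (?Ts (Suc i)) (?Ts i) (?d i) = (if Suc i < Suc s
    then ?d (Suc i) ` carrier (?Ts (Suc (Suc i))) else {zero (?Ts (Suc i))})" if "i < Suc s" for i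
   using that h k1 by (cases i) (auto simp: hres_def)
 qed
 then show ?case by blast
qed

theorem has_add_resolution_iff_gresx:
 fixes T :: "('b, 'm) module"
 assumes T: "fg_module B T" and Y: "lmodule B Y"
 shows "has_add_resolution B T Y \<longleftrightarrow> (\<exists>n. gresx B T n Y)"
proof -
 note hr = has_add_resolution_hres[OF fg_lmodule[OF T]]
 have "\<exists>s (Ts :: nat => ('b, nat => 'm) module) p d. hres B T Y s Ts p d" if g: "gresx B T n Y" for n
 proof -
  from g obtain Y' :: "'b fgm" where Y': "mod_iso B Y Y'" "lmodule B Y'" "gres B T n Y'"
   by (auto simp: gresx_def)
  from gres_hres[OF fg_lmodule[OF T] Y'(3)] obtain s and Ts :: "nat => ('b, nat => 'm) module" and p d
   where h: "hres B T Y' s Ts p d" by blast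
  then have T0: "addc B T (Ts 0)" "p \<in> mod_hom B (Ts 0) Y'" "p ` carrier (Ts 0) = carrier Y'"
   by (auto simp: hres_def)
  from addc_lmodule[OF T0(1)] T0(2,3) mod_iso_sym[OF Y'(1) Y] Y'(2) Y obtain q where
   "q \<in> mod_hom B (Ts 0) Y" "q ` carrier (Ts 0) = carrier Y" "a_kernel (Ts 0) Y q = a_kernel (Ts 0) Y' p"
   by (rule surj_iso_target)
  with h have "hres B T Y s Ts q d" by (simp add: hres_def)
  then show ?thesis by blast
 qed
 then show ?thesis unfolding hr using hres_gresx[OF T Y] by blast
qed

section \<open>Finite injective dimension\<close>

text \<open>\<open>injective_module\<close> quantifies over one element type only; copies carry the
  extension property to all finitely generated modules.\<close>

lemma injective_extend:
 fixes B :: "('b, 'z) ring_scheme"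
 assumes I: "injective_module B I" and X: "fg_module B X" and Y: "fg_module B Y"
  and f: "f \<in> mod_hom B X Y" "inj_on f (carrier X)" and g: "g \<in> mod_hom B X I"
 shows "\<exists>h\<in>mod_hom B Y I. \<forall>x\<in>carrier X. h (f x) = g x"
proof -
 note lX = fg_lmodule[OF X] and lY = fg_lmodule[OF Y]
 from X obtain X' :: "'b fgm"
  where X': "fg_module B X'" "lmodule B X'" "mod_iso B X X'" "mod_iso B X' X" by (rule copy_exists)
 from Y obtain Y' :: "'b fgm"
  where Y': "fg_module B Y'" "lmodule B Y'" "mod_iso B Y Y'" "mod_iso B Y' Y" by (rule copy_exists)
 from X'(3) lX obtain a a' where a: "a \<in> mod_hom B X X'" "a' \<in> mod_hom B X' X"
  "!!x. x \<in> carrier X ==> a' (a x) = x" "!!x. x \<in> carrier X' ==> a (a' x) = x" by (rule mod_isoE) (rule that)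
 from Y'(3) lY obtain b b' where b: "b \<in> mod_hom B Y Y'" "b' \<in> mod_hom B Y' Y"
  "!!x. x \<in> carrier Y ==> b' (b x) = x" "!!x. x \<in> carrier Y' ==> b (b' x) = x" by (rule mod_isoE) (rule that)
 have fh: "(%x. b (f (a' x))) \<in> mod_hom B X' Y'"
  by (rule mod_hom_comp[OF mod_hom_comp[OF a(2) f(1)] b(1)])
 have gh: "(%x. g (a' x)) \<in> mod_hom B X' I" by (rule mod_hom_comp[OF a(2) g])
 have "inj_on (%x. b (f (a' x))) (carrier X')"
  by (rule inj_onI)
    (metis a(4) b(3) f(2) inj_onD mod_homD(1)[OF a(2)] mod_homD(1)[OF f(1)])
 with I X'(1) Y'(1) fh gh obtain h where
  h: "h \<in> mod_hom B Y' I" "\<forall>x\<in>carrier X'. h (b (f (a' x))) = g (a' x)"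
  unfolding injective_module_def by metis
 show ?thesis
 proof (rule bexI[OF _ mod_hom_comp[OF b(1) h(1)]], rule ballI)
  fix x assume x: "x \<in> carrier X"
  then show "h (b (f x)) = g x" using h(2) mod_homD(1)[OF a(1) x] a(3)[OF x] by metis
 qed
qed

lemma injective_iso:
 assumes I: "injective_module B I" and iso: "mod_iso B I J" "lmodule B J"
 shows "injective_module B J"
 unfolding injective_module_def
proof (intro conjI allI impI iso(2))
 fix X Y :: "'a fgm" and f g
 assume *: "fg_module B X & fg_module B Y & f \<in> mod_hom B X Y & inj_on f (carrier X) & g \<in> mod_hom B X J"
 have lI: "lmodule B I" using I by (simp add: injective_module_def)
 from iso(1) lI obtain a a' where a: "a \<in> mod_hom B I J" "a' \<in> mod_hom B J I"
  "!!x. x \<in> carrier I ==> a' (a x) = x" "!!x. x \<in> carrier J ==> a (a' x) = x" by (rule mod_isoE) (rule that)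
 from * have g: "g \<in> mod_hom B X J" by simp
 from injective_extend[OF I, of X Y f] * mod_hom_comp[OF g a(2)] obtain h where
  h: "h \<in> mod_hom B Y I" "\<forall>x\<in>carrier X. h (f x) = a' (g x)" by blast
 show "\<exists>h\<in>mod_hom B Y J. \<forall>x\<in>carrier X. h (f x) = g x"
  by (rule bexI[OF _ mod_hom_comp[OF h(1) a(1)]]) (use h(2) a(4) mod_homD(1)[OF g] in simp)
qed

lemma injective_prod_mod:
 assumes I: "injective_module B I" and J: "injective_module B J"
 shows "injective_module B (prod_mod I J)"
 unfolding injective_module_def
proof (intro conjI allI impI)
 show "lmodule B (prod_mod I J)"
  using I J by (intro lmodule_prod_mod) (auto simp: injective_module_def)
 fix X Y :: "'a fgm" and f g
 assume *: "fg_module B X & fg_module B Y & f \<in> mod_hom B X Y & inj_on f (carrier X) &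
  g \<in> mod_hom B X (prod_mod I J)"
 then have g: "g \<in> mod_hom B X (prod_mod I J)" by simp
 from injective_extend[OF I, of X Y f] * mod_hom_comp[OF g fst_mod_hom] obtain h where
  h: "h \<in> mod_hom B Y I" "\<forall>x\<in>carrier X. h (f x) = fst (g x)" by blast
 from injective_extend[OF J, of X Y f] * mod_hom_comp[OF g snd_mod_hom] obtain k where
  k: "k \<in> mod_hom B Y J" "\<forall>x\<in>carrier X. k (f x) = snd (g x)" by blast
 show "\<exists>h\<in>mod_hom B Y (prod_mod I J). \<forall>x\<in>carrier X. h (f x) = g x"
  by (rule bexI[OF _ pair_mod_hom[OF h(1) k(1)]]) (use h(2) k(2) in simp)
qed

lemma injective_zero:
 assumes "lmodule B I" "carrier I = {zero I}"
 shows "injective_module B I"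
 unfolding injective_module_def
proof (intro conjI allI impI assms(1))
 fix X Y :: "'a fgm" and f g
 assume *: "fg_module B X & fg_module B Y & f \<in> mod_hom B X Y & inj_on f (carrier X) & g \<in> mod_hom B X I"
 then have "g \<in> mod_hom B X I" by simp
 from mod_homD(1)[OF this] assms(2) show "\<exists>h\<in>mod_hom B Y I. \<forall>x\<in>carrier X. h (f x) = g x"
  by (intro bexI[OF _ mod_hom_const_zero[OF assms(1)]]) auto
qed

text \<open>\<open>idim B r Y\<close>: \<open>Y\<close> has an injective resolution of length less than \<open>r\<close>.\<close>

primrec idim :: "('b, 'z) ring_scheme => nat => 'b fgm => bool" where
 "idim B 0 Y \<longleftrightarrow> lmodule B Y & carrier Y = {zero Y}"
| "idim B (Suc r) Y \<longleftrightarrow> (\<exists>(I :: 'b fgm) f (Q :: 'b fgm) p.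
   fg_module B I & injective_module B I & ses B Y f I p Q & idim B r Q)"

definition idimx :: "('b, 'z) ring_scheme => nat => ('b, 'y) module => bool" where
 "idimx B r Y \<longleftrightarrow> lmodule B Y &
   (\<exists>Y' :: 'b fgm. mod_iso B Y Y' & lmodule B Y' & idim B r Y')"

lemma idimx_lmodule: "idimx B r Y ==> lmodule B Y"
 by (simp add: idimx_def)

lemma idimx_iso: "idimx B r X ==> mod_iso B X Y ==> lmodule B Y ==> idimx B r Y"
 unfolding idimx_def using mod_iso_sym mod_iso_trans by metis

lemma idim_iso:
 assumes "idim B r X" "mod_iso B X Y" "lmodule B Y"
 shows "idim B r Y"
proof (cases r)
 case 0
 with assms mod_iso_zero show ?thesis by auto
next
 case (Suc n)
 with assms(1) obtain I Q :: "'a fgm" and f p where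
  I: "fg_module B I" "injective_module B I" "ses B X f I p Q" "idim B n Q" by auto
 from ses_iso[OF I(3) assms(2) mod_iso_refl mod_iso_refl assms(3) sesD(2,3)[OF I(3)]]
 show ?thesis unfolding Suc idim.simps using I(1,2,4) by blast
qed

lemma idimx_copy: "idimx B r Y \<longleftrightarrow> lmodule B Y & idim B r Y"
 for Y :: "'b fgm"
 unfolding idimx_def using idim_iso mod_iso_sym mod_iso_refl by metis

lemma idimx_0: "idimx B 0 X \<longleftrightarrow> lmodule B X & carrier X = {zero X}"
proof
 assume "idimx B 0 X"
 then show "lmodule B X & carrier X = {zero X}"
  unfolding idimx_def using mod_iso_sym mod_iso_zero by (metis idim.simps(1))
next
 assume X: "lmodule B X & carrier X = {zero X}"
 then have "fg_module B X" by (intro zero_fg) auto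
 then obtain X' :: "'a fgm"
  where X': "fg_module B X'" "lmodule B X'" "mod_iso B X X'" "mod_iso B X' X" by (rule copy_exists)
 then show "idimx B 0 X" unfolding idimx_def using X mod_iso_zero by (metis idim.simps(1))
qed

lemma idimx_Suc:
 fixes B :: "('b, 'z) ring_scheme"
 assumes I: "fg_module B I" "injective_module B I" and s: "ses B Y f I p Q" and Q: "idimx B r Q"
  and B: "left_noetherian B"
 shows "idimx B (Suc r) Y"
proof -
 note s' = sesD[OF s]
 from ses_fg_sub[OF B s I(1)] obtain Y' :: "'b fgm"
  where Y': "fg_module B Y'" "lmodule B Y'" "mod_iso B Y Y'" "mod_iso B Y' Y" by (rule copy_exists)
 from I(1) obtain I' :: "'b fgm"
  where I': "fg_module B I'" "lmodule B I'" "mod_iso B I I'" "mod_iso B I' I" by (rule copy_exists)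
 from Q obtain Q' :: "'b fgm" where Q': "mod_iso B Q Q'" "lmodule B Q'" "idim B r Q'"
  by (auto simp: idimx_def)
 from ses_iso[OF s Y'(3) I'(3) Q'(1) Y'(2) I'(2) Q'(2)] have "idim B (Suc r) Y'"
  using I'(1) injective_iso[OF I(2) I'(3,2)] Q'(3) by auto
 then show ?thesis unfolding idimx_def using Y' s'(1) by blast
qed

lemma idimx_SucE:
 assumes "idimx B (Suc r) Y"
 obtains I Q :: "'b fgm" and f p where
  "fg_module (B :: ('b, 'z) ring_scheme) I" "injective_module B I" "ses B Y f I p Q" "idimx B r Q"
proof -
 from assms obtain Y' :: "'b fgm" where Y': "mod_iso B Y Y'" "lmodule B Y'"
  "idim B (Suc r) Y'" and Y: "lmodule B Y" unfolding idimx_def by blast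
 from Y'(3) obtain I Q :: "'b fgm" and f p where
  I: "fg_module B I" "injective_module B I" "ses B Y' f I p Q" "idim B r Q" by auto
 note l = sesD(2,3)[OF I(3)]
 from ses_iso[OF I(3) mod_iso_sym[OF Y'(1) Y] mod_iso_refl mod_iso_refl Y l] obtain f' p' where
  "ses B Y f' I p' Q" by blast
 moreover have "idimx B r Q" unfolding idimx_copy using I(4) l by blast
 ultimately show thesis using I(1,2) that by blast
qed

lemma idimx_fg:
 assumes "left_noetherian B" "idimx B r Y"
 shows "fg_module B Y"
proof (cases r)
 case 0
 with assms(2) show ?thesis by (auto simp: idimx_0 intro: zero_fg)
next
 case (Suc n)
 from assms(2)[unfolded Suc] obtain I Q :: "'a fgm" and f p where
  "fg_module B I" "ses B Y f I p Q" by (rule idimx_SucE) 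
 then show ?thesis using ses_fg_sub[OF assms(1)] by blast
qed

lemma idimx_injective:
 assumes B: "left_noetherian B" and I: "fg_module B I" "injective_module B I"
 shows "idimx B (Suc 0) I"
proof -
 note l = fg_lmodule[OF I(1)]
 note K = submodule_carrier[OF l]
 let ?Q = "quot_module I (carrier I)"
 note q = quot_module_projection[OF l K]
 have z: "carrier ?Q = {zero ?Q}"
 proof -
  have "x = zero ?Q" if "x \<in> carrier ?Q" for x
  proof -
   from that obtain y where "y \<in> carrier I" "x = carrier I +>\<^bsub>I\<^esub> y" unfolding q(3)[symmetric] by blast
   then show ?thesis using q(4)[of y] by simp
  qed
  then show ?thesis using submoduleD(2)[OF submodule_carrier[OF q(1)]] by blast
 qed
 have "ses B I (%x. x) I (%x. carrier I +>\<^bsub>I\<^esub> x) ?Q" using ses_quot_module[OF l K] by simp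
 then show ?thesis using q(1) z by (intro idimx_Suc[OF I _ _ B]) (auto simp: idimx_0)
qed

lemma idim_mono:
 assumes B: "left_noetherian B"
 shows "idim B r Y ==> idim B (Suc r) Y"
proof (induction r arbitrary: Y)
 case 0
 then have "idimx B (Suc 0) Y" by (intro idimx_injective[OF B] zero_fg injective_zero) auto
 then show ?case by (simp only: idimx_copy)
next
 case (Suc r)
 then obtain I Q :: "'a fgm" and f p where
  I: "fg_module B I" "injective_module B I" "ses B Y f I p Q" "idim B r Q" by auto
 from I(1-3) Suc.IH[OF I(4)] show ?case unfolding idim.simps(2)[of B "Suc r"] by blast
qed

lemma idimx_mono: "left_noetherian B ==> idimx B r Y ==> idimx B (Suc r) Y"
 unfolding idimx_def using idim_mono by metis

lemma idimx_le:
 assumes "left_noetherian B" "r \<le> t" "idimx B r Y"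
 shows "idimx B t Y"
 using assms(2) by (induction rule: dec_induct) (use assms idimx_mono in blast)+

section \<open>Injective dimension in short exact sequences\<close>

lemma ses_cokernel:
 assumes Y: "lmodule B Y" and P: "lmodule B P" and e: "e \<in> mod_hom B Y P" "inj_on e (carrier Y)"
 shows "ses B Y e P (%x. e ` carrier Y +>\<^bsub>P\<^esub> x) (quot_module P (e ` carrier Y))"
proof -
 note N = submodule_image[OF Y P e(1) submodule_carrier[OF Y]]
 note W = quot_module_projection[OF P N]
 have "e ` carrier Y = a_kernel P (quot_module P (e ` carrier Y)) (%x. e ` carrier Y +>\<^bsub>P\<^esub> x)"
  unfolding a_kernel_eq using W(4) submoduleD(1)[OF N] by blast
 with Y P e W(1-3) show ?thesis unfolding ses_def by blast
qed

text \<open>The dual horseshoe: \<open>Y\<close> embeds into the product of \<open>I\<close> and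
  \<open>J\<close> by an extension of \<open>a\<close> to \<open>Y\<close> and by \<open>b\<close>
  after \<open>g\<close>. That the cokernels form an exact sequence is the snake lemma, carried out
  on elements.\<close>

lemma coproduct_horseshoe:
 fixes X :: "('b, 'x) module" and Y :: "('b, 'y) module" and Z :: "('b, 'w) module"
  and I :: "('b, 'i) module" and J :: "('b, 'j) module"
 assumes s: "ses B X f Y g Z" and I: "ses B X a I p Q" and J: "ses B Z b J q R"
  and a': "a' \<in> mod_hom B Y I" "!!x. x \<in> carrier X ==> a' (f x) = a x"
 shows "\<exists>e w u v. ses B Y e (prod_mod I J) w (quot_module (prod_mod I J) (e ` carrier Y)) &
  ses B Q u (quot_module (prod_mod I J) (e ` carrier Y)) v R"
proof -
 note s' = sesD[OF s] and I' = sesD[OF I] and J' = sesD[OF J]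
 interpret I: lmodule B I by (rule I'(2))
 interpret J: lmodule B J by (rule J'(2))
 interpret Z: lmodule B Z by (rule s'(3))
 let ?e = "%y. (a' y, b (g y))"
 let ?P = "prod_mod I J"
 let ?W = "quot_module ?P (?e ` carrier Y)"
 note P = lmodule_prod_mod[OF I'(2) J'(2)]
 have bg: "(%y. b (g y)) \<in> mod_hom B Y J" by (rule mod_hom_comp[OF s'(6) J'(4)])
 have e: "?e \<in> mod_hom B Y ?P" by (rule pair_mod_hom[OF a'(1) bg])
 note cl = mod_homD(1)[OF s'(4)] mod_homD(1)[OF s'(6)] mod_homD(1)[OF J'(4)] mod_homD(1)[OF a'(1)]
  mod_homD(1)[OF I'(4)] mod_homD(1)[OF I'(6)] mod_homD(1)[OF J'(6)]
 have bz: "b z = zero J \<longleftrightarrow> z = zero Z" if "z \<in> carrier Z" for z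
  using that inj_on_mod_hom[OF s'(3) J'(2,4)] J'(5) mod_hom_zero[OF J'(4) s'(3) J'(2)] by blast
 have az: "a x = zero I \<longleftrightarrow> x = zero X" if "x \<in> carrier X" for x
  using that inj_on_mod_hom[OF s'(1) I'(2,4)] I'(5) mod_hom_zero[OF I'(4) s'(1) I'(2)] by blast
 have einj: "inj_on ?e (carrier Y)"
  unfolding inj_on_mod_hom[OF s'(2) P e]
 proof (intro ballI impI)
  fix y assume y: "y \<in> carrier Y" "?e y = zero ?P"
  then have "g y = zero Z" using bz cl by simp
  with s y(1) obtain x where x: "x \<in> carrier X" "y = f x" by (rule ses_kernelE)
  then have "a x = zero I" using y(2) a'(2) by simp
  then show "y = zero Y" using x az mod_hom_zero[OF s'(4,1,2)] by simp
 qed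
 note N = submodule_image[OF s'(2) P e submodule_carrier[OF s'(2)]]
 define w where "w = (%x. ?e ` carrier Y +>\<^bsub>?P\<^esub> x)"
 note W = quot_module_projection[OF P N, folded w_def]
 note sw = ses_cokernel[OF s'(2) P e einj, folded w_def]
 interpret W: lmodule B ?W by (rule W(1))
 have "\<exists>v\<in>mod_hom B ?W R. \<forall>x\<in>carrier ?P. v (w x) = q (snd x)"
 proof (rule mod_hom_factor[OF P W(1) J'(3) W(2,3) mod_hom_comp[OF snd_mod_hom J'(6)]])
  fix x assume "x \<in> carrier ?P" "w x = zero ?W"
  then obtain y where "y \<in> carrier Y" "x = ?e y" using W(4) by blast
  then show "q (snd x) = zero R" using ses_comp_zero[OF J] cl by simp
 qed
 then obtain v where v: "v \<in> mod_hom B ?W R" "\<forall>x\<in>carrier ?P. v (w x) = q (snd x)" by blast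
 have i: "(%i. (i, zero J)) \<in> mod_hom B I ?P"
  by (rule pair_mod_hom[OF mod_hom_id mod_hom_const_zero[OF J'(2)]])
 have wi: "w (i, zero J) = zero ?W \<longleftrightarrow> p i = zero Q" if i: "i \<in> carrier I" for i
 proof
  assume "p i = zero Q"
  with I i obtain x where x: "x \<in> carrier X" "i = a x" by (rule ses_kernelE)
  have eq: "?e (f x) = (i, zero J)"
   using x a'(2) ses_comp_zero[OF s x(1)] mod_hom_zero[OF J'(4) s'(3) J'(2)] by simp
  have "(i, zero J) \<in> ?e ` carrier Y" using eq[symmetric] cl(1)[OF x(1)] by (rule image_eqI)
  then show "w (i, zero J) = zero ?W" using W(4)[of "(i, zero J)"] i by simp
 next
  assume "w (i, zero J) = zero ?W"
  then obtain y where y: "y \<in> carrier Y" "i = a' y" "b (g y) = zero J"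
   using W(4)[of "(i, zero J)"] i by auto
  then have "g y = zero Z" using bz cl by simp
  with s y(1) obtain x where "x \<in> carrier X" "y = f x" by (rule ses_kernelE)
  then show "p i = zero Q" using y(2) a'(2) ses_comp_zero[OF I] by simp
 qed
 have "\<exists>u\<in>mod_hom B Q ?W. \<forall>i\<in>carrier I. u (p i) = w (i, zero J)"
  by (rule mod_hom_factor[OF I'(2,3) W(1) I'(6,7) mod_hom_comp[OF i W(2)]]) (simp add: wi)
 then obtain u where u: "u \<in> mod_hom B Q ?W" "\<forall>i\<in>carrier I. u (p i) = w (i, zero J)" by blast
 have "ses B Q u ?W v R"
  unfolding ses_def
 proof (intro conjI I'(3) W(1) J'(3) u(1) v(1))
  show "inj_on u (carrier Q)"
   unfolding inj_on_mod_hom[OF I'(3) W(1) u(1)]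
  proof (intro ballI impI)
   fix x assume x: "x \<in> carrier Q" "u x = zero ?W"
   from x(1) obtain i where "i \<in> carrier I" "x = p i" unfolding I'(7)[symmetric] by blast
   then show "x = zero Q" using x(2) u(2) wi by simp
  qed
  show "v ` carrier ?W = carrier R"
  proof (intro equalityI subsetI)
   fix x assume "x \<in> carrier R"
   then obtain j where j: "j \<in> carrier J" "x = q j" unfolding J'(7)[symmetric] by blast
   then have "(zero I, j) \<in> carrier ?P" by simp
   then show "x \<in> v ` carrier ?W"
    using j v(2) mod_homD(1)[OF W(2)] by (intro image_eqI[of _ v "w (zero I, j)"]) auto
  qed (use mod_homD(1)[OF v(1)] in auto)
  show "u ` carrier Q = a_kernel ?W R v"
  proof (intro equalityI subsetI)
   fix x assume "x \<in> u ` carrier Q"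
   then obtain y where y: "y \<in> carrier Q" "x = u y" by blast
   from y(1) obtain i where i: "i \<in> carrier I" "y = p i" unfolding I'(7)[symmetric] by blast
   have "v x = q (zero J)" using y i u(2) v(2) by simp
   then show "x \<in> a_kernel ?W R v"
    using y mod_homD(1)[OF u(1)] mod_hom_zero[OF J'(6,2,3)] by (simp add: a_kernel_eq)
  next
   fix x assume "x \<in> a_kernel ?W R v"
   then have x: "x \<in> carrier ?W" "v x = zero R" by (auto simp: a_kernel_eq)
   from x(1) obtain ij where "ij \<in> carrier ?P" "x = w ij" unfolding W(3)[symmetric] by blast
   then obtain i j where ij: "i \<in> carrier I" "j \<in> carrier J" "x = w (i, j)" by auto
   then have "q j = zero R" using x(2) v(2) by simp
   with J ij(2) obtain z where z: "z \<in> carrier Z" "j = b z" by (rule ses_kernelE)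
   from z(1) obtain y where y: "y \<in> carrier Y" "z = g y" unfolding s'(7)[symmetric] by blast
   \<comment> \<open>Subtracting the image of \<open>y\<close> removes the
     \<open>J\<close>-component without changing the class in \<open>?W\<close>, so this class comes
     from \<open>I\<close>.\<close>
   let ?i = "msub B I i (a' y)"
   have ic: "?i \<in> carrier I" using ij y cl by simp
   have eq: "msub B ?P (i, j) (?e y) = (?i, zero J)"
    using z y cl ij J.msub_eq_zero[of j j] by (simp add: msub_def)
   have "w (?e y) = zero ?W" using W(4)[of "?e y"] y cl by auto
   then have "w (?i, zero J) = w (i, j)"
    unfolding eq[symmetric] using ij y cl mod_homD(1)[OF W(2), of "(i, j)"]
    by (simp add: mod_hom_msub[OF W(2) P] W.msub_zero)
   then have "x = u (p ?i)" using ij(3) u(2) ic by simp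
   then show "x \<in> u ` carrier Q" using cl(6)[OF ic] by blast
  qed
 qed
 with sw show ?thesis by blast
qed

lemma idim_ext:
 fixes B :: "('b, 'z) ring_scheme" and X Y Z :: "'b fgm"
 assumes B: "left_noetherian B"
 shows "ses B X f Y g Z ==> idim B n X ==> idim B n Z ==> idim B n Y"
proof (induction n arbitrary: X Y Z f g)
 case 0
 then show ?case using ses_zero_middle[OF 0(1)] sesD(2)[OF 0(1)] by simp
next
 case (Suc n)
 note s = Suc.prems(1)
 note s' = sesD[OF s]
 have gX: "idimx B (Suc n) X" "idimx B (Suc n) Z"
  unfolding idimx_copy using s'(1,3) Suc.prems(2,3) by auto
 note fg = idimx_fg[OF B gX(1)] idimx_fg[OF B gX(2)]
 from gX(1) obtain I Q :: "'b fgm" and a p where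
  I: "fg_module B I" "injective_module B I" "ses B X a I p Q" "idimx B n Q" by (rule idimx_SucE)
 from gX(2) obtain J R :: "'b fgm" and b q where
  J: "fg_module B J" "injective_module B J" "ses B Z b J q R" "idimx B n R" by (rule idimx_SucE)
 from injective_extend[OF I(2) fg(1) ses_fg_middle[OF s fg] s'(4,5) sesD(4)[OF I(3)]]
 obtain a' where a': "a' \<in> mod_hom B Y I" "!!x. x \<in> carrier X ==> a' (f x) = a x" by blast
 from coproduct_horseshoe[OF s I(3) J(3) a'] obtain e w u v where
  e: "ses B Y e (prod_mod I J) w (quot_module (prod_mod I J) (e ` carrier Y))"
  and u: "ses B Q u (quot_module (prod_mod I J) (e ` carrier Y)) v R" by blast
 let ?W = "quot_module (prod_mod I J) (e ` carrier Y)"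
 have fP: "fg_module B (prod_mod I J)" by (rule fg_prod_mod[OF I(1) J(1)])
 from ses_fg_quotient[OF e fP] obtain W :: "'b fgm" where
  W: "fg_module B W" "lmodule B W" "mod_iso B ?W W" "mod_iso B W ?W" by (rule copy_exists)
 from ses_iso[OF u mod_iso_refl W(3) mod_iso_refl sesD(1)[OF u] W(2) sesD(3)[OF u]] obtain u' v' where
  "ses B Q u' W v' R" by blast
 from Suc.IH[OF this] I(4) J(4) have "idim B n W" by (simp only: idimx_copy)
 then have "idimx B n W" using W(2) by (simp only: idimx_copy)
 then have "idimx B n ?W" using W(4) sesD(3)[OF e] by (rule idimx_iso)
 from idimx_Suc[OF fP injective_prod_mod[OF I(2) J(2)] e this B]
 show ?case by (simp only: idimx_copy)
qed

lemma idimx_ext: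
 assumes B: "left_noetherian B"
  and s: "ses B X f Y g Z" and X: "idimx B n X" and Z: "idimx B n Z"
 shows "idimx B n Y"
proof -
 from X obtain X' :: "'a fgm" where X': "mod_iso B X X'" "lmodule B X'" "idim B n X'"
  by (auto simp: idimx_def)
 from Z obtain Z' :: "'a fgm" where Z': "mod_iso B Z Z'" "lmodule B Z'" "idim B n Z'"
  by (auto simp: idimx_def)
 from ses_fg_middle[OF s idimx_fg[OF B X] idimx_fg[OF B Z]]
 obtain Y' :: "'a fgm" where Y': "fg_module B Y'" "lmodule B Y'" "mod_iso B Y Y'"
  "mod_iso B Y' Y" by (rule copy_exists)
 from ses_iso[OF s X'(1) Y'(3) Z'(1) X'(2) Y'(2) Z'(2)] obtain f' g'
  where "ses B X' f' Y' g' Z'" by blast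
 from idim_ext[OF B this X'(3) Z'(3)] show ?thesis
  unfolding idimx_def using Y' sesD(2)[OF s] by blast
qed

text \<open>For submodules \<open>X\<close> inside \<open>Y\<close> inside \<open>I\<close> this is
  \<open>0 -> Y/X -> I/X -> I/Y -> 0\<close>, the third isomorphism theorem written with
  sequences.\<close>

lemma ses_pushout_cokernel:
 assumes s: "ses B X f Y g Z" and I: "ses B Y b I p Q"
 shows "\<exists>w u v. ses B X (%x. b (f x)) I w (quot_module I ((%x. b (f x)) ` carrier X)) &
  ses B Z u (quot_module I ((%x. b (f x)) ` carrier X)) v Q"
proof -
 note s' = sesD[OF s] and I' = sesD[OF I]
 let ?e = "%x. b (f x)"
 let ?W = "quot_module I (?e ` carrier X)"
 have e: "?e \<in> mod_hom B X I" by (rule mod_hom_comp[OF s'(4) I'(4)])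
 note cl = mod_homD(1)[OF s'(4)] mod_homD(1)[OF s'(6)] mod_homD(1)[OF I'(4)] mod_homD(1)[OF I'(6)]
 note N = submodule_image[OF s'(1) I'(2) e submodule_carrier[OF s'(1)]]
 define w where "w = (%x. ?e ` carrier X +>\<^bsub>I\<^esub> x)"
 note W = quot_module_projection[OF I'(2) N, folded w_def]
 have "inj_on ?e (carrier X)"
  using s'(5) I'(5) cl(1) by (auto simp: inj_on_def)
 note sw = ses_cokernel[OF s'(1) I'(2) e this, folded w_def]
 have "\<exists>v\<in>mod_hom B ?W Q. \<forall>x\<in>carrier I. v (w x) = p x"
 proof (rule mod_hom_factor[OF I'(2) W(1) I'(3) W(2,3) I'(6)])
  fix x assume "x \<in> carrier I" "w x = zero ?W"
  then obtain y where "y \<in> carrier X" "x = ?e y" using W(4) by blast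
  then show "p x = zero Q" using ses_comp_zero[OF I] cl by simp
 qed
 then obtain v where v: "v \<in> mod_hom B ?W Q" "\<forall>x\<in>carrier I. v (w x) = p x" by blast
 have wb: "w (b y) = zero ?W \<longleftrightarrow> g y = zero Z" if y: "y \<in> carrier Y" for y
 proof
  assume "g y = zero Z"
  with s y obtain x where "x \<in> carrier X" "y = f x" by (rule ses_kernelE)
  then show "w (b y) = zero ?W" using W(4)[of "b y"] cl by simp
 next
  assume "w (b y) = zero ?W"
  then obtain x where x: "x \<in> carrier X" "b y = b (f x)" using W(4)[of "b y"] y cl by auto
  then have "y = f x" using I'(5) y cl by (auto dest: inj_onD)
  then show "g y = zero Z" using ses_comp_zero[OF s x(1)] by simp
 qed
 have "\<exists>u\<in>mod_hom B Z ?W. \<forall>y\<in>carrier Y. u (g y) = w (b y)"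
  by (rule mod_hom_factor[OF s'(2,3) W(1) s'(6,7) mod_hom_comp[OF I'(4) W(2)]]) (simp add: wb)
 then obtain u where u: "u \<in> mod_hom B Z ?W" "\<forall>y\<in>carrier Y. u (g y) = w (b y)" by blast
 have "ses B Z u ?W v Q"
  unfolding ses_def
 proof (intro conjI s'(3) W(1) I'(3) u(1) v(1))
  show "inj_on u (carrier Z)"
   unfolding inj_on_mod_hom[OF s'(3) W(1) u(1)]
  proof (intro ballI impI)
   fix z assume z: "z \<in> carrier Z" "u z = zero ?W"
   from z(1) obtain y where "y \<in> carrier Y" "z = g y" unfolding s'(7)[symmetric] by blast
   then show "z = zero Z" using z(2) u(2) wb by simp
  qed
  show "v ` carrier ?W = carrier Q"
  proof (intro equalityI subsetI)
   fix x assume "x \<in> carrier Q"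
   then obtain j where "j \<in> carrier I" "x = p j" unfolding I'(7)[symmetric] by blast
   then show "x \<in> v ` carrier ?W"
    using v(2) mod_homD(1)[OF W(2)] by (intro image_eqI[of _ v "w j"]) auto
  qed (use mod_homD(1)[OF v(1)] in auto)
  show "u ` carrier Z = a_kernel ?W Q v"
  proof (intro equalityI subsetI)
   fix x assume "x \<in> u ` carrier Z"
   then obtain z where z: "z \<in> carrier Z" "x = u z" by blast
   from z(1) obtain y where y: "y \<in> carrier Y" "z = g y" unfolding s'(7)[symmetric] by blast
   have "v x = p (b y)" using y z u(2) v(2) cl by simp
   then show "x \<in> a_kernel ?W Q v"
    using z mod_homD(1)[OF u(1)] ses_comp_zero[OF I y(1)] by (simp add: a_kernel_eq)
  next
   fix x assume "x \<in> a_kernel ?W Q v"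
   then have x: "x \<in> carrier ?W" "v x = zero Q" by (auto simp: a_kernel_eq)
   from x(1) obtain i where i: "i \<in> carrier I" "x = w i" unfolding W(3)[symmetric] by blast
   then have "p i = zero Q" using x(2) v(2) by simp
   with I i(1) obtain y where y: "y \<in> carrier Y" "i = b y" by (rule ses_kernelE)
   then have "x = u (g y)" using i(2) u(2) by simp
   then show "x \<in> u ` carrier Z" using cl(2)[OF y(1)] by blast
  qed
 qed
 with sw show ?thesis by blast
qed

text \<open>An injective \<open>I\<close> containing \<open>Y\<close> also contains
  \<open>X\<close>, and \<open>I/X\<close> is an extension of \<open>I/Y\<close> by
  \<open>Z\<close>; both have resolutions of the required length.\<close>

lemma idimx_sub:
 assumes B: "left_noetherian B"
  and s: "ses B X f Y g Z" and Y: "idimx B n Y" and Z: "idimx B n Z"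
 shows "idimx B (Suc n) X"
proof (cases n)
 case 0
 have "carrier X = {zero X}"
 proof -
  have "x = zero X" if "x \<in> carrier X" for x
  proof -
   have "f x = zero Y" using mod_homD(1)[OF sesD(4)[OF s] that] Y 0 by (simp add: idimx_0)
   then show ?thesis using inj_on_mod_hom[OF sesD(1)[OF s] sesD(2)[OF s] sesD(4)[OF s]] sesD(5)[OF s] that
    by blast
  qed
  with submoduleD(2)[OF submodule_carrier[OF sesD(1)[OF s]]] show ?thesis by blast
 qed
 then have "idimx B 0 X" using sesD(1)[OF s] by (simp add: idimx_0)
 then show ?thesis unfolding 0 by (rule idimx_mono[OF B])
next
 case (Suc m)
 from Y[unfolded Suc] obtain I Q :: "'a fgm" and b p where
  I: "fg_module B I" "injective_module B I" "ses B Y b I p Q" "idimx B m Q" by (rule idimx_SucE)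
 from ses_pushout_cokernel[OF s I(3)] obtain w u v where
  w: "ses B X (%x. b (f x)) I w (quot_module I ((%x. b (f x)) ` carrier X))" and
  u: "ses B Z u (quot_module I ((%x. b (f x)) ` carrier X)) v Q" by blast
 have "idimx B n Q" unfolding Suc by (rule idimx_mono[OF B I(4)])
 from idimx_ext[OF B u Z this] show ?thesis by (intro idimx_Suc[OF I(1,2) w _ B])
qed

section \<open>Comparison with injective resolutions as sequences\<close>

theorem inj_dim_le_imp_idimx:
 fixes B :: "('b, 'z) ring_scheme"
 assumes B: "left_noetherian B" and M: "lmodule B M" and r: "inj_dim_le B M r"
 shows "idimx B (Suc r) M"
proof -
 from r obtain I :: "nat => 'b fgm" and e d where
  I: "!!j. j \<le> r ==> fg_module B (I j)" "!!j. j \<le> r ==> injective_module B (I j)" and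
  e: "e \<in> mod_hom B M (I 0)" "inj_on e (carrier M)" and
  d: "!!j. j < r ==> d j \<in> mod_hom B (I j) (I (Suc j))" and
  z: "e ` carrier M = (if 0 < r then a_kernel (I 0) (I (Suc 0)) (d 0) else carrier (I 0))"
  "!!j. j < r ==> d j ` carrier (I j) =
   (if Suc j < r then a_kernel (I (Suc j)) (I (Suc (Suc j))) (d (Suc j)) else carrier (I (Suc j)))"
  unfolding inj_dim_le_def Let_def by auto
 let ?Z = "%j. if j < r then a_kernel (I j) (I (Suc j)) (d j) else carrier (I j)"
 have sub: "submodule (?Z j) B (I j)" if "j \<le> r" for j
 proof (cases "j < r")
  case True
  then show ?thesis using submodule_kernel[OF fg_lmodule fg_lmodule d] I(1) by simp
 next
  case False
  then show ?thesis using submodule_carrier[OF fg_lmodule[OF I(1)[OF that]]] by simp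
 qed
 \<comment> \<open>The resolution is read from its right end: the cocycles at place
   \<open>r - k\<close> are resolved by the \<open>k + 1\<close> terms from there on. A resolution
   of dimension \<open>r\<close> has \<open>r + 1\<close> injective terms, whence
   \<open>Suc\<close>.\<close>
 have *: "idimx B (Suc k) ((I (r - k))\<lparr>carrier := ?Z (r - k)\<rparr>)" if "k \<le> r" for k
  using that
 proof (induction k)
  case 0
  then show ?case using idimx_injective[OF B I] by simp
 next
  case (Suc k)
  let ?j = "r - Suc k"
  have j: "?j < r" "Suc ?j = r - k" "?j \<le> r" "Suc ?j \<le> r" using Suc.prems by auto
  have dj: "d ?j \<in> mod_hom B (I ?j) ((I (Suc ?j))\<lparr>carrier := ?Z (Suc ?j)\<rparr>)"
   by (rule mod_hom_restrict_cod[OF d[OF j(1)]]) (simp add: z(2)[OF j(1)])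
  have lZ: "lmodule B ((I (Suc ?j))\<lparr>carrier := ?Z (Suc ?j)\<rparr>)"
   by (rule lmodule_restrict[OF fg_lmodule[OF I(1)[OF j(4)]] sub[OF j(4)]])
  have "a_kernel (I ?j) ((I (Suc ?j))\<lparr>carrier := ?Z (Suc ?j)\<rparr>) (d ?j) = ?Z ?j"
   using j(1) by (simp add: a_kernel_eq)
  with ses_kernel[OF fg_lmodule[OF I(1)[OF j(3)]] lZ dj] z(2)[OF j(1)]
  have "ses B ((I ?j)\<lparr>carrier := ?Z ?j\<rparr>) (%x. x) (I ?j) (d ?j) ((I (Suc ?j))\<lparr>carrier := ?Z (Suc ?j)\<rparr>)"
   by simp
  moreover have "idimx B (Suc k) ((I (Suc ?j))\<lparr>carrier := ?Z (Suc ?j)\<rparr>)"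
   unfolding j(2) using Suc by simp
  ultimately show ?case by (rule idimx_Suc[OF I(1)[OF j(3)] I(2)[OF j(3)] _ _ B])
 qed
 have eZ: "e \<in> mod_hom B M ((I 0)\<lparr>carrier := ?Z 0\<rparr>)" "e ` carrier M = ?Z 0"
  using mod_hom_restrict_cod[OF e(1)] z(1) by auto
 have lZ: "lmodule B ((I 0)\<lparr>carrier := ?Z 0\<rparr>)"
  by (rule lmodule_restrict[OF fg_lmodule[OF I(1)] sub]) auto
 have "mod_iso B M ((I 0)\<lparr>carrier := ?Z 0\<rparr>)"
  by (rule mod_iso_bij[OF eZ(1) e(2)]) (simp add: z(1))
 moreover have "idimx B (Suc r) ((I 0)\<lparr>carrier := ?Z 0\<rparr>)"
  using *[OF order_refl] unfolding diff_self_eq_0 .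
 ultimately show ?thesis using idimx_iso mod_iso_sym M by blast
qed

lemma idim_imp_inj_dim_le:
 fixes B :: "('b, 'z) ring_scheme" and Y :: "'b fgm"
 shows "idim B n Y ==> \<exists>r. inj_dim_le B Y r"
proof (induction n arbitrary: Y)
 case 0
 then have Y: "lmodule B Y" "carrier Y = {zero Y}" by auto
 have "inj_dim_le B Y 0"
  unfolding inj_dim_le_def Let_def
  by (rule exI[of _ "%_. Y"], rule exI[of _ "%x. x"])
    (use zero_fg[OF Y] injective_zero[OF Y] mod_hom_id in auto)
 then show ?case by blast
next
 case (Suc n)
 then obtain I0 Q :: "'b fgm" and f p where
  I0: "fg_module B I0" "injective_module B I0" "ses B Y f I0 p Q" "idim B n Q" by auto
 note s = sesD[OF I0(3)]
 from Suc.IH[OF I0(4)] obtain r where "inj_dim_le B Q r" by blast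
 then obtain I :: "nat => 'b fgm" and e d where
  I: "!!j. j \<le> r ==> fg_module B (I j)" "!!j. j \<le> r ==> injective_module B (I j)" and
  e: "e \<in> mod_hom B Q (I 0)" "inj_on e (carrier Q)" and
  d: "!!j. j < r ==> d j \<in> mod_hom B (I j) (I (Suc j))" and
  z: "e ` carrier Q = (if 0 < r then a_kernel (I 0) (I (Suc 0)) (d 0) else carrier (I 0))"
  "!!j. j < r ==> d j ` carrier (I j) =
   (if Suc j < r then a_kernel (I (Suc j)) (I (Suc (Suc j))) (d (Suc j)) else carrier (I (Suc j)))"
  unfolding inj_dim_le_def Let_def by auto
 let ?I = "%j. case j of 0 => I0 | Suc i => I i"
 let ?d = "%j. case j of 0 => (%x. e (p x)) | Suc i => d i"
 have lI: "lmodule B (I 0)" using fg_lmodule[OF I(1)] by simp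
 have ez: "e x = zero (I 0) \<longleftrightarrow> x = zero Q" if "x \<in> carrier Q" for x
  using that inj_on_mod_hom[OF s(3) lI e(1)] e(2) mod_hom_zero[OF e(1) s(3) lI] by blast
 have k: "f ` carrier Y = a_kernel I0 (I 0) (%x. e (p x))"
  unfolding s(8) using ez mod_homD(1)[OF s(6)] by (auto simp: a_kernel_eq)
 have im: "(%x. e (p x)) ` carrier I0 = e ` carrier Q"
  unfolding s(7)[symmetric] by (simp add: image_image)
 have "inj_dim_le B Y (Suc r)"
  unfolding inj_dim_le_def Let_def
 proof (intro exI conjI allI impI)
  fix j
  show "fg_module B (?I j)" "injective_module B (?I j)" if "j \<le> Suc r"
   using that I I0(1,2) by (auto split: nat.split)
  show "f \<in> mod_hom B Y (?I 0)" "inj_on f (carrier Y)" using s by auto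
  show "?d j \<in> mod_hom B (?I j) (?I (Suc j))" if "j < Suc r"
   using that d mod_hom_comp[OF s(6) e(1)] by (auto split: nat.split)
  show "f ` carrier Y = (if 0 < Suc r then a_kernel (?I 0) (?I (Suc 0)) (?d 0) else carrier (?I 0))"
   using k by simp
  show "?d j ` carrier (?I j) = (if Suc j < Suc r then a_kernel (?I (Suc j)) (?I (Suc (Suc j))) (?d (Suc j))
    else carrier (?I (Suc j)))" if "j < Suc r"
   using that z im by (cases j) auto
 qed
 then show ?case by blast
qed

theorem idimx_imp_inj_dim_le:
 assumes "idimx B n M"
 shows "\<exists>r. inj_dim_le B M r"
proof -
 from assms obtain M' :: "'a fgm" where M: "lmodule B M" "mod_iso B M M'"
  "lmodule B M'" "idim B n M'" by (auto simp: idimx_def)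
 from idim_imp_inj_dim_le[OF M(4)] obtain r where r: "inj_dim_le B M' r" by blast
 from M(2) obtain a where a: "a \<in> mod_hom B M M'" "inj_on a (carrier M)" "a ` carrier M = carrier M'"
  by (auto simp: mod_iso_def bij_betw_def)
 from r obtain I :: "nat => 'a fgm" and e d where
  I: "\<forall>j\<le>r. fg_module B (I j) & injective_module B (I j)" and
  e: "e \<in> mod_hom B M' (I 0)" "inj_on e (carrier M')" and
  d: "\<forall>j<r. d j \<in> mod_hom B (I j) (I (Suc j))" and
  z: "let Z = (%j. if j < r then a_kernel (I j) (I (Suc j)) (d j) else carrier (I j))
     in e ` carrier M' = Z 0 & (\<forall>j<r. d j ` carrier (I j) = Z (Suc j))"
  unfolding inj_dim_le_def by blast
 have "(%x. e (a x)) ` carrier M = e ` carrier M'" unfolding a(3)[symmetric] by (simp add: image_image)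
 moreover have "inj_on (%x. e (a x)) (carrier M)"
  using comp_inj_on[OF a(2), of e] e(2) a(3) by (simp add: comp_def)
 ultimately have "inj_dim_le B M r"
  unfolding inj_dim_le_def using I d z mod_hom_comp[OF a(1) e(1)]
  by (intro exI[of _ I] exI[of _ "%x. e (a x)"] exI[of _ d]) simp
 then show ?thesis by blast
qed

section \<open>The standard duality\<close>

text \<open>\<open>c\<close> is taken from an ideal minimal among those not annihilating
  \<open>y\<close>. If \<open>d c y\<close> is nonzero, the principal ideal of \<open>d c\<close> is
  the whole minimal ideal and so contains \<open>c\<close>. The conclusion says that
  \<open>c y\<close> generates a simple module.\<close>

lemma (in artinian_cring) simple_multiple:
 assumes Y: "lmodule R Y" and y: "y \<in> carrier Y" "y ~= zero Y"
 obtains c where "c \<in> carrier R" "c .[Y] y ~= zero Y"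
  "!!d. d \<in> carrier R ==> d .[Y] (c .[Y] y) ~= zero Y ==>
   \<exists>e\<in>carrier R. e .[Y] (d .[Y] (c .[Y] y)) = c .[Y] y"
proof -
 interpret Y: lmodule R Y by fact
 let ?F = "{I. ideal I R & (\<exists>c\<in>I. c .[Y] y ~= zero Y)}"
 have "\<exists>c\<in>carrier R. c .[Y] y ~= zero Y" by (rule bexI[of _ \<one>]) (use y in simp_all)
 then have "carrier R \<in> ?F" using oneideal by simp
 from minimal_ideal[OF this] obtain I where "I \<in> ?F" and min0: "\<forall>J\<in>?F. J \<subseteq> I --> J = I" by blast
 then have I: "ideal I R" "\<exists>c\<in>I. c .[Y] y ~= zero Y" by simp_all
 have min: "!!J. J \<in> ?F ==> J \<subseteq> I ==> J = I" by (rule min0[rule_format])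
 interpret I: ideal I R by (rule I(1))
 from I(2) obtain c where c: "c \<in> I" "c .[Y] y ~= zero Y" by blast
 have cc: "c \<in> carrier R" using c I.a_subset by blast
 show thesis
 proof (rule that[OF cc c(2)])
  fix d assume d: "d \<in> carrier R" "d .[Y] (c .[Y] y) ~= zero Y"
  have dc: "d \<otimes> c \<in> carrier R" "d \<otimes> c \<in> I" using d c cc I.I_l_closed by auto
  have "(d \<otimes> c) .[Y] y ~= zero Y" using d cc y by (simp add: Y.smult_assoc1)
  then have "PIdl (d \<otimes> c) \<in> ?F"
   using cgenideal_ideal[OF dc(1)] cgenideal_self[OF dc(1)] by blast
  moreover have "PIdl (d \<otimes> c) \<subseteq> I" using I(1) dc(2) by (rule cgenideal_minimal)
  ultimately have "c \<in> PIdl (d \<otimes> c)" using min c(1) by blast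
  then obtain e where e: "e \<in> carrier R" "c = e \<otimes> (d \<otimes> c)" by (auto simp: cgenideal_def)
  have "c .[Y] y = (e \<otimes> (d \<otimes> c)) .[Y] y" using e(2) by simp
  also have "... = e .[Y] (d .[Y] (c .[Y] y))" using e(1) d(1) cc y by (simp add: Y.smult_assoc1)
  finally have "c .[Y] y = e .[Y] (d .[Y] (c .[Y] y))" .
  then show "\<exists>e\<in>carrier R. e .[Y] (d .[Y] (c .[Y] y)) = c .[Y] y"
   by (intro bexI[of _ e] e(1)) (rule sym)
 qed
qed

text \<open>
 Take \<open>w\<close> in a minimal ideal not contained in the annihilator of \<open>z\<close>.
\<close>

lemma (in artinian_cring) annihilator_socle:
 assumes Y: "lmodule R Y" and z: "z \<in> carrier Y" "z ~= zero Y"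
  and simple: "!!d. d \<in> carrier R ==> d .[Y] z ~= zero Y ==> \<exists>e\<in>carrier R. e .[Y] (d .[Y] z) = z"
 obtains w where "w \<in> carrier R" "w \<notin> jacobson_radical R"
  "!!a. a \<in> carrier R ==> a .[Y] z = zero Y ==> a \<otimes> w \<in> jacobson_radical R"
proof -
 interpret Y: lmodule R Y by fact
 let ?m = "{a \<in> carrier R. a .[Y] z = zero Y}"
 have cr: "cring R" ..
 have "submodule {a \<in> carrier (reg_module R). a .[Y] z \<in> {zero Y}} R (reg_module R)"
  by (rule submodule_vimage[OF lmodule_reg[OF ring_axioms] Y smult_right_mod_hom[OF Y z(1)] submodule_zero[OF Y]])
 then have m: "ideal ?m R" using submodule_reg_iff_ideal[OF cr, of ?m] by simp
 \<comment> \<open>The annihilator is maximal because \<open>z\<close> generates a simple module: a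
   \<open>d\<close> outside it has a multiple \<open>e d\<close> acting on \<open>z\<close> as the
   identity, so that \<open>1 - e d\<close> lies in the annihilator.\<close>
 have maxm: "maximalideal ?m R"
 proof (rule maximalidealI[OF m])
  have "\<one> \<notin> ?m" using z by simp
  then show "carrier R ~= ?m" by blast
  fix J assume J: "ideal J R" "?m \<subseteq> J" "J \<subseteq> carrier R"
  interpret J: ideal J R by (rule J(1))
  show "J = ?m | J = carrier R"
  proof (cases "J \<subseteq> ?m")
   case False
   then obtain d where d: "d \<in> J" "d \<notin> ?m" by blast
   then have dc: "d \<in> carrier R" "d .[Y] z ~= zero Y" using J(3) by auto
   from simple[OF this] obtain e where e: "e \<in> carrier R" "e .[Y] (d .[Y] z) = z" by blast
   have "(\<one> \<oplus> \<ominus> \<one> \<otimes> (e \<otimes> d)) .[Y] z = msub R Y z ((e \<otimes> d) .[Y] z)"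
    using e(1) dc z by (simp add: msub_def Y.smult_l_distr Y.smult_assoc1)
   also have "... = zero Y" using e dc z by (simp add: Y.smult_assoc1 Y.msub_eq_zero)
   finally have "\<one> \<oplus> \<ominus> \<one> \<otimes> (e \<otimes> d) \<in> ?m" using e(1) dc by simp
   then have "\<one> \<oplus> \<ominus> \<one> \<otimes> (e \<otimes> d) \<in> J" using J(2) by blast
   moreover have ed: "e \<otimes> d \<in> J" using d(1) e(1) by (rule J.I_l_closed)
   ultimately have "(\<one> \<oplus> \<ominus> \<one> \<otimes> (e \<otimes> d)) \<oplus> e \<otimes> d \<in> J" by (rule J.a_closed)
   moreover have "(\<one> \<oplus> \<ominus> \<one> \<otimes> (e \<otimes> d)) \<oplus> e \<otimes> d = \<one>"
    using e(1) dc by (simp add: l_minus a_assoc l_neg)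
   ultimately show ?thesis using J.one_imp_carrier by simp
  next
   case True
   with J(2) show ?thesis by blast
  qed
 qed
 let ?F = "{L. ideal L R & ~ L \<subseteq> ?m}"
 have "carrier R \<in> ?F" using oneideal maxm maximalideal.I_notcarr by fastforce
 from minimal_ideal[OF this] obtain L where "L \<in> ?F" and min0: "\<forall>J\<in>?F. J \<subseteq> L --> J = L" by blast
 then have L: "ideal L R" "~ L \<subseteq> ?m" by simp_all
 have min: "!!J. J \<in> ?F ==> J \<subseteq> L ==> J = L" by (rule min0[rule_format])
 interpret L: ideal L R by (rule L(1))
 \<comment> \<open>\<open>L\<close> and \<open>M\<close> both contain elements outside
   \<open>?m\<close>, and so does \<open>L \<inter> M\<close>: the product of two such elements does
   not annihilate \<open>z\<close>. Minimality of \<open>L\<close> then gives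
   \<open>L \<inter> M = L\<close>.\<close>
 have sub: "L \<subseteq> M" if M: "maximalideal M R" "M ~= ?m" for M
 proof -
  interpret M: maximalideal M R by (rule M(1))
  have "~ M \<subseteq> ?m"
   using M.I_maximal[OF m] M(2) maximalideal.I_notcarr[OF maxm] by auto
  then obtain b where b: "b \<in> M" "b \<in> carrier R" "b .[Y] z ~= zero Y" using M.a_subset by blast
  from L(2) obtain a where a: "a \<in> L" "a \<in> carrier R" "a .[Y] z ~= zero Y" using L.a_subset by blast
  from simple[OF a(2,3)] obtain e where e: "e \<in> carrier R" "e .[Y] (a .[Y] z) = z" by blast
  have "(a \<otimes> b) .[Y] z ~= zero Y"
  proof
   assume *: "(a \<otimes> b) .[Y] z = zero Y"
   have "b .[Y] z = b .[Y] (e .[Y] (a .[Y] z))" using e(2) by simp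
   also have "... = (b \<otimes> (e \<otimes> a)) .[Y] z" using a b e z by (simp add: Y.smult_assoc1)
   also have "b \<otimes> (e \<otimes> a) = e \<otimes> (a \<otimes> b)" using a b e by (simp add: m_ac)
   also have "(e \<otimes> (a \<otimes> b)) .[Y] z = e .[Y] ((a \<otimes> b) .[Y] z)"
    using a b e z by (intro Y.smult_assoc1) auto
   also have "... = zero Y" using * e(1) by (simp add: Y.smult_zero)
   finally show False using b(3) by simp
  qed
  moreover have "a \<otimes> b \<in> L \<inter> M" using a b L.I_r_closed M.I_l_closed by auto
  moreover have "ideal (L \<inter> M) R" by (rule i_intersect[OF L(1) M.is_ideal])
  ultimately have "L \<inter> M \<in> ?F" by blast
  then have "L \<inter> M = L" using min by blast
  then show ?thesis by blast
 qed
 from L(2) obtain w where w: "w \<in> L" "w \<notin> ?m" by blast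
 have wc: "w \<in> carrier R" using w(1) L.a_subset by blast
 show thesis
 proof (rule that[OF wc])
  show "w \<notin> jacobson_radical R" using w(2) maxm by (auto simp: jacobson_radical_def)
  fix a assume a: "a \<in> carrier R" "a .[Y] z = zero Y"
  \<comment> \<open>The product lies in \<open>?m\<close> because \<open>a\<close> does, and in
    every other maximal ideal because \<open>L\<close> does.\<close>
  have "a \<otimes> w \<in> M" if M: "maximalideal M R" for M
  proof (cases "M = ?m")
   case True
   have "w \<otimes> a \<in> ?m" using a wc z by (simp add: Y.smult_assoc1 Y.smult_zero)
   then show ?thesis unfolding True using m_comm[OF a(1) wc] by simp
  next
   case False
   have "a \<otimes> w \<in> L" using w(1) a(1) by (rule L.I_l_closed)
   then show ?thesis using sub[OF M False] by blast
  qed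
  then show "a \<otimes> w \<in> jacobson_radical R" using a(1) wc by (simp add: jacobson_radical_def)
 qed
qed

lemma submodule_jacobson_radical:
 assumes "cring k"
 shows "submodule (jacobson_radical k) k (reg_module k)"
proof -
 interpret cring k by fact
 have "jacobson_radical k = \<Inter> (insert (carrier k) {I. maximalideal I k})"
  by (auto simp: jacobson_radical_def)
 moreover have "submodule (\<Inter> (insert (carrier k) {I. maximalideal I k})) k (reg_module k)"
  by (rule submodule_Inter[OF lmodule_reg[OF ring_axioms]])
    (auto simp: submodule_reg_iff_ideal[OF assms] oneideal maximalideal.axioms(1))
 ultimately show ?thesis by simp
qed

text \<open>A multiple \<open>z = c y\<close> generates a simple module. Sending \<open>a z\<close>
  to the class of \<open>a w\<close> modulo the radical, with \<open>w\<close> from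
  \<open>annihilator_socle\<close>, is well defined and nonzero at \<open>z\<close>; injectivity of
  \<open>E\<close> extends it to \<open>Y\<close>, and it cannot vanish at \<open>y\<close> as it
  does not vanish at \<open>c y\<close>.\<close>

lemma envelope_cogenerator:
 assumes k: "artinian_cring k"
  and E: "injective_envelope k (quot_module (reg_module k) (jacobson_radical k)) E"
  and Y: "fg_module k Y" and y: "y \<in> carrier Y" "y ~= zero Y"
 shows "\<exists>u\<in>mod_hom k Y E. u y ~= zero E"
proof -
 interpret k: artinian_cring k by (rule k)
 interpret Y: lmodule k Y using Y by (rule fg_lmodule)
 let ?R = "reg_module k" and ?J = "jacobson_radical k"
 let ?Q = "quot_module ?R ?J"
 note R = lmodule_reg[OF k.ring_axioms]
 have J: "submodule ?J k ?R" by (rule submodule_jacobson_radical) (rule k.is_cring)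
 note q = quot_module_projection[OF R J]
 let ?p = "%x. ?J +>\<^bsub>?R\<^esub> x"
 from E obtain f where I: "injective_module k E" and f: "f \<in> mod_hom k ?Q E" "inj_on f (carrier ?Q)"
  by (auto simp: injective_envelope_def)
 have lE: "lmodule k E" using I by (simp add: injective_module_def)
 from k.simple_multiple[OF Y.lmodule_axioms y] obtain c where c: "c \<in> carrier k" "c .[Y] y ~= zero Y"
  "!!d. d \<in> carrier k ==> d .[Y] (c .[Y] y) ~= zero Y ==>
   \<exists>e\<in>carrier k. e .[Y] (d .[Y] (c .[Y] y)) = c .[Y] y" by blast
 let ?z = "c .[Y] y"
 have z: "?z \<in> carrier Y" using c(1) y(1) by simp
 from k.annihilator_socle[OF Y.lmodule_axioms z c(2,3)] obtain w where
  w: "w \<in> carrier k" "w \<notin> ?J" "!!a. a \<in> carrier k ==> a .[Y] ?z = zero Y ==> a *[k] w \<in> ?J" by blast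
 let ?s = "%a. a .[Y] ?z"
 let ?Z = "?s ` carrier k"
 have s: "?s \<in> mod_hom k ?R Y" by (rule smult_right_mod_hom[OF Y.lmodule_axioms z])
 have Z: "submodule ?Z k Y"
  using submodule_image[OF R Y.lmodule_axioms s submodule_carrier[OF R]] by simp
 let ?Zm = "Y\<lparr>carrier := ?Z\<rparr>"
 have lZ: "lmodule k ?Zm" by (rule lmodule_restrict[OF Y.lmodule_axioms Z])
 have sZ: "?s \<in> mod_hom k ?R ?Zm" "?s ` carrier ?R = carrier ?Zm"
  using mod_hom_restrict_cod[OF s] by auto
 have t: "(%a. f (?p (a *[k] w))) \<in> mod_hom k ?R E"
  using mod_hom_comp[OF mod_hom_comp[OF smult_right_mod_hom[OF R, of w] q(2)] f(1)] w(1) by simp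
 have "\<exists>h\<in>mod_hom k ?Zm E. \<forall>a\<in>carrier ?R. h (a .[Y] ?z) = f (?p (a *[k] w))"
 proof (rule mod_hom_factor[OF R lZ lE sZ t])
  fix a assume "a \<in> carrier ?R" "a .[Y] ?z = zero ?Zm"
  then have "?p (a *[k] w) = zero ?Q" using w(3)[of a] q(4)[of "a *[k] w"] w(1) by simp
  then show "f (?p (a *[k] w)) = zero E" using mod_hom_zero[OF f(1) q(1) lE] by simp
 qed
 then obtain h where h: "h \<in> mod_hom k ?Zm E"
  "!!a. a \<in> carrier k ==> h (a .[Y] ?z) = f (?p (a *[k] w))" by auto
 have "fg_module k ?Zm" by (rule fg_image[OF fg_reg[OF k.ring_axioms] lZ sZ])
 from injective_extend[OF I this Y mod_hom_restrict[OF mod_hom_id submoduleD(1)[OF Z]] _ h(1)]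
 obtain u where u: "u \<in> mod_hom k Y E" "\<forall>x\<in>?Z. u x = h x" by (auto simp: inj_on_def)
 have "?p w ~= zero ?Q" using q(4)[of w] w(1,2) by simp
 then have "f (?p w) ~= zero E"
  using f(2) inj_on_mod_hom[OF q(1) lE f(1)] mod_homD(1)[OF q(2), of w] w(1) by auto
 moreover have "u ?z = f (?p w)"
 proof -
  have "?z = one k .[Y] ?z" using z by simp
  then have "?z \<in> ?Z" using k.one_closed by blast
  then have "u ?z = h ?z" using u(2) by blast
  moreover have "h ?z = f (?p w)" using h(2)[of "one k"] w(1) z by simp
  ultimately show ?thesis by simp
 qed
 moreover have "u ?z = c .[E] u y" using mod_homD(3)[OF u(1) c(1) y(1)] .
 ultimately have "u y ~= zero E" using lmodule.smult_zero[OF lE c(1)] by auto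
 with u(1) show ?thesis by blast
qed

section \<open>The dual of the regular module\<close>

lemma dual_reg_simps:
 assumes B: "artin_algebra k B"
 shows "carrier (dual_reg k E B) = mod_hom k B E \<inter> extensional (carrier B)"
  "zero (dual_reg k E B) = (\<lambda>x\<in>carrier B. zero E)"
  "f +[dual_reg k E B] g = (\<lambda>x\<in>carrier B. f x +[E] g x)"
  "b .[dual_reg k E B] f = (\<lambda>x\<in>carrier B. f (x *[B] b))"
proof -
 interpret B: lmodule k B by (rule artin_algebraD(4)[OF B])
 interpret R: ring B by (rule artin_algebraD(2)[OF B])
 let ?N = "base_module B (reg_module (op_ring B))"
 have N: "carrier ?N = carrier B" "zero ?N = zero B" "!!x y. x +[?N] y = x +[B] y"
  by (simp_all add: op_ring_def)
 have sm: "c .[?N] x = c .[B] x" if "c \<in> carrier k" "x \<in> carrier B" for c x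
  using that artin_algebraD(7)[OF B, of c x "one B"] by (simp add: op_ring_def)
 have "mod_hom k ?N E = mod_hom k B E"
  using N sm B.smult_closed by (auto simp: mod_hom_def hom_def)
 then show "carrier (dual_reg k E B) = mod_hom k B E \<inter> extensional (carrier B)"
  using N by (simp add: dual_reg_def dual_def hom_group_def)
 show "zero (dual_reg k E B) = (\<lambda>x\<in>carrier B. zero E)"
  "f +[dual_reg k E B] g = (\<lambda>x\<in>carrier B. f x +[E] g x)"
  "b .[dual_reg k E B] f = (\<lambda>x\<in>carrier B. f (x *[B] b))"
  using N by (simp_all add: dual_reg_def dual_def hom_group_def op_ring_def)
qed

lemma lmodule_dual_reg:
 assumes B: "artin_algebra k B" and E: "lmodule k E"
 shows "lmodule B (dual_reg k E B)"
proof -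
 interpret B: lmodule k B by (rule artin_algebraD(4)[OF B])
 interpret R: ring B by (rule artin_algebraD(2)[OF B])
 interpret E: lmodule k E by (rule E)
 note d = dual_reg_simps[OF B, of E]
 have restr: "(\<lambda>x\<in>carrier B. f x) \<in> carrier (dual_reg k E B)" if "f \<in> mod_hom k B E" for f
  unfolding d using mod_hom_cong[OF that B.lmodule_axioms, of "\<lambda>x\<in>carrier B. f x"] by simp
 have hom: "f \<in> mod_hom k B E" "f \<in> extensional (carrier B)" if "f \<in> carrier (dual_reg k E B)" for f
  using that by (auto simp: d)
 show ?thesis
 proof (rule lmoduleI[OF R.ring_axioms])
  show "zero (dual_reg k E B) \<in> carrier (dual_reg k E B)"
   unfolding d(2) by (rule restr[OF mod_hom_const_zero[OF E]])
  fix f assume f: "f \<in> carrier (dual_reg k E B)"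
  note f' = mod_homD[OF hom(1)[OF f]]
  show "zero (dual_reg k E B) +[dual_reg k E B] f = f" "one B .[dual_reg k E B] f = f"
   "zero B .[dual_reg k E B] f = zero (dual_reg k E B)"
   using f' hom(2)[OF f] mod_hom_zero[OF hom(1)[OF f] B.lmodule_axioms E]
   by (auto simp: d(2-4) fun_eq_iff extensional_def)
  fix g assume g: "g \<in> carrier (dual_reg k E B)"
  note g' = mod_homD[OF hom(1)[OF g]]
  show "f +[dual_reg k E B] g \<in> carrier (dual_reg k E B)"
   unfolding d(3) by (rule restr[OF mod_hom_add[OF E hom(1)[OF f] hom(1)[OF g]]])
  show "f +[dual_reg k E B] g = g +[dual_reg k E B] f"
   using f' g' by (auto simp: d(3) fun_eq_iff E.M.a_comm)
  show "f +[dual_reg k E B] g +[dual_reg k E B] h = f +[dual_reg k E B] (g +[dual_reg k E B] h)"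
   if "h \<in> carrier (dual_reg k E B)" for h
   using f' g' mod_homD[OF hom(1)[OF that]] by (auto simp: d(3) fun_eq_iff E.M.a_assoc)
  show "b .[dual_reg k E B] (f +[dual_reg k E B] g) =
    b .[dual_reg k E B] f +[dual_reg k E B] b .[dual_reg k E B] g" if "b \<in> carrier B" for b
   using that by (auto simp: d(3,4) fun_eq_iff)
 next
  fix b f assume b: "b \<in> carrier B" and f: "f \<in> carrier (dual_reg k E B)"
  note f' = mod_homD[OF hom(1)[OF f]]
  have "(%x. x *[B] b) \<in> mod_hom k B B"
   by (rule mod_homI) (use b in \<open>auto simp: R.l_distr artin_algebraD(6)[OF B]\<close>)
  then show "b .[dual_reg k E B] f \<in> carrier (dual_reg k E B)"
   unfolding d(4) by (intro restr mod_hom_comp[OF _ hom(1)[OF f]])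
  fix c assume c: "c \<in> carrier B"
  show "(b +[B] c) .[dual_reg k E B] f = b .[dual_reg k E B] f +[dual_reg k E B] c .[dual_reg k E B] f"
   using b c f' by (auto simp: d(3,4) fun_eq_iff R.r_distr)
  show "(b *[B] c) .[dual_reg k E B] f = b .[dual_reg k E B] (c .[dual_reg k E B] f)"
   using b c f' by (auto simp: d(4) fun_eq_iff R.m_assoc)
 qed
qed

text \<open>The adjunction between \<open>Hom_B(X, D(B))\<close> and \<open>Hom_k(X, E)\<close>: a
  functional \<open>u\<close> gives the map sending \<open>x\<close> to the functional
  \<open>b \<mapsto> u (b x)\<close>, whose value at \<open>one B\<close> is
  \<open>u x\<close>.\<close>

theorem dual_reg_cogenerator:
 assumes B: "artin_algebra k B"
  and E: "injective_envelope k (quot_module (reg_module k) (jacobson_radical k)) E"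
  and X: "fg_module B X" and x: "x \<in> carrier X" "x ~= zero X"
 shows "\<exists>h\<in>mod_hom B X (dual_reg k E B). h x ~= zero (dual_reg k E B)"
proof -
 interpret B: lmodule k B by (rule artin_algebraD(4)[OF B])
 interpret R: ring B by (rule artin_algebraD(2)[OF B])
 interpret X: lmodule B X using X by (rule fg_lmodule)
 note d = dual_reg_simps[OF B, of E]
 from envelope_cogenerator[OF artin_algebraD(1)[OF B] E fg_base[OF B X], of x] x obtain u
  where u: "u \<in> mod_hom k (base_module B X) E" "u x ~= zero E" by auto
 note u' = mod_homD[OF u(1), simplified]
 let ?h = "%x. \<lambda>b\<in>carrier B. u (b .[X] x)"
 have hc: "?h x \<in> carrier (dual_reg k E B)" if x: "x \<in> carrier X" for x
 proof -
  have "(%b. u (b .[X] x)) \<in> mod_hom k B E"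
  proof (rule mod_homI)
   fix c b assume *: "c \<in> carrier k" "b \<in> carrier B"
   have "c .[B] b = (c .[B] one B) *[B] b" using * by (simp add: artin_algebraD(6)[OF B])
   then show "u ((c .[B] b) .[X] x) = c .[E] u (b .[X] x)"
    using * x u'(3)[of c "b .[X] x"] by (simp add: X.smult_assoc1)
  qed (use x u' in \<open>auto simp: X.smult_l_distr\<close>)
  from mod_hom_cong[OF this B.lmodule_axioms, of "?h x"] show ?thesis unfolding d by simp
 qed
 have "?h \<in> mod_hom B X (dual_reg k E B)"
  by (rule mod_homI)
    (use hc u' in \<open>auto simp: d(3,4) fun_eq_iff X.smult_r_distr X.smult_assoc1\<close>)
 moreover have "?h x ~= zero (dual_reg k E B)"
 proof
  assume "?h x = zero (dual_reg k E B)"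
  from fun_cong[OF this, of "one B"] show False using u(2) x(1) by (simp add: d(2))
 qed
 ultimately show ?thesis by (intro bexI[of _ ?h])
qed

section \<open>Cotilting modules are determined by their perpendicular class\<close>

text \<open>If every map from \<open>X\<close> to \<open>M\<close> killed \<open>x\<close>, so would
  every sum of maps through \<open>M\<close>.\<close>

lemma fac_detect:
 assumes "lmodule B Y" "fac B X M Y h" "x \<in> carrier X" "h x ~= zero Y" "lmodule B M"
 shows "\<exists>f\<in>mod_hom B X M. f x ~= zero M"
 using assms(2,4)
proof induction
 case (fac_zero h)
 then show ?case using assms(3) by blast
next
 case (fac_step h f g h')
 interpret Y: lmodule B Y by fact
 show ?case
 proof (cases "h x = zero Y")
  case True
  have "f x ~= zero M"
  proof
   assume "f x = zero M"
   then have "g (f x) = zero Y" using mod_hom_zero[OF fac_step(3) assms(5,1)] by simp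
   then have "h' x = zero Y" using fac_step(4)[OF assms(3)] True by simp
   with fac_step(6) show False by simp
  qed
  with fac_step(2) show ?thesis by blast
 qed (rule fac_step(5))
qed

text \<open>The image of \<open>k\<close> is central in \<open>B\<close>, so homomorphisms of
  \<open>B\<close>-modules can be multiplied by scalars from \<open>k\<close>.\<close>

lemma mod_hom_base_smult:
 assumes B: "artin_algebra k B" and C: "lmodule B C" and c: "c \<in> carrier k" and h: "h \<in> mod_hom B Z C"
 shows "(%x. c .[base_module B C] h x) \<in> mod_hom B Z C"
proof (rule mod_homI)
 interpret B: lmodule k B by (rule artin_algebraD(4)[OF B])
 interpret R: ring B by (rule artin_algebraD(2)[OF B])
 interpret C: lmodule B C by fact
 fix x assume x: "x \<in> carrier Z"
 show "c .[base_module B C] h x \<in> carrier C" using c x mod_homD[OF h] by simp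
 show "c .[base_module B C] h (x +[Z] y) = c .[base_module B C] h x +[C] c .[base_module B C] h y"
  if "y \<in> carrier Z" for y
  using c x that mod_homD[OF h] by (simp add: C.smult_r_distr)
 fix b assume b: "b \<in> carrier B"
 have "(c .[B] one B) *[B] b = b *[B] (c .[B] one B)"
  using c b by (simp add: artin_algebraD(6,7)[OF B])
 then show "c .[base_module B C] h (b .[Z] x) = b .[C] (c .[base_module B C] h x)"
  using c b x mod_homD[OF h] by (simp flip: C.smult_assoc1)
qed

text \<open>A left \<open>add(C)\<close>-approximation exists since \<open>Hom\<^sub>B(X, C)\<close> is a finitely generated \<open>k\<close>-module.\<close>

lemma left_approximation:
 fixes X :: "('b, 'x) module" and C :: "('b, 'c) module"
 assumes B: "artin_algebra k B" and X: "fg_module B X" and C: "fg_module B C"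
 shows "\<exists>(G :: ('x => 'c) set) f. finite G & f \<in> mod_hom B X (dsum G (%_. C)) &
  (\<forall>h\<in>mod_hom B X C. \<exists>h'\<in>mod_hom B (dsum G (%_. C)) C. \<forall>x\<in>carrier X. h' (f x) = h x)"
proof -
 interpret B: lmodule k B by (rule artin_algebraD(4)[OF B])
 interpret R: ring B by (rule artin_algebraD(2)[OF B])
 interpret X: lmodule B X using X by (rule fg_lmodule)
 interpret C: lmodule B C using C by (rule fg_lmodule)
 have k: "left_noetherian k" by (rule artinian_cring_noetherian[OF artin_algebraD(1)[OF B]])
 from X obtain S where S: "finite S" "S \<subseteq> carrier X"
  "!!N. submodule N B X ==> S \<subseteq> N ==> carrier X \<subseteq> N" by (rule fg_moduleE) blast
 let ?C = "base_module B C"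
 let ?D = "dsum S (%_. ?C)"
 have lC: "lmodule k ?C" by (rule lmodule_base[OF B C.lmodule_axioms])
 have fD: "fg_module k ?D" by (rule fg_dsum[OF lmodule_ring[OF lC] S(1)]) (rule fg_base[OF B C])
 interpret D: lmodule k ?D using fD by (rule fg_lmodule)
 \<comment> \<open>A homomorphism is determined by its values on the generators \<open>S\<close>.
   Restriction to \<open>S\<close> places the homomorphisms into the finitely generated
   \<open>k\<close>-module \<open>?D\<close>, where noetherianness applies.\<close>
 define r where "r h = (\<lambda>s\<in>S. h s)" for h :: "'x => 'c"
 have r_sub: "submodule (r ` H) k ?D"
  if H: "H \<subseteq> mod_hom B X C" "(%x. zero C) \<in> H" "!!h g. h \<in> H ==> g \<in> H ==> (%x. h x +[C] g x) \<in> H"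
   "!!c h. c \<in> carrier k ==> h \<in> H ==> (%x. c .[?C] h x) \<in> H" for H
 proof (rule D.submoduleI)
  show "r ` H \<subseteq> carrier ?D"
  proof (rule image_subsetI)
   fix h assume "h \<in> H"
   then have "h \<in> mod_hom B X C" using H(1) by blast
   from mod_homD(1)[OF this] show "r h \<in> carrier ?D" using S(2) by (auto simp: r_def dsum_simps)
  qed
  have "zero ?D = r (%x. zero C)" by (simp add: r_def dsum_simps)
  then show "zero ?D \<in> r ` H" using H(2) by blast
 next
  fix u v assume "u \<in> r ` H" "v \<in> r ` H"
  then obtain h g where hg: "h \<in> H" "g \<in> H" "u = r h" "v = r g" by blast
  then have "u +[?D] v = r (%x. h x +[C] g x)" by (auto simp: r_def dsum_simps fun_eq_iff)
  then show "u +[?D] v \<in> r ` H" using H(3)[OF hg(1,2)] by blast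
 next
  fix c u assume c: "c \<in> carrier k" and "u \<in> r ` H"
  then obtain h where h: "h \<in> H" "u = r h" by blast
  then have "c .[?D] u = r (%x. c .[?C] h x)" by (auto simp: r_def dsum_simps fun_eq_iff)
  then show "c .[?D] u \<in> r ` H" using H(4)[OF c h(1)] by blast
 qed
 let ?H = "mod_hom B X C"
 have N: "submodule (r ` ?H) k ?D"
  by (intro r_sub mod_hom_const_zero mod_hom_add mod_hom_base_smult[OF B] C.lmodule_axioms) auto
 from noetherian_fg_submodule[OF k fD N] obtain G' where G': "finite G'" "G' \<subseteq> r ` ?H"
  "!!K. submodule K k ?D ==> G' \<subseteq> K ==> r ` ?H \<subseteq> K"
  by (rule fg_restrictE[OF _ D.lmodule_axioms N]) blast
 from finite_subset_image[OF G'(1,2)] obtain G where G: "G \<subseteq> ?H" "finite G" "G' = r ` G" by blast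
 \<comment> \<open>The finite set \<open>G\<close> of homomorphisms is its own index set, whence the
   element type \<open>('x => 'c) => 'c\<close> of the approximation.\<close>
 let ?P = "dsum G (%_. C)"
 let ?f = "%x. \<lambda>g\<in>G. g x"
 have f: "?f \<in> mod_hom B X ?P" by (rule tuple_mod_hom) (use G(1) in blast)
 \<comment> \<open>The maps that factor through \<open>?f\<close>. Their restrictions to
   \<open>S\<close> form a \<open>k\<close>-submodule containing the generators \<open>G'\<close>,
   hence the restrictions of all homomorphisms.\<close>
 let ?H' = "{(%x. h' (?f x)) | h'. h' \<in> mod_hom B ?P C}"
 have H': "submodule (r ` ?H') k ?D"
 proof (rule r_sub)
  show "?H' \<subseteq> ?H" using mod_hom_comp[OF f] by blast
  show "(%x. zero C) \<in> ?H'"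
   by (rule CollectI, rule exI[of _ "%x. zero C"]) (simp add: mod_hom_const_zero C.lmodule_axioms)
  show "(%x. h x +[C] g x) \<in> ?H'" if "h \<in> ?H'" "g \<in> ?H'" for h g
  proof -
   from that obtain h' g' where "h' \<in> mod_hom B ?P C" "h = (%x. h' (?f x))"
    "g' \<in> mod_hom B ?P C" "g = (%x. g' (?f x))" by blast
   then show ?thesis
    by (intro CollectI exI[of _ "%x. h' x +[C] g' x"]) (simp add: mod_hom_add C.lmodule_axioms)
  qed
  show "(%x. c .[?C] h x) \<in> ?H'" if c: "c \<in> carrier k" and "h \<in> ?H'" for c h
  proof -
   from that(2) obtain h' where h': "h' \<in> mod_hom B ?P C" "h = (%x. h' (?f x))" by blast
   show ?thesis
    unfolding h'(2)
    by (intro CollectI exI[of _ "%y. c .[?C] h' y"] conjI refl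
      mod_hom_base_smult[OF B C.lmodule_axioms c h'(1)])
  qed
 qed
 have "G' \<subseteq> r ` ?H'"
  unfolding G(3)
 proof (rule image_subsetI)
  fix g assume g: "g \<in> G"
  have "r g = r (%x. (?f x) g)" using g by (simp add: r_def)
  moreover have "(%x. (?f x) g) \<in> ?H'"
   by (intro CollectI exI[of _ "%y. y g"] conjI refl proj_mod_hom[OF g, of B "%_. C"])
  ultimately show "r g \<in> r ` ?H'" by blast
 qed
 then have sub: "r ` ?H \<subseteq> r ` ?H'" by (rule G'(3)[OF H'])
 have "\<exists>h'\<in>mod_hom B ?P C. \<forall>x\<in>carrier X. h' (?f x) = h x" if h: "h \<in> ?H" for h
 proof -
  from sub h have "r h \<in> r ` ?H'" by blast
  then obtain h' where h': "h' \<in> mod_hom B ?P C" "r h = r (%x. h' (?f x))" by auto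
  note hf = mod_hom_comp[OF f h'(1)]
  have "h' (?f s) = h s" if "s \<in> S" for s
   using fun_cong[OF h'(2), of s] that by (simp add: r_def)
  then have eqS: "S \<subseteq> {x \<in> carrier X. msub B C (h' (?f x)) (h x) \<in> {zero C}}"
   using S(2) mod_homD(1)[OF h] by (auto simp: C.msub_eq_zero subset_iff)
  have "carrier X \<subseteq> {x \<in> carrier X. msub B C (h' (?f x)) (h x) \<in> {zero C}}"
   by (rule S(3)[OF submodule_vimage[OF X.lmodule_axioms C.lmodule_axioms
      mod_hom_diff[OF C.lmodule_axioms hf h] submodule_zero[OF C.lmodule_axioms]] eqS])
  then have "h' (?f x) = h x" if "x \<in> carrier X" for x
   using that mod_homD(1)[OF h] mod_homD(1)[OF hf] C.msub_eq_zero by blast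
  with h'(1) show ?thesis by blast
 qed
 with f G(2) show ?thesis by blast
qed

text \<open>Injectivity of the left approximation is the point. A map to \<open>D(B)\<close> detects
  a given nonzero \<open>x\<close>; it lifts to a module \<open>C1\<close> in \<open>add(C)\<close>,
  since \<open>X\<close> is orthogonal to the kernel of \<open>C1 -> D(B)\<close>. So some map to
  \<open>C\<close> detects \<open>x\<close>, and this map factors through the approximation. That
  all maps to \<open>C\<close> factor also makes the cokernel orthogonal.\<close>

theorem perp_coresolution:
 fixes X :: "('b, 'x) module" and C :: "('b, 'c) module"
 assumes B: "artin_algebra k B"
  and E: "injective_envelope k (quot_module (reg_module k) (jacobson_radical k)) E"
  and C: "fg_module B C" "orth B C C" "gresx B C n (dual_reg k E B)"
  and X: "orth B C X"
 obtains C0 :: "('b, ('x => 'c) => 'c) module" and f g and Y :: "('b, (('x => 'c) => 'c) set) module"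
 where "addc B C C0" "ses B X f C0 g Y" "orth B C Y"
proof -
 interpret R: ring B by (rule artin_algebraD(2)[OF B])
 note lC = fg_lmodule[OF C(1)] and fX = orth_fg[OF X]
 note lX = fg_lmodule[OF fX]
 from left_approximation[OF B fX C(1)] obtain G :: "('x => 'c) set" and f where
  G: "finite G" "f \<in> mod_hom B X (dsum G (%_. C))"
  "!!h. h \<in> mod_hom B X C ==> \<exists>h'\<in>mod_hom B (dsum G (%_. C)) C. \<forall>x\<in>carrier X. h' (f x) = h x" by blast
 let ?P = "dsum G (%_. C)"
 have P: "addc B C ?P" by (intro addc_dsum R.ring_axioms G(1) addc_refl lC)
 note lP = addc_lmodule[OF P]
 have "x = zero X" if x: "x \<in> carrier X" "f x = zero ?P" for x
 proof (rule ccontr)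
  assume "x ~= zero X"
  from dual_reg_cogenerator[OF B E fX x(1) this] obtain h where
   h: "h \<in> mod_hom B X (dual_reg k E B)" "h x ~= zero (dual_reg k E B)" by blast
  show False
  proof (cases n)
   case 0
   then show False using C(3) h(2) mod_homD(1)[OF h(1) x(1)] by (simp add: gresx_0)
  next
   case (Suc m)
   from C(3)[unfolded Suc] obtain C1 :: "'b fgm" and g where
    C1: "addc B C C1" "g \<in> mod_hom B C1 (dual_reg k E B)" "g ` carrier C1 = carrier (dual_reg k E B)"
    "gresx B C m (ker_mod C1 (dual_reg k E B) g)" by (rule gresx_SucE)
   note lC1 = addc_lmodule[OF C1(1)] and lD = gresx_lmodule[OF C(3)]
   from orth_lift[OF gresx_orth[OF C1(4) X] ses_kernel[OF lC1 lD C1(2,3)] h(1)] obtain h1 where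
    h1: "h1 \<in> mod_hom B X C1" "\<forall>x\<in>carrier X. g (h1 x) = h x" by blast
   have "h1 x ~= zero C1" using h1(2) x(1) h(2) mod_hom_zero[OF C1(2) lC1 lD] by auto
   moreover have "fac B C1 C C1 (%x. x)" using C1(1) by (simp add: addc_def)
   ultimately obtain u where u: "u \<in> mod_hom B C1 C" "u (h1 x) ~= zero C"
    using fac_detect[OF lC1 _ mod_homD(1)[OF h1(1) x(1)] _ lC] by blast
   from G(3)[OF mod_hom_comp[OF h1(1) u(1)]] obtain v where
    "v \<in> mod_hom B ?P C" "v (f x) = u (h1 x)" using x(1) by blast
   then show False using u(2) x(2) mod_hom_zero[OF _ lP lC] by simp
  qed
 qed
 then have inj: "inj_on f (carrier X)" using inj_on_mod_hom[OF lX lP G(2)] by blast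
 note s = ses_cokernel[OF lX lP G(2) inj]
 have "orth B C ?P" by (rule orth_dsum[OF G(1) C(2) lC])
 from orth_quotient[OF s lC X this G(3)] show thesis by (rule that[OF P s])
qed

text \<open>Here \<open>orth B X Z\<close> means that \<open>Ext(Z, X)\<close> vanishes, so the
  identity of \<open>X\<close> extends to \<open>Y\<close>.\<close>

lemma orth_ses_splits:
 assumes s: "ses B X f Y g Z" and o: "orth B X Z"
 shows "\<exists>r\<in>mod_hom B Y X. \<forall>x\<in>carrier X. r (f x) = x"
proof -
 note s' = sesD[OF s]
 let ?N = "Y\<lparr>carrier := f ` carrier X\<rparr>"
 have "f \<in> mod_hom B X ?N" by (rule mod_hom_restrict_cod[OF s'(4)]) auto
 from mod_hom_inv_into[OF s'(1) this] s'(5)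
 have inv: "inv_into (carrier X) f \<in> mod_hom B (Y\<lparr>carrier := a_kernel Y Z g\<rparr>) X"
  by (simp add: bij_betw_def s'(8))
 obtain r where r: "r \<in> mod_hom B Y X" "!!y. y \<in> a_kernel Y Z g ==> r y = inv_into (carrier X) f y"
  by (rule extendsD[OF orth_extends[OF o s'(1,2,6,7)] inv]) blast
 have "r (f x) = x" if x: "x \<in> carrier X" for x
 proof -
  have "f x \<in> a_kernel Y Z g" unfolding s'(8)[symmetric] using x by blast
  then show ?thesis using r(2) inv_into_f_f[OF s'(5) x] by simp
 qed
 with r(1) show ?thesis by blast
qed

text \<open>The coresolution of \<open>C'\<close> by \<open>add(C)\<close> has a cokernel orthogonal
  to \<open>C\<close>, hence by \<open>le\<close> to \<open>C'\<close>, and therefore splits. The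
  cokernel has another element type, so \<open>le\<close> is applied to a copy of it.\<close>

theorem addc_of_perp_le:
 fixes C :: "('b, 'c) module" and C' :: "('b, 'd) module"
 assumes B: "artin_algebra k B"
  and E: "injective_envelope k (quot_module (reg_module k) (jacobson_radical k)) E"
  and C: "fg_module B C" "orth B C C" "gresx B C n (dual_reg k E B)"
  and C': "lmodule B C'" "orth B C C'"
  and le: "!!Y :: 'b fgm. orth B C Y ==> orth B C' Y"
 shows "addc B C C'"
proof -
 from perp_coresolution[OF B E C C'(2)] obtain C0 :: "('b, ('d => 'c) => 'c) module" and f g
  and Y :: "('b, (('d => 'c) => 'c) set) module" where
  C0: "addc B C C0" "ses B C' f C0 g Y" "orth B C Y" .
 from orth_fg[OF C0(3)] obtain Y' :: "'b fgm" where
  Y': "fg_module B Y'" "lmodule B Y'" "mod_iso B Y Y'" "mod_iso B Y' Y" by (rule copy_exists)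
 have "orth B C' Y" by (rule orth_iso[OF le[OF orth_iso[OF C0(3) Y'(3,2)]] Y'(4) sesD(3)[OF C0(2)]])
 from orth_ses_splits[OF C0(2) this] obtain r where "r \<in> mod_hom B C0 C'" "\<forall>x\<in>carrier C'. r (f x) = x"
  by blast
 then show ?thesis by (intro addc_retract[OF C0(1) C'(1) sesD(4)[OF C0(2)]]) auto
qed

section \<open>The triangular matrix algebra\<close>

lemma (in abelian_monoid) finsum_swap:
 assumes "finite I" "finite J" "!!i j. i \<in> I ==> j \<in> J ==> f i j \<in> carrier G"
 shows "(\<Oplus>i\<in>I. \<Oplus>j\<in>J. f i j) = (\<Oplus>j\<in>J. \<Oplus>i\<in>I. f i j)"
 using assms(1,3)
proof (induction I rule: finite_induct)
 case empty
 show ?case by (simp add: add.finprod_one_eqI)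
next
 case (insert i I)
 have "(\<Oplus>j\<in>J. \<Oplus>i\<in>insert i I. f i j) = (\<Oplus>j\<in>J. f i j \<oplus> (\<Oplus>i\<in>I. f i j))"
  using insert by (intro finsum_cong') (auto intro!: finsum_closed)
 also have "... = (\<Oplus>j\<in>J. f i j) \<oplus> (\<Oplus>j\<in>J. \<Oplus>i\<in>I. f i j)"
  using insert by (intro finsum_addf) (auto intro!: finsum_closed)
 also have "(\<Oplus>j\<in>J. \<Oplus>i\<in>I. f i j) = (\<Oplus>i\<in>I. \<Oplus>j\<in>J. f i j)" using insert by simp
 finally show ?case using insert by (auto intro!: finsum_closed)
qed

lemma (in abelian_monoid) finsum_single:
 assumes "finite I" "i \<in> I" "f i \<in> carrier G" "!!j. j \<in> I ==> j ~= i ==> f j = \<zero>"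
 shows "(\<Oplus>j\<in>I. f j) = f i"
proof -
 have "(\<Oplus>j\<in>I. f j) = (\<Oplus>j\<in>I. if i = j then (%_. f i) j else \<zero>)"
  using assms by (intro finsum_cong') auto
 also have "... = f i" using assms by (intro add.finprod_singleton) auto
 finally show ?thesis .
qed

lemma lmodule_transfer:
 assumes "lmodule B M" "carrier M' = carrier M" "zero M' = zero M"
  "!!x y. x +[M'] y = x +[M] y" "!!b x. b .[M'] x = b .[M] x"
 shows "lmodule B M'" "(%x. x) \<in> mod_hom B M M'" "mod_iso B M M'"
proof -
 interpret M: lmodule B M by fact
 show "lmodule B M'"
  by (rule lmoduleI)
    (auto simp: assms M.R.ring_axioms M.M.a_ac M.smult_l_distr M.smult_r_distr M.smult_assoc1
     M.smult_zero_left)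
 show i: "(%x. x) \<in> mod_hom B M M'" by (rule mod_homI) (auto simp: assms)
 show "mod_iso B M M'" by (rule mod_iso_bij[OF i]) (auto simp: assms)
qed

definition elem_mat :: "nat => ('k, 'a) module => nat => nat => 'a => nat => nat => 'a" where
 "elem_mat n A p q a = (\<lambda>i\<in>{1..n}. \<lambda>j\<in>{1..n}. if i = p & j = q then a else zero A)"

locale tri_alg =
 fixes k :: "'k ring" and A :: "('k, 'a) module" and n :: nat
 assumes artin: "artin_algebra k A"
begin

sublocale R: ring A by (rule artin_algebraD(2)[OF artin])
sublocale K: lmodule k A by (rule artin_algebraD(4)[OF artin])

abbreviation "T \<equiv> tri_algebra n A"
abbreviation "E \<equiv> elem_mat n A"

text \<open>The matrices as an iterated direct sum over \<open>k\<close>, with zero modules below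
  the diagonal. The module structure and finite generation of \<open>T\<close> over \<open>k\<close>
  are inherited from \<open>dsum\<close>.\<close>

abbreviation "Tdsum \<equiv> dsum {1..n} (%i. dsum {1..n} (%j. if i \<le> j then A else A\<lparr>carrier := {zero A}\<rparr>))"

lemma T_dsum: "carrier T = carrier Tdsum" "zero T = zero Tdsum"
 "x +[T] y = x +[Tdsum] y" "c .[T] x = c .[Tdsum] x"
proof -
 have if_module:
  "carrier (if P then A else A\<lparr>carrier := {zero A}\<rparr>) = (if P then carrier A else {zero A})"
  "zero (if P then A else A\<lparr>carrier := {zero A}\<rparr>) = zero A"
  "add (if P then A else A\<lparr>carrier := {zero A}\<rparr>) = add A"
  "smult (if P then A else A\<lparr>carrier := {zero A}\<rparr>) = smult A" for P
  by auto
 show "carrier T = carrier Tdsum" "zero T = zero Tdsum"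
  "x +[T] y = x +[Tdsum] y" "c .[T] x = c .[Tdsum] x"
  by (simp_all add: tri_algebra_def dsum_simps if_module)
qed

lemma Tdsum_components:
 "i \<in> {1..n} ==> fg_module k (dsum {1..n} (%j. if i \<le> j then A else A\<lparr>carrier := {zero A}\<rparr>))"
proof -
 have "fg_module k (A\<lparr>carrier := {zero A}\<rparr>)"
  by (rule zero_fg[OF lmodule_restrict[OF K.lmodule_axioms submodule_zero[OF K.lmodule_axioms]]]) simp
 then show ?thesis using artin_algebraD(5)[OF artin]
  by (intro fg_dsum lmodule_ring[OF K.lmodule_axioms]) auto
qed

lemma fg_Tdsum: "fg_module k Tdsum"
 by (rule fg_dsum[OF lmodule_ring[OF K.lmodule_axioms] finite_atLeastAtMost Tdsum_components])

lemma lmodule_T: "lmodule k T"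
 by (rule lmodule_transfer(1)[OF fg_lmodule[OF fg_Tdsum]]) (simp_all only: T_dsum)

lemma fg_T: "fg_module k T"
 by (rule fg_iso[OF lmodule_transfer(3)[OF fg_lmodule[OF fg_Tdsum]] fg_Tdsum lmodule_T])
   (simp_all only: T_dsum)

lemma T_carrier:
 "b \<in> carrier T \<longleftrightarrow> b \<in> extensional {1..n} & (\<forall>i\<in>{1..n}. b i \<in> extensional {1..n} &
   (\<forall>j\<in>{1..n}. b i j \<in> carrier A & (j < i --> b i j = zero A)))"
proof -
 have "b i j \<in> (if i \<le> j then carrier A else {zero A}) \<longleftrightarrow> b i j \<in> carrier A & (j < i --> b i j = zero A)"
  for i j by auto
 then show ?thesis unfolding tri_algebra_def by (simp add: PiE_iff) blast
qed

lemma T_entry: "b \<in> carrier T ==> i \<in> {1..n} ==> j \<in> {1..n} ==> b i j \<in> carrier A"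
 and T_lower: "b \<in> carrier T ==> i \<in> {1..n} ==> j \<in> {1..n} ==> j < i ==> b i j = zero A"
 by (auto simp: T_carrier)

lemma T_eqI:
 assumes "b \<in> carrier T" "c \<in> carrier T" "!!i j. i \<in> {1..n} ==> j \<in> {1..n} ==> b i j = c i j"
 shows "b = c"
proof
 fix i
 show "b i = c i"
 proof (cases "i \<in> {1..n}")
  case True
  with assms show ?thesis by (intro extensionalityI[of _ "{1..n}"]) (auto simp: T_carrier)
 next
  case False
  with assms(1,2) show ?thesis by (auto simp: T_carrier extensional_def)
 qed
qed

lemma T_simps:
 assumes "i \<in> {1..n}" "j \<in> {1..n}"
 shows "(b *[T] c) i j = (\<Oplus>\<^bsub>A\<^esub>l\<in>{1..n}. b i l *[A] c l j)" "(b +[T] c) i j = b i j +[A] c i j"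
  "(one T) i j = (if i = j then one A else zero A)" "(zero T) i j = zero A" "(x .[T] c) i j = x .[A] c i j"
  "E p q a i j = (if i = p & j = q then a else zero A)"
 using assms by (simp_all add: tri_algebra_def elem_mat_def)

lemma T_mult_closed:
 assumes "b \<in> carrier T" "c \<in> carrier T"
 shows "b *[T] c \<in> carrier T"
proof -
 have e: "(b *[T] c) \<in> extensional {1..n}" "!!i. i \<in> {1..n} ==> (b *[T] c) i \<in> extensional {1..n}"
  by (auto simp: tri_algebra_def)
 have "(\<Oplus>\<^bsub>A\<^esub>l\<in>{1..n}. b i l *[A] c l j) \<in> carrier A" if "i \<in> {1..n}" "j \<in> {1..n}" for i j
  using that T_entry[OF assms(1)] T_entry[OF assms(2)] by (intro R.finsum_closed) auto
 moreover have "(\<Oplus>\<^bsub>A\<^esub>l\<in>{1..n}. b i l *[A] c l j) = zero A" if ij: "i \<in> {1..n}" "j \<in> {1..n}" "j < i" for i j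
 proof (rule R.add.finprod_one_eqI)
  fix l assume l: "l \<in> {1..n}"
  show "b i l *[A] c l j = zero A"
  proof (cases "l < i")
   case True
   then show ?thesis using T_lower[OF assms(1) ij(1) l] T_entry[OF assms(2) l ij(2)] by simp
  next
   case False
   then show ?thesis using T_lower[OF assms(2) l ij(2)] T_entry[OF assms(1) ij(1) l] ij(3) by simp
  qed
 qed
 ultimately show ?thesis using e by (simp add: T_carrier T_simps)
qed

lemma ring_T: "ring T"
proof -
 interpret L: lmodule k T by (rule lmodule_T)
 have one: "one T \<in> carrier T" by (auto simp: T_carrier tri_algebra_def)
 have entry: "b i j \<in> carrier A" if "b \<in> carrier T" "i \<in> {1..n}" "j \<in> {1..n}" for b i j
  using T_entry that .
 show ?thesis
 proof (rule ringI)
  show "abelian_group T" by (rule L.M.abelian_group_axioms)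
  show "Group.monoid T"
  proof (rule monoidI)
   fix b assume b: "b \<in> carrier T"
   show "one T *[T] b = b"
   proof (rule T_eqI[OF T_mult_closed[OF one b] b])
    fix i j assume ij: "i \<in> {1..n}" "j \<in> {1..n}"
    have "(\<Oplus>\<^bsub>A\<^esub>l\<in>{1..n}. (one T) i l *[A] b l j) = (one T) i i *[A] b i j"
     using ij entry[OF b] by (intro R.finsum_single) (auto simp: T_simps simp del: atLeastAtMost_iff)
    then show "(one T *[T] b) i j = b i j" using ij entry[OF b] by (simp add: T_simps)
   qed
   show "b *[T] one T = b"
   proof (rule T_eqI[OF T_mult_closed[OF b one] b])
    fix i j assume ij: "i \<in> {1..n}" "j \<in> {1..n}"
    have "(\<Oplus>\<^bsub>A\<^esub>l\<in>{1..n}. b i l *[A] (one T) l j) = b i j *[A] (one T) j j"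
     using ij entry[OF b] by (intro R.finsum_single) (auto simp: T_simps simp del: atLeastAtMost_iff)
    then show "(b *[T] one T) i j = b i j" using ij entry[OF b] by (simp add: T_simps)
   qed
   fix c d assume c: "c \<in> carrier T" and d: "d \<in> carrier T"
   show "b *[T] c *[T] d = b *[T] (c *[T] d)"
   proof (rule T_eqI)
    fix i j assume ij: "i \<in> {1..n}" "j \<in> {1..n}"
    have "(\<Oplus>\<^bsub>A\<^esub>l\<in>{1..n}. (\<Oplus>\<^bsub>A\<^esub>m\<in>{1..n}. b i m *[A] c m l) *[A] d l j) =
      (\<Oplus>\<^bsub>A\<^esub>l\<in>{1..n}. \<Oplus>\<^bsub>A\<^esub>m\<in>{1..n}. b i m *[A] c m l *[A] d l j)"
     using ij entry[OF b] entry[OF c] entry[OF d]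
     by (intro R.finsum_cong' R.finsum_ldistr) (auto intro!: R.finsum_closed simp del: atLeastAtMost_iff)
    also have "... = (\<Oplus>\<^bsub>A\<^esub>m\<in>{1..n}. \<Oplus>\<^bsub>A\<^esub>l\<in>{1..n}. b i m *[A] c m l *[A] d l j)"
     using ij entry[OF b] entry[OF c] entry[OF d]
     by (intro R.finsum_swap) (auto simp del: atLeastAtMost_iff)
    also have "... = (\<Oplus>\<^bsub>A\<^esub>m\<in>{1..n}. b i m *[A] (\<Oplus>\<^bsub>A\<^esub>l\<in>{1..n}. c m l *[A] d l j))"
    proof (intro R.finsum_cong' refl)
     fix m assume m: "m \<in> {1..n}"
     have "b i m *[A] (\<Oplus>\<^bsub>A\<^esub>l\<in>{1..n}. c m l *[A] d l j) = (\<Oplus>\<^bsub>A\<^esub>l\<in>{1..n}. b i m *[A] (c m l *[A] d l j))"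
      using ij m entry[OF b] entry[OF c] entry[OF d]
      by (intro R.finsum_rdistr) (auto simp del: atLeastAtMost_iff)
     also have "... = (\<Oplus>\<^bsub>A\<^esub>l\<in>{1..n}. b i m *[A] c m l *[A] d l j)"
      using ij m entry[OF b] entry[OF c] entry[OF d]
      by (intro R.finsum_cong') (auto simp: R.m_assoc simp del: atLeastAtMost_iff)
     finally show "(\<Oplus>\<^bsub>A\<^esub>l\<in>{1..n}. b i m *[A] c m l *[A] d l j) =
       b i m *[A] (\<Oplus>\<^bsub>A\<^esub>l\<in>{1..n}. c m l *[A] d l j)" ..
    qed (use ij entry[OF b] entry[OF c] entry[OF d] in
       \<open>auto intro!: R.finsum_closed simp del: atLeastAtMost_iff\<close>)
    finally have eq: "(\<Oplus>\<^bsub>A\<^esub>l\<in>{1..n}. (\<Oplus>\<^bsub>A\<^esub>m\<in>{1..n}. b i m *[A] c m l) *[A] d l j) =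
      (\<Oplus>\<^bsub>A\<^esub>m\<in>{1..n}. b i m *[A] (\<Oplus>\<^bsub>A\<^esub>l\<in>{1..n}. c m l *[A] d l j))" .
    have "(b *[T] c *[T] d) i j = (\<Oplus>\<^bsub>A\<^esub>l\<in>{1..n}. (\<Oplus>\<^bsub>A\<^esub>m\<in>{1..n}. b i m *[A] c m l) *[A] d l j)"
     unfolding T_simps(1)[OF ij] using ij entry[OF b] entry[OF c] entry[OF d]
     by (intro R.finsum_cong') (auto intro!: R.finsum_closed simp: T_simps simp del: atLeastAtMost_iff)
    moreover have "(b *[T] (c *[T] d)) i j = (\<Oplus>\<^bsub>A\<^esub>m\<in>{1..n}. b i m *[A] (\<Oplus>\<^bsub>A\<^esub>l\<in>{1..n}. c m l *[A] d l j))"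
     unfolding T_simps(1)[OF ij] using ij entry[OF b] entry[OF c] entry[OF d]
     by (intro R.finsum_cong') (auto intro!: R.finsum_closed simp: T_simps simp del: atLeastAtMost_iff)
    ultimately show "(b *[T] c *[T] d) i j = (b *[T] (c *[T] d)) i j" using eq by simp
   qed (intro T_mult_closed b c d)+
  qed (auto intro: T_mult_closed one)
 next
  fix b c d assume b: "b \<in> carrier T" and c: "c \<in> carrier T" and d: "d \<in> carrier T"
  show "(b +[T] c) *[T] d = b *[T] d +[T] c *[T] d"
  proof (rule T_eqI)
   fix i j assume ij: "i \<in> {1..n}" "j \<in> {1..n}"
   have "((b +[T] c) *[T] d) i j = (\<Oplus>\<^bsub>A\<^esub>l\<in>{1..n}. b i l *[A] d l j +[A] c i l *[A] d l j)"
    unfolding T_simps(1)[OF ij] using ij entry[OF b] entry[OF c] entry[OF d]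
    by (intro R.finsum_cong') (auto simp: T_simps R.l_distr simp del: atLeastAtMost_iff)
   also have "... = (b *[T] d +[T] c *[T] d) i j"
    unfolding T_simps[OF ij] using ij entry[OF b] entry[OF c] entry[OF d]
    by (intro R.finsum_addf) (auto simp del: atLeastAtMost_iff)
   finally show "((b +[T] c) *[T] d) i j = (b *[T] d +[T] c *[T] d) i j" .
  qed (intro T_mult_closed L.M.a_closed b c d)+
  show "d *[T] (b +[T] c) = d *[T] b +[T] d *[T] c"
  proof (rule T_eqI)
   fix i j assume ij: "i \<in> {1..n}" "j \<in> {1..n}"
   have "(d *[T] (b +[T] c)) i j = (\<Oplus>\<^bsub>A\<^esub>l\<in>{1..n}. d i l *[A] b l j +[A] d i l *[A] c l j)"
    unfolding T_simps(1)[OF ij] using ij entry[OF b] entry[OF c] entry[OF d]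
    by (intro R.finsum_cong') (auto simp: T_simps R.r_distr simp del: atLeastAtMost_iff)
   also have "... = (d *[T] b +[T] d *[T] c) i j"
    unfolding T_simps[OF ij] using ij entry[OF b] entry[OF c] entry[OF d]
    by (intro R.finsum_addf) (auto simp del: atLeastAtMost_iff)
   finally show "(d *[T] (b +[T] c)) i j = (d *[T] b +[T] d *[T] c) i j" .
  qed (intro T_mult_closed L.M.a_closed b c d)+
 qed
qed

lemma K_finsum_smult:
 assumes "finite I" "x \<in> carrier k" "f \<in> I \<rightarrow> carrier A"
 shows "x .[A] (\<Oplus>\<^bsub>A\<^esub>i\<in>I. f i) = (\<Oplus>\<^bsub>A\<^esub>i\<in>I. x .[A] f i)"
 using assms by (rule K.smult_finsum)

lemma artin_T: "artin_algebra k T"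
proof -
 interpret L: lmodule k T by (rule lmodule_T)
 have entry: "b i j \<in> carrier A" if "b \<in> carrier T" "i \<in> {1..n}" "j \<in> {1..n}" for b i j
  using T_entry that .
 have "module k T"
  by (intro module.intro module_axioms.intro L.M.abelian_group_axioms
     artinian_cring.axioms(1)[OF artin_algebraD(1)[OF artin]])
    (auto simp: L.smult_l_distr L.smult_r_distr L.smult_assoc1)
 moreover have "artin_algebra_axioms k T"
 proof (rule artin_algebra_axioms.intro)
  fix x b c assume x: "x \<in> carrier k" and b: "b \<in> carrier T" and c: "c \<in> carrier T"
  show "(x .[T] b) *[T] c = x .[T] (b *[T] c)"
  proof (rule T_eqI)
   fix i j assume ij: "i \<in> {1..n}" "j \<in> {1..n}"
   have "((x .[T] b) *[T] c) i j = (\<Oplus>\<^bsub>A\<^esub>l\<in>{1..n}. x .[A] (b i l *[A] c l j))"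
    unfolding T_simps(1)[OF ij] using x ij entry[OF b] entry[OF c]
    by (intro R.finsum_cong') (auto simp: T_simps artin_algebraD(6)[OF artin] simp del: atLeastAtMost_iff)
   also have "... = (x .[T] (b *[T] c)) i j"
    unfolding T_simps[OF ij] using x ij entry[OF b] entry[OF c]
    by (intro K_finsum_smult[symmetric]) (auto simp del: atLeastAtMost_iff)
   finally show "((x .[T] b) *[T] c) i j = (x .[T] (b *[T] c)) i j" .
  qed (intro T_mult_closed L.smult_closed x b c)+
  show "b *[T] (x .[T] c) = x .[T] (b *[T] c)"
  proof (rule T_eqI)
   fix i j assume ij: "i \<in> {1..n}" "j \<in> {1..n}"
   have "(b *[T] (x .[T] c)) i j = (\<Oplus>\<^bsub>A\<^esub>l\<in>{1..n}. x .[A] (b i l *[A] c l j))"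
    unfolding T_simps(1)[OF ij] using x ij entry[OF b] entry[OF c]
    by (intro R.finsum_cong') (auto simp: T_simps artin_algebraD(7)[OF artin] simp del: atLeastAtMost_iff)
   also have "... = (x .[T] (b *[T] c)) i j"
    unfolding T_simps[OF ij] using x ij entry[OF b] entry[OF c]
    by (intro K_finsum_smult[symmetric]) (auto simp del: atLeastAtMost_iff)
   finally show "(b *[T] (x .[T] c)) i j = (x .[T] (b *[T] c)) i j" .
  qed (intro T_mult_closed L.smult_closed x b c)+
 qed (rule fg_T)
 ultimately show ?thesis
  by (intro artin_algebra.intro artin_algebraD(1)[OF artin] ring_T)
qed

sublocale RT: ring T by (rule ring_T)

lemma noetherian_A: "left_noetherian A" and noetherian_T: "left_noetherian T"
 by (rule artin_algebra_noetherian[OF artin], rule artin_algebra_noetherian[OF artin_T])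

section \<open>Elementary matrices and reduction of identities to them\<close>

lemma E_closed:
 "p \<in> {1..n} ==> q \<in> {1..n} ==> p \<le> q ==> a \<in> carrier A ==> E p q a \<in> carrier T"
 by (auto simp: T_carrier elem_mat_def)

lemma E_zero: "E p q (zero A) = zero T"
 by (simp add: elem_mat_def tri_algebra_def)

lemma E_add: "a \<in> carrier A ==> b \<in> carrier A ==> E p q (a +[A] b) = E p q a +[T] E p q b"
 by (auto simp: elem_mat_def tri_algebra_def fun_eq_iff)

lemma E_mult:
 assumes "p \<in> {1..n}" "q \<in> {1..n}" "r \<in> {1..n}" "s \<in> {1..n}" "p \<le> q" "r \<le> s"
  and a: "a \<in> carrier A" and b: "b \<in> carrier A"
 shows "E p q a *[T] E r s b = (if q = r then E p s (a *[A] b) else zero T)"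
proof (rule T_eqI)
 show "E p q a *[T] E r s b \<in> carrier T" using assms by (intro T_mult_closed E_closed)
 show "(if q = r then E p s (a *[A] b) else zero T) \<in> carrier T"
  using assms by (auto intro!: E_closed)
 fix i j assume ij: "i \<in> {1..n}" "j \<in> {1..n}"
 have "(\<Oplus>\<^bsub>A\<^esub>l\<in>{1..n}. E p q a i l *[A] E r s b l j) = E p q a i q *[A] E r s b q j"
  using ij assms by (intro R.finsum_single) (auto simp: T_simps simp del: atLeastAtMost_iff)
 then show "(E p q a *[T] E r s b) i j = (if q = r then E p s (a *[A] b) else zero T) i j"
  using ij assms by (auto simp: T_simps simp del: atLeastAtMost_iff)
qed

text \<open>\<open>dsum_induct\<close> is applied twice, to the rows and to the entries of one row.
  Additive statements about \<open>T\<close> are thereby reduced to matrices with a single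
  entry.\<close>

lemma T_induct [consumes 1, case_names zero E add]:
 assumes b: "b \<in> carrier T" and zero: "P (zero T)"
  and E: "!!p q a. p \<in> {1..n} ==> q \<in> {1..n} ==> p \<le> q ==> a \<in> carrier A ==> P (E p q a)"
  and add: "!!b c. b \<in> carrier T ==> c \<in> carrier T ==> P b ==> P c ==> P (b +[T] c)"
 shows "P b"
proof -
 let ?D = "%i. dsum {1..n} (%j. if i \<le> j then A else A\<lparr>carrier := {zero A}\<rparr>)"
 have lz: "lmodule k (A\<lparr>carrier := {zero A}\<rparr>)"
  by (rule lmodule_restrict[OF K.lmodule_axioms submodule_zero[OF K.lmodule_axioms]])
 have lD: "lmodule k (?D i)" if "i \<in> {1..n}" for i using fg_lmodule[OF Tdsum_components[OF that]] .
 have "P (single {1..n} ?D i y)" if i: "i \<in> {1..n}" and y: "y \<in> carrier (?D i)" for i y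
 proof (rule dsum_induct[where I = "{1..n}" and B = k and M = "%j. if i \<le> j then A else A\<lparr>carrier := {zero A}\<rparr>"
    and P = "%y. P (single {1..n} ?D i y)" and x = y])
  have sh: "single {1..n} ?D i \<in> mod_hom k (?D i) Tdsum" by (rule single_mod_hom[OF lD])
  have "single {1..n} ?D i (zero (?D i)) = zero T"
   unfolding T_dsum by (rule mod_hom_zero[OF sh lD[OF i] fg_lmodule[OF fg_Tdsum]])
  then show "P (single {1..n} ?D i (zero (?D i)))" using zero by simp
  fix j a assume j: "j \<in> {1..n}" and a: "a \<in> carrier (if i \<le> j then A else A\<lparr>carrier := {zero A}\<rparr>)"
  have aA: "a \<in> carrier A" using a by (auto split: if_splits)
  have z: "zero (if P then A else A\<lparr>carrier := {zero A}\<rparr>) = zero A" for P by simp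
  have eq: "single {1..n} ?D i (single {1..n} (%j. if i \<le> j then A else A\<lparr>carrier := {zero A}\<rparr>) j a) = E i j a"
   by (auto simp: single_def elem_mat_def fun_eq_iff dsum_simps z)
  show "P (single {1..n} ?D i (single {1..n} (%j. if i \<le> j then A else A\<lparr>carrier := {zero A}\<rparr>) j a))"
  proof (cases "i \<le> j")
   case True
   then show ?thesis unfolding eq using E[OF i j True aA] by simp
  next
   case False
   then have "a = zero A" using a by simp
   then show ?thesis unfolding eq using zero E_zero by simp
  qed
 next
  fix u v assume uv: "u \<in> carrier (?D i)" "v \<in> carrier (?D i)"
   "P (single {1..n} ?D i u)" "P (single {1..n} ?D i v)"
  have sh: "single {1..n} ?D i \<in> mod_hom k (?D i) Tdsum" by (rule single_mod_hom[OF lD])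
  show "P (single {1..n} ?D i (u +[?D i] v))"
   unfolding mod_homD(2)[OF sh uv(1,2)] T_dsum(3)[symmetric]
   by (rule add[OF _ _ uv(3,4)]) (unfold T_dsum, (rule mod_homD(1)[OF sh], fact)+)
 qed (use y lz K.lmodule_axioms in auto)
 then show ?thesis
  using b zero add unfolding T_dsum
  by (intro dsum_induct[where I = "{1..n}" and B = k and M = ?D and P = P and x = b]) (use lD in auto)
qed

lemma T_mod_homI:
 assumes X: "lmodule T X" and Y: "lmodule T Y"
  and f: "!!x. x \<in> carrier X ==> f x \<in> carrier Y"
   "!!x y. x \<in> carrier X ==> y \<in> carrier X ==> f (x +[X] y) = f x +[Y] f y"
   "!!p q a x. p \<in> {1..n} ==> q \<in> {1..n} ==> p \<le> q ==> a \<in> carrier A ==> x \<in> carrier X ==>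
    f (E p q a .[X] x) = E p q a .[Y] f x"
 shows "f \<in> mod_hom T X Y"
proof (rule mod_homI[OF f(1,2)])
 interpret X: lmodule T X by (rule X)
 interpret Y: lmodule T Y by (rule Y)
 fix b x assume b: "b \<in> carrier T" and x: "x \<in> carrier X"
 from b show "f (b .[X] x) = b .[Y] f x"
 proof (induction b rule: T_induct)
  case zero
  have "f (zero X) +[Y] f (zero X) = f (zero X)" using f(2)[of "zero X" "zero X"] by simp
  then have "f (zero X) = zero Y" using f(1)[of "zero X"] by (metis X.M.zero_closed Y.M.add.r_cancel_one)
  then show ?case using x f(1) by (simp add: X.smult_zero_left Y.smult_zero_left)
 qed (use x f in \<open>auto simp: X.smult_l_distr Y.smult_l_distr\<close>)
qed auto

text \<open>The entry \<open>a\<close> in place \<open>(p, q)\<close> acts through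
  \<open>E q q (one A)\<close>, so the diagonal idempotents determine the action of every matrix, in
  particular of the identity.\<close>

lemma T_eq_components:
 assumes X: "lmodule T X" and x: "x \<in> carrier X" and y: "y \<in> carrier X"
  and eq: "!!p. p \<in> {1..n} ==> E p p (one A) .[X] x = E p p (one A) .[X] y"
 shows "x = y"
proof -
 interpret X: lmodule T X by (rule X)
 have "b .[X] x = b .[X] y" if "b \<in> carrier T" for b
  using that
 proof (induction b rule: T_induct)
  case (E p q a)
  have 1: "E p q a = E p q a *[T] E q q (one A)" using E by (simp add: E_mult)
  have "E p q a .[X] x = E p q a .[X] (E q q (one A) .[X] x)"
   using X.smult_assoc1[of "E p q a" "E q q (one A)" x] x E by (simp add: E_closed flip: 1)
  also have "... = E p q a .[X] y"
   using X.smult_assoc1[of "E p q a" "E q q (one A)" y] y E eq[of q] by (simp add: E_closed flip: 1)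
  finally show ?case .
 qed (use x y in \<open>auto simp: X.smult_zero_left X.smult_l_distr\<close>)
 from this[OF RT.one_closed] show ?thesis using x y by simp
qed

end

section \<open>Modules over the triangular matrix algebra\<close>

lemma mor_path_add: "mor_path X i (d + e) = mor_path X i d \<circ> mor_path X (i + d) e"
 by (induction e) (simp_all add: o_assoc add.assoc)

lemma mor_module_dsum:
 "carrier (mor_module n X) = carrier (dsum {1..n} (branch X))"
 "zero (mor_module n X) = zero (dsum {1..n} (branch X))"
 "x +[mor_module n X] y = x +[dsum {1..n} (branch X)] y"
 by (simp_all add: mor_module_def dsum_simps)

text \<open>Outside the interval the branch keeps the operations of \<open>M\<close> on the carrier
  \<open>{zero M}\<close>, so that zero and addition are those of \<open>M\<close> at every
  position.\<close>

definition ivl :: "('a, 't) module => nat => nat => ('a, 't) mor" where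
 "ivl M lo hi =
   \<lparr> branch = (%j. if lo \<le> j & j \<le> hi then M else M\<lparr>carrier := {zero M}\<rparr>),
    strmap = (%j. if lo \<le> j & j < hi then id else (%_. zero M)) \<rparr>"

text \<open>The two objects can differ only at index \<open>0\<close>, which
  \<open>mor_module n\<close> ignores.\<close>

lemma m_obj_ivl: "mor_module n (m_obj M i) = mor_module n (ivl M 1 i)"
proof -
 have b: "branch (m_obj M i) j = branch (ivl M 1 i) j" if "1 \<le> j" for j
  using that by (simp add: m_obj_def ivl_def)
 have s: "strmap (m_obj M i) j = strmap (ivl M 1 i) j" if "1 \<le> j" for j
  using that by (simp add: m_obj_def ivl_def)
 have p: "mor_path (m_obj M i) j d = mor_path (ivl M 1 i) j d" if "1 \<le> j" for j d
  using that by (induction d) (simp_all add: s)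
 show ?thesis
  unfolding mor_module_def by (auto simp: b p fun_eq_iff restrict_def PiE_def Pi_def)
qed

context tri_alg
begin

text \<open>\<open>Mor\<close> without finite generation, so that it applies to
  \<open>ivl M lo hi\<close> for every module \<open>M\<close>.\<close>

definition morl :: "('a, 'x) mor => bool" where
 "morl X \<longleftrightarrow> (\<forall>i\<in>{1..n}. lmodule A (branch X i)) &
   (\<forall>i\<in>{1..n-1}. strmap X i \<in> mod_hom A (branch X (Suc i)) (branch X i))"

lemma Mor_morl: "X \<in> Mor n A ==> morl X"
 by (auto simp: Mor_def morl_def intro: fg_lmodule)

lemma mor_path_hom:
 assumes X: "morl X" and i: "1 \<le> i" and d: "i + d \<le> n"
 shows "mor_path X i d \<in> mod_hom A (branch X (i + d)) (branch X i)"
 using d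
proof (induction d)
 case 0
 show ?case using mod_hom_id by (simp add: id_def)
next
 case (Suc d)
 have "strmap X (i + d) \<in> mod_hom A (branch X (Suc (i + d))) (branch X (i + d))"
  using X Suc.prems i by (simp add: morl_def)
 from mod_hom_comp[OF this Suc.IH] Suc.prems show ?case by (simp add: comp_def)
qed

lemma mor_path_hom':
 "morl X ==> p \<in> {1..n} ==> q \<in> {1..n} ==> p \<le> q ==>
  mor_path X p (q - p) \<in> mod_hom A (branch X q) (branch X p)"
 using mor_path_hom[of X p "q - p"] by simp

lemma mor_component:
 assumes "x \<in> carrier (mor_module n X)" "p \<in> {1..n}"
 shows "x p \<in> carrier (branch X p)"
 using PiE_mem[of x "{1..n}" "%i. carrier (branch X i)" p] assms by (simp only: mor_module_def partial_object.simps)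

lemma mor_eqI:
 assumes "x \<in> carrier (mor_module n X)" "y \<in> carrier (mor_module n X)"
  "!!p. p \<in> {1..n} ==> x p = y p"
 shows "x = y"
 using assms by (intro PiE_ext[of x "{1..n}" "%i. carrier (branch X i)" y])
  (simp_all only: mor_module_def partial_object.simps)

lemma mor_path_closed:
 assumes "morl X" "x \<in> carrier (mor_module n X)" "p \<in> {1..n}" "j \<in> {p..n}"
 shows "mor_path X p (j - p) (x j) \<in> carrier (branch X p)"
 using mod_homD(1)[OF mor_path_hom'[of X p j] mor_component[of x X j]] assms by simp

lemma mor_smult:
 assumes X: "morl X" and x: "x \<in> carrier (mor_module n X)" and p: "p \<in> {1..n}"
  and b: "!!j. j \<in> {p..n} ==> b p j \<in> carrier A"
 shows "(b .[mor_module n X] x) p =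
  (\<Oplus>\<^bsub>branch X p\<^esub>j\<in>{p..n}. b p j .[branch X p] mor_path X p (j - p) (x j))"
proof -
 interpret L: lmodule A "branch X p" using X p by (simp add: morl_def)
 have "{p..n} = insert p {p<..n}" using p by auto
 then have "(\<Oplus>\<^bsub>branch X p\<^esub>j\<in>{p..n}. b p j .[branch X p] mor_path X p (j - p) (x j)) =
  b p p .[branch X p] mor_path X p (p - p) (x p) +[branch X p]
  (\<Oplus>\<^bsub>branch X p\<^esub>j\<in>{p<..n}. b p j .[branch X p] mor_path X p (j - p) (x j))"
  using mor_path_closed[OF X x p] b L.smult_closed[OF b mor_component[OF x p], of p] p
  by (simp only:) (intro L.M.finsum_insert, auto)
 then show ?thesis using p by (simp add: mor_module_def)
qed

lemma mor_E_action:
 assumes X: "morl X" and pq: "p \<in> {1..n}" "q \<in> {1..n}" "p \<le> q" and a: "a \<in> carrier A"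
  and x: "x \<in> carrier (mor_module n X)"
 shows "E p q a .[mor_module n X] x =
  single {1..n} (branch X) p (a .[branch X p] mor_path X p (q - p) (x q))"
proof
 fix i
 show "(E p q a .[mor_module n X] x) i =
  single {1..n} (branch X) p (a .[branch X p] mor_path X p (q - p) (x q)) i"
 proof (cases "i \<in> {1..n}")
  case False
  then show ?thesis by (auto simp: mor_module_def single_def)
 next
  case i: True
  interpret L: lmodule A "branch X i" using X i by (simp add: morl_def)
  note pc = mor_path_closed[OF X x i]
  have e: "E p q a i j = (if i = p & j = q then a else zero A)" if "j \<in> {i..n}" for j
   using that i by (auto simp: elem_mat_def)
  note s = mor_smult[OF X x i, of "E p q a"]
  show ?thesis
  proof (cases "i = p")
   case False
   have "(\<Oplus>\<^bsub>branch X i\<^esub>j\<in>{i..n}. E p q a i j .[branch X i] mor_path X i (j - i) (x j)) = zero (branch X i)"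
    using L.smult_zero_left[OF pc] False by (intro L.M.add.finprod_one_eqI) (simp add: e)
   then show ?thesis using s e False i by (simp add: single_def)
  next
   case True
   have q: "q \<in> {i..n}" using pq True by simp
   have "(\<Oplus>\<^bsub>branch X i\<^esub>j\<in>{i..n}. E p q a i j .[branch X i] mor_path X i (j - i) (x j)) =
     E p q a i q .[branch X i] mor_path X i (q - i) (x q)"
    using L.smult_zero_left[OF pc] pc[OF q] a q by (intro L.M.finsum_single) (auto simp: e)
   then show ?thesis using s e q True i a by (simp add: single_def)
  qed
 qed
qed

text \<open>Associativity is checked for two elementary matrices, where it is functoriality of
  \<open>mor_path\<close>, and spreads to all matrices by \<open>T_induct\<close> in each factor.
  The actions of and on zero follow from additivity alone.\<close>

lemma lmodule_mor:
 assumes X: "morl X"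
 shows "lmodule T (mor_module n X)"
proof -
 let ?M = "mor_module n X"
 have l: "lmodule A (branch X i)" if "i \<in> {1..n}" for i using X that by (simp add: morl_def)
 interpret D: lmodule A "dsum {1..n} (branch X)" by (rule lmodule_dsum[OF R.ring_axioms l])
 note d = mor_module_dsum[of n X]
 note Dc = D.M.a_closed[folded d] D.M.zero_closed[folded d] D.M.l_zero[folded d] D.M.r_zero[folded d]
  D.M.add.r_cancel_one[folded d]
 have bc: "b p j \<in> carrier A" if "b \<in> carrier T" "p \<in> {1..n}" "j \<in> {p..n}" for b p j
  using T_entry[OF that(1,2), of j] that by simp
 note pc = mor_path_closed[OF X]
 have s: "(b .[?M] x) p = (\<Oplus>\<^bsub>branch X p\<^esub>j\<in>{p..n}. b p j .[branch X p] mor_path X p (j - p) (x j))"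
  if "x \<in> carrier ?M" "p \<in> {1..n}" "b \<in> carrier T" for b x p
  by (rule mor_smult[where b = b, OF X that(1,2) bc[OF that(3,2)]])
 have closed: "b .[?M] x \<in> carrier ?M" if b: "b \<in> carrier T" and x: "x \<in> carrier ?M" for b x
 proof -
  have "(b .[?M] x) p \<in> carrier (branch X p)" if p: "p \<in> {1..n}" for p
  proof -
   interpret L: lmodule A "branch X p" by (rule l[OF p])
   show ?thesis
    unfolding s[OF x p b] by (intro L.M.finsum_closed Pi_I L.smult_closed bc[OF b p] pc[OF x p])
  qed
  then show ?thesis by (auto simp: mor_module_def)
 qed
 have add: "(u +[?M] v) p = u p +[branch X p] v p" if "p \<in> {1..n}" for u v p
  using that by (simp add: mor_module_def)
 have radd: "b .[?M] (x +[?M] y) = b .[?M] x +[?M] b .[?M] y"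
  if b: "b \<in> carrier T" and x: "x \<in> carrier ?M" and y: "y \<in> carrier ?M" for b x y
 proof (rule mor_eqI[OF closed[OF b Dc(1)[OF x y]] Dc(1)[OF closed[OF b x] closed[OF b y]]])
  fix p assume p: "p \<in> {1..n}"
  interpret L: lmodule A "branch X p" by (rule l[OF p])
  have "mor_path X p (j - p) ((x +[?M] y) j) =
    mor_path X p (j - p) (x j) +[branch X p] mor_path X p (j - p) (y j)" if "j \<in> {p..n}" for j
   using mod_homD(2)[OF mor_path_hom'[OF X p, of j] mor_component[OF x, of j] mor_component[OF y, of j]]
    that p by (simp add: add)
  then have "(b .[?M] (x +[?M] y)) p = (\<Oplus>\<^bsub>branch X p\<^esub>j\<in>{p..n}. b p j .[branch X p] mor_path X p (j - p) (x j)
    +[branch X p] b p j .[branch X p] mor_path X p (j - p) (y j))"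
   unfolding s[OF Dc(1)[OF x y] p b] using pc[OF x p] pc[OF y p] bc[OF b p]
   by (intro L.M.finsum_cong') (auto simp: L.smult_r_distr)
  also have "... = (b .[?M] x +[?M] b .[?M] y) p"
   unfolding add[OF p] s[OF x p b] s[OF y p b]
   by (intro L.M.finsum_addf Pi_I L.smult_closed bc[OF b p] pc[OF x p] pc[OF y p])
  finally show "(b .[?M] (x +[?M] y)) p = (b .[?M] x +[?M] b .[?M] y) p" .
 qed
 have ladd: "(b +[T] c) .[?M] x = b .[?M] x +[?M] c .[?M] x"
  if b: "b \<in> carrier T" and c: "c \<in> carrier T" and x: "x \<in> carrier ?M" for b c x
 proof (rule mor_eqI[OF closed[OF RT.a_closed[OF b c] x] Dc(1)[OF closed[OF b x] closed[OF c x]]])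
  fix p assume p: "p \<in> {1..n}"
  interpret L: lmodule A "branch X p" by (rule l[OF p])
  have "((b +[T] c) .[?M] x) p = (\<Oplus>\<^bsub>branch X p\<^esub>j\<in>{p..n}. b p j .[branch X p] mor_path X p (j - p) (x j)
    +[branch X p] c p j .[branch X p] mor_path X p (j - p) (x j))"
   unfolding s[OF x p RT.a_closed[OF b c]] using pc[OF x p] bc[OF b p] bc[OF c p] p
   by (intro L.M.finsum_cong') (auto simp: T_simps L.smult_l_distr)
  also have "... = (b .[?M] x +[?M] c .[?M] x) p"
   unfolding add[OF p] s[OF x p b] s[OF x p c]
   by (intro L.M.finsum_addf Pi_I L.smult_closed bc[OF b p] bc[OF c p] pc[OF x p])
  finally show "((b +[T] c) .[?M] x) p = (b .[?M] x +[?M] c .[?M] x) p" .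
 qed
 have zsm: "zero T .[?M] x = zero ?M" if x: "x \<in> carrier ?M" for x
  using ladd[OF RT.zero_closed RT.zero_closed x] closed[OF RT.zero_closed x] by (metis Dc(5) RT.l_zero RT.zero_closed)
 have rzero: "b .[?M] zero ?M = zero ?M" if b: "b \<in> carrier T" for b
  using radd[OF b Dc(2,2)] closed[OF b Dc(2)] by (metis Dc(2,3,5))
 have EE: "(E p q a *[T] E r s b) .[?M] x = E p q a .[?M] (E r s b .[?M] x)"
  if pq: "p \<in> {1..n}" "q \<in> {1..n}" "p \<le> q" and rs: "r \<in> {1..n}" "s \<in> {1..n}" "r \<le> s"
   and a: "a \<in> carrier A" and b: "b \<in> carrier A" and x: "x \<in> carrier ?M" for p q r s a b x
 proof -
  interpret Lp: lmodule A "branch X p" by (rule l[OF pq(1)])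
  note e = mor_E_action[OF X] and hpq = mor_path_hom'[OF X pq]
  have y: "E r s b .[?M] x \<in> carrier ?M" by (rule closed[OF E_closed[OF rs b] x])
  show ?thesis
  proof (cases "q = r")
   case True
   have ps: "p \<le> s" "s \<in> {p..n}" "s \<in> {q..n}" using pq rs True by auto
   have path: "mor_path X p (q - p) (mor_path X q (s - q) (x s)) = mor_path X p (s - p) (x s)"
    using mor_path_add[of X p "q - p" "s - q"] pq rs True by (simp add: fun_eq_iff)
   have "E p q a .[?M] (E r s b .[?M] x) = single {1..n} (branch X) p
     (a .[branch X p] mor_path X p (q - p) (b .[branch X q] mor_path X q (s - q) (x s)))"
    unfolding e[OF pq a y] unfolding e[OF rs b x] using True pq by (simp add: single_def)
   also have "mor_path X p (q - p) (b .[branch X q] mor_path X q (s - q) (x s)) =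
     b .[branch X p] mor_path X p (s - p) (x s)"
    unfolding path[symmetric] by (rule mod_homD(3)[OF hpq b pc[OF x pq(2) ps(3)]])
   also have "a .[branch X p] ... = (a *[A] b) .[branch X p] mor_path X p (s - p) (x s)"
    by (rule Lp.smult_assoc1[OF a b pc[OF x pq(1) ps(2)], symmetric])
   finally show ?thesis
    using pq rs a b True e[OF pq(1) rs(2) ps(1) R.m_closed[OF a b] x] by (simp add: E_mult)
  next
   case False
   have "(E r s b .[?M] x) q = zero (branch X q)"
    unfolding e[OF rs b x] using False pq by (simp add: single_def)
   then have "E p q a .[?M] (E r s b .[?M] x) = single {1..n} (branch X) p (zero (branch X p))"
    unfolding e[OF pq a y] using mod_hom_zero[OF hpq l[OF pq(2)] l[OF pq(1)]] a by (simp add: Lp.smult_zero)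
   also have "... = zero ?M" by (auto simp: single_def mor_module_def fun_eq_iff)
   finally show ?thesis using pq rs a b False x zsm by (simp add: E_mult)
  qed
 qed
 have assoc1: "(E p q a *[T] c) .[?M] x = E p q a .[?M] (c .[?M] x)"
  if pq: "p \<in> {1..n}" "q \<in> {1..n}" "p \<le> q" "a \<in> carrier A" and c: "c \<in> carrier T" and x: "x \<in> carrier ?M"
  for p q a c x
  using c
 proof (induction c rule: T_induct)
  case (E r s b)
  show ?case by (rule EE[OF pq(1-3) E(1-3) pq(4) E(4) x])
 qed (use E_closed[OF pq] x in \<open>simp_all add: zsm rzero RT.r_distr ladd radd closed\<close>)
 have assoc: "(b *[T] c) .[?M] x = b .[?M] (c .[?M] x)"
  if b: "b \<in> carrier T" and c: "c \<in> carrier T" and x: "x \<in> carrier ?M" for b c x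
  using b
 proof (induction b rule: T_induct)
  case (E p q a)
  show ?case by (rule assoc1[OF E c x])
 qed (use c x in \<open>simp_all add: zsm RT.l_distr ladd closed\<close>)
 have one: "one T .[?M] x = x" if x: "x \<in> carrier ?M" for x
 proof (rule mor_eqI[OF closed[OF RT.one_closed x] x])
  fix p assume p: "p \<in> {1..n}"
  interpret L: lmodule A "branch X p" by (rule l[OF p])
  have "(one T .[?M] x) p = (one T) p p .[branch X p] mor_path X p (p - p) (x p)"
   unfolding s[OF x p RT.one_closed]
   using pc[OF x p] mor_component[OF x p] p by (intro L.M.finsum_single) (auto simp: T_simps L.smult_zero_left)
  then show "(one T .[?M] x) p = x p" using p mor_component[OF x p] by (simp add: T_simps)
 qed
 show ?thesis
  by (rule lmoduleI[OF ring_T]) (simp_all only: closed radd ladd zsm assoc one,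
     simp_all only: d D.M.zero_closed D.M.a_closed D.M.a_ac D.M.l_zero D.M.r_zero)
qed

text \<open>Scalar matrices embed \<open>A\<close> in \<open>T\<close>, and under them the module is
  the direct sum of its branches; generators over \<open>A\<close> then generate over
  \<open>T\<close>.\<close>

lemma diag_smult:
 assumes X: "morl X" and a: "a \<in> carrier A" and x: "x \<in> carrier (mor_module n X)"
 shows "(\<lambda>i\<in>{1..n}. \<lambda>j\<in>{1..n}. if i = j then a else zero A) .[mor_module n X] x = a .[dsum {1..n} (branch X)] x"
  (is "?b .[?M] x = _")
proof
 fix p
 show "(?b .[?M] x) p = (a .[dsum {1..n} (branch X)] x) p"
 proof (cases "p \<in> {1..n}")
  case p: True
  interpret L: lmodule A "branch X p" using X p by (simp add: morl_def)
  have b: "?b p j = (if p = j then a else zero A)" if "j \<in> {p..n}" for j using that p by simp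
  have "(?b .[?M] x) p = (\<Oplus>\<^bsub>branch X p\<^esub>j\<in>{p..n}. ?b p j .[branch X p] mor_path X p (j - p) (x j))"
   by (rule mor_smult[OF X x p]) (use b a in simp)
  also have "... = ?b p p .[branch X p] mor_path X p (p - p) (x p)"
   using mor_path_closed[OF X x p] mor_component[OF x p] p a
   by (intro L.M.finsum_single) (auto simp: L.smult_zero_left)
  finally show ?thesis using p by (simp add: dsum_simps)
 qed (auto simp: mor_module_def dsum_simps)
qed

lemma fg_mor:
 assumes X: "morl X" and fg: "!!i. i \<in> {1..n} ==> fg_module A (branch X i)"
 shows "fg_module T (mor_module n X)"
proof -
 let ?D = "dsum {1..n} (branch X)"
 note d = mor_module_dsum[of n X]
 have "fg_module A ?D" by (rule fg_dsum[OF R.ring_axioms finite_atLeastAtMost fg])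
 then interpret D: lmodule A ?D by (rule fg_lmodule)
 obtain S where S: "finite S" "S \<subseteq> carrier ?D" "!!N. submodule N A ?D ==> S \<subseteq> N ==> carrier ?D \<subseteq> N"
  using \<open>fg_module A ?D\<close> by (rule fg_moduleE) blast
 show ?thesis
 proof (rule fg_moduleI[OF lmodule_mor[OF X] S(1)])
  fix N assume N: "submodule N T (mor_module n X)" "S \<subseteq> N"
  note N' = submoduleD[OF N(1)]
  have "submodule N A ?D"
  proof (rule D.submoduleI)
   fix a x assume a: "a \<in> carrier A" and x: "x \<in> N"
   have "(\<lambda>i\<in>{1..n}. \<lambda>j\<in>{1..n}. if i = j then a else zero A) \<in> carrier T" using a by (auto simp: T_carrier)
   from N'(4)[OF this x] show "a .[?D] x \<in> N"
    using diag_smult[OF X a, of x] N'(1) x by auto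
  qed (use N' in \<open>auto simp only: d\<close>)
  from S(3)[OF this N(2)] show "carrier (mor_module n X) \<subseteq> N" unfolding d .
 qed (use S(2) in \<open>simp only: d\<close>)
qed

subsection \<open>The rows of a module\<close>

text \<open>\<open>e Z\<close> for the idempotent \<open>e = E p p (one A)\<close>, described by its
  fixed points: the \<open>p\<close>-th branch of a module that is not given as an object of
  \<open>Mor\<close>.\<close>

definition row :: "(nat => nat => 'a, 'z) module => nat => ('a, 'z) module" where
 "row Z p = \<lparr> carrier = {z \<in> carrier Z. E p p (one A) .[Z] z = z}, mult = undefined, one = undefined,
   zero = zero Z, add = (%x y. x +[Z] y), smult = (%a z. E p p a .[Z] z) \<rparr>"

lemma row_simps [simp]:
 "carrier (row Z p) = {z \<in> carrier Z. E p p (one A) .[Z] z = z}" "zero (row Z p) = zero Z"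
 "x +[row Z p] y = x +[Z] y" "a .[row Z p] z = E p p a .[Z] z"
 by (simp_all add: row_def)

lemma E_E:
 assumes Z: "lmodule T Z" and "p \<in> {1..n}" "q \<in> {1..n}" "s \<in> {1..n}" "p \<le> q" "q \<le> s"
  "a \<in> carrier A" "b \<in> carrier A" "z \<in> carrier Z"
 shows "E p q a .[Z] (E q s b .[Z] z) = E p s (a *[A] b) .[Z] z"
proof -
 interpret Z: lmodule T Z by (rule Z)
 show ?thesis using assms by (simp add: E_closed E_mult flip: Z.smult_assoc1)
qed

lemma E_E_zero:
 assumes Z: "lmodule T Z" and "p \<in> {1..n}" "q \<in> {1..n}" "r \<in> {1..n}" "s \<in> {1..n}" "p \<le> q" "r \<le> s" "q ~= r"
  "a \<in> carrier A" "b \<in> carrier A" "z \<in> carrier Z"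
 shows "E p q a .[Z] (E r s b .[Z] z) = zero Z"
proof -
 interpret Z: lmodule T Z by (rule Z)
 show ?thesis using assms by (simp add: E_closed E_mult Z.smult_zero_left flip: Z.smult_assoc1)
qed

lemma E_in_row:
 assumes Z: "lmodule T Z" and "p \<in> {1..n}" "q \<in> {1..n}" "p \<le> q" "a \<in> carrier A" "z \<in> carrier Z"
 shows "E p q a .[Z] z \<in> carrier (row Z p)"
proof -
 interpret Z: lmodule T Z by (rule Z)
 show ?thesis using assms by (simp add: E_E E_closed)
qed

lemma lmodule_row:
 assumes Z: "lmodule T Z" and p: "p \<in> {1..n}"
 shows "lmodule A (row Z p)"
proof -
 interpret Z: lmodule T Z by (rule Z)
 show ?thesis
  by (rule lmoduleI[OF R.ring_axioms])
    (use p in \<open>auto simp: E_closed Z.smult_zero Z.smult_r_distr Z.M.a_ac E_E[OF Z] E_add Z.smult_l_distr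
     E_zero Z.smult_zero_left simp del: atLeastAtMost_iff\<close>)
qed

lemma E_row_hom:
 assumes Z: "lmodule T Z" and pq: "p \<in> {1..n}" "q \<in> {1..n}" "p \<le> q"
 shows "(%z. E p q (one A) .[Z] z) \<in> mod_hom A (row Z q) (row Z p)"
proof -
 interpret Z: lmodule T Z by (rule Z)
 show ?thesis
  by (rule mod_homI)
    (use pq in \<open>auto simp: E_closed Z.smult_r_distr E_E[OF Z] simp del: atLeastAtMost_iff\<close>)
qed

lemma row_hom:
 assumes f: "f \<in> mod_hom T Z W" and p: "p \<in> {1..n}"
 shows "f \<in> mod_hom A (row Z p) (row W p)"
proof (rule mod_homI)
 fix z assume z: "z \<in> carrier (row Z p)"
 then have "f z = E p p (one A) .[W] f z"
  using mod_homD(3)[OF f, of "E p p (one A)" z] p by (simp add: E_closed)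
 then show "f z \<in> carrier (row W p)" using z mod_homD(1)[OF f] by simp
qed (use p mod_homD[OF f] in \<open>auto simp: E_closed\<close>)

lemma row_surj:
 assumes Z: "lmodule T Z" and f: "f \<in> mod_hom T Z W" "f ` carrier Z = carrier W" and p: "p \<in> {1..n}"
 shows "f ` carrier (row Z p) = carrier (row W p)"
proof (intro equalityI subsetI)
 fix w assume w: "w \<in> carrier (row W p)"
 then obtain z where z: "z \<in> carrier Z" "w = f z" using f(2) by force
 have "f (E p p (one A) .[Z] z) = w"
  using mod_homD(3)[OF f(1), of "E p p (one A)" z] z w p by (simp add: E_closed)
 moreover have "E p p (one A) .[Z] z \<in> carrier (row Z p)" using E_in_row[OF Z p p] z by simp
 ultimately show "w \<in> f ` carrier (row Z p)" by blast
qed (use mod_homD(1)[OF row_hom[OF f(1) p]] in blast)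

subsection \<open>Interval modules\<close>

abbreviation "Ivl M lo hi \<equiv> mor_module n (ivl M lo hi)"

lemma morl_ivl:
 assumes M: "lmodule A M"
 shows "morl (ivl M lo hi)"
proof -
 interpret M: lmodule A M by (rule M)
 have "lmodule A (M\<lparr>carrier := {zero M}\<rparr>)" by (rule lmodule_restrict[OF M submodule_zero[OF M]])
 then show ?thesis
  unfolding morl_def ivl_def by (auto intro!: mod_homI simp: M M.smult_zero)
qed

lemma Ivl_carrier:
 "x \<in> carrier (Ivl M lo hi) \<longleftrightarrow> x \<in> extensional {1..n} &
   (\<forall>p\<in>{1..n}. if lo \<le> p & p \<le> hi then x p \<in> carrier M else x p = zero M)"
proof -
 have "carrier (branch (ivl M lo hi) p) = (if lo \<le> p & p \<le> hi then carrier M else {zero M})" for p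
  by (simp add: ivl_def)
 then show ?thesis unfolding mor_module_def by (auto simp: PiE_iff)
qed

lemma Ivl_simps:
 "zero (Ivl M lo hi) = (\<lambda>p\<in>{1..n}. zero M)" "x +[Ivl M lo hi] y = (\<lambda>p\<in>{1..n}. x p +[M] y p)"
proof -
 have "zero (branch (ivl M lo hi) p) = zero M" "add (branch (ivl M lo hi) p) = add M" for p
  by (simp_all add: ivl_def)
 then show "zero (Ivl M lo hi) = (\<lambda>p\<in>{1..n}. zero M)" "x +[Ivl M lo hi] y = (\<lambda>p\<in>{1..n}. x p +[M] y p)"
  by (simp_all add: mor_module_def)
qed

lemma Ivl_component:
 assumes "lmodule A M" "x \<in> carrier (Ivl M lo hi)" "p \<in> {1..n}"
 shows "x p \<in> carrier M"
proof -
 interpret M: lmodule A M by fact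
 show ?thesis using assms(2,3) by (auto simp: Ivl_carrier split: if_splits)
qed

text \<open>The upper end of the interval is absent from the formula because beyond
  \<open>hi\<close> the element \<open>x\<close> is already zero.\<close>

lemma ivl_path:
 assumes "lmodule A M" "x \<in> carrier (branch (ivl M lo hi) (p + d))"
 shows "mor_path (ivl M lo hi) p d x = (if lo \<le> p then x else zero M)"
 using assms(2)
proof (induction d arbitrary: x)
 case 0
 then show ?case by (auto simp: ivl_def split: if_splits)
next
 case (Suc d)
 interpret M: lmodule A M by fact
 have "strmap (ivl M lo hi) (p + d) x = (if lo \<le> p + d then x else zero M)"
  "strmap (ivl M lo hi) (p + d) x \<in> carrier (branch (ivl M lo hi) (p + d))"
  using Suc.prems by (auto simp: ivl_def split: if_splits)
 with Suc.IH show ?case by auto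
qed

lemma Ivl_E:
 assumes M: "lmodule A M" and x: "x \<in> carrier (Ivl M lo hi)"
  and pq: "p \<in> {1..n}" "q \<in> {1..n}" "p \<le> q" and a: "a \<in> carrier A"
 shows "E p q a .[Ivl M lo hi] x = (\<lambda>r\<in>{1..n}. if r = p & lo \<le> p then a .[M] x q else zero M)"
proof -
 interpret M: lmodule A M by (rule M)
 have "mor_path (ivl M lo hi) p (q - p) (x q) = (if lo \<le> p then x q else zero M)"
  using mor_component[OF x pq(2)] pq(3) by (intro ivl_path[OF M]) simp
 moreover have "smult (branch (ivl M lo hi) p) = smult M" "zero (branch (ivl M lo hi) r) = zero M" for r
  by (simp_all add: ivl_def)
 ultimately show ?thesis
  unfolding mor_E_action[OF morl_ivl[OF M] pq a x] by (auto simp: single_def fun_eq_iff a M.smult_zero)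
qed

lemma lmodule_Ivl: "lmodule A M ==> lmodule T (Ivl M lo hi)"
 by (rule lmodule_mor[OF morl_ivl])

lemma fg_Ivl:
 assumes M: "fg_module A M"
 shows "fg_module T (Ivl M lo hi)"
proof (rule fg_mor[OF morl_ivl[OF fg_lmodule[OF M]]])
 have "fg_module A (M\<lparr>carrier := {zero M}\<rparr>)"
  by (rule zero_fg[OF lmodule_restrict[OF fg_lmodule[OF M] submodule_zero[OF fg_lmodule[OF M]]]]) simp
 then show "fg_module A (branch (ivl M lo hi) i)" for i using M by (simp add: ivl_def)
qed

abbreviation "Imap f \<equiv> %x. \<lambda>p\<in>{1..n}. f (x p)"

lemma Ivl_map:
 assumes M: "lmodule A M" and N: "lmodule A N" and f: "f \<in> mod_hom A M N"
 shows "Imap f \<in> mod_hom T (Ivl M lo hi) (Ivl N lo hi)"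
proof (rule T_mod_homI[OF lmodule_Ivl[OF M] lmodule_Ivl[OF N]])
 note fD = mod_homD[OF f] and f0 = mod_hom_zero[OF f M N] and c = Ivl_component[OF M]
 fix x assume x: "x \<in> carrier (Ivl M lo hi)"
 show fx: "Imap f x \<in> carrier (Ivl N lo hi)"
  using x unfolding Ivl_carrier by (auto simp: fD(1) f0 simp del: atLeastAtMost_iff)
 show "Imap f (x +[Ivl M lo hi] y) = Imap f x +[Ivl N lo hi] Imap f y" if "y \<in> carrier (Ivl M lo hi)" for y
  using c[OF x] c[OF that] by (auto simp: Ivl_simps fD(2) fun_eq_iff simp del: atLeastAtMost_iff)
 fix p q a assume pq: "p \<in> {1..n}" "q \<in> {1..n}" "p \<le> q" "a \<in> carrier A"
 show "Imap f (E p q a .[Ivl M lo hi] x) = E p q a .[Ivl N lo hi] Imap f x"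
  unfolding Ivl_E[OF M x pq] Ivl_E[OF N fx pq]
  using pq c[OF x pq(2)] by (auto simp: f0 fD(3) fun_eq_iff simp del: atLeastAtMost_iff)
qed

lemma Ivl_ses:
 assumes s: "ses A X f Y g Z"
 shows "ses T (Ivl X lo hi) (Imap f) (Ivl Y lo hi) (Imap g) (Ivl Z lo hi)"
proof -
 note sD = sesD[OF s]
 note f = mod_homD(1)[OF sD(4)] and f0 = mod_hom_zero[OF sD(4,1,2)]
  and g = mod_homD(1)[OF sD(6)] and g0 = mod_hom_zero[OF sD(6,2,3)]
 note fh = Ivl_map[OF sD(1,2,4), of lo hi] and gh = Ivl_map[OF sD(2,3,6), of lo hi]
 have fi: "x = zero X" if "x \<in> carrier X" "f x = zero Y" for x
  using sD(5) that inj_on_mod_hom[OF sD(1,2,4)] by blast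
 have inj: "inj_on (Imap f) (carrier (Ivl X lo hi))"
  unfolding inj_on_mod_hom[OF lmodule_Ivl[OF sD(1)] lmodule_Ivl[OF sD(2)] fh]
 proof (intro ballI impI)
  fix x assume x: "x \<in> carrier (Ivl X lo hi)" and e: "Imap f x = zero (Ivl Y lo hi)"
  have "f (x p) = zero Y" if "p \<in> {1..n}" for p using fun_cong[OF e, of p] that by (simp add: Ivl_simps)
  then have "x p = zero X" if "p \<in> {1..n}" for p using Ivl_component[OF sD(1) x that] fi that by blast
  then show "x = zero (Ivl X lo hi)"
   using x by (auto simp: Ivl_simps Ivl_carrier fun_eq_iff extensional_def restrict_def)
 qed
 have surj: "Imap g ` carrier (Ivl Y lo hi) = carrier (Ivl Z lo hi)"
 proof (intro equalityI subsetI)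
  fix z assume z: "z \<in> carrier (Ivl Z lo hi)"
  \<comment> \<open>Zero is lifted to zero, since outside the interval the components of
    \<open>y\<close> have to vanish.\<close>
  define y where "y = (\<lambda>p\<in>{1..n}. if z p = zero Z then zero Y else inv_into (carrier Y) g (z p))"
  have zc: "z p \<in> g ` carrier Y" if "p \<in> {1..n}" for p
   using Ivl_component[OF sD(3) z that] sD(7) by simp
  have "y \<in> carrier (Ivl Y lo hi)"
   using z inv_into_into[OF zc] g0 submoduleD(2)[OF submodule_carrier[OF sD(2)]]
   unfolding Ivl_carrier by (auto simp: y_def simp del: atLeastAtMost_iff)
  moreover have "Imap g y = z"
   using z f_inv_into_f[OF zc] g0
   by (auto simp: y_def fun_eq_iff Ivl_carrier extensional_def simp del: atLeastAtMost_iff)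
  ultimately show "z \<in> Imap g ` carrier (Ivl Y lo hi)" by blast
 qed (use mod_homD(1)[OF gh] in blast)
 have "Imap f ` carrier (Ivl X lo hi) = a_kernel (Ivl Y lo hi) (Ivl Z lo hi) (Imap g)"
 proof (intro equalityI subsetI)
  fix y assume "y \<in> Imap f ` carrier (Ivl X lo hi)"
  then obtain x where x: "x \<in> carrier (Ivl X lo hi)" "y = Imap f x" by blast
  have "Imap g y = zero (Ivl Z lo hi)"
   using ses_comp_zero[OF s Ivl_component[OF sD(1) x(1)]]
   by (auto simp: x(2) Ivl_simps fun_eq_iff simp del: atLeastAtMost_iff)
  then show "y \<in> a_kernel (Ivl Y lo hi) (Ivl Z lo hi) (Imap g)"
   using mod_homD(1)[OF fh x(1)] x(2) by (simp add: a_kernel_eq)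
 next
  fix y assume "y \<in> a_kernel (Ivl Y lo hi) (Ivl Z lo hi) (Imap g)"
  then have y: "y \<in> carrier (Ivl Y lo hi)" "Imap g y = zero (Ivl Z lo hi)" by (auto simp: a_kernel_eq)
  have yp: "y p \<in> f ` carrier X" if p: "p \<in> {1..n}" for p
   using fun_cong[OF y(2), of p] p Ivl_component[OF sD(2) y(1) p] sD(8)
   by (simp add: Ivl_simps a_kernel_eq)
  define x where "x = (\<lambda>p\<in>{1..n}. inv_into (carrier X) f (y p))"
  have "y p = zero Y ==> inv_into (carrier X) f (y p) = zero X" if "p \<in> {1..n}" for p
   using fi[OF inv_into_into[OF yp[OF that]]] f_inv_into_f[OF yp[OF that]] by simp
  then have "x \<in> carrier (Ivl X lo hi)"
   using y(1) inv_into_into[OF yp] unfolding Ivl_carrier by (auto simp: x_def simp del: atLeastAtMost_iff)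
  moreover have "Imap f x = y"
   using y(1) f_inv_into_f[OF yp]
   by (auto simp: x_def fun_eq_iff Ivl_carrier extensional_def simp del: atLeastAtMost_iff)
  ultimately show "y \<in> Imap f ` carrier (Ivl X lo hi)" by blast
 qed
 then show ?thesis
  unfolding ses_def by (intro conjI lmodule_Ivl sD(1-3) fh gh inj surj)
qed

lemma Ivl_addc:
 assumes N: "addc A N P" and Nl: "lmodule A N"
 shows "addc T (Ivl N lo hi) (Ivl P lo hi)"
proof -
 have P: "lmodule A P" by (rule addc_lmodule[OF N])
 have "fac T (Ivl P lo hi) (Ivl N lo hi) (Ivl P lo hi) (Imap h)" if "fac A P N P h" for h
  using that
 proof induction
  case (fac_zero h)
  then show ?case
   by (intro fac.fac_zero)
     (auto simp: Ivl_simps fun_eq_iff Ivl_component[OF P] simp del: atLeastAtMost_iff)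
 next
  case (fac_step h f g h')
  show ?case
   by (rule fac.fac_step[OF fac_step.IH Ivl_map[OF P Nl fac_step.hyps(2)] Ivl_map[OF Nl P fac_step.hyps(3)]])
     (auto simp: Ivl_simps fun_eq_iff fac_step.hyps(4) Ivl_component[OF P] simp del: atLeastAtMost_iff)
 qed
 from this[of "%x. x"] have "fac T (Ivl P lo hi) (Ivl N lo hi) (Ivl P lo hi) (Imap (%x. x))"
  using N by (simp add: addc_def)
 then show ?thesis
  unfolding addc_def using lmodule_Ivl[OF P]
  by (auto elim!: fac_cong simp: Ivl_carrier fun_eq_iff extensional_def)
qed

text \<open>The case \<open>i = n\<close>, in which the quotient is zero, is kept so that all
  summands of \<open>m_module n M\<close> can be treated alike.\<close>

lemma Ivl_cut:
 assumes M: "lmodule A M" and i: "i \<le> n"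
 shows "ses T (Ivl M 1 i) (%x. x) (Ivl M 1 n) (%x. \<lambda>p\<in>{1..n}. if i < p then x p else zero M) (Ivl M (Suc i) n)"
proof -
 interpret M: lmodule A M by (rule M)
 let ?g = "%x. \<lambda>p\<in>{1..n}. if i < p then x p else zero M"
 have c: "x \<in> carrier (Ivl M 1 n)" if "x \<in> carrier (Ivl M 1 i)" for x
  using that by (auto simp: Ivl_carrier split: if_splits)
 have incl: "(%x. x) \<in> mod_hom T (Ivl M 1 i) (Ivl M 1 n)"
 proof (rule T_mod_homI[OF lmodule_Ivl[OF M] lmodule_Ivl[OF M]])
  fix p q a x assume "p \<in> {1..n}" "q \<in> {1..n}" "p \<le> q" "a \<in> carrier A" "x \<in> carrier (Ivl M 1 i)"
  then show "E p q a .[Ivl M 1 i] x = E p q a .[Ivl M 1 n] x" by (simp only: Ivl_E[OF M] c)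
 qed (simp_all only: c Ivl_simps)
 have gc: "?g x \<in> carrier (Ivl M (Suc i) n)" if "x \<in> carrier (Ivl M 1 n)" for x
  using that by (auto simp: Ivl_carrier split: if_splits)
 have g: "?g \<in> mod_hom T (Ivl M 1 n) (Ivl M (Suc i) n)"
 proof (rule T_mod_homI[OF lmodule_Ivl[OF M] lmodule_Ivl[OF M] gc])
  fix p q a x assume pq: "p \<in> {1..n}" "q \<in> {1..n}" "p \<le> q" "a \<in> carrier A" and x: "x \<in> carrier (Ivl M 1 n)"
  show "?g (E p q a .[Ivl M 1 n] x) = E p q a .[Ivl M (Suc i) n] ?g x"
   unfolding Ivl_E[OF M x pq] Ivl_E[OF M gc[OF x] pq] using pq by (auto simp: fun_eq_iff)
 qed (auto simp: Ivl_simps fun_eq_iff)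
 have "?g ` carrier (Ivl M 1 n) = carrier (Ivl M (Suc i) n)"
 proof (intro equalityI subsetI)
  fix x assume x: "x \<in> carrier (Ivl M (Suc i) n)"
  then have "x \<in> carrier (Ivl M 1 n)" by (auto simp: Ivl_carrier split: if_splits)
  moreover have "x = ?g x" using x by (auto simp: Ivl_carrier fun_eq_iff extensional_def split: if_splits)
  ultimately show "x \<in> ?g ` carrier (Ivl M 1 n)" by (rule image_eqI[of x ?g x, rotated])
 qed (use gc in blast)
 moreover have "(%x. x) ` carrier (Ivl M 1 i) = a_kernel (Ivl M 1 n) (Ivl M (Suc i) n) ?g"
 proof -
  have "(x \<in> carrier (Ivl M 1 i)) = (x \<in> carrier (Ivl M 1 n) & ?g x = zero (Ivl M (Suc i) n))" for x
   using i unfolding Ivl_carrier Ivl_simps fun_eq_iff by (auto split: if_splits)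
  then show ?thesis by (auto simp: a_kernel_eq)
 qed
 ultimately show ?thesis
  unfolding ses_def using incl g lmodule_Ivl[OF M] by simp
qed

end

text \<open>The long exact sequence in the second argument: \<open>lift\<close> says that the
  connecting map to \<open>Ext^1(X, M')\<close> is zero. The condition reproduces itself on
  syzygies, where a map to \<open>M''\<close> extends to the cover, lifts to \<open>M\<close> by
  projectivity, and restricts again.\<close>

lemma orth_target_sub:
 fixes B :: "('a, 'z) ring_scheme"
 assumes s: "ses B M' i M r M''" and X: "orth B M X" "orth B M'' X"
  and lift: "!!h. h \<in> mod_hom B X M'' ==> \<exists>h'\<in>mod_hom B X M. \<forall>x\<in>carrier X. r (h' x) = h x"
 shows "orth B M' X"
proof -
 note s' = sesD[OF s]
 interpret M: lmodule B M by (rule s'(2))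
 interpret M'': lmodule B M'' by (rule s'(3))
 define R where "R Y \<longleftrightarrow> orth B M Y & orth B M'' Y &
  (\<forall>h\<in>mod_hom B Y M''. \<exists>h'\<in>mod_hom B Y M. \<forall>x\<in>carrier Y. r (h' x) = h x)"
  for Y :: "'a fgm"
 from orth_fg[OF X(1)] obtain X' :: "'a fgm"
  where X': "fg_module B X'" "lmodule B X'" "mod_iso B X X'" "mod_iso B X' X" by (rule copy_exists)
 show ?thesis
 proof (rule orth_coinduct_kernel[where R = R, OF X'(3) orth_lmodule[OF X(1)] X'(2)])
  obtain a b where ab: "a \<in> mod_hom B X X'" "b \<in> mod_hom B X' X" "!!y. y \<in> carrier X' ==> a (b y) = y"
   by (rule mod_isoE[OF X'(3) orth_lmodule[OF X(1)]]) (rule that)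
  have "\<exists>h'\<in>mod_hom B X' M. \<forall>x\<in>carrier X'. r (h' x) = h x" if h: "h \<in> mod_hom B X' M''" for h
  proof -
   obtain h' where h': "h' \<in> mod_hom B X M" "\<forall>x\<in>carrier X. r (h' x) = h (a x)"
    using lift[OF mod_hom_comp[OF ab(1) h]] by blast
   show ?thesis
    by (rule bexI[OF _ mod_hom_comp[OF ab(2) h'(1)]]) (use h'(2) mod_homD(1)[OF ab(2)] ab(3) in auto)
  qed
  then show "R X'"
   unfolding R_def using orth_iso[OF X(1) X'(3,2)] orth_iso[OF X(2) X'(3,2)] by blast
  fix Y :: "'a fgm" assume "R Y"
  then have Y: "orth B M Y" "orth B M'' Y"
   and lf: "!!h. h \<in> mod_hom B Y M'' ==> \<exists>h'\<in>mod_hom B Y M. \<forall>x\<in>carrier Y. r (h' x) = h x"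
   unfolding R_def by blast+
  from Y(1) obtain P :: "'a fgm" and p where P: "cover B P p Y"
   "extends B P (a_kernel P Y p) M" "orth B M (ker_mod P Y p)" by (rule orthE)
  note P' = coverD[OF P(1)]
  have ex'': "extends B P (a_kernel P Y p) M''" by (rule orth_extends[OF Y(2) s'(3) P'(2,4,5)])
  have "extends B P (a_kernel P Y p) M'"
   unfolding extends_def
  proof
   fix h assume h: "h \<in> mod_hom B (ker_mod P Y p) M'"
   obtain g where g: "g \<in> mod_hom B P M" "!!x. x \<in> a_kernel P Y p ==> g x = i (h x)"
    by (rule extendsD[OF P(2) mod_hom_comp[OF h s'(4)]]) blast
   have gr: "(%x. r (g x)) \<in> mod_hom B P M''" by (rule mod_hom_comp[OF g(1) s'(6)])
   \<comment> \<open>\<open>r\<close> after \<open>g\<close> vanishes on the syzygy and so comes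
     from a map \<open>u\<close> on \<open>Y\<close>. Lifting \<open>u\<close> to \<open>v\<close>
     and subtracting it from \<open>g\<close> leaves a map into the image of \<open>M'\<close> with
     the same values on the syzygy.\<close>
   obtain u where u: "u \<in> mod_hom B Y M''" "\<forall>x\<in>carrier P. u (p x) = r (g x)"
    using mod_hom_factor[OF P'(2,3) s'(3) P'(4,5) gr] g(2) ses_comp_zero[OF s mod_homD(1)[OF h]]
    by (auto simp: a_kernel_eq)
   obtain v where v: "v \<in> mod_hom B Y M" "\<forall>x\<in>carrier Y. r (v x) = u x" using lf[OF u(1)] by blast
   have vp: "(%x. v (p x)) \<in> mod_hom B P M" by (rule mod_hom_comp[OF P'(4) v(1)])
   define w where "w x = msub B M (g x) (v (p x))" for x
   have w: "w \<in> mod_hom B P M" unfolding w_def by (rule mod_hom_diff[OF s'(2) g(1) vp])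
   have "r (w x) = zero M''" if x: "x \<in> carrier P" for x
    unfolding w_def mod_hom_msub[OF s'(6,2) mod_homD(1)[OF g(1) x] mod_homD(1)[OF vp x]]
    using u(2) v(2) x mod_homD(1)[OF P'(4) x] mod_homD(1)[OF gr x] by (simp add: M''.msub_eq_zero)
   then have wi: "w ` carrier P \<subseteq> i ` carrier M'" using mod_homD(1)[OF w] by (auto simp: s'(8) a_kernel_eq)
   have ii: "i \<in> mod_hom B M' (M\<lparr>carrier := i ` carrier M'\<rparr>)" by (rule mod_hom_restrict_cod[OF s'(4)]) simp
   note inv = mod_hom_inv_into[OF s'(1) ii]
   show "\<exists>h'\<in>mod_hom B P M'. \<forall>x\<in>a_kernel P Y p. h' x = h x"
   proof (rule bexI[OF _ mod_hom_comp[OF mod_hom_restrict_cod[OF w wi] inv]], rule ballI)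
    fix x assume x: "x \<in> a_kernel P Y p"
    then have "w x = i (h x)"
     using g(2)[OF x] mod_homD(1)[OF s'(4) mod_homD(1)[OF h]] mod_hom_zero[OF v(1) P'(3) s'(2)]
     by (simp add: w_def a_kernel_eq M.msub_zero)
    then show "inv_into (carrier M') i (w x) = h x"
     using s'(5) mod_homD(1)[OF h] x by simp
   qed (use s'(5) in \<open>simp add: bij_betw_def\<close>)
  qed
  moreover have "R (ker_mod P Y p)"
   unfolding R_def
  proof (intro conjI ballI orth_syzygy[OF Y(2) s'(3) P(1)] P(3))
   fix h assume "h \<in> mod_hom B (ker_mod P Y p) M''"
   from extendsD[OF ex'' this] obtain h1 where
    h1: "h1 \<in> mod_hom B P M''" "!!x. x \<in> a_kernel P Y p ==> h1 x = h x" by blast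
   from projective_lift[OF P'(1) h1(1) s'(2,3,6,7)] obtain h2 where
    h2: "h2 \<in> mod_hom B P M" "\<forall>x\<in>carrier P. r (h2 x) = h1 x" by blast
   show "\<exists>h'\<in>mod_hom B (ker_mod P Y p) M. \<forall>x\<in>carrier (ker_mod P Y p). r (h' x) = h x"
    by (rule bexI[OF _ mod_hom_restrict[OF h2(1)]])
      (use h2(2) h1(2) submoduleD(1)[OF P'(6)] in auto)
  qed
  ultimately show "\<exists>(P :: 'a fgm) p. cover B P p Y &
    extends B P (a_kernel P Y p) M' & R (ker_mod P Y p)"
   using P(1) by blast
 qed
qed

section \<open>Branches, and interval modules as their right adjoint\<close>

context tri_alg
begin

text \<open>A row of \<open>T\<close> is free over \<open>A\<close> on the columns from
  \<open>p\<close> to \<open>n\<close>. This is why taking branches preserves projectives.\<close>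

lemma row_reg:
 assumes p: "p \<in> {1..n}"
 shows "fgproj A (row (reg_module T) p)"
proof -
 let ?N = "%j. if p \<le> j then reg_module A else (reg_module A)\<lparr>carrier := {zero A}\<rparr>"
 have lA: "lmodule A (reg_module A)" by (rule lmodule_reg[OF R.ring_axioms])
 have lT: "lmodule T (reg_module T)" by (rule lmodule_reg[OF RT.ring_axioms])
 note lr = lmodule_row[OF lT p]
 have lz: "lmodule A ((reg_module A)\<lparr>carrier := {zero A}\<rparr>)"
  using lmodule_restrict[OF lA submodule_zero[OF lA]] by simp
 have N: "fgproj A (?N j)" for j using addc_refl[OF lA] addc_zero[OF lz, of "reg_module A"] by simp
 have D: "fgproj A (dsum {1..n} ?N)" by (rule addc_dsum[OF R.ring_axioms finite_atLeastAtMost N])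
 interpret D: lmodule A "dsum {1..n} ?N" by (rule addc_lmodule[OF D])
 have cs: "carrier (?N j) = (if p \<le> j then carrier A else {zero A})" "zero (?N j) = zero A"
  "add (?N j) = add A" "smult (?N j) = mult A" for j
  by (simp_all add: fun_eq_iff)
 have entry: "(E p p a *[T] b) i j = (if i = p then a *[A] b p j else zero A)"
  if a: "a \<in> carrier A" and b: "b \<in> carrier T" and ij: "i \<in> {1..n}" "j \<in> {1..n}" for a b i j
 proof -
  have "(\<Oplus>\<^bsub>A\<^esub>l\<in>{1..n}. E p p a i l *[A] b l j) = E p p a i p *[A] b p j"
   using p a ij T_entry[OF b _ ij(2)]
   by (intro R.finsum_single) (auto simp: T_simps simp del: atLeastAtMost_iff)
  then show ?thesis using p a ij T_entry[OF b p ij(2)] by (simp add: T_simps)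
 qed
 have row: "b \<in> carrier (row (reg_module T) p) \<longleftrightarrow>
   b \<in> carrier T & (\<forall>i\<in>{1..n}. \<forall>j\<in>{1..n}. i ~= p --> b i j = zero A)" for b
 proof (cases "b \<in> carrier T")
  case True
  then have "E p p (one A) *[T] b = b \<longleftrightarrow> (\<forall>i\<in>{1..n}. \<forall>j\<in>{1..n}. (E p p (one A) *[T] b) i j = b i j)"
   using T_eqI[OF RT.m_closed[OF E_closed True]] p by (metis R.one_closed le_refl)
  moreover have "(E p p (one A) *[T] b) i j = (if i = p then b i j else zero A)"
   if "i \<in> {1..n}" "j \<in> {1..n}" for i j
   using entry[OF R.one_closed True that] T_entry[OF True p that(2)] by simp
  ultimately show ?thesis using True by (simp del: atLeastAtMost_iff) metis
 qed simp
 have f: "(%b. b p) \<in> mod_hom A (row (reg_module T) p) (dsum {1..n} ?N)"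
 proof (rule mod_homI)
  fix b assume "b \<in> carrier (row (reg_module T) p)"
  then have b: "b \<in> carrier T" by simp
  then have "b p \<in> extensional {1..n}" using p unfolding T_carrier by blast
  then show "b p \<in> carrier (dsum {1..n} ?N)"
   using T_lower[OF b p] T_entry[OF b p] by (auto simp: dsum_simps cs PiE_iff simp del: atLeastAtMost_iff)
  show "(b +[row (reg_module T) p] c) p = b p +[dsum {1..n} ?N] c p" for c
   using p by (simp add: dsum_simps cs tri_algebra_def)
  fix a assume a: "a \<in> carrier A"
  have "E p p a *[T] b \<in> carrier T" using a b p by (intro RT.m_closed E_closed) auto
  then have "(E p p a *[T] b) p \<in> extensional {1..n}" using p unfolding T_carrier by blast
  then show "(a .[row (reg_module T) p] b) p = a .[dsum {1..n} ?N] b p"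
   using entry[OF a b p] p by (auto simp: dsum_simps cs fun_eq_iff extensional_def)
 qed
 have "inj_on (%b. b p) (carrier (row (reg_module T) p))"
 proof (rule inj_onI)
  fix b c assume bc: "b \<in> carrier (row (reg_module T) p)" "c \<in> carrier (row (reg_module T) p)" "b p = c p"
  note bc' = bc(1,2)[unfolded row]
  show "b = c"
  proof (rule T_eqI)
   fix i j assume "i \<in> {1..n}" "j \<in> {1..n}"
   then show "b i j = c i j" using bc' bc(3) by (cases "i = p") (simp, metis)
  qed (use bc' in blast)+
 qed
 moreover have "(%b. b p) ` carrier (row (reg_module T) p) = carrier (dsum {1..n} ?N)"
 proof (intro equalityI subsetI)
  fix x assume x: "x \<in> carrier (dsum {1..n} ?N)"
  let ?b = "\<lambda>i\<in>{1..n}. \<lambda>j\<in>{1..n}. if i = p then x j else zero A"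
  have "x = ?b p" using x p by (auto simp: dsum_simps fun_eq_iff PiE_iff extensional_def)
  moreover have "?b \<in> carrier (row (reg_module T) p)"
  proof -
   have m: "x j \<in> (if p \<le> j then carrier A else {zero A})" if "j \<in> {1..n}" for j
    using PiE_mem[OF x[unfolded dsum_simps cs] that] .
   then have "x j \<in> carrier A" "j < p ==> x j = zero A" if "j \<in> {1..n}" for j
    using m[OF that] by (auto split: if_splits)
   then show ?thesis unfolding row T_carrier by (simp add: R.zero_closed del: atLeastAtMost_iff)
  qed
  ultimately show "x \<in> (%b. b p) ` carrier (row (reg_module T) p)"
   by (rule image_eqI[of x "%b. b p" ?b])
 qed (use mod_homD(1)[OF f] in blast)
 ultimately have "mod_iso A (row (reg_module T) p) (dsum {1..n} ?N)" by (rule mod_iso_bij[OF f])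
 from addc_iso[OF D mod_iso_sym[OF this lr] lr] show ?thesis .
qed

lemma row_fac:
 assumes "fac T X N Y h" "p \<in> {1..n}"
 shows "fac A (row X p) (row N p) (row Y p) h"
 using assms(1)
proof induction
 case (fac_step h f g h')
 then show ?case
  by (intro fac.fac_step[OF fac_step.IH row_hom[OF _ assms(2)] row_hom[OF _ assms(2)]]) auto
qed (auto intro: fac.fac_zero)

lemma row_fgproj:
 assumes P: "fgproj T P" and p: "p \<in> {1..n}"
 shows "fgproj A (row P p)"
proof (rule addc_trans[OF _ row_reg[OF p]])
 show "addc A (row (reg_module T) p) (row P p)"
  using P lmodule_row[OF addc_lmodule[OF P] p] row_fac[OF _ p, of P "reg_module T" P "%x. x"]
  by (simp add: addc_def)
qed

lemma row_cover:
 assumes P: "cover T P p Z" and j: "j \<in> {1..n}"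
 shows "cover A (row P j) p (row Z j)"
 unfolding cover_def
 by (intro conjI row_fgproj lmodule_row row_hom row_surj coverD[OF P] j)

lemma row_ker_mod: "row (ker_mod P Z p) j = ker_mod (row P j) (row Z j) p"
 by (auto simp: row_def a_kernel_eq)

lemma row_iso:
 assumes "mod_iso T Z W" "lmodule T Z" "lmodule T W" and p: "p \<in> {1..n}"
 shows "mod_iso A (row Z p) (row W p)"
proof -
 from assms(1) obtain f where f: "f \<in> mod_hom T Z W" "inj_on f (carrier Z)" "f ` carrier Z = carrier W"
  by (auto simp: mod_iso_def bij_betw_def)
 show ?thesis
  by (rule mod_iso_bij[OF row_hom[OF f(1) p] _ row_surj[OF assms(2) f(1,3) p]])
    (rule inj_on_subset[OF f(2)], simp)
qed

lemma fg_row: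
 assumes Z: "fg_module T Z" and p: "p \<in> {1..n}"
 shows "fg_module A (row Z p)"
proof -
 from free_cover[OF Z] obtain m f where f: "f \<in> mod_hom T (free_module T m) Z"
  "f ` carrier (free_module T m) = carrier Z" by blast
 have "cover T (free_module T m) f Z"
  unfolding cover_def using fgproj_free[OF RT.ring_axioms] fg_lmodule[OF Z] f by blast
 from cover_fg[OF row_cover[OF this p]] show ?thesis .
qed

text \<open>The map to \<open>Ivl M j n\<close> adjoint to \<open>f\<close>: an element is moved
  from row \<open>q\<close> to row \<open>j\<close> before \<open>f\<close> is applied.\<close>

abbreviation "up M Z j f \<equiv> %z. \<lambda>q\<in>{1..n}. if j \<le> q then f (E j q (one A) .[Z] z) else zero M"

lemma row_up:
 assumes Z: "lmodule T Z" and M: "lmodule A M" and j: "j \<in> {1..n}" and f: "f \<in> mod_hom A (row Z j) M"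
 shows "up M Z j f \<in> mod_hom T Z (Ivl M j n)"
proof (rule T_mod_homI[OF Z lmodule_Ivl[OF M]])
 interpret Z: lmodule T Z by (rule Z)
 interpret M: lmodule A M by (rule M)
 note fc = mod_homD(1)[OF f E_in_row[OF Z j _ _ R.one_closed]]
 fix z assume z: "z \<in> carrier Z"
 show c: "up M Z j f z \<in> carrier (Ivl M j n)" using fc z by (auto simp: Ivl_carrier)
 show "up M Z j f (z +[Z] z') = up M Z j f z +[Ivl M j n] up M Z j f z'" if z': "z' \<in> carrier Z" for z'
 proof -
  have "f (E j q (one A) .[Z] (z +[Z] z')) = f (E j q (one A) .[Z] z) +[M] f (E j q (one A) .[Z] z')"
   if q: "q \<in> {1..n}" "j \<le> q" for q
   using mod_homD(2)[OF f E_in_row[OF Z j q R.one_closed z] E_in_row[OF Z j q R.one_closed z']]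
    E_closed[OF j q R.one_closed] z z' by (simp add: Z.smult_r_distr)
  then show ?thesis by (auto simp: Ivl_simps fun_eq_iff)
 qed
 fix p q a assume pq: "p \<in> {1..n}" "q \<in> {1..n}" "p \<le> q" and a: "a \<in> carrier A"
 have "f (E j r (one A) .[Z] (E p q a .[Z] z)) = (if r = p then a .[M] f (E j q (one A) .[Z] z) else zero M)"
  if r: "r \<in> {1..n}" "j \<le> r" for r
 proof (cases "r = p")
  case True
  have jq: "j \<le> q" using True r pq by simp
  have "E j r (one A) .[Z] (E p q a .[Z] z) = E j j a .[Z] (E j q (one A) .[Z] z)"
   using E_E[OF Z j pq(1,2) _ pq(3) R.one_closed a z] E_E[OF Z j j pq(2) le_refl jq a R.one_closed z]
    True r a by simp
  then show ?thesis
   using mod_homD(3)[OF f a E_in_row[OF Z j pq(2) jq R.one_closed z]] True by simp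
 next
  case False
  then show ?thesis
   using E_E_zero[OF Z j r(1) pq(1,2) r(2) pq(3) False R.one_closed a z]
    mod_hom_zero[OF f lmodule_row[OF Z j] M] by simp
 qed
 then show "up M Z j f (E p q a .[Z] z) = E p q a .[Ivl M j n] up M Z j f z"
  unfolding Ivl_E[OF M c pq a] using pq a by (auto simp: fun_eq_iff)
qed

text \<open>The arrows inside the interval are identities, so a map into it is determined by its
  component at the lowest position \<open>j\<close>; this inverts \<open>up\<close>.\<close>

lemma row_down:
 assumes Z: "lmodule T Z" and M: "lmodule A M" and j: "j \<in> {1..n}" and F: "F \<in> mod_hom T Z (Ivl M j n)"
 shows "(%z. F z j) \<in> mod_hom A (row Z j) M"
  "z \<in> carrier Z ==> up M Z j (%z. F z j) z = F z"
proof -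
 interpret Z: lmodule T Z by (rule Z)
 interpret M: lmodule A M by (rule M)
 note Fc = mod_homD(1)[OF F]
 have FE: "F (E p q a .[Z] z) = (\<lambda>r\<in>{1..n}. if r = p & j \<le> p then a .[M] F z q else zero M)"
  if "z \<in> carrier Z" "p \<in> {1..n}" "q \<in> {1..n}" "p \<le> q" "a \<in> carrier A" for p q a z
  using mod_homD(3)[OF F E_closed[OF that(2-5)] that(1)] Ivl_E[OF M Fc[OF that(1)] that(2-5)] by simp
 show "(%z. F z j) \<in> mod_hom A (row Z j) M"
 proof (rule mod_homI)
  fix z assume "z \<in> carrier (row Z j)"
  then have z: "z \<in> carrier Z" by simp
  show "F z j \<in> carrier M" by (rule Ivl_component[OF M Fc[OF z] j])
  show "F (z +[row Z j] z') j = F z j +[M] F z' j" if "z' \<in> carrier (row Z j)" for z'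
   using mod_homD(2)[OF F z] that j by (simp add: Ivl_simps)
  show "F (a .[row Z j] z) j = a .[M] F z j" if "a \<in> carrier A" for a
   using FE[OF z j j le_refl that] j by simp
 qed
 assume z: "z \<in> carrier Z"
 show "up M Z j (%z. F z j) z = F z"
 proof
  fix q
  show "up M Z j (%z. F z j) z q = F z q"
   using FE[OF z j _ _ R.one_closed, of q] j Ivl_component[OF M Fc[OF z], of q] Fc[OF z]
   by (auto simp: Ivl_carrier extensional_def)
 qed
qed

text \<open>Kernels commute with taking rows, so the extension problems correspond under the
  adjunction.\<close>

lemma extends_Ivl:
 assumes P: "lmodule T P" and K: "submodule (a_kernel P Z p) T P" and M: "lmodule A M" and j: "j \<in> {1..n}"
 shows "extends T P (a_kernel P Z p) (Ivl M j n) \<longleftrightarrow> extends A (row P j) (a_kernel (row P j) (row Z j) p) M"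
proof -
 let ?K = "ker_mod P Z p"
 note lK = lmodule_restrict[OF P K] and rK = row_ker_mod[of P Z p j]
 have Kc: "z \<in> carrier P" if "z \<in> a_kernel P Z p" for z using that by (simp add: a_kernel_eq)
 show ?thesis
 proof
  assume ex: "extends T P (a_kernel P Z p) (Ivl M j n)"
  show "extends A (row P j) (a_kernel (row P j) (row Z j) p) M"
   unfolding extends_def
  proof
   fix f assume "f \<in> mod_hom A (ker_mod (row P j) (row Z j) p) M"
   then have f: "f \<in> mod_hom A (row ?K j) M" unfolding rK .
   obtain H where H: "H \<in> mod_hom T P (Ivl M j n)" "!!x. x \<in> a_kernel P Z p ==> H x = up M ?K j f x"
    by (rule extendsD[OF ex row_up[OF lK M j f]]) blast
   show "\<exists>h'\<in>mod_hom A (row P j) M. \<forall>x\<in>a_kernel (row P j) (row Z j) p. h' x = f x"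
    by (rule bexI[OF _ row_down(1)[OF P M j H(1)]]) (use H(2) j in \<open>auto simp: a_kernel_eq\<close>)
  qed
 next
  assume ex: "extends A (row P j) (a_kernel (row P j) (row Z j) p) M"
  show "extends T P (a_kernel P Z p) (Ivl M j n)"
   unfolding extends_def
  proof
   fix h assume h: "h \<in> mod_hom T ?K (Ivl M j n)"
   note d = row_down[OF lK M j h]
   have "(%z. h z j) \<in> mod_hom A (ker_mod (row P j) (row Z j) p) M" using d(1) unfolding rK .
   from extendsD[OF ex this] obtain g where g: "g \<in> mod_hom A (row P j) M"
    "!!z. z \<in> a_kernel (row P j) (row Z j) p ==> g z = h z j" by blast
   show "\<exists>h'\<in>mod_hom T P (Ivl M j n). \<forall>x\<in>a_kernel P Z p. h' x = h x"
   proof (rule bexI[OF _ row_up[OF P M j g(1)]], rule ballI)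
    fix z assume z: "z \<in> a_kernel P Z p"
    have "g (E j q (one A) .[P] z) = h (E j q (one A) .[P] z) j" if q: "q \<in> {1..n}" "j \<le> q" for q
    proof (rule g(2))
     have "E j q (one A) .[P] z \<in> carrier (row ?K j)"
      using E_in_row[OF lK j q R.one_closed, of z] z by simp
     then show "E j q (one A) .[P] z \<in> a_kernel (row P j) (row Z j) p" unfolding rK by simp
    qed
    then have "up M P j g z = up M ?K j (%z. h z j) z" by (auto simp: fun_eq_iff)
    then show "up M P j g z = h z" using d(2)[of z] z by simp
   qed
  qed
 qed
qed

text \<open>Each direction is a coinduction with \<open>extends_Ivl\<close> as its step. Resolutions
  only have to be carried from \<open>T\<close> to \<open>A\<close>, which exactness of taking rows
  permits.\<close>

theorem orth_Ivl:
 assumes Z: "fg_module T Z" and M: "lmodule A M" and j: "j \<in> {1..n}"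
 shows "orth T (Ivl M j n) Z \<longleftrightarrow> orth A M (row Z j)"
proof
 let ?I = "Ivl M j n"
 assume o: "orth A M (row Z j)"
 obtain Z' :: "(nat => nat => 'a) fgm"
  where Z': "fg_module T Z'" "lmodule T Z'" "mod_iso T Z Z'" "mod_iso T Z' Z" using Z by (rule copy_exists)
 have "orth T ?I Z'"
 proof (rule orth_coinduct[where R = "%Y. fg_module T Y & orth A M (row Y j)"])
  show "fg_module T Z' & orth A M (row Z' j)"
   using Z'(1) orth_iso[OF o row_iso[OF Z'(3) fg_lmodule[OF Z] Z'(2) j] lmodule_row[OF Z'(2) j]] by blast
  fix Y :: "(nat => nat => 'a) fgm"
  assume "fg_module T Y & orth A M (row Y j)" and lY: "lmodule T Y"
  then have Y: "fg_module T Y" "orth A M (row Y j)" by auto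
  \<comment> \<open>A cover of \<open>row Y j\<close> need not come from a cover of
    \<open>Y\<close>. A free cover of \<open>Y\<close> is chosen instead, and
    \<open>orth_syzygy\<close> allows its row to replace whatever cover witnesses the orthogonality
    of \<open>row Y j\<close>.\<close>
  from free_cover[OF Y(1)] obtain m p where p: "p \<in> mod_hom T (free_module T m) Y"
   "p ` carrier (free_module T m) = carrier Y" by blast
  let ?P = "free_module T m"
  have cov: "cover T ?P p Y" unfolding cover_def using fgproj_free[OF RT.ring_axioms] lY p by blast
  note c = coverD[OF cov] and rc = row_cover[OF cov j]
  note rc' = coverD[OF rc]
  have "extends A (row ?P j) (a_kernel (row ?P j) (row Y j) p) M"
   by (rule orth_extends[OF Y(2) M rc'(2,4,5)])
  then have ex: "extends T ?P (a_kernel ?P Y p) ?I" unfolding extends_Ivl[OF c(2,6) M j] .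
  have "fg_module T (ker_mod ?P Y p)"
   by (rule noetherian_fg_submodule[OF noetherian_T fgproj_fg[OF RT.ring_axioms c(1)] c(6)])
  then obtain K' :: "(nat => nat => 'a) fgm"
   where K': "fg_module T K'" "lmodule T K'" "mod_iso T (ker_mod ?P Y p) K'" "mod_iso T K' (ker_mod ?P Y p)"
   by (rule copy_exists)
  have "orth A M (row (ker_mod ?P Y p) j)" unfolding row_ker_mod by (rule orth_syzygy[OF Y(2) M rc])
  then have "orth A M (row K' j)"
   by (rule orth_iso[OF _ row_iso[OF K'(3) c(7) K'(2) j] lmodule_row[OF K'(2) j]])
  with cov ex K' show "\<exists>(P :: (nat => nat => 'a, nat => nat => nat => 'a) module) p
    (K' :: (nat => nat => 'a) fgm). cover T P p Y &
    extends T P (a_kernel P Y p) ?I & mod_iso T (ker_mod P Y p) K' & lmodule T K' &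
    ((fg_module T K' & orth A M (row K' j)) | orth T ?I K')"
   by (intro exI[of _ ?P] exI[of _ p] exI[of _ K']) simp
 qed (rule Z'(2))
 then show "orth T ?I Z" by (rule orth_iso[OF _ Z'(4) fg_lmodule[OF Z]])
next
 let ?I = "Ivl M j n"
 assume o: "orth T ?I Z"
 note lZ = orth_lmodule[OF o]
 obtain Z' :: "(nat => nat => 'a) fgm"
  where Z': "fg_module T Z'" "lmodule T Z'" "mod_iso T Z Z'" "mod_iso T Z' Z" using Z by (rule copy_exists)
 from fg_row[OF Z j] obtain X :: "'a fgm"
  where X: "fg_module A X" "lmodule A X" "mod_iso A (row Z j) X" "mod_iso A X (row Z j)"
  by (rule copy_exists)
 \<comment> \<open>Coinduction over \<open>A\<close> needs modules in \<open>'a fgm\<close>, whereas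
   rows of \<open>T\<close>-modules have another element type; hence copies of rows.\<close>
 define Q where "Q Y \<longleftrightarrow> (\<exists>Z :: (nat => nat => 'a) fgm.
  orth T ?I Z & mod_iso A (row Z j) Y)" for Y :: "'a fgm"
 have "orth A M X"
 proof (rule orth_coinduct[where R = Q])
  show "Q X"
   unfolding Q_def
   using orth_iso[OF o Z'(3,2)] mod_iso_trans[OF row_iso[OF Z'(4,2) lZ j] X(3)] by blast
  fix Y :: "'a fgm" assume "Q Y" and lY: "lmodule A Y"
  then obtain W :: "(nat => nat => 'a) fgm"
   where W: "orth T ?I W" "mod_iso A (row W j) Y" unfolding Q_def by blast
  from W(1) obtain P :: "(nat => nat => 'a) fgm" and p
   where P: "cover T P p W" "extends T P (a_kernel P W p) ?I" "orth T ?I (ker_mod P W p)" by (rule orthE)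
  note c = coverD[OF P(1)] and rc = row_cover[OF P(1) j]
  obtain p' where p': "cover A (row P j) p' Y" "a_kernel (row P j) Y p' = a_kernel (row P j) (row W j) p"
   by (rule cover_iso_kernel[OF rc W(2) lY])
  from fg_row[OF orth_fg[OF P(3)] j] obtain K' :: "'a fgm"
   where K': "fg_module A K'" "lmodule A K'" "mod_iso A (row (ker_mod P W p) j) K'"
    "mod_iso A K' (row (ker_mod P W p) j)"
   by (rule copy_exists)
  have "extends A (row P j) (a_kernel (row P j) (row W j) p) M"
   using P(2) unfolding extends_Ivl[OF c(2,6) M j] .
  moreover have "Q K'" unfolding Q_def using P(3) K'(3) by blast
  moreover have "mod_iso A (ker_mod (row P j) Y p') K'" using K'(3) unfolding row_ker_mod p'(2) .
  ultimately show "\<exists>(P :: ('a, (nat => nat => nat => 'a) set) module) p K'. cover A P p Y &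
    extends A P (a_kernel P Y p) M & mod_iso A (ker_mod P Y p) K' & lmodule A K' & (Q K' | orth A M K')"
   using p' K'(2) by metis
 qed (rule X(2))
 then show "orth A M (row Z j)" by (rule orth_iso[OF _ X(4) lmodule_row[OF lZ j]])
qed

end

section \<open>The perpendicular category of \<open>m_module\<close>\<close>

text \<open>A nonzero \<open>y\<close> in the kernel of \<open>f\<close> is detected by a map to
  \<open>D(B)\<close>. This lifts to a module in \<open>add(M)\<close>, and an extension of the lift
  along \<open>f\<close> would vanish at \<open>y\<close>. For monomorphic \<open>f\<close> the
  extension property is \<open>Ext^1(Coker f, M) = 0\<close>, the higher groups vanishing because
  \<open>X\<close> and \<open>Y\<close> are orthogonal.\<close>

lemma extension_iff_mono_coker:
 fixes B :: "('k, 'b) module"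
 assumes B: "artin_algebra k B"
  and E: "injective_envelope k (quot_module (reg_module k) (jacobson_radical k)) E"
  and M: "lmodule B M" and res: "gresx B M s (dual_reg k E B)"
  and X: "orth B M X" and Y: "orth B M Y" and f: "f \<in> mod_hom B Y X"
 shows "(\<forall>h\<in>mod_hom B Y M. \<exists>h'\<in>mod_hom B X M. \<forall>y\<in>carrier Y. h' (f y) = h y) \<longleftrightarrow>
  inj_on f (carrier Y) & orth B M (coker Y X f)" (is "?ext \<longleftrightarrow> _")
proof -
 note lX = orth_lmodule[OF X] and lY = orth_lmodule[OF Y]
 let ?D = "dual_reg k E B"
 have inj: "inj_on f (carrier Y)" if ext: ?ext
  unfolding inj_on_mod_hom[OF lY lX f]
 proof (intro ballI impI, rule ccontr)
  fix y assume y: "y \<in> carrier Y" "f y = zero X" "y ~= zero Y"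
  from dual_reg_cogenerator[OF B E orth_fg[OF Y] y(1,3)] obtain h
   where h: "h \<in> mod_hom B Y ?D" "h y ~= zero ?D" by blast
  obtain s' where s: "s = Suc s'"
   using res h(2) mod_homD(1)[OF h(1) y(1)] by (cases s) (auto simp: gresx_0)
  from res[unfolded s] obtain T0 :: "'b fgm" and g where
   T0: "addc B M T0" "g \<in> mod_hom B T0 ?D" "g ` carrier T0 = carrier ?D" "gresx B M s' (ker_mod T0 ?D g)"
   by (rule gresx_SucE)
  note lT0 = addc_lmodule[OF T0(1)]
  from orth_lift[OF gresx_orth[OF T0(4) Y] ses_kernel[OF lT0 gresx_lmodule[OF res] T0(2,3)] h(1)]
  obtain u where u: "u \<in> mod_hom B Y T0" "\<forall>y\<in>carrier Y. g (u y) = h y" by blast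
  have "fac B Y M T0 u" using fac_pre[OF u(1), of M T0 "%x. x"] T0(1) by (simp add: addc_def)
  from fac_extend[OF lT0 this f] ext obtain u' where
   "u' \<in> mod_hom B X T0" "\<forall>y\<in>carrier Y. u' (f y) = u y" by blast
  then have "u y = zero T0" using y(1,2) mod_hom_zero[OF _ lX lT0] by metis
  then show False using u(2) y(1) h(2) mod_hom_zero[OF T0(2) lT0 gresx_lmodule[OF res]] by metis
 qed
 show ?thesis
 proof (cases "inj_on f (carrier Y)")
  case True
  note s = ses_cokernel[OF lY lX f True, folded coker_def]
  note s' = sesD[OF s]
  show ?thesis
  proof
   assume ext: ?ext
   from ext show "inj_on f (carrier Y) & orth B M (coker Y X f)"
    using True orth_quotient[OF s M Y X] by blast
  next
   assume "inj_on f (carrier Y) & orth B M (coker Y X f)"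
   then have "orth B M (coker Y X f)" by blast
   from orth_extends[OF this M lX s'(6,7)] have ex: "extends B X (f ` carrier Y) M"
    by (simp only: s'(8)[symmetric])
   show ?ext
   proof
    fix h assume h: "h \<in> mod_hom B Y M"
    have fi: "f \<in> mod_hom B Y (X\<lparr>carrier := f ` carrier Y\<rparr>)" by (rule mod_hom_restrict_cod[OF f]) simp
    have "(%x. h (inv_into (carrier Y) f x)) \<in> mod_hom B (X\<lparr>carrier := f ` carrier Y\<rparr>) M"
     by (rule mod_hom_comp[OF mod_hom_inv_into[OF lY fi] h]) (use True in \<open>simp add: bij_betw_def\<close>)
    from extendsD[OF ex this] obtain h' where "h' \<in> mod_hom B X M"
     "!!x. x \<in> f ` carrier Y ==> h' x = h (inv_into (carrier Y) f x)" by blast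
    then show "\<exists>h'\<in>mod_hom B X M. \<forall>y\<in>carrier Y. h' (f y) = h y"
     using True by (intro bexI[of _ h']) (auto simp: inv_into_f_f)
   qed
  qed
 qed (use inj in blast)
qed

text \<open>A coset is determined by any of its elements, so representatives give an isomorphic copy.\<close>

lemma coker_copy:
 fixes X :: "('b, 'x) module"
 assumes Y: "lmodule B Y" and X: "lmodule B X" and f: "f \<in> mod_hom B Y X"
 obtains Z where "lmodule B Z" "mod_iso B (coker Y X f) (Z :: ('b, 'x) module)"
proof -
 let ?N = "f ` carrier Y" and ?Q = "coker Y X f"
 have N: "submodule ?N B X" by (rule submodule_image[OF Y X f submodule_carrier[OF Y]])
 note q = quot_module_projection[OF X N, folded coker_def]
 interpret X: lmodule B X by (rule X)
 interpret Q: lmodule B ?Q by (rule q(1))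
 have coset: "?N +>\<^bsub>X\<^esub> r = S" if S: "S \<in> carrier ?Q" "r \<in> S" for S r
 proof -
  obtain x where x: "x \<in> carrier X" "S = ?N +>\<^bsub>X\<^esub> x" using S(1) unfolding q(3)[symmetric] by blast
  with S(2) obtain m where m: "m \<in> ?N" "r = m +[X] x" by (auto simp: a_r_coset_def r_coset_def)
  have mc: "m \<in> carrier X" using submodule_in[OF N m(1)] .
  have "?N +>\<^bsub>X\<^esub> m = zero ?Q" using q(4)[OF mc] m(1) by blast
  then show ?thesis
   using mod_homD(2)[OF q(2) mc x(1)] Q.M.l_zero[OF mod_homD(1)[OF q(2) x(1)]]
   unfolding m(2) x(2) by (simp only:)
 qed
 have ne: "(SOME r. r \<in> S) \<in> S" if S: "S \<in> carrier ?Q" for S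
 proof -
  obtain x where x: "x \<in> carrier X" "S = ?N +>\<^bsub>X\<^esub> x" using S unfolding q(3)[symmetric] by blast
  have "zero X +[X] x \<in> S"
   unfolding x(2) a_r_coset_def r_coset_def by (rule UN_I[OF submoduleD(2)[OF N]]) simp
  then show ?thesis by (rule someI)
 qed
 have inj: "inj_on (%S. SOME r. r \<in> S) (carrier ?Q)"
  by (rule inj_on_inverseI[of _ "%r. ?N +>\<^bsub>X\<^esub> r"]) (rule coset[OF _ ne])
 show thesis
  using that[OF lmodule_transport[OF q(1) inj]] transport_iso[OF q(1) inj] unfolding mod_iso_def by blast
qed

context tri_alg
begin

text \<open>By adjunction the cut sequences ask for extension along the composite arrows
  \<open>i+1 -> 1\<close>, the right-hand side for extension along the single arrows
  \<open>i+1 -> i\<close>. A map extended to row \<open>1\<close> pulls back to row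
  \<open>i\<close>; conversely the single extensions are iterated.\<close>

theorem row_criterion:
 assumes Z: "fg_module T Z" and M: "lmodule A M"
 shows "(\<forall>i\<in>{1..n}. orth T (Ivl M 1 i) Z) \<longleftrightarrow> (\<forall>i\<in>{1..n}. orth A M (row Z i)) &
  (\<forall>i\<in>{1..n-1}. \<forall>h\<in>mod_hom A (row Z (Suc i)) M. \<exists>h'\<in>mod_hom A (row Z i) M.
   \<forall>z\<in>carrier (row Z (Suc i)). h' (E i (Suc i) (one A) .[Z] z) = h z)" (is "?o \<longleftrightarrow> ?r & ?x")
proof (cases "n = 0")
 case False
 then have n: "1 \<in> {1..n}" "n \<in> {1..n}" by auto
 have lZ: "lmodule T Z" using Z by (rule fg_lmodule)
 note EE = E_E[OF lZ _ _ _ _ _ R.one_closed R.one_closed]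
 show ?thesis
 proof
  assume o: ?o
  have oS: "orth T (Ivl M (Suc i) n) Z" if "i \<in> {1..n-1}" for i
   using that o n by (intro orth_target_quotient[OF Ivl_cut[OF M, of i]]) auto
  have ?r
  proof
   fix i assume i: "i \<in> {1..n}"
   show "orth A M (row Z i)"
    unfolding orth_Ivl[OF Z M i, symmetric]
   proof (cases "i = 1")
    case False
    then have "i - 1 \<in> {1..n-1}" "Suc (i - 1) = i" using i by auto
    then show "orth T (Ivl M i n) Z" using oS[of "i - 1"] by simp
   qed (use o n in blast)
  qed
  moreover have ?x
  proof (intro ballI)
   fix i h assume i: "i \<in> {1..n-1}" and h: "h \<in> mod_hom A (row Z (Suc i)) M"
   then have ii: "i \<le> n" "i \<in> {1..n}" "Suc i \<in> {1..n}" "1 \<le> i" "1 \<le> Suc i" by auto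
   have oi: "orth T (Ivl M 1 i) Z" using o ii(2) by blast
   \<comment> \<open>The map to the upper interval given by \<open>h\<close> lifts to
     \<open>Ivl M 1 n\<close>. The component of the lift at position \<open>1\<close>, preceded by
     the arrow from row \<open>i\<close> to row \<open>1\<close>, extends \<open>h\<close>.\<close>
   from orth_lift[OF oi Ivl_cut[OF M ii(1)] row_up[OF lZ M ii(3) h]] obtain F where
    F: "F \<in> mod_hom T Z (Ivl M 1 n)"
    "\<forall>z\<in>carrier Z. (\<lambda>p\<in>{1..n}. if i < p then F z p else zero M) = up M Z (Suc i) h z" by blast
   have eq: "F (E 1 i (one A) .[Z] (E i (Suc i) (one A) .[Z] z)) 1 = h z" if z: "z \<in> carrier (row Z (Suc i))" for z
   proof -
    have zc: "z \<in> carrier Z" using z by simp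
    have "F (E 1 i (one A) .[Z] (E i (Suc i) (one A) .[Z] z)) 1 = up M Z 1 (%z. F z 1) z (Suc i)"
     using EE[OF n(1) ii(2,3) ii(4) _ zc] ii by simp
    also have "... = F z (Suc i)" unfolding row_down(2)[OF lZ M n(1) F(1) zc] ..
    also have "... = h z" using fun_cong[OF bspec[OF F(2) zc], of "Suc i"] ii(3) z by simp
    finally show ?thesis .
   qed
   show "\<exists>h'\<in>mod_hom A (row Z i) M. \<forall>z\<in>carrier (row Z (Suc i)). h' (E i (Suc i) (one A) .[Z] z) = h z"
    by (rule bexI[OF _ mod_hom_comp[OF E_row_hom[OF lZ n(1) ii(2,4)] row_down(1)[OF lZ M n(1) F(1)]]])
      (rule ballI, rule eq)
  qed
  ultimately show "?r & ?x" ..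
 next
  assume rx: "?r & ?x"
  have ext: "\<exists>f'\<in>mod_hom A (row Z 1) M. \<forall>z\<in>carrier (row Z (Suc i)). f' (E 1 (Suc i) (one A) .[Z] z) = f z"
   if "i < n" "f \<in> mod_hom A (row Z (Suc i)) M" for i f
   using that
  proof (induction i arbitrary: f)
   case 0
   then show ?case by (intro bexI[of _ f]) auto
  next
   case (Suc i)
   then have ii: "Suc i \<in> {1..n}" "Suc (Suc i) \<in> {1..n}" "Suc i \<in> {1..n-1}" by auto
   from rx ii(3) Suc.prems(2) obtain g where g: "g \<in> mod_hom A (row Z (Suc i)) M"
    "\<forall>z\<in>carrier (row Z (Suc (Suc i))). g (E (Suc i) (Suc (Suc i)) (one A) .[Z] z) = f z" by blast
   from Suc.IH[OF _ g(1)] Suc.prems(1) obtain f' where f': "f' \<in> mod_hom A (row Z 1) M"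
    "\<forall>z\<in>carrier (row Z (Suc i)). f' (E 1 (Suc i) (one A) .[Z] z) = g z" by auto
   have "f' (E 1 (Suc (Suc i)) (one A) .[Z] z) = f z" if z: "z \<in> carrier (row Z (Suc (Suc i)))" for z
   proof -
    have zc: "z \<in> carrier Z" using z by simp
    have "f' (E 1 (Suc (Suc i)) (one A) .[Z] z) =
      f' (E 1 (Suc i) (one A) .[Z] (E (Suc i) (Suc (Suc i)) (one A) .[Z] z))"
     using EE[OF n(1) ii(1,2) _ _ zc] by simp
    also have "... = f z"
     using g(2) z f'(2) E_in_row[OF lZ ii(1,2) _ R.one_closed zc] by simp
    finally show ?thesis .
   qed
   with f'(1) show ?case by blast
  qed
  show ?o
  proof
   fix i assume i: "i \<in> {1..n}"
   have o1: "orth T (Ivl M 1 n) Z" unfolding orth_Ivl[OF Z M n(1)] using rx n(1) by blast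
   show "orth T (Ivl M 1 i) Z"
   proof (cases "i = n")
    case False
    with i have ii: "i \<le> n" "i < n" "Suc i \<in> {1..n}" by auto
    show ?thesis
    proof (rule orth_target_sub[OF Ivl_cut[OF M ii(1)] o1])
     show "orth T (Ivl M (Suc i) n) Z" unfolding orth_Ivl[OF Z M ii(3)] using rx ii(3) by blast
     fix h assume h: "h \<in> mod_hom T Z (Ivl M (Suc i) n)"
     note d = row_down[OF lZ M ii(3) h]
     from ext[OF ii(2) d(1)] obtain f' where f': "f' \<in> mod_hom A (row Z 1) M"
      "\<forall>z\<in>carrier (row Z (Suc i)). f' (E 1 (Suc i) (one A) .[Z] z) = h z (Suc i)" by blast
     have eq: "(\<lambda>p\<in>{1..n}. if i < p then up M Z 1 f' z p else zero M) = h z" if z: "z \<in> carrier Z" for z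
     proof -
      have "f' (E 1 p (one A) .[Z] z) = h (E (Suc i) p (one A) .[Z] z) (Suc i)" if p: "p \<in> {1..n}" "Suc i \<le> p" for p
       using f'(2) E_in_row[OF lZ ii(3) p R.one_closed z] EE[OF n(1) ii(3) p(1) _ p(2) z] by fastforce
      then have "(\<lambda>p\<in>{1..n}. if i < p then up M Z 1 f' z p else zero M) = up M Z (Suc i) (%z. h z (Suc i)) z"
       by (auto simp: fun_eq_iff)
      with d(2)[OF z] show ?thesis by simp
     qed
     show "\<exists>h'\<in>mod_hom T Z (Ivl M 1 n). \<forall>z\<in>carrier Z. (\<lambda>p\<in>{1..n}. if i < p then h' z p else zero M) = h z"
      by (rule bexI[OF _ row_up[OF lZ M n(1) f'(1)]]) (rule ballI, rule eq)
    qed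
   qed (use o1 in simp)
  qed
 qed
qed simp

lemma m_module_Ivl: "m_module n M = dsum {1..n} (Ivl M 1)"
 by (simp add: m_module_def m_obj_ivl)

lemma orth_m_module:
 assumes M: "lmodule A M" and n: "1 \<le> n"
 shows "orth T (m_module n M) Z \<longleftrightarrow> (\<forall>i\<in>{1..n}. orth T (Ivl M 1 i) Z)"
 unfolding m_module_Ivl
proof
 assume o: "orth T (dsum {1..n} (Ivl M 1)) Z"
 show "\<forall>i\<in>{1..n}. orth T (Ivl M 1 i) Z"
  by (rule ballI, rule orth_target_addc[OF o addc_component[OF _ lmodule_Ivl[OF M] RT.ring_axioms]])
next
 have "n \<in> {1..n}" using n by simp
 then show "orth T (dsum {1..n} (Ivl M 1)) Z" if "\<forall>i\<in>{1..n}. orth T (Ivl M 1 i) Z"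
  by (rule orth_target_dsum[OF _ bspec[OF that] lmodule_Ivl[OF M]])
qed

lemma mor_rows:
 assumes X: "morl X" and p: "p \<in> {1..n}"
 shows "(%x. x p) \<in> mod_hom A (row (mor_module n X) p) (branch X p)"
  "single {1..n} (branch X) p \<in> mod_hom A (branch X p) (row (mor_module n X) p)"
  "!!x. x \<in> carrier (row (mor_module n X) p) ==> single {1..n} (branch X) p (x p) = x"
  "single {1..n} (branch X) p y p = y"
proof -
 let ?M = "mor_module n X" and ?s = "single {1..n} (branch X) p"
 have l: "lmodule A (branch X i)" if "i \<in> {1..n}" for i using X that by (simp add: morl_def)
 interpret L: lmodule A "branch X p" by (rule l[OF p])
 have Ep: "E p p a .[?M] x = ?s (a .[branch X p] x p)" if "x \<in> carrier ?M" "a \<in> carrier A" for x a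
  using mor_E_action[OF X p p le_refl that(2,1)] by simp
 show sp: "?s y p = y" for y using p by (simp add: single_def)
 show ps: "?s (x p) = x" if x: "x \<in> carrier (row ?M p)" for x
  using Ep[of x "one A"] x mor_component[of x X p] p by simp
 show "(%x. x p) \<in> mod_hom A (row ?M p) (branch X p)"
  by (rule mod_homI) (use p mor_component in \<open>auto simp: Ep sp mor_module_dsum(3) dsum_simps simp del: atLeastAtMost_iff One_nat_def\<close>)
 have sM: "?s \<in> mod_hom A (branch X p) (dsum {1..n} (branch X))" by (rule single_mod_hom[OF l])
 have sc: "?s y \<in> carrier ?M" if "y \<in> carrier (branch X p)" for y
  unfolding mor_module_dsum by (rule mod_homD(1)[OF sM that])
 show "?s \<in> mod_hom A (branch X p) (row ?M p)"
  by (rule mod_homI) (simp_all add: sc Ep sp mod_homD(2)[OF sM] mor_module_dsum(3) del: One_nat_def)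
qed

theorem mono_cat_perp:
 assumes Env: "injective_envelope k (quot_module (reg_module k) (jacobson_radical k)) Ek"
  and M: "lmodule A M" and res: "gresx A M s (dual_reg k Ek A)" and n: "1 \<le> n"
 shows "mono_cat n A (perp A M) = mor_perp n A (m_module n M)"
proof (rule Set.set_eqI)
 fix X :: "('a, 'x) mor"
 show "X \<in> mono_cat n A (perp A M) \<longleftrightarrow> X \<in> mor_perp n A (m_module n M)"
 proof (cases "X \<in> Mor n A")
  case True
  then have X: "morl X" by (rule Mor_morl)
  have fgb: "fg_module A (branch X i)" if "i \<in> {1..n}" for i using True that by (simp add: Mor_def)
  let ?Z = "mor_module n X" and ?s = "single {1..n} (branch X)"
  have Z: "fg_module T ?Z" by (rule fg_mor[OF X fgb])
  note lZ = fg_lmodule[OF Z]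
  have lm: "lmodule T (m_module n M)"
   unfolding m_module_Ivl by (rule lmodule_dsum[OF RT.ring_axioms lmodule_Ivl[OF M]])
  have row: "orth A M (row ?Z i) \<longleftrightarrow> orth A M (branch X i)" if i: "i \<in> {1..n}" for i
  proof -
   have "mod_iso A (row ?Z i) (branch X i)" 
    by (rule mod_isoI[OF mor_rows(1,2)[OF X i]]) (simp_all only: mor_rows(3,4)[OF X i])
   then show ?thesis
    using orth_iso mod_iso_sym lmodule_row[OF lZ i] fg_lmodule[OF fgb[OF i]] by metis
  qed
  \<comment> \<open>Through \<open>mor_rows\<close> the action of \<open>E i (Suc i) (one A)\<close>
    becomes the structure map \<open>strmap X i\<close>, to which
    \<open>extension_iff_mono_coker\<close> applies.\<close>
  have step: "(\<forall>h\<in>mod_hom A (row ?Z (Suc i)) M. \<exists>h'\<in>mod_hom A (row ?Z i) M.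
    \<forall>z\<in>carrier (row ?Z (Suc i)). h' (E i (Suc i) (one A) .[?Z] z) = h z) \<longleftrightarrow>
   inj_on (strmap X i) (carrier (branch X (Suc i))) &
   (\<exists>Q\<in>perp A M. mod_iso A (coker (branch X (Suc i)) (branch X i) (strmap X i)) (Q :: ('a, 'x) module))"
   (is "?L \<longleftrightarrow> ?R")
   if i: "i \<in> {1..n-1}" and o: "\<forall>i\<in>{1..n}. orth A M (branch X i)" for i
  proof -
   have ii: "i \<in> {1..n}" "Suc i \<in> {1..n}" using i by auto
   note r = mor_rows[OF X ii(1)] and r' = mor_rows[OF X ii(2)]
   have f: "strmap X i \<in> mod_hom A (branch X (Suc i)) (branch X i)" using X i by (simp add: morl_def)
   note lX = fg_lmodule[OF fgb]
   have act: "E i (Suc i) (one A) .[?Z] x = ?s i (strmap X i (x (Suc i)))" if "x \<in> carrier ?Z" for x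
    using mor_E_action[OF X ii _ R.one_closed that] mod_homD(1)[OF f mor_component[OF that ii(2)]]
     lmodule.smult_one[OF lX[OF ii(1)]] by simp
   have "?L \<longleftrightarrow> (\<forall>h\<in>mod_hom A (branch X (Suc i)) M. \<exists>h'\<in>mod_hom A (branch X i) M.
     \<forall>y\<in>carrier (branch X (Suc i)). h' (strmap X i y) = h y)" (is "_ \<longleftrightarrow> ?L'")
   proof
    assume L: ?L
    show ?L'
    proof
     fix h assume h: "h \<in> mod_hom A (branch X (Suc i)) M"
     from bspec[OF L mod_hom_comp[OF r'(1) h]] obtain h' where h': "h' \<in> mod_hom A (row ?Z i) M"
      "\<forall>z\<in>carrier (row ?Z (Suc i)). h' (E i (Suc i) (one A) .[?Z] z) = h (z (Suc i))" by blast
     show "\<exists>h'\<in>mod_hom A (branch X i) M. \<forall>y\<in>carrier (branch X (Suc i)). h' (strmap X i y) = h y"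
     proof (rule bexI[OF _ mod_hom_comp[OF r(2) h'(1)]], rule ballI)
      fix y assume y: "y \<in> carrier (branch X (Suc i))"
      have "?s (Suc i) y \<in> carrier (row ?Z (Suc i))" by (rule mod_homD(1)[OF r'(2) y])
      then show "h' (?s i (strmap X i y)) = h y"
       using h'(2) act[of "?s (Suc i) y"] r'(4) by fastforce
     qed
    qed
   next
    assume L: ?L'
    show ?L
    proof
     fix h assume h: "h \<in> mod_hom A (row ?Z (Suc i)) M"
     from bspec[OF L mod_hom_comp[OF r'(2) h]] obtain h' where h': "h' \<in> mod_hom A (branch X i) M"
      "\<forall>y\<in>carrier (branch X (Suc i)). h' (strmap X i y) = h (?s (Suc i) y)" by blast
     show "\<exists>h'\<in>mod_hom A (row ?Z i) M. \<forall>z\<in>carrier (row ?Z (Suc i)). h' (E i (Suc i) (one A) .[?Z] z) = h z"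
     proof (rule bexI[OF _ mod_hom_comp[OF r(1) h'(1)]], rule ballI)
      fix z assume z: "z \<in> carrier (row ?Z (Suc i))"
      then show "h' ((E i (Suc i) (one A) .[?Z] z) i) = h z"
       using h'(2) mod_homD(1)[OF r'(1) z] r'(3)[OF z] by (simp add: act r(4) del: One_nat_def)
     qed
    qed
   qed
   also have "... \<longleftrightarrow> inj_on (strmap X i) (carrier (branch X (Suc i))) &
     orth A M (coker (branch X (Suc i)) (branch X i) (strmap X i))"
    using extension_iff_mono_coker[OF artin Env M res _ _ f] o ii by blast
   \<comment> \<open>\<open>mono_cat\<close> asks for a copy of the cokernel with element type
     \<open>'x\<close>; \<open>coker_copy\<close> supplies it.\<close>
   also have "orth A M (coker (branch X (Suc i)) (branch X i) (strmap X i)) \<longleftrightarrow>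
    (\<exists>Q\<in>perp A M. mod_iso A (coker (branch X (Suc i)) (branch X i) (strmap X i)) (Q :: ('a, 'x) module))"
    (is "?C \<longleftrightarrow> _")
   proof
    assume C: ?C
    obtain Q :: "('a, 'x) module" where
     "lmodule A Q" "mod_iso A (coker (branch X (Suc i)) (branch X i) (strmap X i)) Q"
     by (rule coker_copy[OF lX[OF ii(2)] lX[OF ii(1)] f])
    with orth_iso[OF C] show "\<exists>Q\<in>perp A M. mod_iso A (coker (branch X (Suc i)) (branch X i) (strmap X i)) (Q :: ('a, 'x) module)"
     unfolding Bex_def perp_iff_orth[OF noetherian_A M] by blast
   next
    assume "\<exists>Q\<in>perp A M. mod_iso A (coker (branch X (Suc i)) (branch X i) (strmap X i)) (Q :: ('a, 'x) module)"
    then obtain Q :: "('a, 'x) module" where Q: "orth A M Q"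
     "mod_iso A (coker (branch X (Suc i)) (branch X i) (strmap X i)) Q"
     unfolding Bex_def perp_iff_orth[OF noetherian_A M] by blast
    have "lmodule A (coker (branch X (Suc i)) (branch X i) (strmap X i))"
     unfolding coker_def
     by (rule quot_module_projection(1)[OF lX[OF ii(1)] submodule_image[OF lX[OF ii(2)] lX[OF ii(1)] f
       submodule_carrier[OF lX[OF ii(2)]]]])
    with orth_iso[OF Q(1)] mod_iso_sym[OF Q(2)] show ?C by blast
   qed
   finally show ?thesis .
  qed
  have "X \<in> mor_perp n A (m_module n M) \<longleftrightarrow> (\<forall>i\<in>{1..n}. orth A M (branch X i)) &
   (\<forall>i\<in>{1..n-1}. \<forall>h\<in>mod_hom A (row ?Z (Suc i)) M. \<exists>h'\<in>mod_hom A (row ?Z i) M.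
    \<forall>z\<in>carrier (row ?Z (Suc i)). h' (E i (Suc i) (one A) .[?Z] z) = h z)"
   (is "_ \<longleftrightarrow> _ & ?x")
  proof -
   have "X \<in> mor_perp n A (m_module n M) \<longleftrightarrow> (\<forall>i\<in>{1..n}. orth A M (row ?Z i)) & ?x"
    using True unfolding mor_perp_def mem_Collect_eq perp_iff_orth[OF noetherian_T lm]
     orth_m_module[OF M n] row_criterion[OF Z M] by blast
   then show ?thesis using row by (simp del: One_nat_def row_simps atLeastAtMost_iff)
  qed
  also have "... \<longleftrightarrow> X \<in> mono_cat n A (perp A M)"
   using True step by (auto simp: mono_cat_def perp_iff_orth[OF noetherian_A M] simp del: atLeastAtMost_iff)
  finally show ?thesis by simp
 qed (simp add: mono_cat_def mor_perp_def)
qed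

end

section \<open>\<open>m_module\<close> is cotilting\<close>

lemma idimx_dsum:
 assumes "finite I" "left_noetherian B" "!!i. i \<in> I ==> idimx B r (N i)"
 shows "idimx B r (dsum I N)"
proof (rule dsum_ses_induct[where Q = "idimx B r", OF assms(1) left_noetherian_ring[OF assms(2)]])
 assume "lmodule B (dsum {} N)" "carrier (dsum {} N) = {zero (dsum {} N)}"
 then show "idimx B r (dsum {} N)" by - (rule idimx_le[OF assms(2) le0], simp add: idimx_0)
next
 fix i J assume "i \<in> I" "idimx B r (dsum J N)" and s: "ses B (N i) (single (insert i J) N i) (dsum (insert i J) N)
  (%x. \<lambda>j\<in>J. x j) (dsum J N)"
 then show "idimx B r (dsum (insert i J) N)"
  using idimx_ext[OF assms(2) s] assms(3) by blast
qed (rule idimx_lmodule[OF assms(3)])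

lemma gresx_dsum:
 assumes "finite I" "fg_module B T" "orth B T T" "!!i. i \<in> I ==> gresx B T s (N i)"
 shows "gresx B T s (dsum I N)"
proof (rule dsum_ses_induct[where Q = "gresx B T s", OF assms(1) lmodule_ring[OF fg_lmodule[OF assms(2)]]])
 assume "lmodule B (dsum {} N)" "carrier (dsum {} N) = {zero (dsum {} N)}"
 then show "gresx B T s (dsum {} N)" by - (rule gresx_le[OF assms(2) le0], simp add: gresx_0)
next
 fix i J assume "i \<in> I" "gresx B T s (dsum J N)" and s: "ses B (N i) (single (insert i J) N i) (dsum (insert i J) N)
  (%x. \<lambda>j\<in>J. x j) (dsum J N)"
 then show "gresx B T s (dsum (insert i J) N)"
  using gresx_ext[OF assms(2,3) s] assms(4) by blast
qed (rule gresx_lmodule[OF assms(4)])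

lemma ses_kernel_iso:
 assumes s: "ses B X f Y g Z"
 shows "mod_iso B X (ker_mod Y Z g)"
proof -
 note s' = sesD[OF s]
 have "f \<in> mod_hom B X (ker_mod Y Z g)" by (rule mod_hom_restrict_cod[OF s'(4)]) (simp add: s'(8))
 then show ?thesis by (rule mod_iso_bij) (simp_all add: s'(5,8))
qed

lemma cotilting_iff:
 assumes B: "artin_algebra k B" and E: "lmodule k E"
 shows "cotilting k E B M \<longleftrightarrow> fg_module B M & (\<exists>r. idimx B r M) & orth B M M &
  (\<exists>s. gresx B M s (dual_reg k E B))"
proof (cases "fg_module B M")
 case True
 note N = artin_algebra_noetherian[OF B] and lM = fg_lmodule[OF True]
 have "(\<exists>r. inj_dim_le B M r) \<longleftrightarrow> (\<exists>r. idimx B r M)"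
  using inj_dim_le_imp_idimx[OF N lM] idimx_imp_inj_dim_le by blast
 moreover have "(\<forall>i\<ge>1. trivial_group (Ext B i M M)) \<longleftrightarrow> orth B M M"
  using perp_iff_orth[OF N lM, of M] True by (simp add: perp_def)
 ultimately show ?thesis
  unfolding cotilting_def has_add_resolution_iff_gresx[OF True lmodule_dual_reg[OF B E]] by simp
qed (simp add: cotilting_def)

context tri_alg
begin

text \<open>A right adjoint of a functor that preserves monomorphisms sends injectives to
  injectives.\<close>

lemma Ivl_injective:
 assumes I: "injective_module A I" and j: "j \<in> {1..n}"
 shows "injective_module T (Ivl I j n)"
 unfolding injective_module_def
proof (intro conjI allI impI)
 have lI: "lmodule A I" using I by (simp add: injective_module_def)
 show "lmodule T (Ivl I j n)" by (rule lmodule_Ivl[OF lI])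
 fix X Y :: "(nat => nat => 'a) fgm" and f g
 assume "fg_module T X & fg_module T Y & f \<in> mod_hom T X Y & inj_on f (carrier X) &
  g \<in> mod_hom T X (Ivl I j n)"
 then have X: "fg_module T X" and Y: "fg_module T Y" and f: "f \<in> mod_hom T X Y" "inj_on f (carrier X)"
  and g: "g \<in> mod_hom T X (Ivl I j n)" by auto
 note lX = fg_lmodule[OF X] and lY = fg_lmodule[OF Y]
 note d = row_down[OF lX lI j g]
 have "inj_on f (carrier (row X j))" by (rule inj_on_subset[OF f(2)]) simp
 from injective_extend[OF I fg_row[OF X j] fg_row[OF Y j] row_hom[OF f(1) j] this d(1)]
 obtain h where h: "h \<in> mod_hom A (row Y j) I" "\<forall>x\<in>carrier (row X j). h (f x) = g x j" by blast
 show "\<exists>h\<in>mod_hom T Y (Ivl I j n). \<forall>x\<in>carrier X. h (f x) = g x"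
 proof (rule bexI[OF _ row_up[OF lY lI j h(1)]], rule ballI)
  fix x assume x: "x \<in> carrier X"
  have "h (E j q (one A) .[Y] f x) = g (E j q (one A) .[X] x) j" if q: "q \<in> {1..n}" "j \<le> q" for q
   using bspec[OF h(2) E_in_row[OF lX j q R.one_closed x]]
    mod_homD(3)[OF f(1) E_closed[OF j q R.one_closed] x] by simp
  then have "up I Y j h (f x) = up I X j (%z. g z j) x" by (auto simp: fun_eq_iff)
  then show "up I Y j h (f x) = g x" using d(2)[OF x] by simp
 qed
qed

lemma Ivl_zero:
 assumes M: "lmodule A M" and z: "carrier M = {zero M} | n < lo"
 shows "carrier (Ivl M lo hi) = {zero (Ivl M lo hi)}"
proof -
 have "x = zero (Ivl M lo hi)" if x: "x \<in> carrier (Ivl M lo hi)" for x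
 proof -
  have "x p = zero M" if "p \<in> {1..n}" for p
   using bspec[OF conjunct2[OF x[unfolded Ivl_carrier]] that] z that by (auto split: if_splits)
  then show ?thesis using x by (auto simp: Ivl_simps Ivl_carrier fun_eq_iff extensional_def)
 qed
 moreover have "zero (Ivl M lo hi) \<in> carrier (Ivl M lo hi)"
  using submoduleD(2)[OF submodule_carrier[OF lmodule_Ivl[OF M]]] .
 ultimately show ?thesis by blast
qed

lemma Imap_id:
 assumes "lmodule A M" "x \<in> carrier (Ivl M lo hi)" "!!y. y \<in> carrier M ==> h y = y"
 shows "Imap h x = x"
proof (rule extensionalityI[of _ "{1..n}"])
 fix p assume "p \<in> {1..n}"
 then show "Imap h x p = x p" using assms(3) Ivl_component[OF assms(1,2)] by simp
qed (use assms(2) in \<open>simp_all only: Ivl_carrier restrict_extensional\<close>)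

lemma Ivl_iso:
 assumes "mod_iso A M N" "lmodule A M" "lmodule A N"
 shows "mod_iso T (Ivl M lo hi) (Ivl N lo hi)"
proof -
 obtain f g where fg: "f \<in> mod_hom A M N" "g \<in> mod_hom A N M"
  "!!x. x \<in> carrier M ==> g (f x) = x" "!!y. y \<in> carrier N ==> f (g y) = y"
  by (rule mod_isoE[OF assms(1,2)]) (rule that)
 show ?thesis
  by (rule mod_isoI[OF Ivl_map[OF assms(2,3) fg(1)] Ivl_map[OF assms(3,2) fg(2)]])
    (use Imap_id[OF assms(2) _ fg(3)] Imap_id[OF assms(3) _ fg(4)] in \<open>simp_all cong: restrict_cong\<close>)
qed

text \<open>\<open>j = Suc n\<close> stands for the zero module, the last term of
  \<open>Ivl_cut\<close> for \<open>i = n\<close>. The induction is carried out for a copy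
  \<open>M'\<close>, since the later cosyzygies lie in \<open>fgm\<close>.\<close>

lemma Ivl_idimx:
 assumes j: "j \<in> {1..Suc n}"
  and M: "idimx A r M"
 shows "idimx T r (Ivl M j n)"
proof -
 obtain M' :: "'a fgm" where M': "mod_iso A M M'" "lmodule A M'" "idim A r M'"
  using M unfolding idimx_def by blast
 have "idimx A r M' ==> idimx T r (Ivl M' j n)"
proof (induction r arbitrary: M')
 case 0
 then show ?case using Ivl_zero[of M' j n] lmodule_Ivl by (auto simp: idimx_0)
next
 case (Suc r)
 show ?case
 proof (cases "j = Suc n")
  case True
  note lM = idimx_lmodule[OF Suc.prems]
  have "idimx T 0 (Ivl M' j n)" using Ivl_zero[OF lM] lmodule_Ivl[OF lM] True by (simp add: idimx_0)
  then show ?thesis by (rule idimx_le[OF noetherian_T le0])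
 next
  case False
  then have j': "j \<in> {1..n}" using j by auto
  from Suc.prems obtain I Q :: "'a fgm" and f p where
   I: "fg_module A I" "injective_module A I" "ses A M' f I p Q" "idimx A r Q" by (rule idimx_SucE)
  show ?thesis
   by (rule idimx_Suc[OF fg_Ivl[OF I(1)] Ivl_injective[OF I(2) j'] Ivl_ses[OF I(3)] Suc.IH[OF I(4)] noetherian_T])
 qed
qed
 then show ?thesis
  using idimx_iso[OF _ Ivl_iso[OF mod_iso_sym[OF M'(1) idimx_lmodule[OF M]] M'(2) idimx_lmodule[OF M]]]
   lmodule_Ivl[OF idimx_lmodule[OF M]] M'(2,3) by (simp add: idimx_copy)
qed

text \<open>The functor \<open>Ivl _ 1 i\<close> is exact and sends \<open>add(M)\<close> into
  \<open>add\<close> of the summand \<open>Ivl M 1 i\<close> of \<open>m_module n M\<close>, so it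
  carries a resolution over term by term.\<close>

lemma Ivl_gresx:
 assumes M: "fg_module A M" and i: "i \<in> {1..n}" and Y: "gresx A M s Y"
 shows "gresx T (m_module n M) s (Ivl Y 1 i)"
proof -
 obtain Y' :: "'a fgm" where Y': "mod_iso A Y Y'" "lmodule A Y'" "gres A M s Y'"
  using Y unfolding gresx_def by blast
 have "gresx A M s Y' ==> gresx T (m_module n M) s (Ivl Y' 1 i)"
proof (induction s arbitrary: Y')
 case 0
 then show ?case using Ivl_zero[of Y' 1 i] lmodule_Ivl by (auto simp: gresx_0)
next
 case (Suc s)
 note lM = fg_lmodule[OF M] and lY' = gresx_lmodule[OF Suc.prems]
 from Suc.prems obtain T0 :: "'a fgm" and g where
  T0: "addc A M T0" "g \<in> mod_hom A T0 Y'" "g ` carrier T0 = carrier Y'" "gresx A M s (ker_mod T0 Y' g)"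
  by (rule gresx_SucE)
 note lT0 = addc_lmodule[OF T0(1)]
 note ss = Ivl_ses[OF ses_kernel[OF lT0 lY' T0(2,3)], of 1 i]
 note ss' = sesD[OF ss]
 have "addc T (m_module n M) (Ivl M 1 i)"
  unfolding m_module_Ivl by (rule addc_component[OF i lmodule_Ivl[OF lM] RT.ring_axioms])
 from addc_trans[OF Ivl_addc[OF T0(1) lM] this]
 have ad: "addc T (m_module n M) (Ivl T0 1 i)" .
 have fgm: "fg_module T (m_module n M)"
  unfolding m_module_Ivl by (rule fg_dsum[OF RT.ring_axioms finite_atLeastAtMost fg_Ivl[OF M]])
 have "gresx T (m_module n M) s (ker_mod (Ivl T0 1 i) (Ivl Y' 1 i) (Imap g))"
  by (rule gresx_iso[OF _ ses_kernel_iso[OF ss] lmodule_restrict[OF ss'(2) submodule_kernel[OF ss'(2,3,6)]]])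
    (rule Suc.IH[OF T0(4)])
 then show ?case by (rule gresx_Suc[OF fgm ad ss'(6,7,3)])
qed
 then show ?thesis
  using gresx_iso[OF _ Ivl_iso[OF mod_iso_sym[OF Y'(1) gresx_lmodule[OF Y]] Y'(2) gresx_lmodule[OF Y]]]
   lmodule_Ivl[OF gresx_lmodule[OF Y]] Y'(2,3) by (simp add: gresx_copy)
qed

text \<open>Checked with \<open>row_criterion\<close>: the rows of \<open>Ivl M 1 i\<close> are
  \<open>M\<close> or zero, and each arrow between neighbours is an identity or starts at zero, so
  the required extensions exist for trivial reasons.\<close>

lemma m_self_orth:
 assumes M: "fg_module A M" and o: "orth A M M" and n: "1 \<le> n"
 shows "orth T (m_module n M) (m_module n M)"
proof -
 note lM = fg_lmodule[OF M]
 have "orth T (m_module n M) (Ivl M 1 i)" for i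
 proof -
  let ?X = "ivl M 1 i"
  note X = morl_ivl[OF lM, of 1 i] and lI = lmodule_Ivl[OF lM, of 1 i]
  have br: "branch ?X j = (if 1 \<le> j & j \<le> i then M else M\<lparr>carrier := {zero M}\<rparr>)" for j by (simp add: ivl_def)
  have oz: "orth A M (M\<lparr>carrier := {zero M}\<rparr>)"
   by (rule orth_zero_module[OF lmodule_restrict[OF lM submodule_zero[OF lM]] _ lM]) simp
  have rows: "orth A M (row (Ivl M 1 i) j)" if j: "j \<in> {1..n}" for j
  proof (rule orth_iso[of A M "branch ?X j"])
   show "mod_iso A (branch ?X j) (row (Ivl M 1 i) j)"
    by (rule mod_isoI[OF mor_rows(2,1)[OF X j]]) (simp_all only: mor_rows(3,4)[OF X j])
  qed (use o oz lmodule_row[OF lI j] in \<open>simp_all add: br del: One_nat_def\<close>)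
  have ext: "\<exists>h'\<in>mod_hom A (row (Ivl M 1 i) j) M. \<forall>z\<in>carrier (row (Ivl M 1 i) (Suc j)).
    h' (E j (Suc j) (one A) .[Ivl M 1 i] z) = h z"
   if j: "j \<in> {1..n-1}" and h: "h \<in> mod_hom A (row (Ivl M 1 i) (Suc j)) M" for j h
  proof -
   have jj: "j \<in> {1..n}" "Suc j \<in> {1..n}" "1 \<le> j" using j by auto
   note r = mor_rows[OF X jj(1)] and r' = mor_rows[OF X jj(2)]
   have z: "z \<in> carrier (Ivl M 1 i)" if "z \<in> carrier (row (Ivl M 1 i) (Suc j))" for z using that by simp
   show ?thesis
   proof (cases "Suc j \<le> i")
    case True
    then have bb: "branch ?X j = branch ?X (Suc j)" using jj by (simp add: br del: One_nat_def)
    have "(%x. h (single {1..n} (branch ?X) (Suc j) (x j))) \<in> mod_hom A (row (Ivl M 1 i) j) M"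
     by (rule mod_hom_comp[OF r(1)[unfolded bb] mod_hom_comp[OF r'(2) h]])
    then show ?thesis
     using Ivl_E[OF lM z jj(1,2) _ R.one_closed] jj r'(3)
      lmodule.smult_one[OF lM Ivl_component[OF lM z jj(2)]]
     by (intro bexI[of _ "%x. h (single {1..n} (branch ?X) (Suc j) (x j))"]) auto
   next
    case False
    have "h z = zero M" if zr: "z \<in> carrier (row (Ivl M 1 i) (Suc j))" for z
    proof -
     have "z (Suc j) = zero (branch ?X (Suc j))"
      using mor_component[OF z[OF zr] jj(2)] False by (simp add: br del: One_nat_def)
     then have "z = zero (row (Ivl M 1 i) (Suc j))"
      using r'(3)[OF zr] mod_hom_zero[OF r'(2) _ lmodule_row[OF lI jj(2)]] X jj(2)
      by (simp add: morl_def)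
     then show ?thesis using mod_hom_zero[OF h lmodule_row[OF lI jj(2)] lM] by simp
    qed
    then show ?thesis by (intro bexI[OF _ mod_hom_const_zero[OF lM]]) auto
   qed
  qed
  show ?thesis
   unfolding orth_m_module[OF lM n] row_criterion[OF fg_Ivl[OF M] lM]
   by (intro conjI ballI rows ext)
 qed
 then show ?thesis
  unfolding m_module_Ivl
  by (intro orth_dsum finite_atLeastAtMost lmodule_dsum[OF RT.ring_axioms lmodule_Ivl[OF lM]])
qed

text \<open>\<open>Ivl M 1 i\<close> is the kernel in \<open>Ivl_cut\<close>, and
  \<open>idimx_sub\<close> costs one step beyond the bound for the two intervals ending at
  \<open>n\<close>.\<close>

lemma m_idimx:
 assumes M: "lmodule A M" and r: "idimx A r M"
 shows "idimx T (Suc r) (m_module n M)"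
 unfolding m_module_Ivl
proof (rule idimx_dsum[OF finite_atLeastAtMost noetherian_T])
 fix i assume "i \<in> {1..n}"
 then have i: "i \<le> n" "1 \<in> {1..Suc n}" "Suc i \<in> {1..Suc n}" by auto
 show "idimx T (Suc r) (Ivl M 1 i)"
  by (rule idimx_sub[OF noetherian_T Ivl_cut[OF M i(1)] Ivl_idimx[OF i(2) r] Ivl_idimx[OF i(3) r]])
qed

text \<open>As a right module \<open>T\<close> is the direct sum of its rows. A functional on row
  \<open>j\<close> consists of functionals \<open>u j p\<close> on the entries in columns
  \<open>p \<ge> j\<close>, and right multiplication by elementary matrices permutes these as in the
  interval from \<open>j\<close> to \<open>n\<close>.\<close>

lemma dual_tri_iso:
 fixes Ek :: "('k, 'e) module"
 assumes Ek: "lmodule k Ek"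
 shows "mod_iso T (dual_reg k Ek T) (dsum {1..n} (%j. Ivl (dual_reg k Ek A) j n))"
proof -
 let ?D = "dual_reg k Ek A" and ?DT = "dual_reg k Ek T"
 let ?S = "dsum {1..n} (%j. Ivl ?D j n)"
 interpret e: lmodule k Ek by (rule Ek)
 note dA = dual_reg_simps[OF artin, of Ek] and dT = dual_reg_simps[OF artin_T, of Ek]
 have lD: "lmodule A ?D" and lDT: "lmodule T ?DT"
  by (rule lmodule_dual_reg[OF artin Ek], rule lmodule_dual_reg[OF artin_T Ek])
 have lS: "lmodule T ?S" by (rule lmodule_dsum[OF RT.ring_axioms lmodule_Ivl[OF lD]])
 define u where "u j p f = (\<lambda>a\<in>carrier A. f (E j p a))" for j p and f :: "(nat => nat => 'a) => 'e"
 define v where "v j f = (\<lambda>p\<in>{1..n}. if j \<le> p then u j p f else zero ?D)" for j f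
 have Ehom: "E j p \<in> mod_hom k A T" if "j \<in> {1..n}" "p \<in> {1..n}" "j \<le> p" for j p
 proof (rule mod_homI)
  fix c a assume "c \<in> carrier k" "a \<in> carrier A"
  then show "E j p (c .[A] a) = c .[T] E j p a"
   by (auto simp: elem_mat_def tri_algebra_def fun_eq_iff K.smult_zero)
 qed (use that in \<open>simp_all only: E_closed E_add\<close>)
 have uc: "u j p f \<in> carrier ?D"
  if "f \<in> carrier ?DT" "j \<in> {1..n}" "p \<in> {1..n}" "j \<le> p" for f j p
 proof -
  have "f \<in> mod_hom k T Ek" using that(1) by (simp add: dT)
  from mod_hom_cong[OF mod_hom_comp[OF Ehom[OF that(2-4)] this] K.lmodule_axioms, of "u j p f"]
  show ?thesis by (simp add: dA u_def)
 qed
 have v: "v j \<in> mod_hom T ?DT (Ivl ?D j n)" if j: "j \<in> {1..n}" for j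
 proof (rule T_mod_homI[OF lDT lmodule_Ivl[OF lD]])
  fix f assume f: "f \<in> carrier ?DT"
  show vc: "v j f \<in> carrier (Ivl ?D j n)" using uc[OF f j] by (auto simp: Ivl_carrier v_def)
  show "v j (f +[?DT] g) = v j f +[Ivl ?D j n] v j g" if "g \<in> carrier ?DT" for g
   using lmodule.axioms(2)[OF lD] j
   by (auto simp: Ivl_simps v_def u_def dA dT fun_eq_iff E_closed abelian_group.axioms)
  fix p q a assume pq: "p \<in> {1..n}" "q \<in> {1..n}" "p \<le> q" and a: "a \<in> carrier A"
  have f0: "f (zero T) = zero Ek" using f mod_hom_zero[OF _ lmodule_T Ek] by (simp add: dT)
  have "u j r (E p q a .[?DT] f) = (if r = p then a .[?D] u j q f else zero ?D)"
   if r: "r \<in> {1..n}" "j \<le> r" for r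
  proof
   fix c
   show "u j r (E p q a .[?DT] f) c = (if r = p then a .[?D] u j q f else zero ?D) c"
   proof (cases "c \<in> carrier A")
    case True
    then show ?thesis
     using E_mult[OF j r(1) pq(1,2) r(2) pq(3) True a] E_closed[OF j r True] a f0
     by (auto simp: u_def dA dT)
   qed (auto simp: u_def dA)
  qed
  then show "v j (E p q a .[?DT] f) = E p q a .[Ivl ?D j n] v j f"
   unfolding Ivl_E[OF lD vc pq a] using pq by (auto simp: v_def fun_eq_iff)
 qed
 let ?w = "%f. \<lambda>j\<in>{1..n}. v j f"
 have w: "?w \<in> mod_hom T ?DT ?S" by (rule tuple_mod_hom[OF v])
 have "inj_on ?w (carrier ?DT)"
  unfolding inj_on_mod_hom[OF lDT lS w]
 proof (intro ballI impI)
  fix f assume f: "f \<in> carrier ?DT" and "?w f = zero ?S"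
  then have "?w f j p a = (zero ?S) j p a" for j p a by (simp only:)
  note w0 = this
  have z: "f (E j p a) = zero Ek" if "j \<in> {1..n}" "p \<in> {1..n}" "j \<le> p" "a \<in> carrier A" for j p a
   using w0[of j p a] that by (simp add: v_def u_def dsum_simps Ivl_simps dA)
  have fh: "f \<in> mod_hom k T Ek" using f by (simp add: dT)
  have "f b = zero Ek" if "b \<in> carrier T" for b
   using that
  proof (induction b rule: T_induct)
   case zero
   show ?case by (rule mod_hom_zero[OF fh lmodule_T Ek])
  qed (use z mod_homD(2)[OF fh] in auto)
  then show "f = zero ?DT" using f by (auto simp: dT fun_eq_iff extensional_def)
 qed
 moreover have "?w ` carrier ?DT = carrier ?S"
 proof (intro equalityI subsetI)
  fix g assume g: "g \<in> carrier ?S"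
  have gI: "g j \<in> carrier (Ivl ?D j n)" if "j \<in> {1..n}" for j
   using PiE_mem[OF g[unfolded dsum_simps] that] .
  have gD: "g j p \<in> carrier ?D" if "j \<in> {1..n}" "p \<in> {1..n}" for j p
   using Ivl_component[OF lD gI[OF that(1)] that(2)] .
  then have gh: "g j p \<in> mod_hom k A Ek" if "j \<in> {1..n}" "p \<in> {1..n}" for j p
   using that by (simp add: dA)
  note gc = mod_homD(1)[OF gh] and g0 = mod_hom_zero[OF gh K.lmodule_axioms Ek]
  \<comment> \<open>The functional assembled from the family \<open>g\<close>; entries below the
    diagonal contribute zero.\<close>
  define F where "F b = (\<Oplus>\<^bsub>Ek\<^esub>j\<in>{1..n}. \<Oplus>\<^bsub>Ek\<^esub>p\<in>{1..n}. g j p (b j p))" for b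
  have Fh: "F \<in> mod_hom k T Ek"
  proof (rule mod_homI)
   fix b assume b: "b \<in> carrier T"
   note bc = T_entry[OF b]
   show "F b \<in> carrier Ek" unfolding F_def by (intro e.M.finsum_closed Pi_I gc bc)
   show "F (b +[T] c) = F b +[Ek] F c" if c: "c \<in> carrier T" for c
   proof -
    have "F (b +[T] c) = (\<Oplus>\<^bsub>Ek\<^esub>j\<in>{1..n}. \<Oplus>\<^bsub>Ek\<^esub>p\<in>{1..n}. g j p (b j p) +[Ek] g j p (c j p))"
     unfolding F_def
     by (intro e.M.finsum_cong' Pi_I e.M.finsum_closed e.M.a_closed gc bc T_entry[OF c] refl)
       (simp_all add: T_simps mod_homD(2)[OF gh bc T_entry[OF c]] del: atLeastAtMost_iff)
    also have "... = (\<Oplus>\<^bsub>Ek\<^esub>j\<in>{1..n}. (\<Oplus>\<^bsub>Ek\<^esub>p\<in>{1..n}. g j p (b j p)) +[Ek] (\<Oplus>\<^bsub>Ek\<^esub>p\<in>{1..n}. g j p (c j p)))"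
     by (intro e.M.finsum_cong' e.M.finsum_addf Pi_I e.M.finsum_closed e.M.a_closed gc bc T_entry[OF c] refl)
    also have "... = F b +[Ek] F c"
     unfolding F_def by (intro e.M.finsum_addf Pi_I e.M.finsum_closed gc bc T_entry[OF c])
    finally show ?thesis .
   qed
   fix x assume x: "x \<in> carrier k"
   have "F (x .[T] b) = (\<Oplus>\<^bsub>Ek\<^esub>j\<in>{1..n}. \<Oplus>\<^bsub>Ek\<^esub>p\<in>{1..n}. x .[Ek] g j p (b j p))"
    unfolding F_def
    by (intro e.M.finsum_cong' Pi_I e.M.finsum_closed e.smult_closed x gc bc refl)
      (simp_all add: T_simps mod_homD(3)[OF gh x bc] del: atLeastAtMost_iff)
   also have "... = (\<Oplus>\<^bsub>Ek\<^esub>j\<in>{1..n}. x .[Ek] (\<Oplus>\<^bsub>Ek\<^esub>p\<in>{1..n}. g j p (b j p)))"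
    by (intro e.M.finsum_cong' e.smult_finsum[symmetric] Pi_I e.M.finsum_closed e.smult_closed x gc bc refl) auto
   also have "... = x .[Ek] F b"
    unfolding F_def by (intro e.smult_finsum[symmetric] Pi_I e.M.finsum_closed x gc bc) auto
   finally show "F (x .[T] b) = x .[Ek] F b" .
  qed
  have FE: "F (E j p a) = g j p a" if jp: "j \<in> {1..n}" "p \<in> {1..n}" and a: "a \<in> carrier A" for j p a
  proof -
   have inner: "(\<Oplus>\<^bsub>Ek\<^esub>q\<in>{1..n}. g i q (E j p a i q)) = (if i = j then g j p a else zero Ek)"
    if i: "i \<in> {1..n}" for i
   proof -
    have "(\<Oplus>\<^bsub>Ek\<^esub>q\<in>{1..n}. g i q (E j p a i q)) = g i p (E j p a i p)"
     by (rule e.M.finsum_single)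
       (use i jp a gc g0 in \<open>auto simp: T_simps simp del: atLeastAtMost_iff\<close>)
    then show ?thesis using i jp g0 by (auto simp: T_simps)
   qed
   have "F (E j p a) = (\<Oplus>\<^bsub>Ek\<^esub>i\<in>{1..n}. if i = j then g j p a else zero Ek)"
    unfolding F_def by (intro e.M.finsum_cong' Pi_I refl) (use inner gc[OF jp a] in auto)
   also have "... = (if j = j then g j p a else zero Ek)"
    by (rule e.M.finsum_single) (use jp gc[OF jp a] in auto)
   finally show ?thesis by simp
  qed
  have "restrict F (carrier T) \<in> carrier ?DT"
   using mod_hom_cong[OF Fh lmodule_T] by (simp add: dT)
  moreover have "?w (restrict F (carrier T)) = g"
  proof
   fix j
   show "?w (restrict F (carrier T)) j = g j"
   proof (cases "j \<in> {1..n}")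
    case j: True
    show ?thesis
    proof
     fix p
     show "?w (restrict F (carrier T)) j p = g j p"
     proof (cases "p \<in> {1..n} & j \<le> p")
      case True
      then have "u j p (restrict F (carrier T)) = g j p"
       using FE[OF j] gD[OF j] j by (auto simp: u_def fun_eq_iff dA extensional_def E_closed)
      then show ?thesis using True j by (simp add: v_def)
     next
      case False
      then show ?thesis using gI[OF j] j by (auto simp: v_def Ivl_carrier extensional_def)
     qed
    qed
   next
    case False
    then show ?thesis using g by (auto simp: dsum_simps PiE_iff extensional_def)
   qed
  qed
  ultimately show "g \<in> ?w ` carrier ?DT" by (metis image_eqI)
 qed (use mod_homD(1)[OF w] in blast)
 ultimately show ?thesis by (rule mod_iso_bij[OF w])
qed

text \<open>The summand for \<open>j = 1\<close> is resolved directly by \<open>Ivl_gresx\<close>.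
  For \<open>j > 1\<close> the interval is the quotient in \<open>Ivl_cut\<close> of two such
  modules, which costs the additional step.\<close>

lemma m_gresx:
 assumes Ek: "lmodule k Ek" and M: "fg_module A M" "orth A M M" and res: "gresx A M s (dual_reg k Ek A)"
  and n: "1 \<le> n"
 shows "gresx T (m_module n M) (Suc s) (dual_reg k Ek T)"
proof -
 let ?D = "dual_reg k Ek A"
 note self = m_self_orth[OF M n]
 have fgm: "fg_module T (m_module n M)"
  unfolding m_module_Ivl by (rule fg_dsum[OF RT.ring_axioms finite_atLeastAtMost fg_Ivl[OF M(1)]])
 have lD: "lmodule A ?D" by (rule lmodule_dual_reg[OF artin Ek])
 have n1: "gresx T (m_module n M) s (Ivl ?D 1 n)" using n by (intro Ivl_gresx[OF M(1) _ res]) simp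
 have "gresx T (m_module n M) (Suc s) (Ivl ?D j n)" if j: "j \<in> {1..n}" for j
 proof (cases "j = 1")
  case True
  then show ?thesis using gresx_mono[OF fgm n1] by simp
 next
  case False
  then obtain i where i: "j = Suc i" "i \<le> n" "i \<in> {1..n}" using j by (cases j) auto
  show ?thesis
   unfolding i(1) by (rule gresx_quotient[OF fgm self Ivl_cut[OF lD i(2)] Ivl_gresx[OF M(1) i(3) res] n1])
 qed
 then have "gresx T (m_module n M) (Suc s) (dsum {1..n} (%j. Ivl ?D j n))"
  by (rule gresx_dsum[OF finite_atLeastAtMost fgm self])
 then show ?thesis
  by (rule gresx_iso[OF _ mod_iso_sym[OF dual_tri_iso[OF Ek]]]) (rule lmodule_dual_reg[OF artin_T Ek])+
qed

theorem m_cotilting: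
 assumes Ek: "lmodule k Ek" and M: "cotilting k Ek A M" and n: "1 \<le> n"
 shows "cotilting k Ek T (m_module n M)"
proof -
 from M obtain r s where M: "fg_module A M" "idimx A r M" "orth A M M" "gresx A M s (dual_reg k Ek A)"
  unfolding cotilting_iff[OF artin Ek] by blast
 have "fg_module T (m_module n M)"
  unfolding m_module_Ivl by (rule fg_dsum[OF RT.ring_axioms finite_atLeastAtMost fg_Ivl[OF M(1)]])
 then show ?thesis
  unfolding cotilting_iff[OF artin_T Ek]
  using m_idimx[OF fg_lmodule[OF M(1)] M(2)] m_self_orth[OF M(1,3) n] m_gresx[OF Ek M(1,3,4) n] by blast
qed

text \<open>A module is recovered from its rows \<open>E i i 1\<close> and the maps \<open>E i (i+1) 1\<close> between them.\<close>

lemma mor_dense: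
 assumes Y: "fg_module T Y"
 obtains X :: "('a, 'a fg_carrier) mor" where "X \<in> Mor n A" "mod_iso T Y (mor_module n X)"
proof -
 have lY: "lmodule T Y" using Y by (rule fg_lmodule)
 interpret Y: lmodule T Y by (rule lY)
 have "\<exists>(N :: 'a fgm) a b. fg_module A N & a \<in> mod_hom A (row Y i) N &
   b \<in> mod_hom A N (row Y i) & (\<forall>x\<in>carrier (row Y i). b (a x) = x) & (\<forall>y\<in>carrier N. a (b y) = y)"
  if i: "i \<in> {1..n}" for i
 proof -
  obtain N :: "'a fgm" where N: "fg_module A N" "mod_iso A (row Y i) N"
   using fg_row[OF Y i] by (rule copy_exists)
  obtain a b where "a \<in> mod_hom A (row Y i) N" "b \<in> mod_hom A N (row Y i)"
   "!!x. x \<in> carrier (row Y i) ==> b (a x) = x" "!!y. y \<in> carrier N ==> a (b y) = y"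
   by (rule mod_isoE[OF N(2) lmodule_row[OF lY i]]) (rule that)
  with N(1) show ?thesis by blast
 qed
 then have "\<exists>(N :: nat => 'a fgm) a b. \<forall>i\<in>{1..n}. fg_module A (N i) &
   a i \<in> mod_hom A (row Y i) (N i) & b i \<in> mod_hom A (N i) (row Y i) &
   (\<forall>x\<in>carrier (row Y i). b i (a i x) = x) & (\<forall>y\<in>carrier (N i). a i (b i y) = y)"
  by metis
 then obtain N :: "nat => 'a fgm" and a b where
  Nab: "\<forall>i\<in>{1..n}. fg_module A (N i) &
   a i \<in> mod_hom A (row Y i) (N i) & b i \<in> mod_hom A (N i) (row Y i) &
   (\<forall>x\<in>carrier (row Y i). b i (a i x) = x) & (\<forall>y\<in>carrier (N i). a i (b i y) = y)"
  by blast
 have fgN: "fg_module A (N i)" and ah: "a i \<in> mod_hom A (row Y i) (N i)"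
  and bh: "b i \<in> mod_hom A (N i) (row Y i)" and ba: "x \<in> carrier (row Y i) ==> b i (a i x) = x"
  and ab: "y \<in> carrier (N i) ==> a i (b i y) = y" if "i \<in> {1..n}" for i x y
  using bspec[OF Nab that] by auto
 note lN = fg_lmodule[OF fgN]
 define X where "X = \<lparr> branch = N, strmap = %i x. a i (E i (Suc i) (one A) .[Y] b (Suc i) x) \<rparr>"
 have sX: "branch X = N" "strmap X i x = a i (E i (Suc i) (one A) .[Y] b (Suc i) x)" for i x
  by (simp_all add: X_def)
 have "strmap X i \<in> mod_hom A (N (Suc i)) (N i)" if "i \<in> {1..n-1}" for i
 proof -
  have ii: "i \<in> {1..n}" "Suc i \<in> {1..n}" using that by auto
  show ?thesis
   using mod_hom_comp[OF mod_hom_comp[OF bh[OF ii(2)] E_row_hom[OF lY ii]] ah[OF ii(1)]]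
   by (simp add: sX(2)[abs_def])
 qed
 then have XM: "X \<in> Mor n A" using fgN by (simp add: Mor_def sX)
 note X = Mor_morl[OF XM]
 let ?Z = "mor_module n X"
 note lZ = lmodule_mor[OF X]
 have bc: "b i x \<in> carrier Y" "E i i (one A) .[Y] b i x = b i x" if "i \<in> {1..n}" "x \<in> carrier (N i)" for i x
  using mod_homD(1)[OF bh[OF that(1)] that(2)] by auto
 have path: "mor_path X p d x = a p (E p (p + d) (one A) .[Y] b (p + d) x)"
  if "p \<in> {1..n}" "p + d \<in> {1..n}" "x \<in> carrier (N (p + d))" for p d x
  using that
 proof (induction d arbitrary: x)
  case 0
  then show ?case using ab[of p x] bc[of p x] by simp
 next
  case (Suc d)
  have pd: "p + d \<in> {1..n}" "Suc (p + d) \<in> {1..n}" using Suc.prems by auto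
  let ?y = "E (p + d) (Suc (p + d)) (one A) .[Y] b (Suc (p + d)) x"
  have bx: "b (Suc (p + d)) x \<in> carrier Y" using bc(1)[OF pd(2)] Suc.prems(3) by simp
  have y: "?y \<in> carrier (row Y (p + d))" by (rule E_in_row[OF lY pd _ R.one_closed bx]) simp
  have "mor_path X p (Suc d) x = a p (E p (p + d) (one A) .[Y] b (p + d) (a (p + d) ?y))"
   using Suc.IH[OF Suc.prems(1) pd(1) mod_homD(1)[OF ah[OF pd(1)] y]] by (simp add: sX)
  also have "b (p + d) (a (p + d) ?y) = ?y" by (rule ba[OF pd(1) y])
  also have "E p (p + d) (one A) .[Y] ?y = E p (p + Suc d) (one A) .[Y] b (p + Suc d) x"
   using E_E[OF lY Suc.prems(1) pd _ _ R.one_closed R.one_closed bx] by simp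
  finally show ?case .
 qed
 define f where "f y = (\<lambda>p\<in>{1..n}. a p (E p p (one A) .[Y] y))" for y
 have rc: "E p q c .[Y] y \<in> carrier (row Y p)"
  if "p \<in> {1..n}" "q \<in> {1..n}" "p \<le> q" "c \<in> carrier A" "y \<in> carrier Y" for p q c y
  by (rule E_in_row[OF lY that])
 have fc: "f y \<in> carrier ?Z" if "y \<in> carrier Y" for y
  using mod_homD(1)[OF ah rc[OF _ _ le_refl R.one_closed that]]
  by (auto simp: f_def mor_module_def sX simp del: atLeastAtMost_iff row_simps)
 have f: "f \<in> mod_hom T Y ?Z"
 proof (rule T_mod_homI[OF lY lZ fc])
  fix x y assume x: "x \<in> carrier Y" and y: "y \<in> carrier Y"
  have "a p (E p p (one A) .[Y] (x +[Y] y)) = a p (E p p (one A) .[Y] x) +[N p] a p (E p p (one A) .[Y] y)"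
   if p: "p \<in> {1..n}" for p
   using mod_homD(2)[OF ah[OF p] rc[OF p p le_refl R.one_closed x] rc[OF p p le_refl R.one_closed y]]
    E_closed[OF p p le_refl R.one_closed] x y by (simp add: Y.smult_r_distr)
  then show "f (x +[Y] y) = f x +[?Z] f y" by (auto simp: f_def mor_module_def sX fun_eq_iff)
  fix p q c assume pq: "p \<in> {1..n}" "q \<in> {1..n}" "p \<le> q" and c: "c \<in> carrier A"
  note r1 = rc[OF pq(2,2) le_refl R.one_closed x]
  have "f (E p q c .[Y] x) = single {1..n} (branch X) p (a p (E p q c .[Y] x))"
  proof
   fix r
   show "f (E p q c .[Y] x) r = single {1..n} (branch X) p (a p (E p q c .[Y] x)) r"
    using E_E[OF lY pq(1,1,2) le_refl pq(3) R.one_closed c x]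
     E_E_zero[OF lY _ _ pq(1,2) le_refl pq(3) _ R.one_closed c x, of r]
     mod_hom_zero[OF ah lmodule_row[OF lY] lN, of r] c
    by (auto simp: f_def single_def sX simp del: atLeastAtMost_iff)
  qed
  also have "a p (E p q c .[Y] x) = c .[N p] a p (E p q (one A) .[Y] x)"
   using mod_homD(3)[OF ah[OF pq(1)] c rc[OF pq R.one_closed x]]
    E_E[OF lY pq(1,1,2) le_refl pq(3) c R.one_closed x] c by simp
  also have "a p (E p q (one A) .[Y] x) = mor_path X p (q - p) (f x q)"
   using path[of p "q - p" "f x q"] pq mod_homD(1)[OF ah[OF pq(2)] r1] ba[OF pq(2) r1]
    E_E[OF lY pq(1,2,2,3) le_refl R.one_closed R.one_closed x]
   by (simp add: f_def del: row_simps)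
  finally show "f (E p q c .[Y] x) = E p q c .[?Z] f x"
   unfolding mor_E_action[OF X pq c fc[OF x]] by (simp only: sX)
 qed
 have "inj_on f (carrier Y)"
 proof (rule inj_onI)
  fix x y assume x: "x \<in> carrier Y" and y: "y \<in> carrier Y" and eq: "f x = f y"
  show "x = y"
  proof (rule T_eq_components[OF lY x y])
   fix p assume p: "p \<in> {1..n}"
   then have "a p (E p p (one A) .[Y] x) = a p (E p p (one A) .[Y] y)" using fun_cong[OF eq, of p] by (simp add: f_def)
   then show "E p p (one A) .[Y] x = E p p (one A) .[Y] y"
    using ba[OF p rc[OF p p le_refl R.one_closed x]] ba[OF p rc[OF p p le_refl R.one_closed y]] by metis
  qed
 qed
 moreover have "f ` carrier Y = carrier ?Z"
 proof (intro equalityI subsetI)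
  fix z assume z: "z \<in> carrier ?Z"
  \<comment> \<open>The image is a submodule, so it suffices to reach the vectors with a single
    nonzero component.\<close>
  have im: "submodule (f ` carrier Y) T ?Z" by (rule submodule_image[OF lY lZ f submodule_carrier[OF lY]])
  note im' = submoduleD[OF im]
  show "z \<in> f ` carrier Y"
  proof (rule dsum_induct[where I = "{1..n}" and M = N and B = A and x = z and P = "%z. z \<in> f ` carrier Y"])
   fix p x assume p: "p \<in> {1..n}" and x: "x \<in> carrier (N p)"
   note bx = bc[OF p x]
   have "f (b p x) = single {1..n} N p x"
   proof
    fix r
    show "f (b p x) r = single {1..n} N p x r"
     using bx ab[OF p x] E_E_zero[OF lY _ _ p p le_refl le_refl _ R.one_closed R.one_closed bx(1), of r]
      mod_hom_zero[OF ah lmodule_row[OF lY] lN, of r]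
     by (auto simp: f_def single_def simp del: atLeastAtMost_iff)
   qed
   then show "single {1..n} N p x \<in> f ` carrier Y" using bx(1) by (metis image_eqI)
  qed (use z im' lN in \<open>simp_all add: mor_module_dsum sX del: One_nat_def\<close>)
 qed (use mod_homD(1)[OF f] in blast)
 ultimately have "mod_iso T Y ?Z" by (rule mod_iso_bij[OF f])
 with XM show thesis by (rule that)
qed

text \<open>\<open>eq\<close> compares objects of \<open>Mor\<close> over one element type; by
  \<open>mor_dense\<close> these represent all finitely generated \<open>T\<close>-modules.\<close>

lemma orth_of_mor_perp:
 assumes eq: "(mor_perp n A M :: ('a, 'a fg_carrier) mor set) = mor_perp n A C"
  and M: "lmodule T M" and C: "lmodule T C" and o: "orth T M Y"
 shows "orth T C Y"
proof -
 obtain X :: "('a, 'a fg_carrier) mor" where X: "X \<in> Mor n A" "mod_iso T Y (mor_module n X)"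
  by (rule mor_dense[OF orth_fg[OF o]])
 note lX = lmodule_mor[OF Mor_morl[OF X(1)]] and lY = orth_lmodule[OF o]
 have "X \<in> mor_perp n A M"
  using X(1) orth_iso[OF o X(2) lX] by (simp add: mor_perp_def perp_iff_orth[OF noetherian_T M])
 then have "orth T C (mor_module n X)"
  unfolding eq by (simp add: mor_perp_def perp_iff_orth[OF noetherian_T C])
 then show ?thesis using mod_iso_sym[OF X(2) lY] lY by (rule orth_iso)
qed

text \<open>\<open>addc_of_perp_le\<close> is used in both directions and puts each of the two
  modules into \<open>add\<close> of the other.\<close>

theorem cotilting_unique:
 fixes M :: "(nat => nat => 'a, 'm) module" and C :: "(nat => nat => 'a, 'c) module"
 assumes Env: "injective_envelope k (quot_module (reg_module k) (jacobson_radical k)) Ek"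
  and M: "cotilting k Ek T M" and C: "cotilting k Ek T C"
  and eq: "(mor_perp n A M :: ('a, 'a fg_carrier) mor set) = mor_perp n A C"
 shows "add_class T C = add_class T M"
proof -
 have Ek: "lmodule k Ek" using Env by (simp add: injective_envelope_def injective_module_def)
 from M obtain s where M': "fg_module T M" "orth T M M" "gresx T M s (dual_reg k Ek T)"
  unfolding cotilting_iff[OF artin_T Ek] by blast
 from C obtain t where C': "fg_module T C" "orth T C C" "gresx T C t (dual_reg k Ek T)"
  unfolding cotilting_iff[OF artin_T Ek] by blast
 note l = fg_lmodule[OF M'(1)] fg_lmodule[OF C'(1)]
 note MC = orth_of_mor_perp[OF eq l] and CM = orth_of_mor_perp[OF eq[symmetric] l(2,1)]
 have mc: "addc T M C" by (rule addc_of_perp_le[OF artin_T Env M' l(2) CM[OF C'(2)] MC])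
 have cm: "addc T C M" by (rule addc_of_perp_le[OF artin_T Env C' l(1) MC[OF M'(2)] CM])
 show ?thesis
  by (rule Set.set_eqI, unfold add_class_iff_addc[OF l(1)] add_class_iff_addc[OF l(2)])
    (rule iffI, erule addc_trans[OF _ mc], erule addc_trans[OF _ cm])
qed

end

theorem theorem3p1:
  fixes k :: "'k ring"
    and E :: "('k, 'e) module"
    and A :: "('k, 'a) module"
    and n :: nat
    and T :: "('a, 't) module"
  assumes "artin_algebra k A"
    and "injective_envelope k (quot_module (reg_module k) (jacobson_radical k)) E"
    and "n \<ge> 2"
    and "fg_module A T"
  shows
    "(has_add_resolution A T (dual_reg k E A) \<longrightarrow>
        (mono_cat n A (perp A T) :: ('a, 'x) mor set) = mor_perp n A (m_module n T)) \<and>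
     (cotilting k E A T \<longrightarrow>
        cotilting k E (tri_algebra n A) (m_module n T) \<and>
        (mono_cat n A (perp A T) :: ('a, 'x) mor set) = mor_perp n A (m_module n T) \<and>
        (\<forall>C :: (nat \<Rightarrow> nat \<Rightarrow> 'a, 'c) module.
           cotilting k E (tri_algebra n A) C \<and>
           (mono_cat n A (perp A T) :: ('a, 'a fg_carrier) mor set) = mor_perp n A C \<longrightarrow>
           (add_class (tri_algebra n A) C :: (nat \<Rightarrow> nat \<Rightarrow> 'a, 'y) module set) =
             add_class (tri_algebra n A) (m_module n T)))"
proof -
 interpret TA: tri_alg k A n by (rule tri_alg.intro) fact
 have n: "1 \<le> n" using assms(3) by simp
 have E: "lmodule k E" using assms(2) by (simp add: injective_envelope_def injective_module_def)
 note lT = fg_lmodule[OF assms(4)]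
 have res: "has_add_resolution A T (dual_reg k E A) \<longleftrightarrow> (\<exists>s. gresx A T s (dual_reg k E A))"
  by (rule has_add_resolution_iff_gresx[OF assms(4) lmodule_dual_reg[OF assms(1) E]])
 show ?thesis
 proof (intro conjI impI allI; (elim conjE)?)
  assume "has_add_resolution A T (dual_reg k E A)"
  then show "(mono_cat n A (perp A T) :: ('a, 'x) mor set) = mor_perp n A (m_module n T)"
   unfolding res using TA.mono_cat_perp[OF assms(2) lT _ n] by blast
 next
  assume c: "cotilting k E A T"
  then obtain s where s: "gresx A T s (dual_reg k E A)" unfolding cotilting_iff[OF assms(1) E] by blast
  \<comment> \<open>\<open>eq\<close> remains polymorphic in the element type of the branches: it is
    used at \<open>'x\<close>, and at \<open>'a fg_carrier\<close> for the uniqueness.\<close>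
  note eq = TA.mono_cat_perp[OF assms(2) lT s n]
  show "(mono_cat n A (perp A T) :: ('a, 'x) mor set) = mor_perp n A (m_module n T)" by (rule eq)
  show m: "cotilting k E (tri_algebra n A) (m_module n T)" by (rule TA.m_cotilting[OF E c n])
  fix C :: "(nat => nat => 'a, 'c) module"
  assume C: "cotilting k E (tri_algebra n A) C"
   "(mono_cat n A (perp A T) :: ('a, 'a fg_carrier) mor set) = mor_perp n A C"
  show "(add_class (tri_algebra n A) C :: (nat => nat => 'a, 'y) module set) =
    add_class (tri_algebra n A) (m_module n T)"
   by (rule TA.cotilting_unique[OF assms(2) m C(1)]) (use C(2) eq in metis)
 qed
qed

end
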